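(* Let $n\ge 4$ be an integer, $1<p<\frac n2$ and $0\le\gamma<n$. Then for all $0\le\alpha\le\beta_{\gamma,n}:=\left(1-\frac{\gamma}{n}\right)\beta(n,2)$ one has $$\sup_{u\in E,\ \|u\|\le 1}\int_{\mathbb{R}^n}\frac{\Phi_{\alpha,j_0}(u)}{|x|^\gamma}\,dx<+\infty .$$ Further, the constant $\beta_{\gamma,n}$ is sharp: if $\alpha>\beta_{\gamma,n}$, then this supremum is infinite.
   Context: Here $\|\cdot\|_s$ is the $L^s(\mathbb{R}^n)$ norm and $p^\ast:=\frac{np}{n-2p}$. The space $E$ is the completion of $C_0^\infty(\mathbb{R}^n)$ (real-valued) with respect to the norm $\|u\|:=\left(\|\Delta u\|_{n/2}^{n/2}+\|\Delta u\|_p^{n/2}\right)^{2/n}$; by the Sobolev embedding $\|u\|_{p^\ast}\le C\|\Delta u\|_p$ its elements are regarded as functions in $L^{p^\ast}(\mathbb{R}^n)$ with distributional Laplacian in $L^p(\mathbb{R}^n)\cap L^{n/2}(\mathbb{R}^n)$. Let $j_0:=\left\lceil \frac{p^\ast(n-2)}{n}\right\rceil$ and, for $\alpha\ge0$ and $s\in\mathbb{R}$, $$\Phi_{\alpha,j_0}(s):=\exp\left(\alpha|s|^{\frac n{n-2}}\right)-\sum_{j=0}^{j_0-1}\frac{\alpha^j|s|^{\frac{nj}{n-2}}}{j!}.$$ Finally $\beta(n,2):=n\left[(n-2)\omega_{n-1}^{2/n}\right]^{\frac{n}{n-2}}$, where $\omega_{n-1}$ is the $(n-1)$-dimensional surface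 measure of the unit sphere in $\mathbb{R}^n$. *)

theory Defs
  imports "HOL-Analysis.Analysis"
begin

text \<open>
  Throughout, \<open>n = CARD('n)\<close> and functions on \<open>\<real>\<^sup>n\<close> are functions on \<^typ>\<open>real ^ 'n\<close>.
\<close>

fun Ck :: "nat \<Rightarrow> ('a::real_normed_vector \<Rightarrow> real) \<Rightarrow> bool" where
  "Ck 0 f \<longleftrightarrow> continuous_on UNIV f"
| "Ck (Suc k) f \<longleftrightarrow>
     (\<forall>x. f differentiable (at x)) \<and> (\<forall>v. Ck k (\<lambda>x. frechet_derivative f (at x) v))"

definition test_functions :: "('a::real_normed_vector \<Rightarrow> real) set" where
  "test_functions = {f. (\<forall>k. Ck k f) \<and> compact (closure {x. f x \<noteq> 0})}"

definition partial :: "'n \<Rightarrow> (real ^ 'n::finite \<Rightarrow> real) \<Rightarrow> real ^ 'n \<Rightarrow> real" where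
  "partial i f x = frechet_derivative f (at x) (axis i 1)"

definition laplacian :: "(real ^ 'n::finite \<Rightarrow> real) \<Rightarrow> real ^ 'n \<Rightarrow> real" where
  "laplacian f x = (\<Sum>i\<in>UNIV. partial i (partial i f) x)"

definition Lspace :: "real \<Rightarrow> ('a::euclidean_space \<Rightarrow> real) set" where
  "Lspace s = {f \<in> borel_measurable lebesgue. integrable lebesgue (\<lambda>x. \<bar>f x\<bar> powr s)}"

text \<open>Only meaningful on \<open>Lspace s\<close>: outside it the Bochner integral is \<open>0\<close>.\<close>

definition Lnorm :: "real \<Rightarrow> ('a::euclidean_space \<Rightarrow> real) \<Rightarrow> real" where
  "Lnorm s f = (LINT x|lebesgue. \<bar>f x\<bar> powr s) powr (1 / s)"

definition locally_integrable :: "('a::euclidean_space \<Rightarrow> real) \<Rightarrow> bool" where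
  "locally_integrable f \<longleftrightarrow> (\<forall>K. compact K \<longrightarrow> set_integrable lebesgue K f)"

definition is_distr_laplacian ::
    "(real ^ 'n::finite \<Rightarrow> real) \<Rightarrow> (real ^ 'n \<Rightarrow> real) \<Rightarrow> bool" where
  "is_distr_laplacian u g \<longleftrightarrow>
     locally_integrable u \<and> locally_integrable g \<and>
     (\<forall>\<phi>\<in>test_functions.
        (LINT x|lebesgue. u x * laplacian \<phi> x) = (LINT x|lebesgue. g x * \<phi> x))"

text \<open>
  The choice is immaterial: two locally integrable distributional Laplacians of the same
  function agree almost everywhere.
\<close>

definition distr_laplacian :: "(real ^ 'n::finite \<Rightarrow> real) \<Rightarrow> real ^ 'n \<Rightarrow> real" where
  "distr_laplacian u = (SOME g. is_distr_laplacian u g)"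

text \<open>The norm on \<open>E\<close> as a function of \<open>g = \<Delta>u\<close>.\<close>

definition mixed_norm :: "real \<Rightarrow> (real ^ 'n::finite \<Rightarrow> real) \<Rightarrow> real" where
  "mixed_norm p g =
     (let n = real CARD('n)
      in (Lnorm (n / 2) g powr (n / 2) + Lnorm p g powr (n / 2)) powr (2 / n))"

definition pstar :: "nat \<Rightarrow> real \<Rightarrow> real" where
  "pstar n p = real n * p / (real n - 2 * p)"

text \<open>
  The completion of the test functions with respect to \<open>\<phi> \<mapsto> mixed_norm p (laplacian \<phi>)\<close>,
  realised inside \<open>Lspace (pstar n p)\<close>.  By the Sobolev inequality every Cauchy sequence of
  test functions converges in that space, and its limit \<open>u\<close> is the function representing the
  class of the sequence.  The Laplacians of the sequence converge in \<open>Lspace p\<close> and in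
  \<open>Lspace (n / 2)\<close>, and the common limit is the distributional Laplacian of \<open>u\<close>.  So
  \<open>distr_laplacian u\<close> lies in both spaces, it determines the class, and \<open>E_norm p u\<close> is the
  limit of the norms of the sequence.
\<close>

definition E_space :: "real \<Rightarrow> (real ^ 'n::finite \<Rightarrow> real) set" where
  "E_space p = {u \<in> Lspace (pstar CARD('n) p).
     \<exists>\<phi> :: nat \<Rightarrow> real ^ 'n \<Rightarrow> real.
       (\<forall>k. \<phi> k \<in> test_functions) \<and>
       (\<forall>\<epsilon>>0. \<exists>N. \<forall>j\<ge>N. \<forall>k\<ge>N. mixed_norm p (laplacian (\<lambda>x. \<phi> j x - \<phi> k x)) < \<epsilon>) \<and>
       (\<lambda>k. Lnorm (pstar CARD('n) p) (\<lambda>x. \<phi> k x - u x)) \<longlonglongrightarrow> 0}"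

definition E_norm :: "real \<Rightarrow> (real ^ 'n::finite \<Rightarrow> real) \<Rightarrow> real" where
  "E_norm p u = mixed_norm p (distr_laplacian u)"

definition j0 :: "nat \<Rightarrow> real \<Rightarrow> nat" where
  "j0 n p = nat \<lceil>pstar n p * (real n - 2) / real n\<rceil>"

text \<open>
  The power \<open>\<bar>s\<bar> powr (n * j / (n - 2))\<close> is written as a \<open>j\<close>-th natural power, because
  \<open>0 powr 0 = 0\<close> while the summand for \<open>j = 0\<close> has to be \<open>1\<close> also at \<open>s = 0\<close>.
\<close>

definition Phi :: "nat \<Rightarrow> real \<Rightarrow> nat \<Rightarrow> real \<Rightarrow> real" where
  "Phi n \<alpha> m s =
     (let t = \<bar>s\<bar> powr (real n / (real n - 2))
      in exp (\<alpha> * t) - (\<Sum>j<m. \<alpha> ^ j * t ^ j / fact j))"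

text \<open>
  The surface measure on the unit sphere, defined through polar coordinates: \<open>n\<close> times the
  volume of the cone over \<open>A\<close> in the unit ball.
\<close>

definition surface_measure :: "(real ^ 'n::finite) set \<Rightarrow> real" where
  "surface_measure A =
     real CARD('n) * measure lebesgue {r *\<^sub>R x |r x. 0 < r \<and> r \<le> 1 \<and> x \<in> A}"

definition sphere_area :: "'n::finite itself \<Rightarrow> real" where
  "sphere_area _ = surface_measure (sphere (0 :: real ^ 'n) 1)"

definition beta :: "'n::finite itself \<Rightarrow> real" where
  "beta T =
     (let n = real CARD('n)
      in n * ((n - 2) * sphere_area T powr (2 / n)) powr (n / (n - 2)))"

definition beta_gamma :: "real \<Rightarrow> 'n::finite itself \<Rightarrow> real" where
  "beta_gamma \<gamma> T = (1 - \<gamma> / real CARD('n)) * beta T"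

definition adams_sup :: "'n::finite itself \<Rightarrow> real \<Rightarrow> real \<Rightarrow> real \<Rightarrow> ennreal" where
  "adams_sup _ p \<gamma> \<alpha> =
     (SUP u \<in> {u :: real ^ 'n \<Rightarrow> real. u \<in> E_space p \<and> E_norm p u \<le> 1}.
        \<integral>\<^sup>+ x. ennreal (Phi CARD('n) \<alpha> (j0 CARD('n) p) (u x) / norm x powr \<gamma>) \<partial>lebesgue)"

end

theory Submission
  imports Defs "HOL-Real_Asymp.Real_Asymp"
begin

text \<open>
  A test function is dominated by the Newtonian potential of \<open>g = \<bar>\<Delta>u\<bar>\<close>, so O'Neil's rearrangement
  inequality compares its level sets with those of a one-dimensional potential \<open>W\<close> of the decreasing
  rearrangement of \<open>g\<close>.  The parts of the rearrangement on \<open>(0, 1)\<close> and on \<open>(1, \<infinity>)\<close> contribute at most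
  \<open>a w(t) + C b\<close> to \<open>W(t)\<close> for \<open>t < 1\<close>, where \<open>a = \<parallel>g\<parallel>\<close> in \<open>L powr (n/2)\<close>, \<open>b = \<parallel>g\<parallel>\<close> in \<open>L powr p\<close> and \<open>w\<close> is
  the normalised potential.  Since the norm on \<open>E\<close> combines \<open>a\<close> and \<open>b\<close> with exponent \<open>n/2\<close>, Hoelder's
  inequality gives \<open>(a w + C b) powr (n/(n-2)) \<le> w powr (n/(n-2)) + const\<close>: the \<open>L powr p\<close> part costs only a
  factor, and the critical exponent survives.  The Adams--Garsia argument bounds the integral over \<open>(0, 1)\<close>;
  over \<open>(1, \<infinity>)\<close> one has \<open>\<Phi>(s) \<le> C s powr p*\<close> for bounded \<open>s\<close>, and a Schur test suffices.  The weight turns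
  into \<open>t powr (- \<gamma>/n)\<close> by the Hardy--Littlewood inequality.  Fatou's lemma passes to \<open>E\<close>.

  For sharpness, the functions \<open>- (1/2) ln (\<bar>x\<bar>\<^sup>2 + \<epsilon>\<^sup>2)\<close>, cut off near the unit sphere, have norm to the
  power \<open>n/2\<close> at most \<open>(1 + o(1)) D ln (1/\<epsilon>)\<close>, because only the \<open>L powr (n/2)\<close> part is critical; dividing by
  the norm and integrating over the ball of radius \<open>\<epsilon>\<close> shows divergence beyond the critical constant.
\<close>

section \<open>Layers and radial integrals\<close>

text \<open>The critical exponent itself is included, so no multiplicative constant may be lost in
  front of the potential. O'Neil's bound is exact enough: for the kernel
  \<open>|x| powr (2 - n)\<close>, which is \<open>(t/V) powr (-\<delta>)\<close> in the volume
  variable with \<open>\<delta> = 1 - 2/n\<close>, the extra factor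
  \<open>1 / (1 - \<delta>)\<close> occurs only on \<open>\<tau> < t\<close>, where Hoelder's
  inequality gives a bounded term; the part between \<open>t\<close> and 1 gives
  \<open>(ln (1/t)) powr \<delta>\<close> with constant one. After \<open>t = exp (-x)\<close> one
  has to integrate \<open>exp (-\<kappa> F)\<close> with \<open>F = x - w powr (1/\<delta>)\<close>.
  \<open>F\<close> is bounded below but need not grow; Garsia's observation is that the set where
  \<open>F \<le> \<nu>\<close> still has length \<open>O(\<nu>)\<close>. The exponent
  \<open>\<kappa> = 1 - \<gamma>/n\<close> comes from multiplying \<open>dt\<close> by the
  rearranged weight, and it is the factor in \<open>beta_gamma\<close>. Rearrangements enter only
  through one-sided comparisons of level sets, so equimeasurability is never proved. They are
  applied to \<open>|laplacian \<phi>|\<close> for test functions, bounded and with support of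
  finite measure, so all distribution functions are finite.\<close>

lemma nn_integral_mult_layers:
  fixes a b :: "'a::euclidean_space \<Rightarrow> real"
  assumes [measurable]: "a \<in> borel_measurable borel" "b \<in> borel_measurable borel"
    and a: "\<And>x. 0 \<le> a x" and b: "\<And>x. 0 \<le> b x"
  shows "(\<integral>\<^sup>+x. ennreal (a x * b x) \<partial>lborel) =
    (\<integral>\<^sup>+r. \<integral>\<^sup>+s. indicator {0..} r * indicator {0..} s * emeasure lborel {x. r < a x \<and> s < b x} \<partial>lborel \<partial>lborel)"
proof -
  have "(\<integral>\<^sup>+x. ennreal (a x * b x) \<partial>lborel) = (\<integral>\<^sup>+x. \<integral>\<^sup>+r. \<integral>\<^sup>+s. indicator {0..} r * indicator {0..} s * indicator {x. r < a x \<and> s < b x} x \<partial>lborel \<partial>lborel \<partial>lborel)"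
  proof (intro nn_integral_cong)
    fix x :: 'a
    have eq: "indicator {0..} r * indicator {0..} s * indicator {x. r < a x \<and> s < b x} x = (indicator {0..<a x} r * indicator {0..<b x} s :: ennreal)" for r s :: real
      by (auto simp: indicator_def)
    show "ennreal (a x * b x) = (\<integral>\<^sup>+r. \<integral>\<^sup>+s. indicator {0..} r * indicator {0..} s * indicator {x. r < a x \<and> s < b x} x \<partial>lborel \<partial>lborel)"
      unfolding eq using a[of x] b[of x] by (simp add: nn_integral_cmult nn_integral_multc ennreal_mult)
  qed
  also have "\<dots> = (\<integral>\<^sup>+r. \<integral>\<^sup>+x. \<integral>\<^sup>+s. indicator {0..} r * indicator {0..} s * indicator {x. r < a x \<and> s < b x} x \<partial>lborel \<partial>lborel \<partial>lborel)"
    by (rule lborel_pair.Fubini') measurable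
  also have "\<dots> = (\<integral>\<^sup>+r. \<integral>\<^sup>+s. \<integral>\<^sup>+x. indicator {0..} r * indicator {0..} s * indicator {x. r < a x \<and> s < b x} x \<partial>lborel \<partial>lborel \<partial>lborel)"
    by (intro nn_integral_cong lborel_pair.Fubini') measurable
  also have "\<dots> = (\<integral>\<^sup>+r. \<integral>\<^sup>+s. indicator {0..} r * indicator {0..} s * emeasure lborel {x. r < a x \<and> s < b x} \<partial>lborel \<partial>lborel)"
    by (simp add: nn_integral_cmult mult.assoc)
  finally show ?thesis .
qed

lemma nn_integral_layers:
  fixes a :: "'a::euclidean_space \<Rightarrow> real"
  assumes [measurable]: "a \<in> borel_measurable borel" and a: "\<And>x. 0 \<le> a x"
  shows "(\<integral>\<^sup>+x. ennreal (a x) \<partial>lborel) = (\<integral>\<^sup>+r. indicator {0..} r * emeasure lborel {x. r < a x} \<partial>lborel)"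
proof -
  have "(\<integral>\<^sup>+x. ennreal (a x) \<partial>lborel) = (\<integral>\<^sup>+x. \<integral>\<^sup>+r. indicator {0..} r * indicator {x. r < a x} x \<partial>lborel \<partial>lborel)"
  proof (intro nn_integral_cong)
    fix x :: 'a
    have eq: "indicator {0..} r * indicator {x. r < a x} x = (indicator {0..<a x} r :: ennreal)" for r :: real
      by (auto simp: indicator_def)
    show "ennreal (a x) = (\<integral>\<^sup>+r. indicator {0..} r * indicator {x. r < a x} x \<partial>lborel)"
      unfolding eq using a[of x] by simp
  qed
  also have "\<dots> = (\<integral>\<^sup>+r. \<integral>\<^sup>+x. indicator {0..} r * indicator {x. r < a x} x \<partial>lborel \<partial>lborel)"
    by (rule lborel_pair.Fubini') measurable
  finally show ?thesis by (simp add: nn_integral_cmult)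
qed

lemma nn_integral_mono_layers:
  fixes a :: "'a::euclidean_space \<Rightarrow> real" and b :: "'b::euclidean_space \<Rightarrow> real"
  assumes [measurable]: "a \<in> borel_measurable borel" "b \<in> borel_measurable borel"
    and "\<And>x. 0 \<le> a x" "\<And>x. 0 \<le> b x"
    and le: "\<And>r. 0 \<le> r \<Longrightarrow> emeasure lborel {x. r < a x} \<le> emeasure lborel {x. r < b x}"
  shows "(\<integral>\<^sup>+x. ennreal (a x) \<partial>lborel) \<le> (\<integral>\<^sup>+x. ennreal (b x) \<partial>lborel)"
  using assms by (auto simp: nn_integral_layers indicator_def intro!: nn_integral_mono)

text \<open>By the layer formula for products it suffices to compare measures of the sets
  \<open>{r < a} \<inter> {s < b}\<close>. Functions that decrease on (0, \<infinity>) and vanish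
  elsewhere have nested level sets, so for \<open>as\<close> and \<open>bs\<close> this intersection
  is one of the two level sets, and its measure bounds that of the corresponding level set of
  \<open>a\<close> or \<open>b\<close>.\<close>

theorem Hardy_Littlewood_inequality:
  fixes a b :: "'a::euclidean_space \<Rightarrow> real" and as bs :: "real \<Rightarrow> real"
  assumes [measurable]: "a \<in> borel_measurable borel" "b \<in> borel_measurable borel"
      "as \<in> borel_measurable borel" "bs \<in> borel_measurable borel"
    and nn: "\<And>x. 0 \<le> a x" "\<And>x. 0 \<le> b x" "\<And>x. 0 \<le> as x" "\<And>x. 0 \<le> bs x"
    and as: "\<And>s t. 0 < s \<Longrightarrow> s \<le> t \<Longrightarrow> as t \<le> as s"
    and bs: "\<And>s t. 0 < s \<Longrightarrow> s \<le> t \<Longrightarrow> bs t \<le> bs s"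
    and as0: "\<And>t. t \<le> 0 \<Longrightarrow> as t = 0" and bs0: "\<And>t. t \<le> 0 \<Longrightarrow> bs t = 0"
    and la: "\<And>r. 0 \<le> r \<Longrightarrow> emeasure lborel {x. r < a x} \<le> emeasure lborel {x. r < as x}"
    and lb: "\<And>r. 0 \<le> r \<Longrightarrow> emeasure lborel {x. r < b x} \<le> emeasure lborel {x. r < bs x}"
  shows "(\<integral>\<^sup>+x. ennreal (a x * b x) \<partial>lborel) \<le> (\<integral>\<^sup>+t. ennreal (as t * bs t) \<partial>lborel)"
proof -
  have "emeasure lborel {x. r < a x \<and> s < b x} \<le> emeasure lborel {x. r < as x \<and> s < bs x}"
    if rs: "0 \<le> r" "0 \<le> s" for r s
  proof -
    have "{x. r < as x} \<subseteq> {x. s < bs x} \<or> {x. s < bs x} \<subseteq> {x. r < as x}"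
    proof (rule ccontr)
      assume "\<not> ?thesis"
      then obtain x y where xy: "r < as x" "\<not> s < bs x" "s < bs y" "\<not> r < as y" by auto
      have "0 < x" using as0[of x] xy rs by force
      have "0 < y" using bs0[of y] xy rs by force
      show False using as[OF \<open>0 < y\<close>, of x] bs[OF \<open>0 < x\<close>, of y] xy by linarith
    qed
    then show ?thesis
    proof
      assume "{x. r < as x} \<subseteq> {x. s < bs x}"
      then have *: "{x. r < as x \<and> s < bs x} = {x. r < as x}" by auto
      have "emeasure lborel {x. r < a x \<and> s < b x} \<le> emeasure lborel {x. r < a x}"
        by (rule emeasure_mono) auto
      then show ?thesis using la[of r] rs * by auto
    next
      assume "{x. s < bs x} \<subseteq> {x. r < as x}"
      then have *: "{x. r < as x \<and> s < bs x} = {x. s < bs x}" by auto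
      have "emeasure lborel {x. r < a x \<and> s < b x} \<le> emeasure lborel {x. s < b x}"
        by (rule emeasure_mono) auto
      then show ?thesis using lb[of s] rs * by auto
    qed
  qed
  then show ?thesis
    using nn by (auto simp: nn_integral_mult_layers indicator_def intro!: nn_integral_mono)
qed

lemma emeasure_norm_le:
  fixes r :: real
  assumes "0 \<le> r"
  shows "emeasure lborel {x::'a::euclidean_space. norm x \<le> r} = ennreal (unit_ball_vol (real DIM('a)) * r ^ DIM('a))"
proof -
  have "{x::'a. norm x \<le> r} = cball 0 r" by (auto simp: dist_norm)
  then show ?thesis using emeasure_cball[OF assms, of "0::'a"] by simp
qed

text \<open>A ball of radius \<open>r\<close> has measure \<open>V r^n\<close>, so the map
  \<open>x \<mapsto> V |x|^n\<close> carries Lebesgue measure to Lebesgue measure on (0,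
  \<infinity>); this is checked on half-lines, which generate the Borel sets. All radial integrals
  below are computed in this volume variable \<open>t\<close>.\<close>

lemma nn_integral_radial:
  fixes g :: "real \<Rightarrow> ennreal"
  assumes [measurable]: "g \<in> borel_measurable borel"
  shows "(\<integral>\<^sup>+(x::'a::euclidean_space). g (unit_ball_vol (real DIM('a)) * norm x ^ DIM('a)) \<partial>lborel)
       = (\<integral>\<^sup>+t. g t * indicator {0<..} t \<partial>lborel)"
proof -
  define V where "V = unit_ball_vol (real DIM('a))"
  have V: "0 < V" by (simp add: V_def)
  let ?h = "\<lambda>x::'a. V * norm x ^ DIM('a)"
  have "distr lborel borel ?h = density lborel (indicator {0<..})" (is "?M = ?N")
  proof (rule measure_eqI_generator_eq[where E="range atMost" and \<Omega>=UNIV and A="\<lambda>i. {..real i}"])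
    show "Int_stable (range (atMost :: real \<Rightarrow> _))" by (auto simp: Int_stable_def)
    show "sets ?M = sigma_sets UNIV (range atMost)" "sets ?N = sigma_sets UNIV (range atMost)"
      by (simp_all add: borel_eq_atMost)
    have *: "emeasure ?M {..c} = ennreal (max 0 c)" for c
    proof (cases "0 \<le> c")
      case True
      have "{x. ?h x \<le> c} = {x::'a. norm x \<le> root DIM('a) (c / V)}"
      proof (intro Collect_cong)
        fix x :: 'a
        have "?h x \<le> c \<longleftrightarrow> norm x ^ DIM('a) \<le> c / V" using V by (simp add: field_simps)
        also have "\<dots> \<longleftrightarrow> root DIM('a) (norm x ^ DIM('a)) \<le> root DIM('a) (c/V)" by simp
        finally show "?h x \<le> c \<longleftrightarrow> norm x \<le> root DIM('a) (c / V)" by (simp add: real_root_power_cancel)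
      qed
      then have "emeasure ?M {..c} = emeasure lborel {x::'a. norm x \<le> root DIM('a) (c / V)}"
        by (subst emeasure_distr) (auto simp: vimage_def)
      also have "\<dots> = ennreal c" using True V
        by (subst emeasure_norm_le) (auto simp: V_def[symmetric])
      finally show ?thesis using True by simp
    next
      case False
      have "\<not> ?h x \<le> c" for x using False V by (smt (verit) mult_nonneg_nonneg zero_le_power norm_ge_zero)
      then have "emeasure ?M {..c} = 0" by (subst emeasure_distr) (auto simp: vimage_def)
      then show ?thesis using False by (simp add: max_def)
    qed
    have **: "emeasure ?N {..c} = ennreal (max 0 c)" for c
    proof -
      have "emeasure ?N {..c} = (\<integral>\<^sup>+x. indicator {0<..} x * indicator {..c} x \<partial>lborel)"
        by (subst emeasure_density) auto
      also have "\<dots> = (\<integral>\<^sup>+x. indicator {0<..c} x \<partial>lborel)"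
        by (intro nn_integral_cong) (auto split: split_indicator)
      also have "\<dots> = ennreal (max 0 c)" by (cases "0 \<le> c") (auto simp: max_def)
      finally show ?thesis .
    qed
    show "\<And>X. X \<in> range atMost \<Longrightarrow> emeasure ?M X = emeasure ?N X" using * ** by auto
    show "range (\<lambda>i. {..real i}) \<subseteq> range atMost" by auto
    show "(\<Union>i. {..real i}) = UNIV" by (auto simp: real_arch_simple)
    show "emeasure ?M {..real i} \<noteq> \<infinity>" for i using * by simp
  qed auto
  then have "(\<integral>\<^sup>+t. g t \<partial>?M) = (\<integral>\<^sup>+t. g t \<partial>?N)" by simp
  then show ?thesis
    unfolding V_def by (simp add: nn_integral_distr nn_integral_density mult.commute)
qed

lemma emeasure_radial:
  fixes g :: "real \<Rightarrow> real"
  assumes [measurable]: "g \<in> borel_measurable borel"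
  shows "emeasure lborel {x::'a::euclidean_space. r < g (unit_ball_vol (real DIM('a)) * norm x ^ DIM('a))}
       = emeasure lborel {t. 0 < t \<and> r < g t}"
proof -
  have "emeasure lborel {x::'a. r < g (unit_ball_vol (real DIM('a)) * norm x ^ DIM('a))} =
     (\<integral>\<^sup>+x. indicator {t. r < g t} (unit_ball_vol (real DIM('a)) * norm (x::'a) ^ DIM('a)) \<partial>lborel)"
    by (subst nn_integral_indicator[symmetric]) (auto intro!: nn_integral_cong simp del: nn_integral_indicator split: split_indicator)
  also have "\<dots> = (\<integral>\<^sup>+t. indicator {t. 0 < t \<and> r < g t} t \<partial>lborel)"
    by (subst nn_integral_radial) (auto intro!: nn_integral_cong simp del: nn_integral_indicator split: split_indicator)
  finally show ?thesis by simp
qed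

lemma nn_integral_powr_Ioo:
  fixes a c :: real
  assumes "a > -1" "0 \<le> c"
  shows "(\<integral>\<^sup>+t. ennreal (t powr a) * indicator {0<..<c} t \<partial>lborel) = ennreal (c powr (a+1) / (a+1))"
proof -
  have "(\<integral>\<^sup>+t. ennreal (t powr a) * indicator {0<..<c} t \<partial>lborel) = (\<integral>\<^sup>+t. ennreal (t powr a) * indicator {0..c} t \<partial>lborel)"
  proof (rule nn_integral_cong_AE)
    show "AE t in lborel. ennreal (t powr a) * indicator {0<..<c} t = ennreal (t powr a) * indicator {0..c} t"
      using AE_lborel_singleton[of 0] AE_lborel_singleton[of c]
      by eventually_elim (auto simp: indicator_def)
  qed
  also have "\<dots> = ennreal (c powr (a+1) / (a+1))"
    by (rule nn_integral_has_integral_lebesgue') (auto intro: has_integral_powr_from_0 assms)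
  finally show ?thesis .
qed

lemma nn_integral_powr_Ioi:
  fixes e c :: real
  assumes "e < -1" "0 < c"
  shows "(\<integral>\<^sup>+t. ennreal (t powr e) * indicator {c<..} t \<partial>lborel) = ennreal (c powr (e+1) / (-(e+1)))"
proof -
  have "(\<integral>\<^sup>+t. ennreal (t powr e) * indicator {c<..} t \<partial>lborel) = (\<integral>\<^sup>+t. ennreal (t powr e) * indicator {c..} t \<partial>lborel)"
  proof (rule nn_integral_cong_AE)
    show "AE t in lborel. ennreal (t powr e) * indicator {c<..} t = ennreal (t powr e) * indicator {c..} t"
      using AE_lborel_singleton[of c]
      by eventually_elim (auto simp: indicator_def)
  qed
  also have "\<dots> = ennreal (-(c powr (e+1)) / (e+1))"
    by (rule nn_integral_has_integral_lebesgue') (use has_integral_powr_to_inf[of e c] assms in auto)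
  finally show ?thesis by (simp add: minus_divide_right del: minus_divide_right[symmetric])
qed

lemma nn_integral_eq_0_powr:
  fixes f :: "'a \<Rightarrow> real"
  assumes [measurable]: "f \<in> borel_measurable M" and "\<And>x. 0 \<le> f x" "(\<integral>\<^sup>+x. ennreal (f x powr p) \<partial>M) \<le> 0"
  shows "AE x in M. f x = 0"
proof -
  have "(\<integral>\<^sup>+x. ennreal (f x powr p) \<partial>M) = 0" using assms by simp
  then have "AE x in M. ennreal (f x powr p) = 0" by (subst (asm) nn_integral_0_iff_AE) auto
  then show ?thesis by eventually_elim (auto simp: ennreal_eq_0_iff powr_nonneg_iff)
qed

text \<open>Stated with upper bounds \<open>A\<close>, \<open>B\<close> in place of norms, so that
  it applies to integrals that have only been estimated. Young's inequality for \<open>f / A\<close>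
  and \<open>g / B\<close> gives it; if a bound is zero, one factor vanishes almost
  everywhere.\<close>

theorem nn_integral_Holder:
  fixes f g :: "'a \<Rightarrow> real"
  assumes [measurable]: "f \<in> borel_measurable M" "g \<in> borel_measurable M"
    and nn: "\<And>x. 0 \<le> f x" "\<And>x. 0 \<le> g x"
    and pq: "1 < p" "1 < q" "1/p + 1/q = 1"
    and A: "0 \<le> A" "(\<integral>\<^sup>+x. ennreal (f x powr p) \<partial>M) \<le> ennreal (A powr p)"
    and B: "0 \<le> B" "(\<integral>\<^sup>+x. ennreal (g x powr q) \<partial>M) \<le> ennreal (B powr q)"
  shows "(\<integral>\<^sup>+x. ennreal (f x * g x) \<partial>M) \<le> ennreal (A * B)"
proof (cases "A = 0 \<or> B = 0")
  case True
  then have "(AE x in M. f x = 0) \<or> (AE x in M. g x = 0)"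
    using nn_integral_eq_0_powr[of f M p] nn_integral_eq_0_powr[of g M q] A B nn by auto
  then have "AE x in M. ennreal (f x * g x) = 0" by auto
  then have "(\<integral>\<^sup>+x. ennreal (f x * g x) \<partial>M) = (\<integral>\<^sup>+x. 0 \<partial>M)" by (intro nn_integral_cong_AE) auto
  then show ?thesis by simp
next
  case False
  then have AB: "0 < A" "0 < B" using A B by auto
  have "f x * g x \<le> A * B * (f x powr p * (1 / (p * A powr p)) + g x powr q * (1 / (q * B powr q)))" for x
  proof -
    have "(f x / A) * (g x / B) \<le> (f x / A) powr p / p + (g x / B) powr q / q"
      by (rule Youngs_inequality) (use pq nn AB in auto)
    also have "\<dots> = f x powr p * (1 / (p * A powr p)) + g x powr q * (1 / (q * B powr q))"
      using AB nn by (simp add: powr_divide field_simps)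
    finally show ?thesis using AB by (simp add: field_simps)
  qed
  then have "(\<integral>\<^sup>+x. ennreal (f x * g x) \<partial>M) \<le>
      (\<integral>\<^sup>+x. ennreal (A*B) * (ennreal (f x powr p) * ennreal (1 / (p * A powr p)) + ennreal (g x powr q) * ennreal (1 / (q * B powr q))) \<partial>M)"
    using AB pq by (intro nn_integral_mono) (simp add: ennreal_mult[symmetric] ennreal_plus[symmetric] del: ennreal_plus)
  also have "\<dots> = ennreal (A*B) * ((\<integral>\<^sup>+x. ennreal (f x powr p) \<partial>M) * ennreal (1 / (p * A powr p)) + (\<integral>\<^sup>+x. ennreal (g x powr q) \<partial>M) * ennreal (1 / (q * B powr q)))"
    by (simp add: nn_integral_cmult nn_integral_add nn_integral_multc)
  also have "\<dots> \<le> ennreal (A*B) * (ennreal (A powr p) * ennreal (1 / (p * A powr p)) + ennreal (B powr q) * ennreal (1 / (q * B powr q)))"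
    by (intro mult_left_mono add_mono mult_right_mono A B) auto
  also have "\<dots> = ennreal (A*B * (A powr p * (1 / (p * A powr p)) + B powr q * (1 / (q * B powr q))))"
    using AB pq by (simp add: ennreal_mult[symmetric] ennreal_plus[symmetric] del: ennreal_plus)
  also have "A*B * (A powr p * (1 / (p * A powr p)) + B powr q * (1 / (q * B powr q))) = A * B"
    using AB pq by (simp add: field_simps)
  finally show ?thesis .
qed

section \<open>Rearrangement of Riesz potentials\<close>

lemma lborel_nn_integral_reflect:
  fixes f :: "'a::euclidean_space \<Rightarrow> ennreal"
  assumes [measurable]: "f \<in> borel_measurable borel"
  shows "(\<integral>\<^sup>+y. f (x - y) \<partial>lborel) = (\<integral>\<^sup>+y. f y \<partial>lborel)"
proof -
  have "(lborel :: 'a measure) = density (distr lborel borel (\<lambda>z. x + (-1) *\<^sub>R z)) (\<lambda>_. ennreal (\<bar>-1\<bar> ^ DIM('a)))"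
    by (rule lborel_affine) simp
  then have "(\<integral>\<^sup>+y. f y \<partial>lborel) = (\<integral>\<^sup>+y. f y \<partial>density (distr lborel borel (\<lambda>z. x + (-1) *\<^sub>R z)) (\<lambda>_. ennreal (\<bar>-1\<bar> ^ DIM('a))))"
    by metis
  also have "\<dots> = (\<integral>\<^sup>+y. f (x - y) \<partial>lborel)"
    by (simp add: nn_integral_density nn_integral_distr)
  finally show ?thesis by simp
qed

lemma lborel_emeasure_reflect:
  fixes A :: "'a::euclidean_space set"
  assumes [measurable]: "A \<in> sets borel"
  shows "emeasure lborel {y. x - y \<in> A} = emeasure lborel A"
proof -
  have "emeasure lborel {y. x - y \<in> A} = (\<integral>\<^sup>+y. indicator {y. x - y \<in> A} y \<partial>lborel)"
    by (subst nn_integral_indicator) auto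
  also have "\<dots> = (\<integral>\<^sup>+y. indicator A (x - y) \<partial>lborel)"
    by (intro nn_integral_cong) (auto split: split_indicator)
  also have "\<dots> = emeasure lborel A" by (subst lborel_nn_integral_reflect) auto
  finally show ?thesis .
qed

text \<open>Among sets of measure \<open>\<tau>\<close> the ball about \<open>x\<close> is extremal.
  \<open>bs\<close> is the kernel in the volume variable, so the Hardy-Littlewood inequality
  replaces \<open>B\<close> by the interval (0, \<open>\<tau>\<close>), where the integral is
  explicit.\<close>

lemma Riesz_kernel_set_integral_le:
  fixes x :: "'a::euclidean_space" and \<delta> \<tau> :: real
  defines "V \<equiv> unit_ball_vol (real DIM('a))"
  assumes [measurable]: "B \<in> sets borel" and B: "emeasure lborel B = ennreal \<tau>" and "0 \<le> \<tau>"
    and \<delta>: "0 < \<delta>" "\<delta> < 1"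
  shows "(\<integral>\<^sup>+y. ennreal (norm (x - y) powr (- (real DIM('a) * \<delta>))) * indicator B y \<partial>lborel)
       \<le> ennreal (V powr \<delta> * (\<tau> powr (1 - \<delta>) / (1 - \<delta>)))"
proof -
  have V: "0 < V" by (simp add: V_def)
  define bs where "bs = (\<lambda>t::real. if 0 < t then (t / V) powr (- \<delta>) else 0)"
  have [measurable]: "bs \<in> borel_measurable borel" unfolding bs_def by measurable
  \<comment> \<open>At \<open>z = 0\<close> both sides are 0, because
    \<open>0 powr _ = 0\<close>.\<close>
  have bs: "norm z powr (- (real DIM('a) * \<delta>)) = bs (V * norm z ^ DIM('a))" for z :: 'a
    using V by (cases "z = 0") (auto simp: bs_def powr_realpow[symmetric] powr_powr zero_power)
  have "(\<integral>\<^sup>+y. ennreal (norm (x - y) powr (- (real DIM('a) * \<delta>))) * indicator B y \<partial>lborel)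
      = (\<integral>\<^sup>+y. ennreal (indicator B y * norm (x - y) powr (- (real DIM('a) * \<delta>))) \<partial>lborel)"
    by (intro nn_integral_cong) (auto split: split_indicator)
  also have "\<dots> \<le> (\<integral>\<^sup>+t. ennreal (indicator {0<..<\<tau>} t * bs t) \<partial>lborel)"
  proof (rule Hardy_Littlewood_inequality)
    fix r :: real assume r: "0 \<le> r"
    have i: "{y. r < indicator B y} = (if r < 1 then B else {})" for B :: "'b set"
      using r by (auto split: split_indicator)
    show "emeasure lborel {y. r < indicator B y} \<le> emeasure lborel {t. r < indicator {0<..<\<tau>} t}"
      unfolding i using B \<open>0 \<le> \<tau>\<close> by auto
    have "emeasure lborel {y. r < norm (x - y) powr (- (real DIM('a) * \<delta>))}
        = emeasure lborel {z::'a. r < norm z powr (- (real DIM('a) * \<delta>))}"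
      using lborel_emeasure_reflect[of "{z::'a. r < norm z powr (- (real DIM('a) * \<delta>))}" x] by simp
    also have "\<dots> = emeasure lborel {t. 0 < t \<and> r < bs t}"
      unfolding bs V_def by (rule emeasure_radial) simp
    also have "\<dots> \<le> emeasure lborel {t. r < bs t}" by (rule emeasure_mono) auto
    finally show "emeasure lborel {y. r < norm (x - y) powr (- (real DIM('a) * \<delta>))} \<le> emeasure lborel {t. r < bs t}" .
  next
    show "bs t \<le> bs s" if "0 < s" "s \<le> t" for s t
      using that V \<delta> by (auto simp: bs_def intro!: powr_mono2' divide_right_mono)
  qed (auto simp: bs_def split: split_indicator)
  also have "\<dots> = (\<integral>\<^sup>+t. ennreal (V powr \<delta>) * (ennreal (t powr (-\<delta>)) * indicator {0<..<\<tau>} t) \<partial>lborel)"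
    using V by (intro nn_integral_cong)
      (auto simp: bs_def powr_divide powr_minus ennreal_mult[symmetric] field_simps split: split_indicator)
  also have "\<dots> = ennreal (V powr \<delta>) * ennreal (\<tau> powr (1 - \<delta>) / (1 - \<delta>))"
    using \<delta> \<open>0 \<le> \<tau>\<close> by (subst nn_integral_cmult) (auto simp: nn_integral_powr_Ioo)
  finally show ?thesis using \<delta> by (simp add: ennreal_mult[symmetric])
qed

text \<open>\<open>rearr g\<close> is the decreasing rearrangement of \<open>g\<close>, provided all its positive level sets have finite measure
  (\<open>measure\<close> is \<open>0\<close> on sets of infinite measure).\<close>

definition rearr :: "('a::euclidean_space \<Rightarrow> real) \<Rightarrow> real \<Rightarrow> real" where
  "rearr g \<tau> = (if \<tau> \<le> 0 then 0 else measure lborel {s. 0 \<le> s \<and> ennreal \<tau> < emeasure lborel {y. s < g y}})"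

text \<open>For the decreasing function \<open>k(\<tau>) = \<tau> powr (-\<delta>)\<close> this is
  the mean of \<open>k\<close> over (0, t) as long as \<open>\<tau> < t\<close>, and
  \<open>k(\<tau>)\<close> afterwards: the kernel in O'Neil's bound for averages of the
  rearrangement of a convolution.\<close>

definition ONeil_kernel :: "real \<Rightarrow> real \<Rightarrow> real \<Rightarrow> real" where
  "ONeil_kernel \<delta> t \<tau> = (if \<tau> \<le> 0 then 0 else if \<tau> < t then t powr (- \<delta>) / (1 - \<delta>) else \<tau> powr (- \<delta>))"

lemma ONeil_kernel_measurable[measurable]: "ONeil_kernel \<delta> t \<in> borel_measurable borel"
  unfolding ONeil_kernel_def by measurable

lemma ONeil_kernel_nonneg: "\<delta> < 1 \<Longrightarrow> 0 \<le> ONeil_kernel \<delta> t \<tau>"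
  by (simp add: ONeil_kernel_def)

text \<open>The integral of \<open>rearr g\<close> against \<open>ONeil_kernel \<delta> t\<close>, written as an integral over the levels of \<open>g\<close>.\<close>

definition ONeil_bound :: "real \<Rightarrow> ('a::euclidean_space \<Rightarrow> real) \<Rightarrow> real \<Rightarrow> ennreal" where
  "ONeil_bound \<delta> g t = (\<integral>\<^sup>+s. indicator {0..} s *
     ennreal (min (measure lborel {y. s < g y} * t powr (- \<delta>)) (measure lborel {y. s < g y} powr (1 - \<delta>)) / (1 - \<delta>)) \<partial>lborel)"

lemma emeasure_level_eq_measure:
  fixes g :: "'a::euclidean_space \<Rightarrow> real"
  assumes [measurable]: "g \<in> borel_measurable borel" and "emeasure lborel {y. 0 < g y} < \<infinity>" "0 \<le> s"
  shows "emeasure lborel {y. s < g y} = ennreal (measure lborel {y. s < g y})"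
proof -
  have "emeasure lborel {y. s < g y} \<le> emeasure lborel {y. 0 < g y}"
    using assms by (intro emeasure_mono) auto
  then show ?thesis using assms by (intro emeasure_eq_ennreal_measure) (auto simp: top_unique less_top[symmetric])
qed

text \<open>Cut \<open>g\<close> into layers, the indicators of its level sets. For one layer
  \<open>B\<close> of measure \<open>\<tau>\<close> the double integral of the kernel over
  \<open>A\<close> and \<open>B\<close> has two bounds: \<open>t\<close> times the extremal integral
  for measure \<open>\<tau>\<close>, or \<open>\<tau>\<close> times the extremal integral for
  measure \<open>t\<close>. The smaller one is the integrand of \<open>ONeil_bound\<close>.\<close>

lemma Riesz_potential_set_average_le:
  fixes g :: "'a::euclidean_space \<Rightarrow> real" and \<delta> t :: real
  defines "V \<equiv> unit_ball_vol (real DIM('a))"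
  assumes [measurable]: "g \<in> borel_measurable borel" and g: "\<And>x. 0 \<le> g x"
    and fin: "emeasure lborel {y. 0 < g y} < \<infinity>"
    and [measurable]: "A \<in> sets borel" and A: "emeasure lborel A = ennreal t" "0 < t"
    and \<delta>: "0 < \<delta>" "\<delta> < 1"
  shows "(\<integral>\<^sup>+x. indicator A x * (\<integral>\<^sup>+y. ennreal (norm (x - y) powr (- (real DIM('a) * \<delta>)) * g y) \<partial>lborel) \<partial>lborel)
     \<le> ennreal (V powr \<delta> * t) * ONeil_bound \<delta> g t"
proof -
  have V: "0 < V" by (simp add: V_def)
  let ?K = "\<lambda>x y :: 'a. ennreal (norm (x - y) powr (- (real DIM('a) * \<delta>)))"
  let ?L = "\<lambda>s. measure lborel {y. s < g y}"
  have gl: "ennreal (g y) = (\<integral>\<^sup>+s. indicator {0..<g y} s \<partial>lborel)" for y using g[of y] by simp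
  have "(\<integral>\<^sup>+x. indicator A x * (\<integral>\<^sup>+y. ennreal (norm (x - y) powr (- (real DIM('a) * \<delta>)) * g y) \<partial>lborel) \<partial>lborel)
    = (\<integral>\<^sup>+x. \<integral>\<^sup>+y. \<integral>\<^sup>+s. indicator A x * ?K x y * (indicator {0..} s * indicator {y. s < g y} y) \<partial>lborel \<partial>lborel \<partial>lborel)"
  proof (intro nn_integral_cong)
    fix x :: 'a
    have "indicator A x * (\<integral>\<^sup>+y. ennreal (norm (x - y) powr (- (real DIM('a) * \<delta>)) * g y) \<partial>lborel)
      = (\<integral>\<^sup>+y. indicator A x * ?K x y * ennreal (g y) \<partial>lborel)"
      using g by (simp add: ennreal_mult nn_integral_cmult mult.assoc)
    also have "\<dots> = (\<integral>\<^sup>+y. \<integral>\<^sup>+s. indicator A x * ?K x y * (indicator {0..} s * indicator {y. s < g y} y) \<partial>lborel \<partial>lborel)"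
    proof (intro nn_integral_cong)
      fix y :: 'a
      have "indicator A x * ?K x y * ennreal (g y) = (\<integral>\<^sup>+s. indicator A x * ?K x y * indicator {0..<g y} s \<partial>lborel)"
        unfolding gl by (subst nn_integral_cmult) auto
      also have "\<dots> = (\<integral>\<^sup>+s. indicator A x * ?K x y * (indicator {0..} s * indicator {y. s < g y} y) \<partial>lborel)"
        by (intro nn_integral_cong) (auto split: split_indicator)
      finally show "indicator A x * ?K x y * ennreal (g y) = (\<integral>\<^sup>+s. indicator A x * ?K x y * (indicator {0..} s * indicator {y. s < g y} y) \<partial>lborel)" .
    qed
    finally show "indicator A x * (\<integral>\<^sup>+y. ennreal (norm (x - y) powr (- (real DIM('a) * \<delta>)) * g y) \<partial>lborel)
      = (\<integral>\<^sup>+y. \<integral>\<^sup>+s. indicator A x * ?K x y * (indicator {0..} s * indicator {y. s < g y} y) \<partial>lborel \<partial>lborel)" .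
  qed
  also have "\<dots> = (\<integral>\<^sup>+x. \<integral>\<^sup>+s. \<integral>\<^sup>+y. indicator A x * ?K x y * (indicator {0..} s * indicator {y. s < g y} y) \<partial>lborel \<partial>lborel \<partial>lborel)"
    by (intro nn_integral_cong lborel_pair.Fubini') measurable
  also have "\<dots> = (\<integral>\<^sup>+s. \<integral>\<^sup>+x. \<integral>\<^sup>+y. indicator A x * ?K x y * (indicator {0..} s * indicator {y. s < g y} y) \<partial>lborel \<partial>lborel \<partial>lborel)"
    by (rule lborel_pair.Fubini') measurable
  also have "\<dots> \<le> (\<integral>\<^sup>+s. ennreal (V powr \<delta> * t) * (indicator {0..} s * ennreal (min (?L s * t powr (- \<delta>)) (?L s powr (1 - \<delta>)) / (1 - \<delta>))) \<partial>lborel)"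
  proof (intro nn_integral_mono)
    fix s :: real
    show "(\<integral>\<^sup>+x. \<integral>\<^sup>+y. indicator A x * ?K x y * (indicator {0..} s * indicator {y. s < g y} y) \<partial>lborel \<partial>lborel)
      \<le> ennreal (V powr \<delta> * t) * (indicator {0..} s * ennreal (min (?L s * t powr (- \<delta>)) (?L s powr (1 - \<delta>)) / (1 - \<delta>)))"
    proof (cases "0 \<le> s")
      case s: True
      define B where "B = {y. s < g y}"
      have [measurable]: "B \<in> sets borel" unfolding B_def by measurable
      define \<tau> where "\<tau> = ?L s"
      have B: "emeasure lborel B = ennreal \<tau>" and \<tau>: "0 \<le> \<tau>"
        unfolding B_def \<tau>_def using emeasure_level_eq_measure[OF _ fin s] by auto
      let ?I = "\<integral>\<^sup>+x. \<integral>\<^sup>+y. indicator A x * ?K x y * indicator B y \<partial>lborel \<partial>lborel"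
      have "?I = (\<integral>\<^sup>+x. (\<integral>\<^sup>+y. ?K x y * indicator B y \<partial>lborel) * indicator A x \<partial>lborel)"
        by (intro nn_integral_cong) (auto split: split_indicator)
      also have "\<dots> \<le> (\<integral>\<^sup>+x. ennreal (V powr \<delta> * (\<tau> powr (1 - \<delta>) / (1 - \<delta>))) * indicator A x \<partial>lborel)"
        unfolding V_def by (intro nn_integral_mono mult_right_mono Riesz_kernel_set_integral_le B \<tau> \<delta>) auto
      also have "\<dots> = ennreal (V powr \<delta> * t * (\<tau> powr (1 - \<delta>) / (1 - \<delta>)))"
        using A V \<delta> by (subst nn_integral_cmult_indicator) (auto simp: ennreal_mult[symmetric] mult_ac)
      finally have 1: "?I \<le> ennreal (V powr \<delta> * t * (\<tau> powr (1 - \<delta>) / (1 - \<delta>)))" .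
      \<comment> \<open>Integrating in the other order exchanges the roles of \<open>A\<close> and
        \<open>B\<close> and gives the second bound.\<close>
      have "?I = (\<integral>\<^sup>+y. \<integral>\<^sup>+x. indicator A x * ?K x y * indicator B y \<partial>lborel \<partial>lborel)"
        by (rule lborel_pair.Fubini') measurable
      also have "\<dots> = (\<integral>\<^sup>+y. (\<integral>\<^sup>+x. ?K y x * indicator A x \<partial>lborel) * indicator B y \<partial>lborel)"
        by (intro nn_integral_cong) (auto simp: norm_minus_commute mult.commute split: split_indicator)
      also have "\<dots> \<le> (\<integral>\<^sup>+y. ennreal (V powr \<delta> * (t powr (1 - \<delta>) / (1 - \<delta>))) * indicator B y \<partial>lborel)"
        unfolding V_def using A by (intro nn_integral_mono mult_right_mono Riesz_kernel_set_integral_le \<delta>) auto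
      also have "\<dots> = ennreal (V powr \<delta> * (t powr (1 - \<delta>) / (1 - \<delta>)) * \<tau>)"
        using A B V \<delta> \<tau> by (subst nn_integral_cmult_indicator) (auto simp: ennreal_mult[symmetric] mult_ac)
      also have "V powr \<delta> * (t powr (1 - \<delta>) / (1 - \<delta>)) * \<tau> = V powr \<delta> * t * (\<tau> * t powr (-\<delta>) / (1 - \<delta>))"
        using A by (simp add: powr_diff powr_minus field_simps)
      finally have 2: "?I \<le> ennreal (V powr \<delta> * t * (\<tau> * t powr (-\<delta>) / (1 - \<delta>)))" .
      have "?I \<le> ennreal (V powr \<delta> * t * (min (\<tau> * t powr (- \<delta>)) (\<tau> powr (1 - \<delta>)) / (1 - \<delta>)))"
        using 1 2 by (auto simp: min_def)
      also have "\<dots> = ennreal (V powr \<delta> * t) * ennreal (min (\<tau> * t powr (- \<delta>)) (\<tau> powr (1 - \<delta>)) / (1 - \<delta>))"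
        using A V \<delta> \<tau> by (intro ennreal_mult) auto
      finally have 3: "?I \<le> \<dots>" .
      have "indicator {0..} s = (1::ennreal)" using s by simp
      then show ?thesis using 3 by (simp add: \<tau>_def B_def)
    qed simp
  qed
  also have "\<dots> = ennreal (V powr \<delta> * t) * ONeil_bound \<delta> g t"
  proof -
    have "(\<lambda>s. measure lborel {y. s < g y}) \<in> borel_measurable borel"
      unfolding measure_def by measurable
    then show ?thesis unfolding ONeil_bound_def by (subst nn_integral_cmult) auto
  qed
  finally show ?thesis .
qed

lemma ONeil_bound_measurable[measurable]:
  fixes g :: "'a::euclidean_space \<Rightarrow> real"
  assumes [measurable]: "g \<in> borel_measurable borel"
  shows "ONeil_bound \<delta> g \<in> borel_measurable borel"
  unfolding ONeil_bound_def measure_def by measurable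

lemma ONeil_bound_antimono:
  assumes "0 < \<delta>" "\<delta> < 1" "0 < s" "s \<le> t"
  shows "ONeil_bound \<delta> g t \<le> ONeil_bound \<delta> g s"
proof -
  have "t powr - \<delta> \<le> s powr - \<delta>" using assms by (intro powr_mono2') auto
  then show ?thesis unfolding ONeil_bound_def using assms
    by (intro nn_integral_mono mult_left_mono ennreal_leI divide_right_mono min.mono order.refl) auto
qed

lemma rearr_nonneg: "0 \<le> rearr g \<tau>"
  by (simp add: rearr_def)

text \<open>The bound \<open>M\<close> confines the levels that are counted to
  \<open>{0..M}\<close>, so their measure is finite and \<open>measure\<close> loses nothing against
  \<open>emeasure\<close>.\<close>

lemma rearr_eq:
  fixes g :: "'a::euclidean_space \<Rightarrow> real"
  assumes [measurable]: "g \<in> borel_measurable borel" and g: "\<And>x. g x \<le> M" and "0 < \<tau>"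
  shows "ennreal (rearr g \<tau>) = (\<integral>\<^sup>+s. indicator {0..} s * indicator {s. ennreal \<tau> < emeasure lborel {y. s < g y}} s \<partial>lborel)"
proof -
  let ?S = "{s. 0 \<le> s \<and> ennreal \<tau> < emeasure lborel {y. s < g y}}"
  have "s \<le> M" if "ennreal \<tau> < emeasure lborel {y. s < g y}" for s
  proof (rule ccontr)
    assume "\<not> s \<le> M"
    then have "{y. s < g y} = {}" using g by (auto simp: not_less intro: order.trans[OF g])
    then show False using that by simp
  qed
  then have "?S \<subseteq> {0..M}" by auto
  then have "emeasure lborel ?S \<le> emeasure lborel {0..M}" by (intro emeasure_mono) auto
  also have "\<dots> < \<infinity>" by (simp add: emeasure_lborel_Icc_eq)
  finally have "emeasure lborel ?S = ennreal (rearr g \<tau>)"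
    using \<open>0 < \<tau>\<close> by (simp add: rearr_def emeasure_eq_ennreal_measure less_top)
  moreover have "emeasure lborel ?S = (\<integral>\<^sup>+s. indicator ?S s \<partial>lborel)"
    by (subst nn_integral_indicator) auto
  moreover have "\<dots> = (\<integral>\<^sup>+s. indicator {0..} s * indicator {s. ennreal \<tau> < emeasure lborel {y. s < g y}} s \<partial>lborel)"
    by (intro nn_integral_cong) (auto split: split_indicator)
  ultimately show ?thesis by simp
qed

lemma rearr_measurable[measurable]:
  fixes g :: "'a::euclidean_space \<Rightarrow> real"
  assumes [measurable]: "g \<in> borel_measurable borel"
  shows "rearr g \<in> borel_measurable borel"
proof -
  have "rearr g = (\<lambda>\<tau>. if \<tau> \<le> 0 then 0 else enn2real (\<integral>\<^sup>+s. indicator {0..} s * indicator {s. ennreal \<tau> < emeasure lborel {y. s < g y}} s \<partial>lborel))"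
  proof (rule ext)
    fix \<tau>
    let ?S = "{s. 0 \<le> s \<and> ennreal \<tau> < emeasure lborel {y. s < g y}}"
    have "emeasure lborel ?S = (\<integral>\<^sup>+s. indicator ?S s \<partial>lborel)"
      by (subst nn_integral_indicator) auto
    moreover have "\<dots> = (\<integral>\<^sup>+s. indicator {0..} s * indicator {s. ennreal \<tau> < emeasure lborel {y. s < g y}} s \<partial>lborel)"
      by (intro nn_integral_cong) (auto split: split_indicator)
    ultimately show "rearr g \<tau> = (if \<tau> \<le> 0 then 0 else enn2real (\<integral>\<^sup>+s. indicator {0..} s * indicator {s. ennreal \<tau> < emeasure lborel {y. s < g y}} s \<partial>lborel))"
      by (simp add: rearr_def measure_def)
  qed
  also have "\<dots> \<in> borel_measurable borel" by measurable
  finally show ?thesis .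
qed

text \<open>For \<open>L \<le> t\<close> the kernel is constant on (0, L). For \<open>L > t\<close>
  its constant part has the same integral over (0, t) as \<open>\<tau> powr (-\<delta>)\<close>,
  being the mean, so the total is \<open>L powr (1 - \<delta>) / (1 - \<delta>)\<close>. In both
  cases the minimum on the left is met.\<close>

lemma ONeil_kernel_integral_ge:
  assumes \<delta>: "0 < \<delta>" "\<delta> < 1" and t: "0 < t" and L: "0 \<le> L"
  shows "ennreal (min (L * t powr (- \<delta>)) (L powr (1 - \<delta>)) / (1 - \<delta>)) \<le> (\<integral>\<^sup>+\<tau>. ennreal (ONeil_kernel \<delta> t \<tau>) * indicator {0<..<L} \<tau> \<partial>lborel)"
proof (cases "L \<le> t")
  case True
  have "(\<integral>\<^sup>+\<tau>. ennreal (ONeil_kernel \<delta> t \<tau>) * indicator {0<..<L} \<tau> \<partial>lborel) = (\<integral>\<^sup>+\<tau>. ennreal (t powr (- \<delta>) / (1 - \<delta>)) * indicator {0<..<L} \<tau> \<partial>lborel)"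
    using True by (intro nn_integral_cong) (auto simp: ONeil_kernel_def split: split_indicator)
  also have "\<dots> = ennreal (L * t powr (- \<delta>) / (1 - \<delta>))"
    using L \<delta> by (subst nn_integral_cmult_indicator) (auto simp: ennreal_mult[symmetric] mult.commute)
  also have "\<dots> \<ge> ennreal (min (L * t powr (- \<delta>)) (L powr (1 - \<delta>)) / (1 - \<delta>))"
    using \<delta> by (intro ennreal_leI divide_right_mono) auto
  finally show ?thesis .
next
  case False
  have "(\<integral>\<^sup>+\<tau>. ennreal (ONeil_kernel \<delta> t \<tau>) * indicator {0<..<L} \<tau> \<partial>lborel) =
     (\<integral>\<^sup>+\<tau>. ennreal (t powr (- \<delta>) / (1 - \<delta>)) * indicator {0<..<t} \<tau> + ennreal (\<tau> powr (-\<delta>)) * indicator {t..<L} \<tau> \<partial>lborel)"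
    using False t by (intro nn_integral_cong) (auto simp: ONeil_kernel_def split: split_indicator)
  also have "\<dots> = ennreal (t powr (1 - \<delta>) / (1 - \<delta>)) + (\<integral>\<^sup>+\<tau>. ennreal (\<tau> powr (-\<delta>)) * indicator {t..<L} \<tau> \<partial>lborel)"
  proof -
    have "(\<integral>\<^sup>+\<tau>. ennreal (t powr (- \<delta>) / (1 - \<delta>)) * indicator {0<..<t} \<tau> \<partial>lborel) = ennreal (t powr (1 - \<delta>) / (1 - \<delta>))"
      using t \<delta> by (subst nn_integral_cmult_indicator) (auto simp: ennreal_mult[symmetric] powr_diff powr_minus field_simps)
    then show ?thesis using \<delta> by (subst nn_integral_add) auto
  qed
  also have "ennreal (t powr (1 - \<delta>) / (1 - \<delta>)) = (\<integral>\<^sup>+\<tau>. ennreal (\<tau> powr (-\<delta>)) * indicator {0<..<t} \<tau> \<partial>lborel)"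
    using t \<delta> by (subst nn_integral_powr_Ioo) auto
  also have "\<dots> + (\<integral>\<^sup>+\<tau>. ennreal (\<tau> powr (-\<delta>)) * indicator {t..<L} \<tau> \<partial>lborel) = (\<integral>\<^sup>+\<tau>. ennreal (\<tau> powr (-\<delta>)) * indicator {0<..<L} \<tau> \<partial>lborel)"
    using False t by (subst nn_integral_add[symmetric]) (auto intro!: nn_integral_cong split: split_indicator)
  also have "\<dots> = ennreal (L powr (1 - \<delta>) / (1 - \<delta>))"
    using L \<delta> by (subst nn_integral_powr_Ioo) auto
  also have "\<dots> \<ge> ennreal (min (L * t powr (- \<delta>)) (L powr (1 - \<delta>)) / (1 - \<delta>))"
    using \<delta> by (intro ennreal_leI divide_right_mono) auto
  finally show ?thesis .
qed

text \<open>Tonelli: for each level \<open>s\<close> the kernel is integrated over (0, L) with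
  \<open>L\<close> the measure of the level set, and in the other order each \<open>\<tau>\<close>
  is weighted by the length of the set of levels with \<open>\<tau> < L\<close>, which is
  \<open>rearr g \<tau>\<close>.\<close>

lemma ONeil_bound_le_rearr:
  fixes g :: "'a::euclidean_space \<Rightarrow> real"
  assumes [measurable]: "g \<in> borel_measurable borel" and g: "\<And>x. g x \<le> M"
    and fin: "emeasure lborel {y. 0 < g y} < \<infinity>" and \<delta>: "0 < \<delta>" "\<delta> < 1" and t: "0 < t"
  shows "ONeil_bound \<delta> g t \<le> (\<integral>\<^sup>+\<tau>. ennreal (rearr g \<tau> * ONeil_kernel \<delta> t \<tau>) \<partial>lborel)"
proof -
  let ?R = "\<lambda>s \<tau>. indicator {0<..} \<tau> * ennreal (ONeil_kernel \<delta> t \<tau>) * (indicator {0..} s * indicator {s. ennreal \<tau> < emeasure lborel {y. s < g y}} s)"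
  have [measurable]: "Measurable.pred (borel \<Otimes>\<^sub>M borel) (\<lambda>(s::real, \<tau>). ennreal \<tau> < emeasure lborel {y. s < g y})"
    by measurable
  have "ONeil_bound \<delta> g t \<le> (\<integral>\<^sup>+s. \<integral>\<^sup>+\<tau>. ?R s \<tau> \<partial>lborel \<partial>lborel)"
    unfolding ONeil_bound_def
  proof (intro nn_integral_mono)
    fix s :: real
    show "indicator {0..} s * ennreal (min (measure lborel {y. s < g y} * t powr (- \<delta>)) (measure lborel {y. s < g y} powr (1 - \<delta>)) / (1 - \<delta>))
       \<le> (\<integral>\<^sup>+\<tau>. ?R s \<tau> \<partial>lborel)"
    proof (cases "0 \<le> s")
      case True
      let ?L = "measure lborel {y. s < g y}"
      have "ennreal (min (?L * t powr (- \<delta>)) (?L powr (1 - \<delta>)) / (1 - \<delta>)) \<le> (\<integral>\<^sup>+\<tau>. ennreal (ONeil_kernel \<delta> t \<tau>) * indicator {0<..<?L} \<tau> \<partial>lborel)"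
        by (rule ONeil_kernel_integral_ge) (use \<delta> t in auto)
      also have "\<dots> \<le> (\<integral>\<^sup>+\<tau>. ?R s \<tau> \<partial>lborel)"
        using True emeasure_level_eq_measure[OF _ fin True]
        by (intro nn_integral_mono) (auto split: split_indicator intro: ennreal_lessI)
      finally show ?thesis using True by simp
    qed simp
  qed
  also have "\<dots> = (\<integral>\<^sup>+\<tau>. \<integral>\<^sup>+s. ?R s \<tau> \<partial>lborel \<partial>lborel)"
    by (rule lborel_pair.Fubini') measurable
  also have "\<dots> = (\<integral>\<^sup>+\<tau>. ennreal (rearr g \<tau> * ONeil_kernel \<delta> t \<tau>) \<partial>lborel)"
  proof (intro nn_integral_cong)
    fix \<tau> :: real
    show "(\<integral>\<^sup>+s. ?R s \<tau> \<partial>lborel) = ennreal (rearr g \<tau> * ONeil_kernel \<delta> t \<tau>)"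
    proof (cases "0 < \<tau>")
      case True
      then show ?thesis using \<delta>
        by (subst nn_integral_cmult) (auto simp: ennreal_mult' rearr_eq[OF _ g, symmetric] rearr_nonneg ONeil_kernel_nonneg mult.commute ennreal_mult)
    next
      case False
      then show ?thesis by (simp add: ONeil_kernel_def)
    qed
  qed
  finally show ?thesis .
qed

text \<open>If \<open>r < rearr g \<tau>\<close>, then the level set of \<open>g\<close> at
  \<open>r\<close> has measure above \<open>\<tau>\<close>, since otherwise all levels counted by
  \<open>rearr\<close> would lie in \<open>{0..r}\<close>. Hence the set on the left lies in the
  interval from 0 to the number on the right.\<close>

lemma emeasure_level_rearr_le:
  fixes g :: "'a::euclidean_space \<Rightarrow> real"
  assumes [measurable]: "g \<in> borel_measurable borel" and r: "0 \<le> r"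
  shows "emeasure lborel {\<tau>. r < rearr g \<tau>} \<le> emeasure lborel {y. r < g y}"
proof -
  let ?E = "emeasure lborel {y. r < g y}"
  have "0 < \<tau> \<and> ennreal \<tau> < ?E" if "r < rearr g \<tau>" for \<tau>
  proof
    show \<tau>: "0 < \<tau>" using that r by (auto simp: rearr_def split: if_splits)
    show "ennreal \<tau> < ?E"
    proof (rule ccontr)
      assume n: "\<not> ennreal \<tau> < ?E"
      let ?S = "{s. 0 \<le> s \<and> ennreal \<tau> < emeasure lborel {y. s < g y}}"
      have "s \<le> r" if "s \<in> ?S" for s
      proof (rule ccontr)
        assume "\<not> s \<le> r"
        then have "emeasure lborel {y. s < g y} \<le> ?E" by (intro emeasure_mono) auto
        then show False using that n by auto
      qed
      then have "measure lborel ?S \<le> measure lborel {0..r}"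
        by (intro measure_mono_fmeasurable) (auto simp: fmeasurable_def emeasure_lborel_Icc_eq)
      then show False using that r \<tau> by (simp add: rearr_def)
    qed
  qed
  then have sub: "{\<tau>. r < rearr g \<tau>} \<subseteq> {\<tau>. 0 < \<tau> \<and> ennreal \<tau> < ?E}" by auto
  show ?thesis
  proof (cases "?E = \<infinity>")
    case False
    then obtain e where e: "?E = ennreal e" "0 \<le> e" by (cases ?E) auto
    have "emeasure lborel {\<tau>. r < rearr g \<tau>} \<le> emeasure lborel {0<..<e}"
      using sub e by (intro emeasure_mono) (auto simp: ennreal_less_iff)
    then show ?thesis using e by simp
  qed simp
qed

lemma nn_integral_rearr_powr_le:
  fixes g :: "'a::euclidean_space \<Rightarrow> real"
  assumes [measurable]: "g \<in> borel_measurable borel" and g: "\<And>x. 0 \<le> g x" and s: "0 < s"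
  shows "(\<integral>\<^sup>+\<tau>. ennreal (rearr g \<tau> powr s) \<partial>lborel) \<le> (\<integral>\<^sup>+x. ennreal (g x powr s) \<partial>lborel)"
proof (rule nn_integral_mono_layers)
  fix r :: real assume r: "0 \<le> r"
  have *: "r < a powr s \<longleftrightarrow> r powr (1/s) < a" if "0 \<le> a" for a
  proof
    assume "r < a powr s"
    then have "r powr (1/s) < (a powr s) powr (1/s)" using r s by (intro powr_less_mono2) auto
    then show "r powr (1/s) < a" using s that by (simp add: powr_powr)
  next
    assume "r powr (1/s) < a"
    then have "(r powr (1/s)) powr s < a powr s" using s by (intro powr_less_mono2) auto
    then show "r < a powr s" using s r by (simp add: powr_powr)
  qed
  show "emeasure lborel {x. r < rearr g x powr s} \<le> emeasure lborel {x. r < g x powr s}"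
    using emeasure_level_rearr_le[of g "r powr (1/s)"] by (simp add: * g rearr_nonneg)
qed auto

text \<open>If \<open>{r < a}\<close> has measure above \<open>t\<close>, averaging \<open>a\<close>
  over a subset of some measure \<open>t' > t\<close> shows that the one-dimensional potential
  exceeds \<open>r\<close> at \<open>t'\<close>, and by monotonicity at \<open>t\<close>. So its
  level set contains an interval starting at 0 whose length is the measure of
  \<open>{r < a}\<close>.\<close>

theorem Riesz_potential_level_le:
  fixes a g :: "'a::euclidean_space \<Rightarrow> real" and \<delta> c :: real
  defines "V \<equiv> unit_ball_vol (real DIM('a))"
  assumes [measurable]: "g \<in> borel_measurable borel" "a \<in> borel_measurable borel"
    and g: "\<And>x. 0 \<le> g x"
    and fin: "emeasure lborel {y. 0 < g y} < \<infinity>"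
    and \<delta>: "0 < \<delta>" "\<delta> < 1" and c: "0 \<le> c"
    and a: "\<And>x. ennreal (a x) \<le> ennreal c * (\<integral>\<^sup>+y. ennreal (norm (x - y) powr (- (real DIM('a) * \<delta>)) * g y) \<partial>lborel)"
    and ON: "\<And>t. 0 < t \<Longrightarrow> ONeil_bound \<delta> g t < \<infinity>" and r: "0 \<le> r"
  shows "emeasure lborel {x. r < a x} \<le> emeasure lborel {t. 0 < t \<and> r < c * V powr \<delta> * enn2real (ONeil_bound \<delta> g t)}"
proof -
  let ?W = "\<lambda>t. c * V powr \<delta> * enn2real (ONeil_bound \<delta> g t)"
  let ?E = "emeasure lborel {x. r < a x}"
  have V: "0 < V" by (simp add: V_def)
  have key: "r < ?W t" if t: "0 < t" "ennreal t < ?E" for t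
  proof -
    \<comment> \<open>The set may have infinite measure and \<open>a\<close> may come arbitrarily
      close to \<open>r\<close> on it. Intersecting with balls and raising the level by
      \<open>1 / (k + 1)\<close> gives finite measure and the margin \<open>r < r'\<close> that
      makes the final inequality strict.\<close>
    have "(\<lambda>k. emeasure lborel ({x. r + 1 / real (Suc k) < a x} \<inter> ball 0 (real k))) \<longlonglongrightarrow> emeasure lborel (\<Union>k. {x. r + 1 / real (Suc k) < a x} \<inter> ball 0 (real k))"
    proof (intro Lim_emeasure_incseq)
      show "incseq (\<lambda>k. {x. r + 1 / real (Suc k) < a x} \<inter> ball 0 (real k))"
      proof (rule incseq_SucI)
        fix k
        have "1 / real (Suc (Suc k)) \<le> 1 / real (Suc k)" by (simp add: field_simps)
        then show "{x. r + 1 / real (Suc k) < a x} \<inter> ball 0 (real k) \<subseteq> {x. r + 1 / real (Suc (Suc k)) < a x} \<inter> ball 0 (real (Suc k))"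
          by auto
      qed
    qed auto
    also have "(\<Union>k. {x. r + 1 / real (Suc k) < a x} \<inter> ball 0 (real k)) = {x. r < a x}"
    proof (intro set_eqI iffI)
      fix x assume "x \<in> {x. r < a x}"
      then have "0 < a x - r" by simp
      then obtain k1 where k1: "1 / real (Suc k1) < a x - r" using nat_approx_posE by blast
      obtain k2 where k2: "norm x < real k2" using reals_Archimedean2 by blast
      have "1 / real (Suc (max k1 k2)) \<le> 1 / real (Suc k1)" by (intro divide_left_mono) auto
      then have "x \<in> {x. r + 1 / real (Suc (max k1 k2)) < a x} \<inter> ball 0 (real (max k1 k2))"
        using k1 k2 by auto
      then show "x \<in> (\<Union>k. {x. r + 1 / real (Suc k) < a x} \<inter> ball 0 (real k))" by blast
    next
      fix x assume "x \<in> (\<Union>k. {x. r + 1 / real (Suc k) < a x} \<inter> ball 0 (real k))"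
      then obtain k where "r + 1 / real (Suc k) < a x" by auto
      moreover have "0 < 1 / real (Suc k)" by simp
      ultimately have "r < a x" by linarith
      then show "x \<in> {x. r < a x}" by simp
    qed
    finally have "(\<lambda>k. emeasure lborel ({x. r + 1 / real (Suc k) < a x} \<inter> ball 0 (real k))) \<longlonglongrightarrow> ?E" .
    then have "\<forall>\<^sub>F k in sequentially. ennreal t < emeasure lborel ({x. r + 1 / real (Suc k) < a x} \<inter> ball 0 (real k))"
      using t(2) by (rule order_tendstoD)
    then obtain k where k: "ennreal t < emeasure lborel ({x. r + 1 / real (Suc k) < a x} \<inter> ball 0 (real k))"
      by (auto simp: eventually_sequentially)
    define A where "A = {x. r + 1 / real (Suc k) < a x} \<inter> ball 0 (real k)"
    have [measurable]: "A \<in> sets borel" unfolding A_def by measurable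
    define r' where "r' = r + 1 / real (Suc k)"
    have r': "r < r'" unfolding r'_def by simp
    have "emeasure lborel A \<le> emeasure lborel (ball (0::'a) (real k))"
      unfolding A_def by (intro emeasure_mono) auto
    also have "\<dots> < \<infinity>" by (rule emeasure_lborel_ball_finite)
    finally obtain t' where t': "emeasure lborel A = ennreal t'" "0 \<le> t'" by (cases "emeasure lborel A") auto
    have tt': "t < t'" using k[folded A_def] t t' by (simp add: ennreal_less_iff)
    have "ennreal (r' * t') = (\<integral>\<^sup>+x. ennreal r' * indicator A x \<partial>lborel)"
      using t' r r' by (simp add: nn_integral_cmult_indicator ennreal_mult)
    also have "\<dots> \<le> (\<integral>\<^sup>+x. indicator A x * ennreal (a x) \<partial>lborel)"
      by (intro nn_integral_mono) (auto simp: A_def r'_def split: split_indicator intro!: ennreal_leI)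
    also have "\<dots> \<le> (\<integral>\<^sup>+x. ennreal c * (indicator A x * (\<integral>\<^sup>+y. ennreal (norm (x - y) powr (- (real DIM('a) * \<delta>)) * g y) \<partial>lborel)) \<partial>lborel)"
      using a by (intro nn_integral_mono) (auto split: split_indicator)
    also have "\<dots> = ennreal c * (\<integral>\<^sup>+x. indicator A x * (\<integral>\<^sup>+y. ennreal (norm (x - y) powr (- (real DIM('a) * \<delta>)) * g y) \<partial>lborel) \<partial>lborel)"
      by (intro nn_integral_cmult) measurable
    also have "\<dots> \<le> ennreal c * (ennreal (V powr \<delta> * t') * ONeil_bound \<delta> g t')"
      unfolding V_def using t' tt' t
      by (intro mult_left_mono Riesz_potential_set_average_le g fin \<delta>) auto
    also have "\<dots> = ennreal c * (ennreal (V powr \<delta> * t') * ennreal (enn2real (ONeil_bound \<delta> g t')))"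
      using ON[of t'] tt' t by (simp add: ennreal_enn2real_if)
    also have "\<dots> = ennreal (?W t' * t')"
      using c t' by (simp add: ennreal_mult[symmetric] mult_ac)
    finally have "r' * t' \<le> ?W t' * t'" using c by (subst (asm) ennreal_le_iff) (auto simp: t')
    then have "r' \<le> ?W t'" using tt' t by simp
    also have "\<dots> \<le> ?W t"
      using ONeil_bound_antimono[of \<delta> t t' g] ON[of t] tt' t \<delta> c
      by (intro mult_left_mono enn2real_mono) auto
    finally show ?thesis using r' by simp
  qed
  show ?thesis
  \<comment> \<open>The measure on the left may be infinite, so it is approached from below by
    finite values.\<close>
  proof (rule dense_le)
    fix e assume "e < ?E"
    then obtain e' where e': "e = ennreal e'" "0 \<le> e'" by (cases e) auto
    have "{0<..<e'} \<subseteq> {t. 0 < t \<and> r < ?W t}"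
    proof
      fix t assume "t \<in> {0<..<e'}"
      then have "0 < t" "ennreal t < e" using e' by (auto simp: ennreal_less_iff)
      then have "0 < t" "ennreal t < ?E" using \<open>e < ?E\<close> by auto
      with key show "t \<in> {t. 0 < t \<and> r < ?W t}" by auto
    qed
    moreover have "{t. 0 < t \<and> r < ?W t} \<in> sets lborel"
      by measurable
    ultimately have "emeasure lborel {0<..<e'} \<le> emeasure lborel {t. 0 < t \<and> r < ?W t}"
      by (intro emeasure_mono) auto
    then show "e \<le> emeasure lborel {t. 0 < t \<and> r < ?W t}" using e' by simp
  qed
qed

section \<open>One-dimensional potential estimates\<close>

text \<open>Normalise by the two sums and apply Young's inequality to each term. When the first sum
  is at most one, this merges two contributions to a potential without a multiplicative
  constant.\<close>

lemma powr_Holder2: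
  fixes a1 a2 b1 b2 \<theta> :: real
  assumes "0 < \<theta>" "\<theta> < 1" "0 \<le> a1" "0 \<le> a2" "0 \<le> b1" "0 \<le> b2"
  shows "a1 powr (1 - \<theta>) * b1 powr \<theta> + a2 powr (1 - \<theta>) * b2 powr \<theta> \<le> (a1 + a2) powr (1 - \<theta>) * (b1 + b2) powr \<theta>"
proof -
  have Y: "a powr (1 - \<theta>) * b powr \<theta> \<le> (1 - \<theta>) * a + \<theta> * b" if "0 \<le> a" "0 \<le> b" for a b :: real
  proof (cases "a = 0 \<or> b = 0")
    case True then show ?thesis using that assms by auto
  next
    case False then show ?thesis using that assms by (intro Youngs_inequality_0) auto
  qed
  define A where "A = a1 + a2"
  define B where "B = b1 + b2"
  show ?thesis
  proof (cases "A = 0 \<or> B = 0")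
    case True
    then have "(a1 = 0 \<and> a2 = 0) \<or> (b1 = 0 \<and> b2 = 0)" using assms unfolding A_def B_def by auto
    then show ?thesis by auto
  next
    case False
    then have AB: "0 < A" "0 < B" using assms unfolding A_def B_def by auto
    have "(a1 / A) powr (1 - \<theta>) * (b1 / B) powr \<theta> + (a2 / A) powr (1 - \<theta>) * (b2 / B) powr \<theta>
      \<le> ((1 - \<theta>) * (a1 / A) + \<theta> * (b1 / B)) + ((1 - \<theta>) * (a2 / A) + \<theta> * (b2 / B))"
      using AB assms by (intro add_mono Y) auto
    also have "\<dots> = (1 - \<theta>) * ((a1 + a2) / A) + \<theta> * ((b1 + b2) / B)" by (simp add: add_divide_distrib algebra_simps)
    also have "\<dots> = 1" using AB by (simp add: A_def[symmetric] B_def[symmetric])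
    finally have "(a1 powr (1 - \<theta>) * b1 powr \<theta> + a2 powr (1 - \<theta>) * b2 powr \<theta>) / (A powr (1 - \<theta>) * B powr \<theta>) \<le> 1"
      using AB assms by (simp add: powr_divide add_divide_distrib)
    then show ?thesis using AB by (simp add: A_def B_def pos_divide_le_eq)
  qed
qed

section \<open>A one-dimensional Hardy-Littlewood-Sobolev estimate by a Schur test\<close>

lemma nn_integral_powr_max:
  fixes a b \<tau> :: real
  assumes "a < 1" "1 < a + b" "0 < \<tau>"
  shows "(\<integral>\<^sup>+t. ennreal (t powr (-a) * max t \<tau> powr (-b)) * indicator {0<..} t \<partial>lborel)
    = ennreal ((1 / (1 - a) + 1 / (a + b - 1)) * \<tau> powr (1 - a - b))"
proof -
  have "(\<integral>\<^sup>+t. ennreal (t powr (-a) * max t \<tau> powr (-b)) * indicator {0<..} t \<partial>lborel)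
    = (\<integral>\<^sup>+t. ennreal (\<tau> powr (-b)) * (ennreal (t powr (-a)) * indicator {0<..<\<tau>} t) + ennreal (t powr (-a-b)) * indicator {\<tau><..} t \<partial>lborel)"
  proof (rule nn_integral_cong_AE)
    show "AE t in lborel. ennreal (t powr (-a) * max t \<tau> powr (-b)) * indicator {0<..} t =
        ennreal (\<tau> powr (-b)) * (ennreal (t powr (-a)) * indicator {0<..<\<tau>} t) + ennreal (t powr (-a-b)) * indicator {\<tau><..} t"
      using AE_lborel_singleton[of \<tau>]
    proof eventually_elim
      fix t assume "t \<noteq> \<tau>"
      moreover have "t powr (-a) * t powr (-b) = t powr (-a-b)" by (simp add: powr_add[symmetric])
      ultimately show "ennreal (t powr (-a) * max t \<tau> powr (-b)) * indicator {0<..} t =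
        ennreal (\<tau> powr (-b)) * (ennreal (t powr (-a)) * indicator {0<..<\<tau>} t) + ennreal (t powr (-a-b)) * indicator {\<tau><..} t"
        using assms by (auto simp: max_def ennreal_mult[symmetric] mult.commute split: split_indicator)
    qed
  qed
  also have "\<dots> = ennreal (\<tau> powr (-b)) * ennreal (\<tau> powr (-a+1) / (-a+1)) + ennreal (\<tau> powr (-a-b+1) / (-(-a-b+1)))"
    using assms by (subst nn_integral_add) (auto simp: nn_integral_cmult nn_integral_powr_Ioo nn_integral_powr_Ioi)
  also have "\<dots> = ennreal (\<tau> powr (-b) * (\<tau> powr (-a+1) / (-a+1)) + \<tau> powr (-a-b+1) / (-(-a-b+1)))"
    using assms by (simp add: ennreal_mult[symmetric] ennreal_plus[symmetric] del: ennreal_plus)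
  also have "\<tau> powr (-b) * (\<tau> powr (-a+1) / (-a+1)) = \<tau> powr (1-a-b) / (1-a)"
    by (simp add: powr_add[symmetric] algebra_simps)
  also have "\<tau> powr (1-a-b) / (1-a) + \<tau> powr (-a-b+1) / (-(-a-b+1)) = (1 / (1 - a) + 1 / (a + b - 1)) * \<tau> powr (1 - a - b)"
    by (simp add: algebra_simps)
  finally show ?thesis .
qed

text \<open>The kernel \<open>max t \<tau> powr (-\<delta>)\<close> is symmetric and dominates
  \<open>ONeil_kernel \<delta> t \<tau>\<close> up to the factor
  \<open>q = 1 / (1 - \<delta>)\<close>, a loss that is harmless wherever no sharp constant is at
  stake.\<close>

definition max_potential :: "real \<Rightarrow> (real \<Rightarrow> real) \<Rightarrow> real \<Rightarrow> ennreal" where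
  "max_potential \<delta> G t = (\<integral>\<^sup>+\<tau>. ennreal (G \<tau> * max t \<tau> powr (-\<delta>)) * indicator {0<..} \<tau> \<partial>lborel)"

lemma max_potential_measurable[measurable]:
  assumes [measurable]: "G \<in> borel_measurable borel"
  shows "max_potential \<delta> G \<in> borel_measurable borel"
  unfolding max_potential_def by measurable

text \<open>Hoelder's inequality against the kernel: its \<open>p'\<close>-th power is integrable
  because \<open>p < q\<close> means \<open>\<delta> * p' > 1\<close>, and the power of
  \<open>t\<close> comes from \<open>1/s = \<delta> - 1/p'\<close>.\<close>

lemma max_potential_le:
  fixes p q \<delta> s :: real
  assumes pq: "1 < p" "p < q" and \<delta>: "\<delta> = 1 - 1/q" and s: "1/s = 1/p - 1/q"
  obtains C where "0 \<le> C" "\<And>G B t. G \<in> borel_measurable borel \<Longrightarrow> (\<And>\<tau>. 0 \<le> G \<tau>) \<Longrightarrow> 0 \<le> B \<Longrightarrow>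
     (\<integral>\<^sup>+\<tau>. ennreal (G \<tau> powr p) \<partial>lborel) \<le> ennreal (B powr p) \<Longrightarrow> 0 < t \<Longrightarrow>
     max_potential \<delta> G t \<le> ennreal (C * B * t powr (- (1/s)))"
proof -
  define p' where "p' = p / (p - 1)"
  have p': "1 < p'" "1/p + 1/p' = 1" using pq by (auto simp: p'_def field_simps)
  have dp: "1 < \<delta> * p'"
  proof -
    have "1/q < 1/p" using pq by (simp add: field_simps)
    then have "1 / p' < \<delta>" using \<delta> p'(2) by linarith
    then show ?thesis using p'(1) by (simp add: field_simps)
  qed
  define K where "K = 1 + 1 / (\<delta> * p' - 1)"
  have K: "0 < K" using dp unfolding K_def by (simp add: add_pos_pos)
  define C where "C = K powr (1/p')"
  show ?thesis
  proof
    show "0 \<le> C" by (simp add: C_def)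
    fix G :: "real \<Rightarrow> real" and B t :: real
    assume [measurable]: "G \<in> borel_measurable borel" and G: "\<And>\<tau>. 0 \<le> G \<tau>" and B: "0 \<le> B"
      "(\<integral>\<^sup>+\<tau>. ennreal (G \<tau> powr p) \<partial>lborel) \<le> ennreal (B powr p)" and t: "0 < t"
    have "max_potential \<delta> G t = (\<integral>\<^sup>+\<tau>. ennreal (G \<tau> * (max t \<tau> powr (-\<delta>) * indicator {0<..} \<tau>)) \<partial>lborel)"
      unfolding max_potential_def by (intro nn_integral_cong) (auto split: split_indicator)
    also have "\<dots> \<le> ennreal (B * (C * t powr (- (1/s))))"
    proof (rule nn_integral_Holder[OF _ _ _ _ pq(1) p' B])
      have "(\<integral>\<^sup>+\<tau>. ennreal ((max t \<tau> powr (-\<delta>) * indicator {0<..} \<tau>) powr p') \<partial>lborel)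
        = (\<integral>\<^sup>+\<tau>. ennreal (\<tau> powr (-0) * max \<tau> t powr (-(\<delta> * p'))) * indicator {0<..} \<tau> \<partial>lborel)"
        by (intro nn_integral_cong) (auto simp: powr_powr max.commute split: split_indicator)
      also have "\<dots> = ennreal ((1 / (1 - 0) + 1 / (0 + \<delta> * p' - 1)) * t powr (1 - 0 - \<delta> * p'))"
        by (rule nn_integral_powr_max) (use dp t in auto)
      also have "(1 / (1 - 0) + 1 / (0 + \<delta> * p' - 1)) * t powr (1 - 0 - \<delta> * p') = (C * t powr (- (1/s))) powr p'"
      proof -
        have "1/s = \<delta> - 1/p'" using s \<delta> p' by linarith
        then have "- (1/s) * p' = 1 - \<delta> * p'" using p' by (simp add: field_simps)
        then show ?thesis using p' K t by (simp add: C_def powr_mult powr_powr K_def)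
      qed
      finally show "(\<integral>\<^sup>+\<tau>. ennreal ((max t \<tau> powr (-\<delta>) * indicator {0<..} \<tau>) powr p') \<partial>lborel) \<le> ennreal ((C * t powr (- (1/s))) powr p')"
        by simp
    qed (auto simp: G C_def)
    finally show "max_potential \<delta> G t \<le> ennreal (C * B * t powr (- (1/s)))" by (simp add: mult_ac)
  qed
qed

text \<open>Write \<open>J powr s = J powr (s - p) * J powr p\<close>. The first factor is estimated
  by the pointwise bound, the second by a Schur test with weight
  \<open>\<tau> powr \<sigma>\<close>; the weight in \<open>t\<close> that results is again one for
  which the kernel integrates explicitly. In the application \<open>s\<close> is
  \<open>pstar\<close>.\<close>

theorem max_potential_powr_integral_le:
  fixes p q \<delta> s :: real
  assumes pq: "1 < p" "p < q" and \<delta>: "\<delta> = 1 - 1/q" and s: "1/s = 1/p - 1/q"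
  obtains C where "0 \<le> C" "\<And>G B. G \<in> borel_measurable borel \<Longrightarrow> (\<And>\<tau>. 0 \<le> G \<tau>) \<Longrightarrow> 0 \<le> B \<Longrightarrow>
     (\<integral>\<^sup>+\<tau>. ennreal (G \<tau> powr p) \<partial>lborel) \<le> ennreal (B powr p) \<Longrightarrow>
     (\<integral>\<^sup>+t. ennreal (enn2real (max_potential \<delta> G t) powr s) * indicator {0<..} t \<partial>lborel) \<le> ennreal (C * B powr s)"
proof -
  obtain C0 where C0: "0 \<le> C0" "\<And>G B t. G \<in> borel_measurable borel \<Longrightarrow> (\<And>\<tau>. 0 \<le> G \<tau>) \<Longrightarrow> 0 \<le> B \<Longrightarrow>
     (\<integral>\<^sup>+\<tau>. ennreal (G \<tau> powr p) \<partial>lborel) \<le> ennreal (B powr p) \<Longrightarrow> 0 < t \<Longrightarrow>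
     max_potential \<delta> G t \<le> ennreal (C0 * B * t powr (- (1/s)))"
    using max_potential_le[OF assms] by blast
  define p' where "p' = p / (p - 1)"
  have p': "1 < p'" "1/p + 1/p' = 1" using pq by (auto simp: p'_def field_simps)
  have pp: "p / p' = p - 1" "p' * (p - 1) = p" using pq by (auto simp: p'_def field_simps)
  have "1/q < 1/p" "0 < 1/q" using pq by (auto intro: divide_strict_left_mono)
  then have s0: "0 < 1/s" "1/s < 1/p" unfolding s by auto
  have sp: "0 < s" using s0(1) by (simp only: zero_less_divide_1_iff)
  moreover have "p < s" using s0(2) pq sp by (simp add: field_simps)
  ultimately have sp: "0 < s" "p < s" by auto
  \<comment> \<open>\<open>\<sigma> * p' < 1\<close> and \<open>1 < \<sigma> * p' + \<delta>\<close>
    make the inner integral of the Schur test converge at 0 and at infinity;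
    \<open>\<sigma> * p < \<delta>\<close> and \<open>0 < \<sigma>\<close> do the same for the outer
    one. These conditions cut out the interval between \<open>\<sigma>l\<close> and
    \<open>\<sigma>h\<close>, nonempty because \<open>p < q\<close>.\<close>
  define \<sigma>l where "\<sigma>l = 1 / (q * p')"
  define \<sigma>h where "\<sigma>h = min (1/p') (\<delta> / p)"
  have "\<sigma>l < \<sigma>h"
  proof -
    have "1 / (q * p') < 1 / p'" using pq p' by (simp add: field_simps)
    moreover have "1 / (q * p') < \<delta> / p"
    proof -
      have "1 / (q * p') = (p - 1) / (p * q)" using pq by (simp add: p'_def)
      also have "\<dots> < (q - 1) / (p * q)" using pq by (intro divide_strict_right_mono) auto
      also have "\<dots> = \<delta> / p" unfolding \<delta> using pq by (simp add: field_simps)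
      finally show ?thesis .
    qed
    ultimately show ?thesis unfolding \<sigma>l_def \<sigma>h_def by simp
  qed
  then obtain \<sigma> where \<sigma>': "\<sigma>l < \<sigma>" "\<sigma> < \<sigma>h" using dense by blast
  have \<sigma>: "\<sigma> * p' < 1" "1 < \<sigma> * p' + \<delta>" "\<sigma> * p < \<delta>" "0 < \<sigma>"
  proof -
    show "\<sigma> * p' < 1" using \<sigma>'(2) p' by (simp add: \<sigma>h_def field_simps)
    have "1 / q < \<sigma> * p'" using \<sigma>'(1) p' pq by (simp add: \<sigma>l_def field_simps)
    then show "1 < \<sigma> * p' + \<delta>" using \<delta> by linarith
    show "\<sigma> * p < \<delta>" using \<sigma>'(2) pq by (simp add: \<sigma>h_def field_simps)
    have "0 < \<sigma>l" using pq p' by (simp add: \<sigma>l_def)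
    then show "0 < \<sigma>" using \<sigma>'(1) by linarith
  qed
  define K2 where "K2 = 1 / (1 - \<sigma> * p') + 1 / (\<sigma> * p' + \<delta> - 1)"
  have K2: "0 < K2" unfolding K2_def using \<sigma> by (intro add_pos_pos) auto
  define K3 where "K3 = 1 / (1 - (1/q + \<sigma> * p)) + 1 / ((1/q + \<sigma> * p) + \<delta> - 1)"
  have a3: "1/q + \<sigma> * p < 1" "1 < (1/q + \<sigma> * p) + \<delta>" using \<sigma> \<delta> pq by auto
  have K3: "0 < K3" unfolding K3_def using a3 by (intro add_pos_pos) auto
  define C where "C = C0 powr (s - p) * K2 powr (p - 1) * K3"
  show ?thesis
  proof
    show "0 \<le> C" using K3 by (simp add: C_def)
    fix G :: "real \<Rightarrow> real" and B :: real
    assume Gm[measurable]: "G \<in> borel_measurable borel" and G: "\<And>\<tau>. 0 \<le> G \<tau>" and B: "0 \<le> B"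
      "(\<integral>\<^sup>+\<tau>. ennreal (G \<tau> powr p) \<partial>lborel) \<le> ennreal (B powr p)"
    define J where "J = (\<lambda>t. enn2real (max_potential \<delta> G t))"
    define H where "H = (\<lambda>t. \<integral>\<^sup>+\<tau>. ennreal (G \<tau> powr p * \<tau> powr (\<sigma> * p) * max t \<tau> powr (-\<delta>)) * indicator {0<..} \<tau> \<partial>lborel)"
    have Hm[measurable]: "H \<in> borel_measurable borel" unfolding H_def by measurable
    have J1: "J t \<le> C0 * B * t powr (- (1/s))" if "0 < t" for t
      unfolding J_def using C0(2)[OF Gm G B that] C0(1) B by (intro enn2real_leI) auto
    have Jfin: "ennreal (J t) = max_potential \<delta> G t" if "0 < t" for t
      unfolding J_def using C0(2)[OF Gm G B that] by (subst ennreal_enn2real) (auto simp: top_unique less_top[symmetric])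
    have J0: "0 \<le> J t" for t by (simp add: J_def)
    have Jm[measurable]: "J \<in> borel_measurable borel" unfolding J_def by measurable
    have J2: "ennreal (J t powr p) \<le> H t * ennreal (K2 powr (p - 1) * t powr ((1 - \<delta> - \<sigma> * p') * (p - 1)))" if t: "0 < t" for t
    proof -
      \<comment> \<open>Finiteness of \<open>H t\<close> comes first, so that Hoelder's inequality
        can be applied with a real bound \<open>h\<close>.\<close>
      have "H t \<le> (\<integral>\<^sup>+\<tau>. ennreal (t powr (\<sigma> * p - \<delta>)) * ennreal (G \<tau> powr p) \<partial>lborel)"
        unfolding H_def
      proof (intro nn_integral_mono)
        fix \<tau> :: real
        have "\<tau> powr (\<sigma> * p) * max t \<tau> powr (-\<delta>) \<le> t powr (\<sigma> * p - \<delta>)" if "0 < \<tau>"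
        proof -
          have "\<tau> powr (\<sigma> * p) * max t \<tau> powr (-\<delta>) \<le> max t \<tau> powr (\<sigma> * p) * max t \<tau> powr (-\<delta>)"
            using that \<sigma> pq by (intro mult_right_mono powr_mono2) auto
          also have "\<dots> = max t \<tau> powr (\<sigma> * p - \<delta>)" by (simp add: powr_add[symmetric])
          also have "\<dots> \<le> t powr (\<sigma> * p - \<delta>)" using t \<sigma> by (intro powr_mono2') auto
          finally show ?thesis .
        qed
        then show "ennreal (G \<tau> powr p * \<tau> powr (\<sigma> * p) * max t \<tau> powr (-\<delta>)) * indicator {0<..} \<tau>
           \<le> ennreal (t powr (\<sigma> * p - \<delta>)) * ennreal (G \<tau> powr p)"
          by (auto simp: ennreal_mult[symmetric] mult.assoc mult.commute[of "t powr _"] split: split_indicator intro!: ennreal_leI mult_left_mono)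
      qed
      also have "\<dots> = ennreal (t powr (\<sigma> * p - \<delta>)) * (\<integral>\<^sup>+\<tau>. ennreal (G \<tau> powr p) \<partial>lborel)" by (simp add: nn_integral_cmult)
      also have "\<dots> \<le> ennreal (t powr (\<sigma> * p - \<delta>)) * ennreal (B powr p)" using B by (intro mult_left_mono) auto
      also have "\<dots> < \<infinity>" by (simp add: ennreal_mult[symmetric])
      finally obtain h where h: "H t = ennreal h" "0 \<le> h" by (cases "H t") auto
      \<comment> \<open>The kernel is split with exponents \<open>-\<delta>/p\<close> and
        \<open>-\<delta>/p'\<close>, and the weight \<open>\<tau> powr \<sigma>\<close> is inserted
        together with its inverse.\<close>
      have "ennreal (J t) = (\<integral>\<^sup>+\<tau>. ennreal ((G \<tau> * \<tau> powr \<sigma> * max t \<tau> powr (-\<delta>/p) * indicator {0<..} \<tau>) * (\<tau> powr (-\<sigma>) * max t \<tau> powr (-\<delta>/p') * indicator {0<..} \<tau>)) \<partial>lborel)"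
        unfolding Jfin[OF t] max_potential_def
      proof (intro nn_integral_cong)
        fix \<tau> :: real
        have "- \<delta> / p + - \<delta> / p' = - \<delta> * (1/p + 1/p')" by (simp add: algebra_simps)
        then have e: "- \<delta> / p + - \<delta> / p' = - \<delta>" unfolding p'(2) by simp
        have "max t \<tau> powr (-\<delta>/p) * max t \<tau> powr (-\<delta>/p') = max t \<tau> powr (-\<delta>)"
          unfolding powr_add[symmetric] e ..
        moreover have "\<tau> powr \<sigma> * \<tau> powr (-\<sigma>) = 1" if "0 < \<tau>" using that by (simp add: powr_add[symmetric])
        ultimately have eq: "G \<tau> * \<tau> powr \<sigma> * max t \<tau> powr (-\<delta>/p) * (\<tau> powr (-\<sigma>) * max t \<tau> powr (-\<delta>/p')) = G \<tau> * max t \<tau> powr (-\<delta>)" if "0 < \<tau>"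
          using that by (metis (no_types, opaque_lifting) mult.assoc mult.commute mult.left_commute mult_1)
        show "ennreal (G \<tau> * max t \<tau> powr (-\<delta>)) * indicator {0<..} \<tau> = ennreal ((G \<tau> * \<tau> powr \<sigma> * max t \<tau> powr (-\<delta>/p) * indicator {0<..} \<tau>) * (\<tau> powr (-\<sigma>) * max t \<tau> powr (-\<delta>/p') * indicator {0<..} \<tau>))"
        proof (cases "0 < \<tau>")
          case True
          then have i: "indicator {0<..} \<tau> = (1::real)" "indicator {0<..} \<tau> = (1::ennreal)" by auto
          show ?thesis unfolding i mult_1_right eq[OF True] ..
        qed simp
      qed
      also have "\<dots> \<le> ennreal (h powr (1/p) * (K2 * t powr (1 - \<delta> - \<sigma> * p')) powr (1/p'))"
      proof (rule nn_integral_Holder[OF _ _ _ _ pq(1) p'])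
        have "(\<integral>\<^sup>+\<tau>. ennreal ((G \<tau> * \<tau> powr \<sigma> * max t \<tau> powr (-\<delta>/p) * indicator {0<..} \<tau>) powr p) \<partial>lborel) = H t"
          unfolding H_def using G pq by (intro nn_integral_cong) (auto simp: powr_mult powr_powr split: split_indicator)
        then show "(\<integral>\<^sup>+\<tau>. ennreal ((G \<tau> * \<tau> powr \<sigma> * max t \<tau> powr (-\<delta>/p) * indicator {0<..} \<tau>) powr p) \<partial>lborel) \<le> ennreal ((h powr (1/p)) powr p)"
          using h pq by (simp add: powr_powr)
        have "(\<integral>\<^sup>+\<tau>. ennreal ((\<tau> powr (-\<sigma>) * max t \<tau> powr (-\<delta>/p') * indicator {0<..} \<tau>) powr p') \<partial>lborel) =
          (\<integral>\<^sup>+\<tau>. ennreal (\<tau> powr (-(\<sigma> * p')) * max \<tau> t powr (-\<delta>)) * indicator {0<..} \<tau> \<partial>lborel)"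
          using p' by (intro nn_integral_cong) (auto simp: powr_mult powr_powr max.commute split: split_indicator)
        also have "\<dots> = ennreal (K2 * t powr (1 - \<sigma> * p' - \<delta>))"
          unfolding K2_def by (rule nn_integral_powr_max) (use \<sigma> t in auto)
        also have "K2 * t powr (1 - \<sigma> * p' - \<delta>) = ((K2 * t powr (1 - \<delta> - \<sigma> * p')) powr (1/p')) powr p'"
          using p' K2 by (simp add: powr_powr algebra_simps)
        finally show "(\<integral>\<^sup>+\<tau>. ennreal ((\<tau> powr (-\<sigma>) * max t \<tau> powr (-\<delta>/p') * indicator {0<..} \<tau>) powr p') \<partial>lborel) \<le> ennreal (((K2 * t powr (1 - \<delta> - \<sigma> * p')) powr (1/p')) powr p')"
          by simp
      qed (auto simp: G)
      finally have "J t \<le> h powr (1/p) * (K2 * t powr (1 - \<delta> - \<sigma> * p')) powr (1/p')"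
        by (subst (asm) ennreal_le_iff) auto
      then have "J t powr p \<le> (h powr (1/p) * (K2 * t powr (1 - \<delta> - \<sigma> * p')) powr (1/p')) powr p"
        using J0 pq by (intro powr_mono2) auto
      also have "\<dots> = h * (K2 powr (p - 1) * t powr ((1 - \<delta> - \<sigma> * p') * (p - 1)))"
      proof -
        have "(X powr (1/p')) powr p = X powr (p - 1)" for X using pp by (simp add: powr_powr)
        moreover have "(h powr (1/p)) powr p = h" using h pq by (simp add: powr_powr)
        ultimately have "(h powr (1/p) * X powr (1/p')) powr p = h * X powr (p - 1)" for X
          by (simp only: powr_mult)
        from this[of "K2 * t powr (1 - \<delta> - \<sigma> * p')"] show ?thesis
          by (simp only: powr_mult[of K2 "t powr (1 - \<delta> - \<sigma> * p')" "p - 1"] powr_powr[of t])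
      qed
      finally show ?thesis using h by (simp add: ennreal_mult[symmetric])
    qed
    define D where "D = C0 powr (s - p) * B powr (s - p) * K2 powr (p - 1)"
    have D: "0 \<le> D" by (simp add: D_def)
    have "(\<integral>\<^sup>+t. ennreal (J t powr s) * indicator {0<..} t \<partial>lborel)
      \<le> (\<integral>\<^sup>+t. ennreal D * (ennreal (t powr (-(1/q + \<sigma> * p))) * indicator {0<..} t * H t) \<partial>lborel)"
    proof (intro nn_integral_mono)
      fix t :: real
      show "ennreal (J t powr s) * indicator {0<..} t \<le> ennreal D * (ennreal (t powr (-(1/q + \<sigma> * p))) * indicator {0<..} t * H t)"
      proof (cases "0 < t")
        case True
        have "J t powr s = J t powr (s - p) * J t powr p" using sp by (simp add: powr_add[symmetric])
        also have "ennreal \<dots> = ennreal (J t powr (s - p)) * ennreal (J t powr p)" by (simp add: ennreal_mult)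
        also have "\<dots> \<le> ennreal ((C0 * B * t powr (- (1/s))) powr (s - p)) * (H t * ennreal (K2 powr (p - 1) * t powr ((1 - \<delta> - \<sigma> * p') * (p - 1))))"
          using J1[OF True] J0 sp by (intro mult_mono J2 True ennreal_leI powr_mono2) auto
        also have "\<dots> = ennreal ((C0 * B * t powr (- (1/s))) powr (s - p) * (K2 powr (p - 1) * t powr ((1 - \<delta> - \<sigma> * p') * (p - 1)))) * H t"
          by (simp add: ennreal_mult mult_ac)
        also have "(C0 * B * t powr (- (1/s))) powr (s - p) * (K2 powr (p - 1) * t powr ((1 - \<delta> - \<sigma> * p') * (p - 1)))
          = D * (t powr (- (1/s) * (s - p)) * t powr ((1 - \<delta> - \<sigma> * p') * (p - 1)))"
          using C0(1) B(1) True unfolding D_def by (simp add: powr_mult powr_powr mult_ac)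
        \<comment> \<open>\<open>(s - p) / s = p / q\<close> turns the pointwise decay into
          \<open>t powr (-p/q)\<close>; the other exponent is
          \<open>(p - 1)/q - \<sigma> * p\<close> because \<open>p' * (p - 1) = p\<close>.\<close>
        also have "t powr (- (1/s) * (s - p)) * t powr ((1 - \<delta> - \<sigma> * p') * (p - 1)) = t powr (-(1/q + \<sigma> * p))"
        proof -
          have "- (1/s) * (s - p) = -1 + p * (1/s)" using sp by (simp add: field_simps)
          also have "\<dots> = - p / q" unfolding s using pq by (simp add: field_simps)
          finally have 1: "- (1/s) * (s - p) = - p / q" .
          have "(1 - \<delta> - \<sigma> * p') * (p - 1) = (p - 1) / q - \<sigma> * (p' * (p - 1))"
            unfolding \<delta> by (simp add: algebra_simps)
          then have 2: "(1 - \<delta> - \<sigma> * p') * (p - 1) = (p - 1) / q - \<sigma> * p" unfolding pp .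
          show ?thesis unfolding powr_add[symmetric] 1 2 by (simp add: diff_divide_distrib)
        qed
        finally show ?thesis using True D by (simp add: ennreal_mult mult.assoc)
      qed simp
    qed
    also have "\<dots> = ennreal D * (\<integral>\<^sup>+t. ennreal (t powr (-(1/q + \<sigma> * p))) * indicator {0<..} t * H t \<partial>lborel)"
      by (simp add: nn_integral_cmult)
    also have "(\<integral>\<^sup>+t. ennreal (t powr (-(1/q + \<sigma> * p))) * indicator {0<..} t * H t \<partial>lborel)
      = (\<integral>\<^sup>+t. \<integral>\<^sup>+\<tau>. ennreal (t powr (-(1/q + \<sigma> * p))) * indicator {0<..} t * (ennreal (G \<tau> powr p * \<tau> powr (\<sigma> * p) * max t \<tau> powr (-\<delta>)) * indicator {0<..} \<tau>) \<partial>lborel \<partial>lborel)"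
      unfolding H_def by (simp add: nn_integral_cmult)
    also have "\<dots> = (\<integral>\<^sup>+\<tau>. \<integral>\<^sup>+t. ennreal (t powr (-(1/q + \<sigma> * p))) * indicator {0<..} t * (ennreal (G \<tau> powr p * \<tau> powr (\<sigma> * p) * max t \<tau> powr (-\<delta>)) * indicator {0<..} \<tau>) \<partial>lborel \<partial>lborel)"
      by (rule lborel_pair.Fubini') measurable
    also have "\<dots> \<le> (\<integral>\<^sup>+\<tau>. ennreal K3 * ennreal (G \<tau> powr p) \<partial>lborel)"
    proof (intro nn_integral_mono)
      fix \<tau> :: real
      show "(\<integral>\<^sup>+t. ennreal (t powr (-(1/q + \<sigma> * p))) * indicator {0<..} t * (ennreal (G \<tau> powr p * \<tau> powr (\<sigma> * p) * max t \<tau> powr (-\<delta>)) * indicator {0<..} \<tau>) \<partial>lborel)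
         \<le> ennreal K3 * ennreal (G \<tau> powr p)"
      proof (cases "0 < \<tau>")
        case True
        have "(\<integral>\<^sup>+t. ennreal (t powr (-(1/q + \<sigma> * p))) * indicator {0<..} t * (ennreal (G \<tau> powr p * \<tau> powr (\<sigma> * p) * max t \<tau> powr (-\<delta>)) * indicator {0<..} \<tau>) \<partial>lborel)
          = (\<integral>\<^sup>+t. ennreal (G \<tau> powr p * \<tau> powr (\<sigma> * p)) * (ennreal (t powr (-(1/q + \<sigma> * p)) * max t \<tau> powr (-\<delta>)) * indicator {0<..} t) \<partial>lborel)"
          using True by (intro nn_integral_cong) (auto simp: ennreal_mult[symmetric] mult_ac split: split_indicator)
        also have "\<dots> = ennreal (G \<tau> powr p * \<tau> powr (\<sigma> * p)) * ennreal (K3 * \<tau> powr (1 - (1/q + \<sigma> * p) - \<delta>))"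
          unfolding K3_def using a3 True by (subst nn_integral_cmult, simp, subst nn_integral_powr_max) auto
        also have "\<dots> = ennreal (K3 * G \<tau> powr p * (\<tau> powr (\<sigma> * p) * \<tau> powr (1 - (1/q + \<sigma> * p) - \<delta>)))"
          using K3 by (simp add: ennreal_mult[symmetric] mult_ac)
        \<comment> \<open>The exponents add up to \<open>1 - 1/q - \<delta> = 0\<close>, so that no
          weight is left on \<open>G powr p\<close>.\<close>
        also have "\<tau> powr (\<sigma> * p) * \<tau> powr (1 - (1/q + \<sigma> * p) - \<delta>) = 1"
          using True unfolding powr_add[symmetric] \<delta> by simp
        finally show ?thesis using K3 by (simp add: ennreal_mult)
      qed simp
    qed
    also have "\<dots> = ennreal K3 * (\<integral>\<^sup>+\<tau>. ennreal (G \<tau> powr p) \<partial>lborel)" by (simp add: nn_integral_cmult)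
    also have "\<dots> \<le> ennreal K3 * ennreal (B powr p)" using B by (intro mult_left_mono) auto
    finally have "(\<integral>\<^sup>+t. ennreal (J t powr s) * indicator {0<..} t \<partial>lborel) \<le> ennreal D * (ennreal K3 * ennreal (B powr p))"
      by (simp add: mult_left_mono)
    also have "\<dots> = ennreal (D * (K3 * B powr p))" using D K3 by (simp add: ennreal_mult[symmetric])
    also have "D * (K3 * B powr p) = C * (B powr (s - p) * B powr p)" by (simp add: C_def D_def)
    also have "B powr (s - p) * B powr p = B powr s" using sp by (simp add: powr_add[symmetric])
    finally show "(\<integral>\<^sup>+t. ennreal (enn2real (max_potential \<delta> G t) powr s) * indicator {0<..} t \<partial>lborel) \<le> ennreal (C * B powr s)"
      unfolding J_def .
  qed
qed

section \<open>Garsia's argument on the logarithmic scale\<close>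

lemma powr_one_minus_le:
  fixes y \<theta> :: real
  assumes "0 \<le> y" "y \<le> 1" "0 < \<theta>" "\<theta> \<le> 1"
  shows "(1 - y) powr \<theta> \<le> 1 - \<theta> * y"
proof (cases "\<theta> = 1 \<or> y = 1")
  case True then show ?thesis using assms by auto
next
  case False
  have "(1 - y) powr \<theta> * 1 powr (1 - \<theta>) \<le> \<theta> * (1 - y) + (1 - \<theta>) * 1"
    using False assms by (intro Youngs_inequality_0) auto
  then show ?thesis by (simp add: algebra_simps)
qed

text \<open>The Garsia lemmas are applied with \<open>W = w (exp (- x))\<close> and with \<open>l\<close> the mass of \<open>G powr q\<close> on
  \<open>(0, exp (- x))\<close>; their hypotheses on \<open>W\<close> are what Hoelder's inequality gives for these data.\<close>

lemma Garsia_mass_bound: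
  fixes q \<delta> x W l \<nu> :: real
  assumes q: "1 < q" and \<delta>: "\<delta> = 1 - 1/q" and x: "0 < x" and W: "0 \<le> W" and l: "0 \<le> l" "l \<le> 1"
    and up: "W \<le> q * l powr (1/q) + (1 - l) powr (1/q) * x powr \<delta>"
    and \<nu>: "1 \<le> \<nu>" "x - W powr (1/\<delta>) \<le> \<nu>"
  shows "x * l \<le> (q + (q\<^sup>2) powr (1/\<delta>)) / \<delta> * \<nu>"
proof -
  have \<delta>01: "0 < \<delta>" "\<delta> < 1" "1/q = 1 - \<delta>" unfolding \<delta> using q by auto
  have K: "1 \<le> (q + (q\<^sup>2) powr (1/\<delta>)) / \<delta>"
    using q \<delta>01(1,2) add_increasing2[OF powr_ge_zero[of "q\<^sup>2" "1/\<delta>"], of \<delta> q] by simp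
  show ?thesis
  proof (cases "x \<le> \<nu>")
    case True
    have "x * l \<le> \<nu> * 1" using True l x by (intro mult_mono) auto
    also have "\<dots> \<le> (q + (q\<^sup>2) powr (1/\<delta>)) / \<delta> * \<nu>" using mult_right_mono[OF K, of \<nu>] \<nu> by simp
    finally show ?thesis .
  next
    case False
    define Y where "Y = x * l"
    have Y: "0 \<le> Y" using x l by (simp add: Y_def)
    \<comment> \<open>Multiplying the bound on \<open>W\<close> by \<open>x powr (1/q)\<close> turns
      \<open>x powr \<delta>\<close> into \<open>x\<close>, which cancels against the left side;
      what remains of the loss \<open>1 - l/q\<close> is the term \<open>x * l / q\<close> to be
      estimated.\<close>
    have "(x - \<nu>) powr \<delta> \<le> (W powr (1/\<delta>)) powr \<delta>"
      using False \<nu> \<delta>01 by (intro powr_mono2) auto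
    also have "\<dots> = W" using W \<delta>01 by (simp add: powr_powr)
    also have "\<dots> \<le> q * l powr (1/q) + (1 - l / q) * x powr \<delta>"
      using up powr_one_minus_le[of l "1/q"] l q by (simp add: mult_right_mono order.trans[OF up])
    finally have 1: "(x - \<nu>) powr \<delta> \<le> q * l powr (1/q) + (1 - l / q) * x powr \<delta>" .
    have "x - \<nu> = (x - \<nu>) powr \<delta> * (x - \<nu>) powr (1/q)" using False \<delta>01 by (simp add: powr_add[symmetric])
    also have "\<dots> \<le> (q * l powr (1/q) + (1 - l / q) * x powr \<delta>) * x powr (1/q)"
      using 1 False \<nu> q by (intro mult_mono powr_mono2 order.trans[OF powr_ge_zero 1]) auto
    also have "\<dots> = q * Y powr (1/q) + (1 - l / q) * (x powr \<delta> * x powr (1/q))"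
      using x l by (simp add: Y_def powr_mult algebra_simps)
    also have "x powr \<delta> * x powr (1/q) = x" using x \<delta>01 by (simp add: powr_add[symmetric])
    finally have 2: "Y / q \<le> q * Y powr (1/q) + \<nu>" by (simp add: Y_def algebra_simps)
    have "q\<^sup>2 * Y powr (1/q) \<le> (q\<^sup>2) powr (1/\<delta>) / (1/\<delta>) + (Y powr (1/q)) powr q / q"
      using \<delta>01 q Y by (intro Youngs_inequality) auto
    also have "\<dots> = \<delta> * (q\<^sup>2) powr (1/\<delta>) + Y * (1 - \<delta>)" unfolding \<delta>01(3)[symmetric] using Y q by (simp add: powr_powr)
    finally have 3: "q\<^sup>2 * Y powr (1/q) \<le> \<delta> * (q\<^sup>2) powr (1/\<delta>) + Y * (1 - \<delta>)" .
    \<comment> \<open>After multiplication by \<open>q\<close> the sublinear term is absorbed by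
      Young's inequality: it costs \<open>(1 - \<delta>) * Y\<close>, so \<open>\<delta> * Y\<close>
      stays on the left.\<close>
    have "Y \<le> q * (q * Y powr (1/q) + \<nu>)" using 2 q by (simp add: field_simps)
    also have "\<dots> = q\<^sup>2 * Y powr (1/q) + q * \<nu>" by (simp add: power2_eq_square algebra_simps)
    finally have "\<delta> * Y \<le> \<delta> * (q\<^sup>2) powr (1/\<delta>) + q * \<nu>" using 3 by (simp add: algebra_simps)
    also have "\<dots> \<le> (q\<^sup>2) powr (1/\<delta>) * \<nu> + q * \<nu>"
    proof -
      have "\<delta> * (q\<^sup>2) powr (1/\<delta>) \<le> 1 * (q\<^sup>2) powr (1/\<delta>)" using \<delta>01 by (intro mult_right_mono) auto
      also have "\<dots> \<le> (q\<^sup>2) powr (1/\<delta>) * \<nu>" using \<nu> mult_left_mono[of 1 \<nu> "(q\<^sup>2) powr (1/\<delta>)"] by simp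
      finally show ?thesis by simp
    qed
    finally show ?thesis using \<delta>01 by (simp add: Y_def field_simps)
  qed
qed

text \<open>At a point with deficit at most \<open>\<nu>\<close> little mass is left:
  \<open>l1\<close> is at most a multiple of \<open>\<nu> / x1\<close>. Beyond \<open>x1\<close> the
  potential can grow only through this mass, so the third bound makes \<open>W2\<close> fall short
  of \<open>x2 powr \<delta>\<close> by an amount that forces a deficit linear in the gap, up to
  \<open>O(\<nu>)\<close>.\<close>

lemma Garsia_gap_bound:
  fixes q \<delta> :: real
  assumes q: "1 < q" and \<delta>: "\<delta> = 1 - 1/q"
  obtains K where "1 \<le> K" "\<And>x1 x2 W1 W2 l1 l2 \<nu>. 0 < x1 \<Longrightarrow> x1 < x2 \<Longrightarrow> 0 \<le> W1 \<Longrightarrow> 0 \<le> W2 \<Longrightarrow>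
      0 \<le> l1 \<Longrightarrow> l1 \<le> 1 \<Longrightarrow> 0 \<le> l2 \<Longrightarrow> l2 \<le> 1 \<Longrightarrow>
      W1 \<le> q * l1 powr (1/q) + (1 - l1) powr (1/q) * x1 powr \<delta> \<Longrightarrow>
      W2 \<le> q * l2 powr (1/q) + (1 - l2) powr (1/q) * x2 powr \<delta> \<Longrightarrow>
      W2 \<le> q * l2 powr (1/q) + l1 powr (1/q) * (x2 - x1) powr \<delta> + x1 powr \<delta> \<Longrightarrow>
      1 \<le> \<nu> \<Longrightarrow> x1 - W1 powr (1/\<delta>) \<le> \<nu> \<Longrightarrow> x2 - W2 powr (1/\<delta>) \<le> \<nu> \<Longrightarrow> K * \<nu> \<le> x1 \<Longrightarrow> x2 - x1 \<le> K * \<nu>"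
proof -
  have \<delta>01: "0 < \<delta>" "\<delta> < 1" "1/q = 1 - \<delta>" unfolding \<delta> using q by auto
  define K1 where "K1 = (q + (q\<^sup>2) powr (1/\<delta>)) / \<delta>"
  have K1: "1 \<le> K1" unfolding K1_def
    using q \<delta>01(1,2) add_increasing2[OF powr_ge_zero[of "q\<^sup>2" "1/\<delta>"], of \<delta> q] by simp
  \<comment> \<open>Chosen backwards from the absorption below.
    \<open>M powr (1/q) = 4 powr \<delta>\<close> lets Young's inequality put only
    \<open>\<delta> * d / 4\<close> on the gap \<open>d\<close>; \<open>\<epsilon>\<close> makes
    \<open>M * \<epsilon> * d / q\<close> another \<open>\<delta> * d / 4\<close>; half of the gain
    \<open>\<delta> * d\<close> survives, and \<open>K3\<close> solves the remaining inequality for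
    \<open>d\<close>.\<close>
  define M where "M = (4::real) powr (q - 1)"
  have M: "0 < M" by (simp add: M_def)
  define \<epsilon> where "\<epsilon> = \<delta> * q / (4 * M)"
  have \<epsilon>: "0 < \<epsilon>" using \<delta>01 q M by (simp add: \<epsilon>_def)
  define K3 where "K3 = (1 + q * (1 + K1) + M * K1 / q) * 2 / \<delta>"
  define K where "K = max 1 (max (K1 / \<epsilon>) K3)"
  show ?thesis
  proof (rule that[of K])
    show "1 \<le> K" by (simp add: K_def)
    fix x1 x2 W1 W2 l1 l2 \<nu> :: real
    assume x: "0 < x1" "x1 < x2" and W: "0 \<le> W1" "0 \<le> W2" and l: "0 \<le> l1" "l1 \<le> 1" "0 \<le> l2" "l2 \<le> 1"
      and u1: "W1 \<le> q * l1 powr (1/q) + (1 - l1) powr (1/q) * x1 powr \<delta>"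
      and u2: "W2 \<le> q * l2 powr (1/q) + (1 - l2) powr (1/q) * x2 powr \<delta>"
      and u3: "W2 \<le> q * l2 powr (1/q) + l1 powr (1/q) * (x2 - x1) powr \<delta> + x1 powr \<delta>"
      and \<nu>: "1 \<le> \<nu>" "x1 - W1 powr (1/\<delta>) \<le> \<nu>" "x2 - W2 powr (1/\<delta>) \<le> \<nu>" and big: "K * \<nu> \<le> x1"
    have Y1: "x1 * l1 \<le> K1 * \<nu>" unfolding K1_def
      by (rule Garsia_mass_bound[OF q \<delta> x(1) W(1) l(1,2) u1 \<nu>(1,2)])
    have Y2: "x2 * l2 \<le> K1 * \<nu>" unfolding K1_def
      using x by (intro Garsia_mass_bound[OF q \<delta> _ W(2) l(3,4) u2 \<nu>(1,3)]) auto
    show "x2 - x1 \<le> K * \<nu>"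
    proof (cases "x2 \<le> \<nu>")
      case True
      have "\<nu> \<le> K * \<nu>" using \<nu> mult_right_mono[of 1 K \<nu>] by (simp add: K_def)
      then show ?thesis using True x by linarith
    next
      case False
      define d where "d = x2 - x1"
      have d: "0 < d" using x by (simp add: d_def)
      have "(x2 - \<nu>) powr \<delta> \<le> (W2 powr (1/\<delta>)) powr \<delta>"
        using False \<nu> \<delta>01 by (intro powr_mono2) auto
      also have "\<dots> = W2" using W \<delta>01 by (simp add: powr_powr)
      also note u3
      finally have 1: "(x2 - \<nu>) powr \<delta> \<le> q * l2 powr (1/q) + l1 powr (1/q) * d powr \<delta> + x1 powr \<delta>"
        unfolding d_def .
      have "x2 - \<nu> = (x2 - \<nu>) powr \<delta> * (x2 - \<nu>) powr (1/q)" using False \<delta>01 by (simp add: powr_add[symmetric])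
      also have "\<dots> \<le> (q * l2 powr (1/q) + l1 powr (1/q) * d powr \<delta> + x1 powr \<delta>) * x2 powr (1/q)"
        using 1 False \<nu> q by (intro mult_mono powr_mono2 order.trans[OF powr_ge_zero 1]) auto
      also have "\<dots> = q * (x2 * l2) powr (1/q) + (l1 * x2) powr (1/q) * d powr \<delta> + x1 powr \<delta> * x2 powr (1/q)"
        using x l by (simp add: powr_mult algebra_simps)
      also have "\<dots> \<le> q * (K1 * \<nu>) powr (1/q) + (K1 * \<nu> + \<epsilon> * d) powr (1/q) * d powr \<delta> + (\<delta> * x1 + (1/q) * x2)"
      proof (intro add_mono mult_left_mono mult_right_mono powr_mono2)
        \<comment> \<open>Here the condition that \<open>x1\<close> is large is used: with the mass
          bound at \<open>x1\<close> it gives \<open>l1 \<le> \<epsilon>\<close>.\<close>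
        have "K1 / \<epsilon> * \<nu> \<le> K * \<nu>" using \<nu> by (intro mult_right_mono) (auto simp: K_def)
        then have "K1 / \<epsilon> * \<nu> \<le> x1" using big by linarith
        then have "K1 * \<nu> \<le> \<epsilon> * x1" using \<epsilon> by (simp add: field_simps)
        then have "l1 \<le> \<epsilon>" using Y1 x(1) by (metis (no_types, opaque_lifting) mult.commute mult_left_le_imp_le order.trans)
        then have "l1 * d \<le> \<epsilon> * d" using d by (intro mult_right_mono) auto
        then show "l1 * x2 \<le> K1 * \<nu> + \<epsilon> * d" using Y1 by (simp add: d_def algebra_simps)
        \<comment> \<open>The weighted mean inequality. Its right side is
          \<open>x2 - \<delta> * d\<close>, and this gain absorbs all terms linear in
          \<open>d\<close>.\<close>
        show "x1 powr \<delta> * x2 powr (1/q) \<le> \<delta> * x1 + (1/q) * x2"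
          using \<delta>01 x by (intro Youngs_inequality_0) auto
      qed (use Y2 q l x in auto)
      also have "(K1 * \<nu> + \<epsilon> * d) powr (1/q) * d powr \<delta> \<le> M * (K1 * \<nu> + \<epsilon> * d) / q + \<delta> * d / 4"
      proof -
        define A where "A = K1 * \<nu> + \<epsilon> * d"
        have A: "0 < A" using K1 \<nu> \<epsilon> d by (simp add: A_def add_pos_pos)
        have "M powr (1/q) = 4 powr \<delta>" unfolding M_def powr_powr using q by (simp add: \<delta> diff_divide_distrib)
        then have "A powr (1/q) * d powr \<delta> = (M * A) powr (1/q) * (d / 4) powr \<delta>"
          using A d M by (simp add: powr_mult powr_divide)
        also have "\<dots> \<le> (1/q) * (M * A) + \<delta> * (d / 4)"
          using A d M \<delta>01 q by (intro Youngs_inequality_0) auto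
        finally show ?thesis by (simp add: A_def)
      qed
      also have "M * (K1 * \<nu> + \<epsilon> * d) / q = M * K1 * \<nu> / q + \<delta> * d / 4"
        using q M by (simp add: \<epsilon>_def field_simps)
      also have "\<delta> * x1 + (1/q) * x2 = x2 - \<delta> * d" unfolding \<delta>01(3) by (simp add: d_def algebra_simps)
      finally have 2: "\<delta> * d / 2 \<le> \<nu> + q * (K1 * \<nu>) powr (1/q) + M * K1 * \<nu> / q" by linarith
      have "(K1 * \<nu>) powr (1/q) \<le> (1 + K1 * \<nu>) powr (1/q)" using K1 \<nu> q by (intro powr_mono2) auto
      also have "\<dots> \<le> (1 + K1 * \<nu>) powr 1" using K1 \<nu> q by (intro powr_mono) auto
      also have "\<dots> \<le> (1 + K1) * \<nu>" using K1 \<nu> by (simp add: algebra_simps)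
      finally have "q * (K1 * \<nu>) powr (1/q) \<le> q * ((1 + K1) * \<nu>)" using q by (intro mult_left_mono) auto
      with 2 have "\<delta> * d / 2 \<le> (1 + q * (1 + K1) + M * K1 / q) * \<nu>" by (simp add: algebra_simps)
      then have "d \<le> K3 * \<nu>" using \<delta>01 by (simp add: K3_def field_simps)
      also have "\<dots> \<le> K * \<nu>" using \<nu> by (intro mult_right_mono) (auto simp: K_def)
      finally show ?thesis by (simp add: d_def)
    qed
  qed
qed

lemma nn_integral_inverse_Icc:
  fixes a b :: real
  assumes "0 < a" "a \<le> b"
  shows "(\<integral>\<^sup>+t. ennreal (1/t) * indicator {a..b} t \<partial>lborel) = ennreal (ln b - ln a)"
proof (rule nn_integral_has_integral_lebesgue')
  show "((\<lambda>t. 1/t) has_integral ln b - ln a) {a..b}"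
    using assms by (intro fundamental_theorem_of_calculus)
      (auto intro!: derivative_eq_intros simp: has_real_derivative_iff_has_vector_derivative[symmetric])
qed (use assms in auto)

lemma powr_neg_powr_inverse: "0 < x \<Longrightarrow> 0 < \<delta> \<Longrightarrow> (x powr (-\<delta>)) powr (1/\<delta>) = 1/x" for x \<delta> :: real
  unfolding powr_powr by (simp add: powr_minus_divide)

text \<open>The kernel raised to the dual exponent \<open>1/\<delta>\<close> is
  \<open>1/\<tau>\<close>, so the logarithmic length of the interval appears. This is the origin of
  the exponential class and of the exponent \<open>1/\<delta> = n/(n - 2)\<close>.\<close>

lemma nn_integral_le_1_powr_div:
  fixes G :: "real \<Rightarrow> real"
  assumes q: "1 < q" and \<delta>: "\<delta> = 1 - 1/q" and [measurable]: "G \<in> borel_measurable borel" and G: "\<And>\<tau>. 0 \<le> G \<tau>"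
    and ab: "0 < a" "a \<le> b" and M: "0 \<le> M"
    and le: "(\<integral>\<^sup>+\<tau>. ennreal (G \<tau> powr q) * indicator {a..<b} \<tau> \<partial>lborel) \<le> ennreal M"
  shows "(\<integral>\<^sup>+\<tau>. ennreal (G \<tau> * \<tau> powr (-\<delta>)) * indicator {a..<b} \<tau> \<partial>lborel) \<le> ennreal (M powr (1/q) * (ln b - ln a) powr \<delta>)"
proof -
  have \<delta>01: "0 < \<delta>" "\<delta> < 1" unfolding \<delta> using q by auto
  have ln: "0 \<le> ln b - ln a" using ab by simp
  have "(\<integral>\<^sup>+\<tau>. ennreal (G \<tau> * \<tau> powr (-\<delta>)) * indicator {a..<b} \<tau> \<partial>lborel)
    = (\<integral>\<^sup>+\<tau>. ennreal ((G \<tau> * indicator {a..<b} \<tau>) * (\<tau> powr (-\<delta>) * indicator {a..<b} \<tau>)) \<partial>lborel)"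
    by (intro nn_integral_cong) (auto split: split_indicator)
  also have "\<dots> \<le> ennreal (M powr (1/q) * (ln b - ln a) powr \<delta>)"
  proof (rule nn_integral_Holder[where p=q and q="1/\<delta>"])
    have "(\<integral>\<^sup>+\<tau>. ennreal ((G \<tau> * indicator {a..<b} \<tau>) powr q) \<partial>lborel) = (\<integral>\<^sup>+\<tau>. ennreal (G \<tau> powr q) * indicator {a..<b} \<tau> \<partial>lborel)"
      using q by (intro nn_integral_cong) (auto split: split_indicator)
    then show "(\<integral>\<^sup>+\<tau>. ennreal ((G \<tau> * indicator {a..<b} \<tau>) powr q) \<partial>lborel) \<le> ennreal ((M powr (1/q)) powr q)"
      using le q M by (simp add: powr_powr)
    have "(\<integral>\<^sup>+\<tau>. ennreal ((\<tau> powr (-\<delta>) * indicator {a..<b} \<tau>) powr (1/\<delta>)) \<partial>lborel) \<le> (\<integral>\<^sup>+\<tau>. ennreal (1/\<tau>) * indicator {a..b} \<tau> \<partial>lborel)"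
      using \<delta>01 ab by (intro nn_integral_mono) (auto simp: powr_neg_powr_inverse split: split_indicator)
    also have "\<dots> = ennreal (((ln b - ln a) powr \<delta>) powr (1/\<delta>))"
      using nn_integral_inverse_Icc[OF ab] ln \<delta>01 by (simp add: powr_powr)
    finally show "(\<integral>\<^sup>+\<tau>. ennreal ((\<tau> powr (-\<delta>) * indicator {a..<b} \<tau>) powr (1/\<delta>)) \<partial>lborel) \<le> ennreal (((ln b - ln a) powr \<delta>) powr (1/\<delta>))" .
  qed (use G q \<delta> \<delta>01 in auto)
  finally show ?thesis .
qed

text \<open>The averaged part of the kernel is constant on (0, t), and by scaling its dual norm is
  \<open>q\<close> whatever \<open>t\<close> is, so this part never produces a logarithm.\<close>

lemma nn_integral_initial_average_le:
  fixes G :: "real \<Rightarrow> real"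
  assumes q: "1 < q" and \<delta>: "\<delta> = 1 - 1/q" and [measurable]: "G \<in> borel_measurable borel" and G: "\<And>\<tau>. 0 \<le> G \<tau>"
    and t: "0 < t" and M: "0 \<le> M"
    and le: "(\<integral>\<^sup>+\<tau>. ennreal (G \<tau> powr q) * indicator {0<..<t} \<tau> \<partial>lborel) \<le> ennreal M"
  shows "(\<integral>\<^sup>+\<tau>. ennreal (G \<tau> * (t powr (-\<delta>) / (1 - \<delta>))) * indicator {0<..<t} \<tau> \<partial>lborel) \<le> ennreal (q * M powr (1/q))"
proof -
  have \<delta>01: "0 < \<delta>" "\<delta> < 1" unfolding \<delta> using q by auto
  have "(\<integral>\<^sup>+\<tau>. ennreal (G \<tau> * (t powr (-\<delta>) / (1 - \<delta>))) * indicator {0<..<t} \<tau> \<partial>lborel)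
    = (\<integral>\<^sup>+\<tau>. ennreal ((G \<tau> * indicator {0<..<t} \<tau>) * (t powr (-\<delta>) / (1 - \<delta>) * indicator {0<..<t} \<tau>)) \<partial>lborel)"
    by (intro nn_integral_cong) (auto split: split_indicator)
  also have "\<dots> \<le> ennreal (M powr (1/q) * q)"
  proof (rule nn_integral_Holder[where p=q and q="1/\<delta>"])
    have "(\<integral>\<^sup>+\<tau>. ennreal ((G \<tau> * indicator {0<..<t} \<tau>) powr q) \<partial>lborel) = (\<integral>\<^sup>+\<tau>. ennreal (G \<tau> powr q) * indicator {0<..<t} \<tau> \<partial>lborel)"
      using q by (intro nn_integral_cong) (auto split: split_indicator)
    then show "(\<integral>\<^sup>+\<tau>. ennreal ((G \<tau> * indicator {0<..<t} \<tau>) powr q) \<partial>lborel) \<le> ennreal ((M powr (1/q)) powr q)"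
      using le q M by (simp add: powr_powr)
    have "(\<integral>\<^sup>+\<tau>. ennreal ((t powr (-\<delta>) / (1 - \<delta>) * indicator {0<..<t} \<tau>) powr (1/\<delta>)) \<partial>lborel)
      = (\<integral>\<^sup>+\<tau>. ennreal ((t powr (-\<delta>) / (1 - \<delta>)) powr (1/\<delta>)) * indicator {0<..<t} \<tau> \<partial>lborel)"
      using \<delta>01 by (intro nn_integral_cong) (auto split: split_indicator)
    also have "\<dots> = ennreal ((t powr (-\<delta>) / (1 - \<delta>)) powr (1/\<delta>) * t)"
      using t by (subst nn_integral_cmult_indicator) (auto simp: ennreal_mult)
    also have "(t powr (-\<delta>) / (1 - \<delta>)) powr (1/\<delta>) * t = q powr (1/\<delta>)"
    proof -
      have "t powr (-\<delta>) / (1 - \<delta>) = t powr (-\<delta>) * q" by (simp add: \<delta>)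
      then show ?thesis using powr_neg_powr_inverse[OF t \<delta>01(1)] t by (simp add: powr_mult)
    qed
    finally show "(\<integral>\<^sup>+\<tau>. ennreal ((t powr (-\<delta>) / (1 - \<delta>) * indicator {0<..<t} \<tau>) powr (1/\<delta>)) \<partial>lborel) \<le> ennreal (q powr (1/\<delta>))"
      by simp
  qed (use G q \<delta> \<delta>01 in auto)
  finally show ?thesis by (simp add: mult.commute)
qed

text \<open>With \<open>F = - ln t - w powr (1/\<delta>)\<close> the integrand is
  \<open>exp (- \<kappa> * F) / t\<close>. \<open>F\<close> is bounded below, and the set
  \<open>E \<nu>\<close> where \<open>F \<le> \<nu>\<close> has measure \<open>O(\<nu>)\<close> with
  respect to \<open>dt / t\<close>, so summing over integer levels leaves a series with terms
  \<open>(k + 1) * r ^ k\<close>.\<close>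

theorem Adams_Garsia_inequality:
  fixes q \<delta> \<kappa> :: real
  assumes q: "1 < q" and \<delta>: "\<delta> = 1 - 1/q" and \<kappa>: "0 < \<kappa>"
  obtains C where "0 \<le> C" "\<And>G w. G \<in> borel_measurable borel \<Longrightarrow> (\<And>\<tau>. 0 \<le> G \<tau>) \<Longrightarrow>
     (\<integral>\<^sup>+\<tau>. ennreal (G \<tau> powr q) * indicator {0<..<1} \<tau> \<partial>lborel) \<le> 1 \<Longrightarrow>
     w \<in> borel_measurable borel \<Longrightarrow> (\<And>t. 0 \<le> w t) \<Longrightarrow>
     (\<And>t. 0 < t \<Longrightarrow> t < 1 \<Longrightarrow> ennreal (w t) \<le> (\<integral>\<^sup>+\<tau>. ennreal (G \<tau> * ONeil_kernel \<delta> t \<tau>) * indicator {0<..<1} \<tau> \<partial>lborel)) \<Longrightarrow>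
     (\<integral>\<^sup>+t. ennreal (exp (\<kappa> * w t powr (1/\<delta>)) * t powr (\<kappa> - 1)) * indicator {0<..<1} t \<partial>lborel) \<le> ennreal C"
proof -
  have \<delta>01: "0 < \<delta>" "\<delta> < 1" "1/q = 1 - \<delta>" unfolding \<delta> using q by auto
  obtain K where K1: "1 \<le> K" and K: "\<And>x1 x2 W1 W2 l1 l2 \<nu>. 0 < x1 \<Longrightarrow> x1 < x2 \<Longrightarrow> 0 \<le> W1 \<Longrightarrow> 0 \<le> W2 \<Longrightarrow>
      0 \<le> l1 \<Longrightarrow> l1 \<le> 1 \<Longrightarrow> 0 \<le> l2 \<Longrightarrow> l2 \<le> 1 \<Longrightarrow>
      W1 \<le> q * l1 powr (1/q) + (1 - l1) powr (1/q) * x1 powr \<delta> \<Longrightarrow>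
      W2 \<le> q * l2 powr (1/q) + (1 - l2) powr (1/q) * x2 powr \<delta> \<Longrightarrow>
      W2 \<le> q * l2 powr (1/q) + l1 powr (1/q) * (x2 - x1) powr \<delta> + x1 powr \<delta> \<Longrightarrow>
      1 \<le> \<nu> \<Longrightarrow> x1 - W1 powr (1/\<delta>) \<le> \<nu> \<Longrightarrow> x2 - W2 powr (1/\<delta>) \<le> \<nu> \<Longrightarrow> K * \<nu> \<le> x1 \<Longrightarrow> x2 - x1 \<le> K * \<nu>"
    using Garsia_gap_bound[OF q \<delta>] by blast
  define c where "c = q powr (1/\<delta>)"
  define D where "D = exp (\<kappa> * c)"
  define r where "r = exp (-\<kappa>)"
  have r: "0 < r" "r < 1" using \<kappa> by (auto simp: r_def)
  have D: "1 \<le> D" using \<kappa> by (simp add: D_def c_def)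
  show ?thesis
  proof
    show "0 \<le> D * (3 * K) * (1 / (1 - r)\<^sup>2)" using D K1 by simp
    fix G w :: "real \<Rightarrow> real"
    assume [measurable]: "G \<in> borel_measurable borel" and G: "\<And>\<tau>. 0 \<le> G \<tau>"
      and G1: "(\<integral>\<^sup>+\<tau>. ennreal (G \<tau> powr q) * indicator {0<..<1} \<tau> \<partial>lborel) \<le> 1"
      and [measurable]: "w \<in> borel_measurable borel" and w: "\<And>t. 0 \<le> w t"
      and wle: "\<And>t. 0 < t \<Longrightarrow> t < 1 \<Longrightarrow> ennreal (w t) \<le> (\<integral>\<^sup>+\<tau>. ennreal (G \<tau> * ONeil_kernel \<delta> t \<tau>) * indicator {0<..<1} \<tau> \<partial>lborel)"
    define I where "I = (\<lambda>S. \<integral>\<^sup>+\<tau>. ennreal (G \<tau> powr q) * indicator S \<tau> \<partial>lborel)"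
    define l where "l = (\<lambda>t. enn2real (I {0<..<t}))"
    have Imono: "I S \<le> I T" if "S \<subseteq> T" for S T
      unfolding I_def using that by (intro nn_integral_mono) (auto split: split_indicator)
    have I1: "I S \<le> 1" if "S \<subseteq> {0<..<1}" for S using Imono[OF that] G1 unfolding I_def by (rule order.trans)
    have Il: "I {0<..<t} = ennreal (l t)" if "t < 1" for t
    proof -
      have "I {0<..<t} \<le> 1" using that by (intro I1) auto
      also have "(1::ennreal) < \<infinity>" by simp
      finally show ?thesis unfolding l_def by simp
    qed
    have l0: "0 \<le> l t" for t by (simp add: l_def)
    have l1: "l t \<le> 1" if "t < 1" for t
    proof -
      have "I {0<..<t} \<le> 1" using that by (intro I1) auto
      then show ?thesis using Il[OF that] by simp
    qed
    have lmono: "l u \<le> l t" if "u < t" "t < 1" for u t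
    proof -
      have "I {0<..<u} \<le> I {0<..<t}" using that by (intro Imono) auto
      then show ?thesis using Il[of u] Il[of t] that l0 by (simp add: ennreal_le_iff)
    qed
    have Iadd: "I {a..<b} \<le> ennreal (M - l a)" if ab: "0 < a" "a \<le> b" "b \<le> 1" and M: "I {0<..<b} \<le> ennreal M" for a b M
    proof (cases "a < 1")
      case True
      have "I {0<..<a} + I {a..<b} = I {0<..<b}"
        unfolding I_def using ab by (subst nn_integral_add[symmetric]) (auto intro!: nn_integral_cong split: split_indicator)
      then have "ennreal (l a) + I {a..<b} \<le> ennreal M" using Il[OF True] M by simp
      then show ?thesis using l0[of a]
        by (cases "I {a..<b}") (auto simp: ennreal_plus[symmetric] ennreal_le_iff2 top_unique simp del: ennreal_plus)
    next
      case False
      then have "{a..<b} = {}" using ab by auto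
      then show ?thesis by (simp add: I_def)
    qed
    have wsplit: "ennreal (w t) \<le> ennreal (q * l t powr (1/q)) + (\<integral>\<^sup>+\<tau>. ennreal (G \<tau> * \<tau> powr (-\<delta>)) * indicator {t..<1} \<tau> \<partial>lborel)" if t: "0 < t" "t < 1" for t
    proof -
      have "ennreal (w t) \<le> (\<integral>\<^sup>+\<tau>. ennreal (G \<tau> * ONeil_kernel \<delta> t \<tau>) * indicator {0<..<1} \<tau> \<partial>lborel)" by (rule wle[OF t])
      also have "\<dots> = (\<integral>\<^sup>+\<tau>. ennreal (G \<tau> * (t powr (-\<delta>) / (1 - \<delta>))) * indicator {0<..<t} \<tau> + ennreal (G \<tau> * \<tau> powr (-\<delta>)) * indicator {t..<1} \<tau> \<partial>lborel)"
        using t by (intro nn_integral_cong) (auto simp: ONeil_kernel_def split: split_indicator)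
      also have "\<dots> = (\<integral>\<^sup>+\<tau>. ennreal (G \<tau> * (t powr (-\<delta>) / (1 - \<delta>))) * indicator {0<..<t} \<tau> \<partial>lborel) + (\<integral>\<^sup>+\<tau>. ennreal (G \<tau> * \<tau> powr (-\<delta>)) * indicator {t..<1} \<tau> \<partial>lborel)"
        by (rule nn_integral_add) auto
      also have "\<dots> \<le> ennreal (q * l t powr (1/q)) + (\<integral>\<^sup>+\<tau>. ennreal (G \<tau> * \<tau> powr (-\<delta>)) * indicator {t..<1} \<tau> \<partial>lborel)"
        using Il[OF t(2)] by (intro add_right_mono nn_integral_initial_average_le[OF q \<delta> _ G t(1) l0]) (auto simp: I_def)
      finally show ?thesis .
    qed
    have seg: "(\<integral>\<^sup>+\<tau>. ennreal (G \<tau> * \<tau> powr (-\<delta>)) * indicator {a..<b} \<tau> \<partial>lborel) \<le> ennreal ((M - l a) powr (1/q) * (ln b - ln a) powr \<delta>)"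
      if ab: "0 < a" "a \<le> b" "b \<le> 1" and M: "I {0<..<b} \<le> ennreal M" "l a \<le> M" for a b M
      using Iadd[OF ab M(1)] M(2) ab unfolding I_def by (intro nn_integral_le_1_powr_div[OF q \<delta> _ G]) auto
    \<comment> \<open>This bound and the next are the hypotheses of the Garsia lemmas: the mass of
      \<open>G powr q\<close>, at most one in total, is split at \<open>t\<close>, and in the second
      bound also at a smaller point \<open>u\<close>.\<close>
    have bound1: "w t \<le> q * l t powr (1/q) + (1 - l t) powr (1/q) * (- ln t) powr \<delta>" if t: "0 < t" "t < 1" for t
    proof -
      have "ennreal (w t) \<le> ennreal (q * l t powr (1/q)) + ennreal ((1 - l t) powr (1/q) * (ln 1 - ln t) powr \<delta>)"
        using t I1[of "{0<..<1}"] l1[of t] by (intro order.trans[OF wsplit[OF t]] add_left_mono seg) auto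
      then show ?thesis using q by (simp add: ennreal_plus[symmetric] del: ennreal_plus)
    qed
    have bound2: "w u \<le> q * l u powr (1/q) + l t powr (1/q) * (- ln u - - ln t) powr \<delta> + (- ln t) powr \<delta>" if tu: "0 < u" "u < t" "t < 1" for t u
    proof -
      have "(\<integral>\<^sup>+\<tau>. ennreal (G \<tau> * \<tau> powr (-\<delta>)) * indicator {u..<1} \<tau> \<partial>lborel) =
        (\<integral>\<^sup>+\<tau>. ennreal (G \<tau> * \<tau> powr (-\<delta>)) * indicator {u..<t} \<tau> \<partial>lborel) + (\<integral>\<^sup>+\<tau>. ennreal (G \<tau> * \<tau> powr (-\<delta>)) * indicator {t..<1} \<tau> \<partial>lborel)"
        using tu by (subst nn_integral_add[symmetric]) (auto intro!: nn_integral_cong split: split_indicator)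
      also have "\<dots> \<le> ennreal ((l t - l u) powr (1/q) * (ln t - ln u) powr \<delta>) + ennreal ((1 - l t) powr (1/q) * (ln 1 - ln t) powr \<delta>)"
      proof -
        have "l u \<le> l t" using lmono tu by auto
        then show ?thesis using tu Il[of t] I1[of "{0<..<1}"] l1[of t] by (intro add_mono seg) auto
      qed
      also have "\<dots> = ennreal ((l t - l u) powr (1/q) * (ln t - ln u) powr \<delta> + (1 - l t) powr (1/q) * (ln 1 - ln t) powr \<delta>)" by simp
      also have "\<dots> \<le> ennreal (l t powr (1/q) * (ln t - ln u) powr \<delta> + 1 * (ln 1 - ln t) powr \<delta>)"
      proof -
        have "l u \<le> l t" using lmono tu by auto
        moreover have "(1 - l t) powr (1/q) \<le> 1 powr (1/q)" using l0[of t] l1[of t] tu q by (intro powr_mono2) auto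
        ultimately show ?thesis using l0[of u] q by (intro ennreal_leI add_mono mult_right_mono powr_mono2) auto
      qed
      finally have "ennreal (w u) \<le> ennreal (q * l u powr (1/q)) + ennreal (l t powr (1/q) * (ln t - ln u) powr \<delta> + 1 * (ln 1 - ln t) powr \<delta>)"
        using wsplit[of u] tu by (meson add_left_mono order.trans order.strict_trans)
      then show ?thesis using q by (simp add: ennreal_plus[symmetric] add.assoc del: ennreal_plus)
    qed
    define F where "F = (\<lambda>t. - ln t - w t powr (1/\<delta>))"
    define E where "E = (\<lambda>\<nu>. {t. 0 < t \<and> t < 1 \<and> F t \<le> \<nu>})"
    have Em[measurable]: "E \<nu> \<in> sets borel" for \<nu> unfolding E_def F_def by measurable
    \<comment> \<open>\<open>c = q powr (1/\<delta>)\<close> makes \<open>q\<close> equal to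
      \<open>c powr \<delta>\<close>. Two-term Hoelder with masses \<open>l t\<close> and
      \<open>1 - l t\<close> then gives \<open>w t \<le> (c - ln t) powr \<delta>\<close>.\<close>
    have Fge: "- c \<le> F t" if t: "0 < t" "t < 1" for t
    proof -
      have "w t \<le> l t powr (1 - \<delta>) * c powr \<delta> + (1 - l t) powr (1 - \<delta>) * (- ln t) powr \<delta>"
        using bound1[OF t] q \<delta>01 by (simp add: c_def powr_powr mult.commute)
      also have "\<dots> \<le> (l t + (1 - l t)) powr (1 - \<delta>) * (c + - ln t) powr \<delta>"
        using \<delta>01 l0 l1 t by (intro powr_Holder2) (auto simp: c_def)
      finally have "w t \<le> (c - ln t) powr \<delta>" by simp
      then have "w t powr (1/\<delta>) \<le> ((c - ln t) powr \<delta>) powr (1/\<delta>)" using w \<delta>01 by (intro powr_mono2) auto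
      also have "\<dots> = c - ln t"
      proof -
        have "0 \<le> c - ln t" using ln_less_zero[OF t] powr_ge_zero[of q "1/\<delta>"] unfolding c_def by linarith
        then show ?thesis using \<delta>01 by (simp add: powr_powr)
      qed
      finally show ?thesis by (simp add: F_def)
    qed
    have gap: "- ln u - - ln t \<le> K * \<nu>" if "t \<in> E \<nu>" "u \<in> E \<nu>" "u < t" "1 \<le> \<nu>" "K * \<nu> \<le> - ln t" for t u \<nu>
    proof (rule K[where ?W1.0="w t" and ?W2.0="w u" and ?l1.0="l t" and ?l2.0="l u"])
      show "- ln t < - ln u" "0 < - ln t" using that by (auto simp: E_def)
      show "w t \<le> q * l t powr (1/q) + (1 - l t) powr (1/q) * (- ln t) powr \<delta>"
        "w u \<le> q * l u powr (1/q) + (1 - l u) powr (1/q) * (- ln u) powr \<delta>"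
        "w u \<le> q * l u powr (1/q) + l t powr (1/q) * (- ln u - - ln t) powr \<delta> + (- ln t) powr \<delta>"
        using that by (auto simp: E_def intro: bound1 bound2[simplified])
      show "- ln t - w t powr (1/\<delta>) \<le> \<nu>" "- ln u - w u powr (1/\<delta>) \<le> \<nu>" using that by (auto simp: E_def F_def)
      show "l t \<le> 1" "l u \<le> 1" using that by (auto simp: E_def intro: l1)
    qed (use that w l0 in auto)
    have Emeas: "(\<integral>\<^sup>+t. ennreal (1/t) * indicator (E \<nu>) t \<partial>lborel) \<le> ennreal (3 * K * \<nu>)" if \<nu>: "1 \<le> \<nu>" for \<nu>
    proof -
      have K\<nu>: "0 \<le> K * \<nu>" using K1 \<nu> by simp
      \<comment> \<open>On the logarithmic scale any two points of \<open>E \<nu>\<close> beyond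
        \<open>K * \<nu>\<close> are within \<open>K * \<nu>\<close> of each other;
        \<open>x0\<close> is one of them, and arbitrary if there is none.\<close>
      obtain x0 where x0: "\<And>t. t \<in> E \<nu> \<Longrightarrow> K * \<nu> \<le> - ln t \<Longrightarrow> x0 - K * \<nu> \<le> - ln t \<and> - ln t \<le> x0 + K * \<nu>"
      proof (cases "\<exists>t\<in>E \<nu>. K * \<nu> \<le> - ln t")
        case True
        then obtain s where s: "s \<in> E \<nu>" "K * \<nu> \<le> - ln s" by blast
        have "- ln s - K * \<nu> \<le> - ln t \<and> - ln t \<le> - ln s + K * \<nu>" if t: "t \<in> E \<nu>" "K * \<nu> \<le> - ln t" for t
        proof (cases t s rule: linorder_cases)
          case less
          then have "- ln s \<le> - ln t" using t by (auto simp: E_def)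
          then show ?thesis using gap[OF s(1) t(1) less \<nu> s(2)] K\<nu> by linarith
        next
          case equal then show ?thesis using K\<nu> by simp
        next
          case greater
          then have "- ln t \<le> - ln s" using s by (auto simp: E_def)
          then show ?thesis using gap[OF t(1) s(1) greater \<nu> t(2)] K\<nu> by linarith
        qed
        then show ?thesis by (rule that)
      qed (use that in blast)
      \<comment> \<open>In the variable \<open>- ln t\<close>: an interval of length
        \<open>K * \<nu>\<close> at the origin and one of length \<open>2 * K * \<nu>\<close> about
        \<open>x0\<close>, hence the factor 3.\<close>
      have sub: "E \<nu> \<subseteq> {exp (- (K * \<nu>))..1} \<union> {exp (- (x0 + K * \<nu>))..exp (- (x0 - K * \<nu>))}"
      proof
        fix t assume t: "t \<in> E \<nu>"
        then have t0: "0 < t" "t < 1" by (auto simp: E_def)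
        show "t \<in> {exp (- (K * \<nu>))..1} \<union> {exp (- (x0 + K * \<nu>))..exp (- (x0 - K * \<nu>))}"
        proof (cases "K * \<nu> \<le> - ln t")
          case True
          then have "- (x0 + K * \<nu>) \<le> ln t" "ln t \<le> - (x0 - K * \<nu>)" using x0[OF t] by auto
          then have "exp (- (x0 + K * \<nu>)) \<le> exp (ln t)" "exp (ln t) \<le> exp (- (x0 - K * \<nu>))" by (simp_all only: exp_le_cancel_iff)
          then show ?thesis using t0 by simp
        next
          case False
          then have "exp (- (K * \<nu>)) \<le> exp (ln t)" by simp
          then show ?thesis using t0 by simp
        qed
      qed
      have "(\<integral>\<^sup>+t. ennreal (1/t) * indicator (E \<nu>) t \<partial>lborel) \<le>
        (\<integral>\<^sup>+t. ennreal (1/t) * indicator {exp (- (K * \<nu>))..1} t + ennreal (1/t) * indicator {exp (- (x0 + K * \<nu>))..exp (- (x0 - K * \<nu>))} t \<partial>lborel)"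
        using sub by (intro nn_integral_mono) (auto split: split_indicator)
      also have "\<dots> = ennreal (ln 1 - ln (exp (- (K * \<nu>)))) + ennreal (ln (exp (- (x0 - K * \<nu>))) - ln (exp (- (x0 + K * \<nu>))))"
      proof (subst nn_integral_add)
        have "exp (- (K * \<nu>)) \<le> 1" "exp (- (x0 + K * \<nu>)) \<le> exp (- (x0 - K * \<nu>))" using K\<nu> by auto
        note * = nn_integral_inverse_Icc[OF exp_gt_zero this(1)] nn_integral_inverse_Icc[OF exp_gt_zero this(2)]
        show "(\<integral>\<^sup>+t. ennreal (1/t) * indicator {exp (- (K * \<nu>))..1} t \<partial>lborel) + (\<integral>\<^sup>+t. ennreal (1/t) * indicator {exp (- (x0 + K * \<nu>))..exp (- (x0 - K * \<nu>))} t \<partial>lborel)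
          = ennreal (ln 1 - ln (exp (- (K * \<nu>)))) + ennreal (ln (exp (- (x0 - K * \<nu>))) - ln (exp (- (x0 + K * \<nu>))))"
          unfolding * ..
      qed auto
      also have "\<dots> = ennreal (3 * K * \<nu>)" using K\<nu> by (simp add: ennreal_plus[symmetric] del: ennreal_plus)
      finally show ?thesis .
    qed
    have "(\<integral>\<^sup>+t. ennreal (exp (\<kappa> * w t powr (1/\<delta>)) * t powr (\<kappa> - 1)) * indicator {0<..<1} t \<partial>lborel)
      \<le> (\<integral>\<^sup>+t. (\<Sum>k. ennreal (D * r ^ k) * (ennreal (1/t) * indicator (E (real (Suc k))) t)) \<partial>lborel)"
    proof (intro nn_integral_mono)
      fix t :: real
      show "ennreal (exp (\<kappa> * w t powr (1/\<delta>)) * t powr (\<kappa> - 1)) * indicator {0<..<1} t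
         \<le> (\<Sum>k. ennreal (D * r ^ k) * (ennreal (1/t) * indicator (E (real (Suc k))) t))"
      proof (cases "0 < t \<and> t < 1")
        case True
        \<comment> \<open>\<open>nat\<close> puts all negative values of \<open>F\<close> on level
          0; there the lower bound \<open>- c\<close> is used and accounts for the factor
          \<open>D\<close>.\<close>
        define k where "k = nat \<lfloor>F t\<rfloor>"
        have "exp (\<kappa> * w t powr (1/\<delta>)) * t powr (\<kappa> - 1) = exp (\<kappa> * w t powr (1/\<delta>)) * exp ((\<kappa> - 1) * ln t)"
          using True by (simp add: powr_def)
        also have "\<dots> = exp (- \<kappa> * F t) * exp (- ln t)"
          unfolding exp_add[symmetric] by (simp add: F_def algebra_simps)
        also have "exp (- ln t) = 1/t" using True by (simp add: exp_minus field_simps)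
        finally have e: "exp (\<kappa> * w t powr (1/\<delta>)) * t powr (\<kappa> - 1) = exp (- \<kappa> * F t) * (1/t)" .
        have "F t \<le> real (Suc k)" unfolding k_def by linarith
        then have tE: "t \<in> E (real (Suc k))" using True by (auto simp: E_def)
        have "exp (- \<kappa> * F t) \<le> D * r ^ k"
        proof (cases "0 \<le> F t")
          case True
          then have "real k \<le> F t" unfolding k_def by simp
          then have "\<kappa> * real k \<le> \<kappa> * F t" using \<kappa> by simp
          then have "exp (- \<kappa> * F t) \<le> 1 * r ^ k" by (simp add: r_def exp_of_nat_mult[symmetric] mult.commute)
          also have "\<dots> \<le> D * r ^ k" using D r by (intro mult_right_mono) auto
          finally show ?thesis .
        next
          case False
          then have "k = 0" by (simp add: k_def)
          moreover have "\<kappa> * - c \<le> \<kappa> * F t" using Fge[of t] True \<kappa> by (intro mult_left_mono) auto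
          ultimately show ?thesis by (simp add: D_def)
        qed
        then have "exp (- \<kappa> * F t) * (1/t) \<le> D * r ^ k * (1/t)" using True by (intro mult_right_mono) auto
        then have "ennreal (exp (\<kappa> * w t powr (1/\<delta>)) * t powr (\<kappa> - 1)) * indicator {0<..<1} t \<le> ennreal (D * r ^ k) * (ennreal (1/t) * indicator (E (real (Suc k))) t)"
          using True tE D r unfolding e by (simp add: ennreal_mult[symmetric] del: of_nat_Suc)
        also have "\<dots> = (\<Sum>k\<in>{k}. ennreal (D * r ^ k) * (ennreal (1/t) * indicator (E (real (Suc k))) t))" by simp
        also have "\<dots> \<le> (\<Sum>k. ennreal (D * r ^ k) * (ennreal (1/t) * indicator (E (real (Suc k))) t))"
          by (rule sum_le_suminf) auto
        finally show ?thesis .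
      qed auto
    qed
    also have "\<dots> = (\<Sum>k. \<integral>\<^sup>+t. ennreal (D * r ^ k) * (ennreal (1/t) * indicator (E (real (Suc k))) t) \<partial>lborel)"
      by (rule nn_integral_suminf) measurable
    also have "\<dots> \<le> (\<Sum>k. ennreal (D * (3 * K) * (real (Suc k) * r ^ k)))"
    proof (intro suminf_le)
      fix k
      have "(\<integral>\<^sup>+t. ennreal (D * r ^ k) * (ennreal (1/t) * indicator (E (real (Suc k))) t) \<partial>lborel) = ennreal (D * r ^ k) * (\<integral>\<^sup>+t. ennreal (1/t) * indicator (E (real (Suc k))) t \<partial>lborel)"
        by (rule nn_integral_cmult) measurable
      also have "\<dots> \<le> ennreal (D * r ^ k) * ennreal (3 * K * real (Suc k))" by (intro mult_left_mono Emeas) auto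
      also have "\<dots> = ennreal (D * (3 * K) * (real (Suc k) * r ^ k))" using D K1 r by (simp add: ennreal_mult[symmetric] mult_ac)
      finally show "(\<integral>\<^sup>+t. ennreal (D * r ^ k) * (ennreal (1/t) * indicator (E (real (Suc k))) t) \<partial>lborel) \<le> ennreal (D * (3 * K) * (real (Suc k) * r ^ k))" .
    qed auto
    also have "\<dots> = ennreal (D * (3 * K) * (1 / (1 - r)\<^sup>2))"
    proof (rule suminf_ennreal_eq)
      show "(\<lambda>k. D * (3 * K) * (real (Suc k) * r ^ k)) sums (D * (3 * K) * (1 / (1 - r)\<^sup>2))"
        using r by (intro sums_mult geometric_deriv_sums) auto
      show "0 \<le> D * (3 * K) * (real (Suc k) * r ^ k)" for k using D K1 r by simp
    qed
    finally show "(\<integral>\<^sup>+t. ennreal (exp (\<kappa> * w t powr (1/\<delta>)) * t powr (\<kappa> - 1)) * indicator {0<..<1} t \<partial>lborel) \<le> ennreal (D * (3 * K) * (1 / (1 - r)\<^sup>2))" .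
  qed
qed

text \<open>Only the first bound is sharp. For the other two the kernel is replaced by
  \<open>q * max t \<tau> powr (-\<delta>)\<close> and the bound on \<open>G powr p\<close>
  suffices: it makes the potential decay for large \<open>t\<close> and puts it into the class of
  exponent \<open>s\<close>.\<close>

theorem ONeil_potential_bounds:
  fixes p q \<delta> s \<kappa> :: real
  assumes pq: "1 < p" "p < q" and \<delta>: "\<delta> = 1 - 1/q" and s: "1/s = 1/p - 1/q" and \<kappa>: "0 < \<kappa>"
  obtains C where "0 \<le> C" "\<And>G W A B. G \<in> borel_measurable borel \<Longrightarrow> (\<And>\<tau>. 0 \<le> G \<tau>) \<Longrightarrow> 0 \<le> A \<Longrightarrow> 0 \<le> B \<Longrightarrow>
     (\<integral>\<^sup>+\<tau>. ennreal (G \<tau> powr q) \<partial>lborel) \<le> ennreal (A powr q) \<Longrightarrow>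
     (\<integral>\<^sup>+\<tau>. ennreal (G \<tau> powr p) \<partial>lborel) \<le> ennreal (B powr p) \<Longrightarrow> A powr q + B powr q \<le> 1 \<Longrightarrow>
     W \<in> borel_measurable borel \<Longrightarrow> (\<And>t. 0 \<le> W t) \<Longrightarrow>
     (\<And>t. 0 < t \<Longrightarrow> ennreal (W t) \<le> (\<integral>\<^sup>+\<tau>. ennreal (G \<tau> * ONeil_kernel \<delta> t \<tau>) \<partial>lborel)) \<Longrightarrow>
     (\<integral>\<^sup>+t. ennreal (exp (\<kappa> * W t powr (1/\<delta>)) * t powr (\<kappa> - 1)) * indicator {0<..<1} t \<partial>lborel) \<le> ennreal C \<and>
     (\<forall>t\<ge>1. W t \<le> C) \<and>
     (\<integral>\<^sup>+t. ennreal (W t powr s) * indicator {0<..} t \<partial>lborel) \<le> ennreal C"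
proof -
  have q: "1 < q" using pq by simp
  have \<delta>01: "0 < \<delta>" "\<delta> < 1" unfolding \<delta> using q by auto
  have q\<delta>: "1 / (1 - \<delta>) = q" by (simp add: \<delta>)
  have "1/q < 1/p" using pq by (auto intro: divide_strict_left_mono)
  then have "0 < 1/s" unfolding s by simp
  then have s0: "0 < s" by (simp only: zero_less_divide_1_iff)
  obtain C0 where C0: "0 \<le> C0" "\<And>G B t. G \<in> borel_measurable borel \<Longrightarrow> (\<And>\<tau>. 0 \<le> G \<tau>) \<Longrightarrow> 0 \<le> B \<Longrightarrow>
     (\<integral>\<^sup>+\<tau>. ennreal (G \<tau> powr p) \<partial>lborel) \<le> ennreal (B powr p) \<Longrightarrow> 0 < t \<Longrightarrow>
     max_potential \<delta> G t \<le> ennreal (C0 * B * t powr (- (1/s)))"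
    using max_potential_le[OF pq \<delta> s] by blast
  obtain C1 where C1: "0 \<le> C1" "\<And>G B. G \<in> borel_measurable borel \<Longrightarrow> (\<And>\<tau>. 0 \<le> G \<tau>) \<Longrightarrow> 0 \<le> B \<Longrightarrow>
     (\<integral>\<^sup>+\<tau>. ennreal (G \<tau> powr p) \<partial>lborel) \<le> ennreal (B powr p) \<Longrightarrow>
     (\<integral>\<^sup>+t. ennreal (enn2real (max_potential \<delta> G t) powr s) * indicator {0<..} t \<partial>lborel) \<le> ennreal (C1 * B powr s)"
    using max_potential_powr_integral_le[OF pq \<delta> s] by blast
  obtain C2 where C2: "0 \<le> C2" "\<And>G w. G \<in> borel_measurable borel \<Longrightarrow> (\<And>\<tau>. 0 \<le> G \<tau>) \<Longrightarrow>
     (\<integral>\<^sup>+\<tau>. ennreal (G \<tau> powr q) * indicator {0<..<1} \<tau> \<partial>lborel) \<le> 1 \<Longrightarrow>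
     w \<in> borel_measurable borel \<Longrightarrow> (\<And>t. 0 \<le> w t) \<Longrightarrow>
     (\<And>t. 0 < t \<Longrightarrow> t < 1 \<Longrightarrow> ennreal (w t) \<le> (\<integral>\<^sup>+\<tau>. ennreal (G \<tau> * ONeil_kernel \<delta> t \<tau>) * indicator {0<..<1} \<tau> \<partial>lborel)) \<Longrightarrow>
     (\<integral>\<^sup>+t. ennreal (exp (\<kappa> * w t powr (1/\<delta>)) * t powr (\<kappa> - 1)) * indicator {0<..<1} t \<partial>lborel) \<le> ennreal C2"
    using Adams_Garsia_inequality[OF q \<delta> \<kappa>] by blast
  \<comment> \<open>The price of the part of \<open>G\<close> beyond 1: its contribution adds
    \<open>C0 powr (1/\<delta>)\<close> to \<open>w powr (1/\<delta>)\<close> in the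
    exponent.\<close>
  define E where "E = exp (\<kappa> * C0 powr (1/\<delta>))"
  define C where "C = max (E * C2) (max (q * C0) (q powr s * C1))"
  show ?thesis
  proof
    have "0 \<le> q * C0" using C0(1) q by simp
    also have "\<dots> \<le> C" by (simp add: C_def)
    finally show "0 \<le> C" .
    fix G W :: "real \<Rightarrow> real" and A B :: real
    assume Gm[measurable]: "G \<in> borel_measurable borel" and G: "\<And>\<tau>. 0 \<le> G \<tau>" and AB: "0 \<le> A" "0 \<le> B"
      and Gq: "(\<integral>\<^sup>+\<tau>. ennreal (G \<tau> powr q) \<partial>lborel) \<le> ennreal (A powr q)"
      and Gp: "(\<integral>\<^sup>+\<tau>. ennreal (G \<tau> powr p) \<partial>lborel) \<le> ennreal (B powr p)" and AB1: "A powr q + B powr q \<le> 1"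
      and [measurable]: "W \<in> borel_measurable borel" and W: "\<And>t. 0 \<le> W t"
      and Wle: "\<And>t. 0 < t \<Longrightarrow> ennreal (W t) \<le> (\<integral>\<^sup>+\<tau>. ennreal (G \<tau> * ONeil_kernel \<delta> t \<tau>) \<partial>lborel)"
    have B1: "B \<le> 1"
    proof (rule ccontr)
      assume "\<not> B \<le> 1"
      then have "1 < B powr q" using q by simp
      then show False using AB1 powr_ge_zero[of A q] by linarith
    qed
    have J: "max_potential \<delta> G t \<le> ennreal (C0 * B * t powr (- (1/s)))" if "0 < t" for t
      by (rule C0(2)[OF Gm G AB(2) Gp that])
    have Wmax: "W t \<le> q * enn2real (max_potential \<delta> G t)" if t: "0 < t" for t
    proof -
      have "ennreal (W t) \<le> (\<integral>\<^sup>+\<tau>. ennreal (G \<tau> * ONeil_kernel \<delta> t \<tau>) \<partial>lborel)" by (rule Wle[OF t])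
      also have "\<dots> \<le> (\<integral>\<^sup>+\<tau>. ennreal q * (ennreal (G \<tau> * max t \<tau> powr (-\<delta>)) * indicator {0<..} \<tau>) \<partial>lborel)"
      proof (intro nn_integral_mono)
        fix \<tau> :: real
        have "ONeil_kernel \<delta> t \<tau> \<le> q * max t \<tau> powr (-\<delta>)" if "0 < \<tau>"
        proof (cases "\<tau> < t")
          case True
          have "t powr (-\<delta>) / (1 - \<delta>) = 1 / (1 - \<delta>) * t powr (-\<delta>)" by simp
          then show ?thesis using that True unfolding q\<delta> by (simp add: ONeil_kernel_def max_def)
        next
          case False
          have "1 * \<tau> powr (-\<delta>) \<le> q * \<tau> powr (-\<delta>)" using q by (intro mult_right_mono) auto
          then show ?thesis using False that by (auto simp: ONeil_kernel_def max_def)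
        qed
        then have "G \<tau> * ONeil_kernel \<delta> t \<tau> \<le> q * (G \<tau> * max t \<tau> powr (-\<delta>))" if "0 < \<tau>"
          using mult_left_mono[OF _ G[of \<tau>], of "ONeil_kernel \<delta> t \<tau>" "q * max t \<tau> powr (-\<delta>)"] that
          by (simp add: mult.left_commute)
        then show "ennreal (G \<tau> * ONeil_kernel \<delta> t \<tau>) \<le> ennreal q * (ennreal (G \<tau> * max t \<tau> powr (-\<delta>)) * indicator {0<..} \<tau>)"
          using q by (cases "0 < \<tau>") (auto simp: ennreal_mult'[symmetric] ONeil_kernel_def intro!: ennreal_leI split: split_indicator)
      qed
      also have "\<dots> = ennreal q * max_potential \<delta> G t" unfolding max_potential_def by (rule nn_integral_cmult) auto
      also have "\<dots> = ennreal q * ennreal (enn2real (max_potential \<delta> G t))"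
        using J[OF t] by (subst ennreal_enn2real) (auto simp: less_top[symmetric] top_unique)
      finally show ?thesis using q by (simp add: ennreal_mult[symmetric])
    qed
    have "W t \<le> C" if "1 \<le> t" for t
    proof -
      have "W t \<le> q * enn2real (max_potential \<delta> G t)" using that by (intro Wmax) auto
      also have "\<dots> \<le> q * (C0 * B * t powr (- (1/s)))"
        using J[of t] that q C0(1) AB by (intro mult_left_mono enn2real_leI) auto
      also have "\<dots> \<le> q * (C0 * 1 * 1)"
      proof -
        have "t powr (- (1/s)) \<le> 1 powr (- (1/s))" using that s0 by (intro powr_mono2') auto
        then show ?thesis using q C0(1) B1 AB by (intro mult_left_mono mult_mono) auto
      qed
      also have "\<dots> \<le> C" by (simp add: C_def)
      finally show ?thesis .
    qed
    moreover have "(\<integral>\<^sup>+t. ennreal (W t powr s) * indicator {0<..} t \<partial>lborel) \<le> ennreal C"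
    proof -
      have "(\<integral>\<^sup>+t. ennreal (W t powr s) * indicator {0<..} t \<partial>lborel) \<le>
          (\<integral>\<^sup>+t. ennreal (q powr s) * (ennreal (enn2real (max_potential \<delta> G t) powr s) * indicator {0<..} t) \<partial>lborel)"
      proof (intro nn_integral_mono)
        fix t :: real
        have "W t powr s \<le> q powr s * enn2real (max_potential \<delta> G t) powr s" if "0 < t"
          using powr_mono2[OF _ W Wmax[OF that], of s] s0 by (simp add: powr_mult)
        then show "ennreal (W t powr s) * indicator {0<..} t \<le> ennreal (q powr s) * (ennreal (enn2real (max_potential \<delta> G t) powr s) * indicator {0<..} t)"
          by (auto simp: ennreal_mult[symmetric] intro!: ennreal_leI split: split_indicator)
      qed
      also have "\<dots> = ennreal (q powr s) * (\<integral>\<^sup>+t. ennreal (enn2real (max_potential \<delta> G t) powr s) * indicator {0<..} t \<partial>lborel)"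
        by (rule nn_integral_cmult) measurable
      also have "\<dots> \<le> ennreal (q powr s) * ennreal (C1 * B powr s)" by (intro mult_left_mono C1(2)[OF Gm G AB(2) Gp]) auto
      also have "\<dots> = ennreal (q powr s * C1 * B powr s)" using C1(1) by (simp add: ennreal_mult[symmetric] mult.assoc)
      also have "\<dots> \<le> ennreal (q powr s * C1 * 1)"
        using C1(1) B1 AB s0 powr_mono2[of s B 1] by (intro ennreal_leI mult_left_mono) auto
      also have "\<dots> \<le> ennreal C" by (intro ennreal_leI) (simp add: C_def)
      finally show ?thesis .
    qed
    moreover have "(\<integral>\<^sup>+t. ennreal (exp (\<kappa> * W t powr (1/\<delta>)) * t powr (\<kappa> - 1)) * indicator {0<..<1} t \<partial>lborel) \<le> ennreal C"
    proof -
      define Q where "Q = (\<lambda>t. \<integral>\<^sup>+\<tau>. ennreal (G \<tau> * ONeil_kernel \<delta> t \<tau>) * indicator {0<..<1} \<tau> \<partial>lborel)"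
      have WQ: "ennreal (W t) \<le> Q t + ennreal (C0 * B)" if t: "0 < t" "t < 1" for t
      proof -
        have "ennreal (W t) \<le> (\<integral>\<^sup>+\<tau>. ennreal (G \<tau> * ONeil_kernel \<delta> t \<tau>) \<partial>lborel)" by (rule Wle[OF t(1)])
        \<comment> \<open>For \<open>t < 1 \<le> \<tau>\<close> the kernel is
          \<open>\<tau> powr (-\<delta>)\<close>, independent of \<open>t\<close>, so the far part
          is at most \<open>max_potential\<close> at 1.\<close>
        also have "\<dots> \<le> (\<integral>\<^sup>+\<tau>. ennreal (G \<tau> * ONeil_kernel \<delta> t \<tau>) * indicator {0<..<1} \<tau> + ennreal (G \<tau> * max 1 \<tau> powr (-\<delta>)) * indicator {0<..} \<tau> \<partial>lborel)"
          using t by (intro nn_integral_mono) (auto simp: ONeil_kernel_def max_def split: split_indicator)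
        also have "\<dots> = Q t + max_potential \<delta> G 1" unfolding Q_def max_potential_def by (rule nn_integral_add) auto
        also have "\<dots> \<le> Q t + ennreal (C0 * B)" using J[of 1] by (intro add_left_mono) simp
        finally show ?thesis .
      qed
      define H where "H = (\<lambda>\<tau>. G \<tau> / A)"
      \<comment> \<open>What is left after subtracting the far part, divided by \<open>A\<close> so
        that it belongs to the normalised \<open>H\<close>. For \<open>A = 0\<close> the division
        gives 0, in agreement with \<open>A0\<close>: then \<open>G\<close> vanishes almost
        everywhere and the truncated difference is 0.\<close>
      define w where "w = (\<lambda>t. if 0 < t \<and> t < 1 then max 0 (W t - C0 * B) / A else 0)"
      have [measurable]: "H \<in> borel_measurable borel" "w \<in> borel_measurable borel" unfolding H_def w_def by measurable
      have Qle: "ennreal (max 0 (W t - C0 * B)) \<le> Q t" if t: "0 < t" "t < 1" for t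
      proof (cases "Q t")
        case (real r)
        have "ennreal (W t) \<le> ennreal (r + C0 * B)" using WQ[OF t] real C0(1) AB by simp
        then have "W t \<le> r + C0 * B" using real C0(1) AB by (subst (asm) ennreal_le_iff) auto
        then show ?thesis using real by (auto intro!: ennreal_leI)
      qed simp
      have A0: "max 0 (W t - C0 * B) = 0" if A0: "A = 0" and t: "0 < t" "t < 1" for t
      proof -
        have "AE \<tau> in lborel. G \<tau> = 0" using Gq A0 G by (intro nn_integral_eq_0_powr[of G lborel q]) auto
        then have "Q t = (\<integral>\<^sup>+\<tau>. 0 \<partial>(lborel::real measure))" unfolding Q_def by (intro nn_integral_cong_AE) auto
        then show ?thesis using Qle[OF t] by (simp add: ennreal_eq_0_iff)
      qed
      have "(\<integral>\<^sup>+t. ennreal (exp (\<kappa> * w t powr (1/\<delta>)) * t powr (\<kappa> - 1)) * indicator {0<..<1} t \<partial>lborel) \<le> ennreal C2"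
      proof (rule C2(2)[where G=H])
        show "(\<integral>\<^sup>+\<tau>. ennreal (H \<tau> powr q) * indicator {0<..<1} \<tau> \<partial>lborel) \<le> 1"
        proof (cases "A = 0")
          case True then show ?thesis using q by (simp add: H_def)
        next
          case False
          have "(\<integral>\<^sup>+\<tau>. ennreal (H \<tau> powr q) * indicator {0<..<1} \<tau> \<partial>lborel) \<le> (\<integral>\<^sup>+\<tau>. ennreal (1 / A powr q) * ennreal (G \<tau> powr q) \<partial>lborel)"
            using AB G by (intro nn_integral_mono) (auto simp: H_def powr_divide ennreal_mult[symmetric] split: split_indicator)
          also have "\<dots> = ennreal (1 / A powr q) * (\<integral>\<^sup>+\<tau>. ennreal (G \<tau> powr q) \<partial>lborel)" by (rule nn_integral_cmult) auto
          also have "\<dots> \<le> ennreal (1 / A powr q) * ennreal (A powr q)" by (intro mult_left_mono Gq) auto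
          also have "\<dots> = 1" using False by (simp add: ennreal_mult[symmetric])
          finally show ?thesis .
        qed
        show "ennreal (w t) \<le> (\<integral>\<^sup>+\<tau>. ennreal (H \<tau> * ONeil_kernel \<delta> t \<tau>) * indicator {0<..<1} \<tau> \<partial>lborel)" if t: "0 < t" "t < 1" for t
        proof -
          have "ennreal (w t) = ennreal (1 / A) * ennreal (max 0 (W t - C0 * B))"
            using t AB by (simp add: w_def ennreal_mult[symmetric])
          also have "\<dots> \<le> ennreal (1 / A) * Q t" by (intro mult_left_mono Qle t) auto
          also have "\<dots> = (\<integral>\<^sup>+\<tau>. ennreal (1 / A) * (ennreal (G \<tau> * ONeil_kernel \<delta> t \<tau>) * indicator {0<..<1} \<tau>) \<partial>lborel)"
            unfolding Q_def by (rule nn_integral_cmult[symmetric]) auto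
          also have "\<dots> = (\<integral>\<^sup>+\<tau>. ennreal (H \<tau> * ONeil_kernel \<delta> t \<tau>) * indicator {0<..<1} \<tau> \<partial>lborel)"
            using AB G ONeil_kernel_nonneg[OF \<delta>01(2)]
            by (intro nn_integral_cong) (auto simp: H_def ennreal_mult[symmetric] split: split_indicator)
          finally show ?thesis .
        qed
      qed (use G AB in \<open>auto simp: H_def w_def\<close>)
      note w_bound = this
      have "(\<integral>\<^sup>+t. ennreal (exp (\<kappa> * W t powr (1/\<delta>)) * t powr (\<kappa> - 1)) * indicator {0<..<1} t \<partial>lborel)
        \<le> (\<integral>\<^sup>+t. ennreal E * (ennreal (exp (\<kappa> * w t powr (1/\<delta>)) * t powr (\<kappa> - 1)) * indicator {0<..<1} t) \<partial>lborel)"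
      proof (intro nn_integral_mono)
        fix t :: real
        show "ennreal (exp (\<kappa> * W t powr (1/\<delta>)) * t powr (\<kappa> - 1)) * indicator {0<..<1} t
          \<le> ennreal E * (ennreal (exp (\<kappa> * w t powr (1/\<delta>)) * t powr (\<kappa> - 1)) * indicator {0<..<1} t)"
        proof (cases "0 < t \<and> t < 1")
          case True
          have w0: "0 \<le> w t" using AB by (simp add: w_def)
          have "W t \<le> A * w t + B * C0"
            using A0[of t] True AB by (cases "A = 0") (auto simp: w_def max_def mult.commute split: if_splits)
          also have "\<dots> = (A powr q) powr (1 - \<delta>) * (w t powr (1/\<delta>)) powr \<delta> + (B powr q) powr (1 - \<delta>) * (C0 powr (1/\<delta>)) powr \<delta>"
            using AB w0 C0(1) \<delta>01 q by (simp add: powr_powr \<delta>)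
          also have "\<dots> \<le> (A powr q + B powr q) powr (1 - \<delta>) * (w t powr (1/\<delta>) + C0 powr (1/\<delta>)) powr \<delta>"
            using \<delta>01 by (intro powr_Holder2) auto
          also have "\<dots> \<le> 1 powr (1 - \<delta>) * (w t powr (1/\<delta>) + C0 powr (1/\<delta>)) powr \<delta>"
            using \<delta>01 AB1 by (intro mult_right_mono powr_mono2) auto
          finally have "W t powr (1/\<delta>) \<le> ((w t powr (1/\<delta>) + C0 powr (1/\<delta>)) powr \<delta>) powr (1/\<delta>)"
            using W \<delta>01 by (intro powr_mono2) auto
          also have "\<dots> = w t powr (1/\<delta>) + C0 powr (1/\<delta>)" using \<delta>01 by (simp add: powr_powr)
          finally have "\<kappa> * W t powr (1/\<delta>) \<le> \<kappa> * C0 powr (1/\<delta>) + \<kappa> * w t powr (1/\<delta>)"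
            using \<kappa> by (simp add: distrib_left[symmetric] add.commute)
          then have "exp (\<kappa> * W t powr (1/\<delta>)) \<le> E * exp (\<kappa> * w t powr (1/\<delta>))"
            unfolding E_def exp_add[symmetric] by (simp only: exp_le_cancel_iff)
          then have "exp (\<kappa> * W t powr (1/\<delta>)) * t powr (\<kappa> - 1) \<le> E * (exp (\<kappa> * w t powr (1/\<delta>)) * t powr (\<kappa> - 1))"
            unfolding mult.assoc[symmetric] by (intro mult_right_mono) auto
          then show ?thesis using True by (simp add: ennreal_mult[symmetric] E_def)
        qed auto
      qed
      also have "\<dots> = ennreal E * (\<integral>\<^sup>+t. ennreal (exp (\<kappa> * w t powr (1/\<delta>)) * t powr (\<kappa> - 1)) * indicator {0<..<1} t \<partial>lborel)"
        by (rule nn_integral_cmult) measurable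
      also have "\<dots> \<le> ennreal E * ennreal C2" by (intro mult_left_mono w_bound) auto
      also have "\<dots> = ennreal (E * C2)" using C2(1) by (simp add: ennreal_mult[symmetric] E_def)
      also have "\<dots> \<le> ennreal C" by (intro ennreal_leI) (simp add: C_def)
      finally show ?thesis .
    qed
    ultimately show "(\<integral>\<^sup>+t. ennreal (exp (\<kappa> * W t powr (1/\<delta>)) * t powr (\<kappa> - 1)) * indicator {0<..<1} t \<partial>lborel) \<le> ennreal C \<and>
     (\<forall>t\<ge>1. W t \<le> C) \<and>
     (\<integral>\<^sup>+t. ennreal (W t powr s) * indicator {0<..} t \<partial>lborel) \<le> ennreal C" by blast
  qed
qed

section \<open>Exponential integrability of Riesz potentials\<close>

text \<open>Levels above \<open>M\<close> are empty, and each of the others has at most the measure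
  of the support. Hence \<open>enn2real\<close> of this bound can be used later without
  loss.\<close>

lemma ONeil_bound_finite:
  fixes g :: "'a::euclidean_space \<Rightarrow> real"
  assumes [measurable]: "g \<in> borel_measurable borel" and g: "\<And>x. g x \<le> M"
    and fin: "emeasure lborel {y. 0 < g y} < \<infinity>" and \<delta>: "\<delta> < 1"
  shows "ONeil_bound \<delta> g t < \<infinity>"
proof -
  define L where "L = measure lborel {y. 0 < g y}"
  have L: "measure lborel {y. s < g y} \<le> L" if "0 \<le> s" for s
    unfolding L_def using fin that by (intro measure_mono_fmeasurable) (auto simp: fmeasurable_def)
  have "ONeil_bound \<delta> g t \<le> (\<integral>\<^sup>+s. ennreal (L * t powr (-\<delta>) / (1 - \<delta>)) * indicator {0..max 0 M} s \<partial>lborel)"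
    unfolding ONeil_bound_def
  proof (intro nn_integral_mono)
    fix s :: real
    show "indicator {0..} s * ennreal (min (measure lborel {y. s < g y} * t powr (- \<delta>)) (measure lborel {y. s < g y} powr (1 - \<delta>)) / (1 - \<delta>))
        \<le> ennreal (L * t powr (-\<delta>) / (1 - \<delta>)) * indicator {0..max 0 M} s"
    proof (cases "0 \<le> s \<and> s \<le> M")
      case True
      have "min (measure lborel {y. s < g y} * t powr (- \<delta>)) (measure lborel {y. s < g y} powr (1 - \<delta>)) \<le> L * t powr (-\<delta>)"
        using L[of s] True by (intro min.coboundedI1 mult_right_mono) auto
      then show ?thesis using True \<delta> by (auto intro!: ennreal_leI divide_right_mono)
    next
      case False
      show ?thesis
      proof (cases "0 \<le> s")
        case True
        then have "{y. s < g y} = {}" using False g by (auto simp: not_less intro: order.trans[OF g])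
        then show ?thesis by simp
      qed simp
    qed
  qed
  also have "\<dots> < \<infinity>"
    by (subst nn_integral_cmult_indicator) (auto simp: ennreal_mult_less_top)
  finally show ?thesis .
qed

text \<open>For nonnegative argument the sign, the monotonicity and the power bound of
  \<open>Phi\<close> become termwise comparisons of this series.\<close>

lemma exp_tail_sums: "(\<lambda>j. (y::real) ^ (j + m) / fact (j + m)) sums (exp y - (\<Sum>j<m. y ^ j / fact j))"
proof -
  have "(\<lambda>j. y ^ j / fact j) sums exp y"
    using exp_converges[of y] by (simp add: divide_inverse mult.commute)
  then show ?thesis by (subst sums_iff_shift) simp
qed

lemma exp_tail_mono:
  assumes "0 \<le> x" "x \<le> (y::real)"
  shows "exp x - (\<Sum>j<m. x ^ j / fact j) \<le> exp y - (\<Sum>j<m. y ^ j / fact j)"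
  by (rule sums_le[OF _ exp_tail_sums exp_tail_sums]) (use assms in \<open>auto intro!: divide_right_mono power_mono\<close>)

lemma exp_tail_nonneg:
  assumes "0 \<le> (y::real)"
  shows "0 \<le> exp y - (\<Sum>j<m. y ^ j / fact j)"
  by (rule sums_le[OF _ sums_zero exp_tail_sums]) (use assms in auto)

lemma exp_tail_le_exp:
  assumes "0 \<le> (y::real)"
  shows "exp y - (\<Sum>j<m. y ^ j / fact j) \<le> exp y"
  using assms by (auto intro!: sum_nonneg)

text \<open>Termwise from \<open>fact j \<le> fact (j + m)\<close>. It is the bound for bounded
  arguments, where the tail is comparable to its first term.\<close>

lemma exp_tail_le_power:
  assumes "0 \<le> (y::real)"
  shows "exp y - (\<Sum>j<m. y ^ j / fact j) \<le> y ^ m * exp y"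
proof (rule sums_le[OF _ exp_tail_sums])
  have "(\<lambda>j. y ^ j / fact j) sums exp y"
    using exp_converges[of y] by (simp add: divide_inverse mult.commute)
  then show "(\<lambda>j. y ^ m * (y ^ j / fact j)) sums (y ^ m * exp y)" by (rule sums_mult)
  fix j
  have "(fact j :: real) \<le> fact (j + m)" by (intro fact_mono) auto
  then have "y ^ (j + m) / fact (j + m) \<le> y ^ (j + m) / fact j"
    using assms by (intro divide_left_mono) auto
  then show "y ^ (j + m) / fact (j + m) \<le> y ^ m * (y ^ j / fact j)" by (simp add: power_add mult.commute)
qed

lemma Phi_eq: "Phi n \<alpha> m s = exp (\<alpha> * \<bar>s\<bar> powr (real n / (real n - 2))) - (\<Sum>j<m. (\<alpha> * \<bar>s\<bar> powr (real n / (real n - 2))) ^ j / fact j)"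
  by (simp add: Phi_def Let_def power_mult_distrib)

lemma Phi_abs: "Phi n \<alpha> m \<bar>s\<bar> = Phi n \<alpha> m s"
  by (simp add: Phi_eq)

lemma Phi_nonneg: "0 \<le> \<alpha> \<Longrightarrow> 0 \<le> Phi n \<alpha> m s"
  unfolding Phi_eq by (intro exp_tail_nonneg) simp

lemma Phi_mono:
  assumes "0 \<le> \<alpha>" "2 < n" "\<bar>s\<bar> \<le> \<bar>t\<bar>"
  shows "Phi n \<alpha> m s \<le> Phi n \<alpha> m t"
  unfolding Phi_eq using assms by (intro exp_tail_mono mult_left_mono powr_mono2) auto

lemma continuous_on_Phi: "2 < n \<Longrightarrow> continuous_on UNIV (Phi n \<alpha> m)"
  unfolding Phi_eq[abs_def] by (intro continuous_intros continuous_on_powr') auto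

lemma Phi_measurable[measurable]: "Phi n \<alpha> m \<in> borel_measurable borel"
  unfolding Phi_eq[abs_def] by measurable

text \<open>For continuous nondecreasing \<open>\<Psi>\<close> the part of [0, \<infinity>) where
  \<open>\<Psi> > r\<close> is the half-line beyond \<open>Sup S\<close>, with \<open>S\<close> the
  closed set of \<open>s \<ge> 0\<close> where \<open>\<Psi> s \<le> r\<close>. So a level set of
  the composition is a level set of the inner function.\<close>

lemma level_comp_mono:
  fixes \<Psi> :: "real \<Rightarrow> real" and a :: "'a::euclidean_space \<Rightarrow> real" and v :: "real \<Rightarrow> real"
  assumes \<Psi>: "continuous_on UNIV \<Psi>" "\<And>s t. 0 \<le> s \<Longrightarrow> s \<le> t \<Longrightarrow> \<Psi> s \<le> \<Psi> t" "\<Psi> 0 \<le> 0"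
    and a: "\<And>x. 0 \<le> a x" and v: "\<And>t. 0 \<le> v t" and r: "0 \<le> r"
    and le: "\<And>r. 0 \<le> r \<Longrightarrow> emeasure lborel {x. r < a x} \<le> emeasure lborel {t. 0 < t \<and> r < v t}"
  shows "emeasure lborel {x. r < \<Psi> (a x)} \<le> emeasure lborel {t. 0 < t \<and> r < \<Psi> (v t)}"
proof (cases "\<exists>s1\<ge>0. r < \<Psi> s1")
  case True
  then obtain s1 where s1: "0 \<le> s1" "r < \<Psi> s1" by blast
  define S where "S = {s. 0 \<le> s \<and> \<Psi> s \<le> r}"
  have "closed S"
    unfolding S_def by (intro closed_Collect_conj closed_Collect_le \<Psi>(1) continuous_intros)
  moreover have "0 \<in> S" using \<Psi>(3) r by (simp add: S_def)
  moreover have "s \<le> s1" if "s \<in> S" for s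
    using \<Psi>(2)[of s1 s] s1 that by (auto simp: S_def not_le) (meson leI order.trans not_le less_imp_le)
  then have "bdd_above S" by (auto simp: bdd_above_def)
  ultimately have Sup: "Sup S \<in> S" "\<And>s. s \<in> S \<Longrightarrow> s \<le> Sup S"
    by (auto intro!: closed_contains_Sup cSup_upper)
  have eq: "r < \<Psi> s \<longleftrightarrow> Sup S < s" if "0 \<le> s" for s
  proof -
    have "\<Psi> s \<le> r \<longleftrightarrow> s \<le> Sup S"
      using Sup(1) Sup(2)[of s] \<Psi>(2)[of s "Sup S"] that by (auto simp: S_def)
    then show ?thesis by (meson not_le)
  qed
  have "0 \<le> Sup S" using Sup(1) by (simp add: S_def)
  then show ?thesis using le[of "Sup S"] by (simp add: eq a v)
next
  case False
  then have "{x. r < \<Psi> (a x)} = {}" using a by auto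
  then show ?thesis by simp
qed

text \<open>The cone over the sphere is the closed unit ball without its centre, and a point is a
  null set.\<close>

lemma sphere_area_eq: "sphere_area TYPE('n::finite) = real CARD('n) * unit_ball_vol (real CARD('n))"
proof -
  have "{r *\<^sub>R x |r x. 0 < r \<and> r \<le> 1 \<and> x \<in> sphere (0 :: real ^ 'n) 1} = cball 0 1 - {0}"
  proof (intro set_eqI iffI)
    fix y :: "real ^ 'n" assume "y \<in> cball 0 1 - {0}"
    then have "y = norm y *\<^sub>R (y /\<^sub>R norm y)" "0 < norm y" "norm y \<le> 1" "y /\<^sub>R norm y \<in> sphere 0 1" by auto
    then show "y \<in> {r *\<^sub>R x |r x. 0 < r \<and> r \<le> 1 \<and> x \<in> sphere (0 :: real ^ 'n) 1}" by blast
  qed auto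
  moreover have "measure lebesgue (cball (0 :: real ^ 'n) 1 - {0}) = measure lebesgue (cball (0 :: real ^ 'n) 1)"
    by (intro measure_Diff_null_set) auto
  moreover have "measure lebesgue (cball (0 :: real ^ 'n) 1) = unit_ball_vol (real CARD('n))"
    using content_cball[of 1 "0 :: real ^ 'n"] by simp
  ultimately show ?thesis unfolding sphere_area_def surface_measure_def by simp
qed

text \<open>This is where the value of \<open>\<beta>(n,2)\<close> comes from: it cancels the constant of the rearranged Newtonian potential.\<close>

lemma beta_potential_constant:
  fixes V \<delta> :: real
  assumes n: "2 < CARD('n::finite)"
  defines "V \<equiv> unit_ball_vol (real CARD('n))" and "\<delta> \<equiv> 1 - 2 / real CARD('n)"
  shows "beta TYPE('n) * (1 / ((real CARD('n) - 2) * real CARD('n) * V) * V powr \<delta>) powr (1/\<delta>) = 1"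
proof -
  define N where "N = real CARD('n)"
  have N: "2 < N" using n by (simp add: N_def)
  have V: "0 < V" by (simp add: V_def)
  have \<delta>: "0 < \<delta>" "\<delta> < 1" using N by (auto simp: \<delta>_def N_def[symmetric])
  have e: "N / (N - 2) = 1/\<delta>" using N by (simp add: \<delta>_def N_def[symmetric] field_simps)
  define Z where "Z = (N - 2) * (N * V) powr (2/N)"
  define Y where "Y = 1 / ((N - 2) * N * V) * V powr \<delta>"
  have "beta TYPE('n) = N * Z powr (1/\<delta>)"
  proof -
    have "unit_ball_vol N = V" by (simp add: V_def N_def)
    then show ?thesis by (simp only: beta_def Let_def sphere_area_eq N_def[symmetric] e Z_def)
  qed
  then have "beta TYPE('n) * Y powr (1/\<delta>) = N * (Z * Y) powr (1/\<delta>)"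
    by (simp only: mult.assoc powr_mult[of Z Y])
  \<comment> \<open>Since \<open>2/N - 1 = -\<delta>\<close>, the powers of \<open>V\<close> cancel
    and the product is \<open>N powr (-\<delta>)\<close>; its \<open>1/\<delta>\<close>-th power is
    \<open>1/N\<close>, which cancels the factor \<open>N\<close> of \<open>beta\<close>.\<close>
  also have "Z * Y = ((N - 2) * (N * V) powr (2/N)) * (1 / ((N - 2) * N * V) * V powr \<delta>)"
    by (simp only: Z_def Y_def)
  also have "((N - 2) * (N * V) powr (2/N)) * (1 / ((N - 2) * N * V) * V powr \<delta>) = (N * V) powr (2/N) / (N * V) powr 1 * V powr \<delta>"
    using N V by (simp add: field_simps)
  also have "\<dots> = (N * V) powr (- \<delta>) * V powr \<delta>"
    unfolding powr_diff[symmetric] by (simp add: \<delta>_def N_def[symmetric])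
  also have "\<dots> = N powr (- \<delta>)" using N V by (simp add: powr_mult powr_minus field_simps)
  also have "N * (N powr (- \<delta>)) powr (1/\<delta>) = 1"
    using powr_neg_powr_inverse[of N \<delta>] N \<delta> by simp
  finally show ?thesis by (simp only: N_def Y_def)
qed

text \<open>The Hardy-Littlewood inequality moves the integral to the half-line, with
  \<open>\<Psi>\<close> applied to the rearranged potential. On (0, 1) the tail of the series is
  replaced by the whole exponential, to which the sharp bound applies; on [1, \<infinity>) the
  potential is bounded and only the first term of the tail matters.\<close>

theorem weighted_exponential_integral_bound:
  fixes p \<gamma> \<alpha> :: real
  defines "N \<equiv> real CARD('n::finite)"
  assumes n: "2 < CARD('n)" and p: "1 < p" "p < N / 2" and \<gamma>: "0 \<le> \<gamma>" "\<gamma> < N"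
    and \<alpha>: "0 \<le> \<alpha>" "\<alpha> \<le> beta_gamma \<gamma> TYPE('n)"
  obtains C where "0 \<le> C" "\<And>(a :: real ^ 'n \<Rightarrow> real) g A B M. a \<in> borel_measurable borel \<Longrightarrow> g \<in> borel_measurable borel \<Longrightarrow>
     (\<And>x. 0 \<le> a x) \<Longrightarrow> (\<And>x. 0 \<le> g x) \<Longrightarrow> (\<And>x. g x \<le> M) \<Longrightarrow> emeasure lborel {x. 0 < g x} < \<infinity> \<Longrightarrow>
     (\<And>x. ennreal (a x) \<le> ennreal (1 / ((N - 2) * N * unit_ball_vol N)) * (\<integral>\<^sup>+y. ennreal (norm (x - y) powr (2 - N) * g y) \<partial>lborel)) \<Longrightarrow>
     0 \<le> A \<Longrightarrow> 0 \<le> B \<Longrightarrow>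
     (\<integral>\<^sup>+x. ennreal (g x powr (N / 2)) \<partial>lborel) \<le> ennreal (A powr (N / 2)) \<Longrightarrow>
     (\<integral>\<^sup>+x. ennreal (g x powr p) \<partial>lborel) \<le> ennreal (B powr p) \<Longrightarrow> A powr (N / 2) + B powr (N / 2) \<le> 1 \<Longrightarrow>
     (\<integral>\<^sup>+x. ennreal (Phi CARD('n) \<alpha> (j0 CARD('n) p) (a x) / norm x powr \<gamma>) \<partial>lborel) \<le> ennreal C"
proof -
  have N: "2 < N" using n by (simp add: N_def)
  define V where "V = unit_ball_vol N"
  have V: "0 < V" by (simp add: V_def N_def)
  define q where "q = N / 2"
  define \<delta> where "\<delta> = 1 - 1/q"
  define s where "s = pstar CARD('n) p"
  define \<kappa> where "\<kappa> = 1 - \<gamma> / N"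
  define c where "c = 1 / ((N - 2) * N * V)"
  define m where "m = j0 CARD('n) p"
  have q: "1 < q" "p < q" using N p by (auto simp: q_def)
  have \<delta>: "0 < \<delta>" "\<delta> < 1" unfolding \<delta>_def using q by auto
  have \<delta>N: "\<delta> = 1 - 2 / N" by (simp add: \<delta>_def q_def)
  have N\<delta>: "- (N * \<delta>) = 2 - N" using N by (simp add: \<delta>N algebra_simps)
  have e: "N / (N - 2) = 1/\<delta>" using N by (simp add: \<delta>N field_simps)
  have c: "0 \<le> c" using N V by (simp add: c_def)
  have s: "1/s = 1/p - 1/q" using p N by (simp add: s_def pstar_def N_def[symmetric] q_def field_simps)
  have s0: "0 < s" using p N by (simp add: s_def pstar_def N_def[symmetric])
  have \<kappa>: "0 < \<kappa>" "\<kappa> \<le> 1" using \<gamma> N by (auto simp: \<kappa>_def)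
  \<comment> \<open>\<open>j0\<close> is the least natural number with
    \<open>j0 / \<delta> \<ge> pstar\<close>: the lowest power of the potential that
    \<open>Phi\<close> keeps is at least the power \<open>pstar\<close>, for which integrability is
    known.\<close>
  have ms: "s \<le> m / \<delta>"
  proof -
    have "s * \<delta> = pstar CARD('n) p * (real CARD('n) - 2) / real CARD('n)"
      using N by (simp add: s_def \<delta>N N_def[symmetric] field_simps)
    also have "\<dots> \<le> real m" unfolding m_def j0_def by linarith
    finally show ?thesis using \<delta> by (simp add: field_simps)
  qed
  \<comment> \<open>\<open>c * V powr \<delta>\<close> is the constant in front of the rearranged
    potential. At the critical \<open>\<alpha>\<close> equality holds, so the exponential bound is
    used with no room to spare.\<close>
  have Ck: "\<alpha> * (c * V powr \<delta>) powr (1/\<delta>) \<le> \<kappa>"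
  proof -
    have b: "beta TYPE('n) * (c * V powr \<delta>) powr (1/\<delta>) = 1"
      unfolding c_def V_def \<delta>N N_def by (rule beta_potential_constant[OF n])
    have "\<alpha> * (c * V powr \<delta>) powr (1/\<delta>) \<le> beta_gamma \<gamma> TYPE('n) * (c * V powr \<delta>) powr (1/\<delta>)"
      by (intro mult_right_mono \<alpha>) auto
    also have "\<dots> = \<kappa>" using b by (simp add: beta_gamma_def \<kappa>_def N_def mult.assoc)
    finally show ?thesis .
  qed
  obtain C where C: "0 \<le> C" "\<And>G W A B. G \<in> borel_measurable borel \<Longrightarrow> (\<And>\<tau>. 0 \<le> G \<tau>) \<Longrightarrow> 0 \<le> A \<Longrightarrow> 0 \<le> B \<Longrightarrow>
     (\<integral>\<^sup>+\<tau>. ennreal (G \<tau> powr q) \<partial>lborel) \<le> ennreal (A powr q) \<Longrightarrow>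
     (\<integral>\<^sup>+\<tau>. ennreal (G \<tau> powr p) \<partial>lborel) \<le> ennreal (B powr p) \<Longrightarrow> A powr q + B powr q \<le> 1 \<Longrightarrow>
     W \<in> borel_measurable borel \<Longrightarrow> (\<And>t. 0 \<le> W t) \<Longrightarrow>
     (\<And>t. 0 < t \<Longrightarrow> ennreal (W t) \<le> (\<integral>\<^sup>+\<tau>. ennreal (G \<tau> * ONeil_kernel \<delta> t \<tau>) \<partial>lborel)) \<Longrightarrow>
     (\<integral>\<^sup>+t. ennreal (exp (\<kappa> * W t powr (1/\<delta>)) * t powr (\<kappa> - 1)) * indicator {0<..<1} t \<partial>lborel) \<le> ennreal C \<and>
     (\<forall>t\<ge>1. W t \<le> C) \<and>
     (\<integral>\<^sup>+t. ennreal (W t powr s) * indicator {0<..} t \<partial>lborel) \<le> ennreal C"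
    using ONeil_potential_bounds[OF p(1) q(2) \<delta>_def s \<kappa>(1)] by blast
  define D where "D = C powr (m / \<delta> - s) * exp (C powr (1/\<delta>))"
  have D: "0 \<le> D" by (simp add: D_def)
  define C' where "C' = V powr (\<gamma> / N) * C + V powr (\<gamma> / N) * D * C"
  show ?thesis
  proof
    show "0 \<le> C'" using C(1) D by (simp add: C'_def)
    fix a g :: "real ^ 'n \<Rightarrow> real" and A B M :: real
    assume [measurable]: "a \<in> borel_measurable borel" "g \<in> borel_measurable borel"
      and a: "\<And>x. 0 \<le> a x" and g: "\<And>x. 0 \<le> g x" and M: "\<And>x. g x \<le> M" and fin: "emeasure lborel {x. 0 < g x} < \<infinity>"
      and ag: "\<And>x. ennreal (a x) \<le> ennreal (1 / ((N - 2) * N * unit_ball_vol N)) * (\<integral>\<^sup>+y. ennreal (norm (x - y) powr (2 - N) * g y) \<partial>lborel)"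
      and AB: "0 \<le> A" "0 \<le> B" "(\<integral>\<^sup>+x. ennreal (g x powr (N / 2)) \<partial>lborel) \<le> ennreal (A powr (N / 2))"
        "(\<integral>\<^sup>+x. ennreal (g x powr p) \<partial>lborel) \<le> ennreal (B powr p)" "A powr (N / 2) + B powr (N / 2) \<le> 1"
    define W where "W = (\<lambda>t. enn2real (ONeil_bound \<delta> g t))"
    have Wm[measurable]: "W \<in> borel_measurable borel" unfolding W_def by measurable
    have W0: "0 \<le> W t" for t by (simp add: W_def)
    have ON: "ONeil_bound \<delta> g t < \<infinity>" for t by (rule ONeil_bound_finite[OF _ M fin \<delta>(2)]) simp
    have "(\<integral>\<^sup>+t. ennreal (exp (\<kappa> * W t powr (1/\<delta>)) * t powr (\<kappa> - 1)) * indicator {0<..<1} t \<partial>lborel) \<le> ennreal C \<and>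
     (\<forall>t\<ge>1. W t \<le> C) \<and>
     (\<integral>\<^sup>+t. ennreal (W t powr s) * indicator {0<..} t \<partial>lborel) \<le> ennreal C"
    proof (rule C(2)[of "rearr g", OF _ rearr_nonneg AB(1,2) _ _ _ Wm W0])
      show "(\<integral>\<^sup>+\<tau>. ennreal (rearr g \<tau> powr q) \<partial>lborel) \<le> ennreal (A powr q)"
        using q g by (intro order.trans[OF nn_integral_rearr_powr_le AB(3)[folded q_def]]) auto
      show "(\<integral>\<^sup>+\<tau>. ennreal (rearr g \<tau> powr p) \<partial>lborel) \<le> ennreal (B powr p)"
        using p g by (intro order.trans[OF nn_integral_rearr_powr_le AB(4)]) auto
      show "A powr q + B powr q \<le> 1" using AB(5) by (simp add: q_def)
      show "ennreal (W t) \<le> (\<integral>\<^sup>+\<tau>. ennreal (rearr g \<tau> * ONeil_kernel \<delta> t \<tau>) \<partial>lborel)" if "0 < t" for t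
        using ONeil_bound_le_rearr[OF _ M fin \<delta> that] ON[of t] by (simp add: W_def)
    qed simp
    then have b1: "(\<integral>\<^sup>+t. ennreal (exp (\<kappa> * W t powr (1/\<delta>)) * t powr (\<kappa> - 1)) * indicator {0<..<1} t \<partial>lborel) \<le> ennreal C"
      and b2: "\<And>t. 1 \<le> t \<Longrightarrow> W t \<le> C"
      and b3: "(\<integral>\<^sup>+t. ennreal (W t powr s) * indicator {0<..} t \<partial>lborel) \<le> ennreal C" by auto
    have level: "emeasure lborel {x. r < a x} \<le> emeasure lborel {t. 0 < t \<and> r < c * V powr \<delta> * W t}" if "0 \<le> r" for r
      unfolding W_def V_def N_def
      using Riesz_potential_level_le[of g a \<delta> c r, OF _ _ g fin \<delta> c _ ON that] ag N\<delta>
      by (simp add: N_def[symmetric] c_def V_def)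
    define \<Psi> where "\<Psi> = Phi CARD('n) \<alpha> m"
    have [measurable]: "\<Psi> \<in> borel_measurable borel" unfolding \<Psi>_def by measurable
    have j0: "0 < m"
    proof -
      have "0 < s" by (rule s0)
      then have "0 < real m / \<delta>" using ms by linarith
      then show ?thesis using \<delta> by (simp add: zero_less_divide_iff)
    qed
    \<comment> \<open>Because \<open>m > 0\<close>, the constant term of the exponential is
      subtracted; this makes the integrand vanish where the potential does.\<close>
    have \<Psi>0: "\<Psi> 0 = 0"
      using j0 by (simp add: \<Psi>_def Phi_eq power_0_left sum.remove[of "{..<m}" 0])
    define as where "as = (\<lambda>t. if 0 < t then \<Psi> (c * V powr \<delta> * W t) else 0)"
    define bs where "bs = (\<lambda>t. if 0 < t then (t / V) powr (- (\<gamma> / N)) else 0)"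
    have [measurable]: "as \<in> borel_measurable borel" "bs \<in> borel_measurable borel" unfolding as_def bs_def by measurable
    have \<Psi>nn: "0 \<le> \<Psi> x" for x unfolding \<Psi>_def by (rule Phi_nonneg[OF \<alpha>(1)])
    \<comment> \<open>At the origin both sides are 0: \<open>0 powr \<gamma> = 0\<close> even for
      \<open>\<gamma> = 0\<close>, and \<open>1 / 0 = 0\<close>.\<close>
    have bs_eq: "1 / norm x powr \<gamma> = bs (V * norm x ^ CARD('n))" for x :: "real ^ 'n"
      using V N by (cases "x = 0") (auto simp: bs_def powr_realpow[symmetric] powr_powr N_def[symmetric] powr_minus_divide zero_power)
    have cV: "0 \<le> c * V powr \<delta>" using c by simp
    have "(\<integral>\<^sup>+x. ennreal (Phi CARD('n) \<alpha> (j0 CARD('n) p) (a x) / norm x powr \<gamma>) \<partial>lborel)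
       = (\<integral>\<^sup>+x. ennreal (\<Psi> (a x) * (1 / norm x powr \<gamma>)) \<partial>lborel)" by (simp add: \<Psi>_def m_def)
    also have "\<dots> \<le> (\<integral>\<^sup>+t. ennreal (as t * bs t) \<partial>lborel)"
    proof (rule Hardy_Littlewood_inequality)
      show "as t' \<le> as t" if "0 < t" "t \<le> t'" for t t'
      proof -
        have "W t' \<le> W t" unfolding W_def using ONeil_bound_antimono[OF \<delta> that] ON[of t] by (intro enn2real_mono) auto
        then have "c * V powr \<delta> * W t' \<le> c * V powr \<delta> * W t" by (intro mult_left_mono cV)
        then show ?thesis using that \<alpha> n W0 cV unfolding as_def \<Psi>_def by (auto intro!: Phi_mono)
      qed
      show "bs t' \<le> bs t" if "0 < t" "t \<le> t'" for t t'
        using that V \<gamma> N by (auto simp: bs_def intro!: powr_mono2' divide_right_mono)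
      fix r :: real assume r: "0 \<le> r"
      have "emeasure lborel {x. r < \<Psi> (a x)} \<le> emeasure lborel {t. 0 < t \<and> r < \<Psi> (c * V powr \<delta> * W t)}"
      proof (rule level_comp_mono[OF _ _ _ a _ r level])
        show "continuous_on UNIV \<Psi>" unfolding \<Psi>_def by (rule continuous_on_Phi[OF n])
        show "\<Psi> u \<le> \<Psi> v" if "0 \<le> u" "u \<le> v" for u v
          unfolding \<Psi>_def using that n \<alpha> by (intro Phi_mono) auto
      qed (use \<Psi>0 cV W0 in auto)
      also have "\<dots> \<le> emeasure lborel {t. r < as t}" by (intro emeasure_mono) (auto simp: as_def)
      finally show "emeasure lborel {x. r < \<Psi> (a x)} \<le> emeasure lborel {t. r < as t}" .
      have "emeasure lborel {x :: real ^ 'n. r < 1 / norm x powr \<gamma>} = emeasure lborel {t. 0 < t \<and> r < bs t}"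
        using emeasure_radial[of bs r, where 'a="real ^ 'n"] unfolding bs_eq by (simp add: V_def N_def)
      also have "\<dots> \<le> emeasure lborel {t. r < bs t}" by (intro emeasure_mono) auto
      finally show "emeasure lborel {x :: real ^ 'n. r < 1 / norm x powr \<gamma>} \<le> emeasure lborel {t. r < bs t}" .
    qed (auto simp: as_def bs_def \<Psi>nn)
    also have "\<dots> \<le> (\<integral>\<^sup>+t. ennreal (V powr (\<gamma> / N)) * (ennreal (exp (\<kappa> * W t powr (1/\<delta>)) * t powr (\<kappa> - 1)) * indicator {0<..<1} t)
        + ennreal (V powr (\<gamma> / N) * D) * (ennreal (W t powr s) * indicator {0<..} t) \<partial>lborel)"
    proof (intro nn_integral_mono)
      fix t :: real
      define y where "y = \<alpha> * (c * V powr \<delta> * W t) powr (1/\<delta>)"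
      have y0: "0 \<le> y" using \<alpha> by (simp add: y_def)
      have y1: "y \<le> \<kappa> * W t powr (1/\<delta>)"
        unfolding y_def powr_mult[of _ "W t"] using Ck by (simp add: mult.assoc[symmetric] mult_right_mono)
      have as_y: "as t = exp y - (\<Sum>j<m. y ^ j / fact j)" if "0 < t"
      proof -
        have "0 \<le> c * V powr \<delta> * W t" using cV W0[of t] by simp
        then show ?thesis using that by (simp add: as_def \<Psi>_def Phi_eq y_def N_def[symmetric] e del: zero_le_mult_iff)
      qed
      have bs1: "bs t = V powr (\<gamma> / N) * t powr (\<kappa> - 1)" if "0 < t"
      proof -
        have "\<kappa> - 1 = - (\<gamma> / N)" by (simp add: \<kappa>_def)
        then show ?thesis using that V by (simp add: bs_def powr_divide powr_minus_divide)
      qed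
      consider "t \<le> 0" | "0 < t" "t < 1" | "1 \<le> t" by linarith
      then show "ennreal (as t * bs t) \<le> ennreal (V powr (\<gamma> / N)) * (ennreal (exp (\<kappa> * W t powr (1/\<delta>)) * t powr (\<kappa> - 1)) * indicator {0<..<1} t)
        + ennreal (V powr (\<gamma> / N) * D) * (ennreal (W t powr s) * indicator {0<..} t)"
      proof cases
        case 1 then show ?thesis by (simp add: as_def)
      next
        case 2
        have "as t \<le> exp y" using exp_tail_le_exp[OF y0] as_y 2 by simp
        also have "\<dots> \<le> exp (\<kappa> * W t powr (1/\<delta>))" using y1 by simp
        finally have "as t * bs t \<le> exp (\<kappa> * W t powr (1/\<delta>)) * bs t"
          by (intro mult_right_mono) (auto simp: bs_def)
        also have "\<dots> = V powr (\<gamma> / N) * (exp (\<kappa> * W t powr (1/\<delta>)) * t powr (\<kappa> - 1))" using bs1 2 by simp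
        finally have "ennreal (as t * bs t) \<le> ennreal (V powr (\<gamma> / N)) * (ennreal (exp (\<kappa> * W t powr (1/\<delta>)) * t powr (\<kappa> - 1)) * indicator {0<..<1} t)"
          using 2 by (simp add: ennreal_mult[symmetric])
        then show ?thesis by (rule order.trans) simp
      next
        case 3
        have y2: "y \<le> W t powr (1/\<delta>)" using y1 \<kappa> mult_right_mono[of \<kappa> 1 "W t powr (1/\<delta>)"] by simp
        have "W t powr (1/\<delta>) \<le> C powr (1/\<delta>)" using W0[of t] b2[OF 3] \<delta> by (intro powr_mono2) auto
        then have ey: "exp y \<le> exp (C powr (1/\<delta>))" using y2 by simp
        \<comment> \<open>Of the power \<open>m / \<delta>\<close> of \<open>W\<close> the part
          \<open>s\<close> is kept for integration; the excess is nonnegative and is bounded through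
          \<open>W t \<le> C\<close>.\<close>
        have "y ^ m \<le> (W t powr (1/\<delta>)) ^ m" using y2 y0 by (intro power_mono)
        also have "\<dots> = W t powr (m / \<delta> - s) * W t powr s"
          using j0 W0[of t]
          by (cases "W t = 0") (auto simp: powr_add[symmetric] powr_powr zero_power powr_realpow[symmetric])
        also have "\<dots> \<le> C powr (m / \<delta> - s) * W t powr s"
          using W0[of t] b2[OF 3] ms by (intro mult_right_mono powr_mono2) auto
        finally have "y ^ m * exp y \<le> (C powr (m / \<delta> - s) * W t powr s) * exp (C powr (1/\<delta>))"
          using ey y0 by (intro mult_mono) auto
        then have "as t \<le> D * W t powr s" using exp_tail_le_power[OF y0, of m] as_y 3 by (simp add: D_def mult_ac)
        moreover have "bs t \<le> V powr (\<gamma> / N) * 1"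
        proof -
          have "t powr (\<kappa> - 1) \<le> 1 powr (\<kappa> - 1)" using 3 \<kappa> by (intro powr_mono2') auto
          then show ?thesis using bs1 3 by (simp add: mult_left_le)
        qed
        ultimately have "as t * bs t \<le> (D * W t powr s) * (V powr (\<gamma> / N) * 1)"
          using D by (intro mult_mono) (auto simp: bs_def)
        then have "ennreal (as t * bs t) \<le> ennreal (V powr (\<gamma> / N) * D) * (ennreal (W t powr s) * indicator {0<..} t)"
          using 3 D by (simp add: ennreal_mult[symmetric] mult_ac ennreal_leI)
        then show ?thesis by (rule order.trans) simp
      qed
    qed
    also have "\<dots> = ennreal (V powr (\<gamma> / N)) * (\<integral>\<^sup>+t. ennreal (exp (\<kappa> * W t powr (1/\<delta>)) * t powr (\<kappa> - 1)) * indicator {0<..<1} t \<partial>lborel)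
        + ennreal (V powr (\<gamma> / N) * D) * (\<integral>\<^sup>+t. ennreal (W t powr s) * indicator {0<..} t \<partial>lborel)"
      by (subst nn_integral_add) (auto simp: nn_integral_cmult)
    also have "\<dots> \<le> ennreal (V powr (\<gamma> / N)) * ennreal C + ennreal (V powr (\<gamma> / N) * D) * ennreal C"
      by (intro add_mono mult_left_mono b1 b3) auto
    also have "\<dots> = ennreal C'" using C(1) D by (simp add: C'_def ennreal_mult[symmetric] ennreal_plus[symmetric] del: ennreal_plus)
    finally show "(\<integral>\<^sup>+x. ennreal (Phi CARD('n) \<alpha> (j0 CARD('n) p) (a x) / norm x powr \<gamma>) \<partial>lborel) \<le> ennreal C'" .
  qed
qed

section \<open>Test functions\<close>

text \<open>\<open>Ck\<close> is phrased through \<open>frechet_derivative\<close>; this rule lets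
  an explicit candidate for the derivative be supplied instead.\<close>

lemma Ck_SucI:
  assumes "\<And>x. (f has_derivative f' x) (at x)" "\<And>v. Ck k (\<lambda>x. f' x v)"
  shows "Ck (Suc k) f"
proof -
  have "frechet_derivative f (at x) = f' x" for x
    using frechet_derivative_at[OF assms(1)[of x]] by simp
  then show ?thesis using assms by (auto simp: differentiable_def)
qed

lemma Ck_has_derivative:
  assumes "Ck (Suc k) f"
  shows "(f has_derivative frechet_derivative f (at x)) (at x)"
  using assms by (simp add: frechet_derivative_works[symmetric])

lemma Ck_SucD: "Ck (Suc k) f \<Longrightarrow> Ck k (\<lambda>x. frechet_derivative f (at x) v)"
  by simp

lemma Ck_Suc_imp: "Ck (Suc k) f \<Longrightarrow> Ck k f"
proof (induction k arbitrary: f)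
  case 0
  then show ?case
    using differentiable_imp_continuous_within[of f _ UNIV] by (auto simp: continuous_on_eq_continuous_within)
next
  case (Suc k)
  show ?case
  proof (rule Ck_SucI)
    show "(f has_derivative frechet_derivative f (at x)) (at x)" for x using Suc.prems by (rule Ck_has_derivative)
    show "Ck k (\<lambda>x. frechet_derivative f (at x) v)" for v using Suc.prems by (intro Suc.IH Ck_SucD)
  qed
qed

lemma Ck_const: "Ck k (\<lambda>x. c)"
proof (induction k arbitrary: c)
  case (Suc k)
  show ?case by (rule Ck_SucI[where f'="\<lambda>x v. 0"]) (auto intro!: Suc derivative_eq_intros)
qed auto

lemma Ck_bounded_linear: "bounded_linear f \<Longrightarrow> Ck k f"
proof (cases k)
  case 0 then show "bounded_linear f \<Longrightarrow> Ck k f" by (auto simp: linear_continuous_on)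
next
  case (Suc j) then show "bounded_linear f \<Longrightarrow> Ck k f"
    by (auto intro!: Ck_SucI[where f'="\<lambda>x. f"] Ck_const bounded_linear_imp_has_derivative simp del: Ck.simps)
qed

lemma Ck_add: "Ck k f \<Longrightarrow> Ck k g \<Longrightarrow> Ck k (\<lambda>x. f x + g x)"
proof (induction k arbitrary: f g)
  case 0 then show ?case by (auto intro: continuous_intros)
next
  case (Suc k)
  show ?case
  proof (rule Ck_SucI[where f'="\<lambda>x v. frechet_derivative f (at x) v + frechet_derivative g (at x) v"])
    show "((\<lambda>x. f x + g x) has_derivative (\<lambda>v. frechet_derivative f (at x) v + frechet_derivative g (at x) v)) (at x)" for x
      using Suc.prems by (intro has_derivative_add Ck_has_derivative)
    show "Ck k (\<lambda>x. frechet_derivative f (at x) v + frechet_derivative g (at x) v)" for v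
      using Suc.prems by (intro Suc.IH Ck_SucD)
  qed
qed

lemma Ck_mult: "Ck k f \<Longrightarrow> Ck k g \<Longrightarrow> Ck k (\<lambda>x. f x * g x)"
proof (induction k arbitrary: f g)
  case 0 then show ?case by (auto intro: continuous_intros)
next
  case (Suc k)
  show ?case
  proof (rule Ck_SucI[where f'="\<lambda>x v. f x * frechet_derivative g (at x) v + frechet_derivative f (at x) v * g x"])
    show "((\<lambda>x. f x * g x) has_derivative (\<lambda>v. f x * frechet_derivative g (at x) v + frechet_derivative f (at x) v * g x)) (at x)" for x
      using Suc.prems by (intro has_derivative_mult Ck_has_derivative)
    show "Ck k (\<lambda>x. f x * frechet_derivative g (at x) v + frechet_derivative f (at x) v * g x)" for v
      by (intro Ck_add Suc.IH Ck_SucD Suc.prems Ck_Suc_imp[OF Suc.prems(1)] Ck_Suc_imp[OF Suc.prems(2)])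
  qed
qed

lemma Ck_cmult: "Ck k f \<Longrightarrow> Ck k (\<lambda>x. c * f x)"
  by (intro Ck_mult Ck_const)

lemma Ck_diff: "Ck k f \<Longrightarrow> Ck k g \<Longrightarrow> Ck k (\<lambda>x. f x - g x)"
  using Ck_add[of k f "\<lambda>x. - 1 * g x"] Ck_cmult[of k g "-1"] by simp

lemma Ck_sum: "(\<And>i. i \<in> A \<Longrightarrow> Ck k (f i)) \<Longrightarrow> Ck k (\<lambda>x. \<Sum>i\<in>A. f i x)"
  by (induction A rule: infinite_finite_induct) (auto intro!: Ck_const Ck_add)

lemma Ck_prod: "(\<And>i. i \<in> A \<Longrightarrow> Ck k (f i)) \<Longrightarrow> Ck k (\<lambda>x. \<Prod>i\<in>A. f i x)"
  by (induction A rule: infinite_finite_induct) (auto intro!: Ck_const Ck_mult)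

text \<open>Regularity of \<open>g'\<close> is asked only after composition with \<open>f\<close>,
  so the rule serves families closed under differentiation, such as powers and \<open>flat\<close>,
  by induction on \<open>k\<close>.\<close>

lemma Ck_chain:
  assumes "Ck (Suc k) f" "\<And>x. (g has_real_derivative g' (f x)) (at (f x))" "Ck k (\<lambda>x. g' (f x))"
  shows "Ck (Suc k) (\<lambda>x. g (f x))"
proof (rule Ck_SucI[where f'="\<lambda>x v. g' (f x) * frechet_derivative f (at x) v"])
  show "((\<lambda>x. g (f x)) has_derivative (\<lambda>v. g' (f x) * frechet_derivative f (at x) v)) (at x)" for x
    using has_derivative_compose[OF Ck_has_derivative[OF assms(1)], of g "(*) (g' (f x))"] assms(2)[of x]
    by (simp add: has_field_derivative_def)
  show "Ck k (\<lambda>x. g' (f x) * frechet_derivative f (at x) v)" for v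
    using assms by (intro Ck_mult Ck_SucD)
qed

lemma Ck_powr:
  assumes "Ck k f" "\<And>x. 0 < f x"
  shows "Ck k (\<lambda>x. f x powr b)"
  using assms
proof (induction k arbitrary: b)
  case 0
  have "f x \<noteq> 0" for x using assms(2)[of x] by simp
  then have "continuous_on UNIV (\<lambda>x. f x powr b)"
    using 0(1) by (intro continuous_on_powr) auto
  then show ?case by simp
next
  case (Suc k)
  show ?case
  proof (rule Ck_chain[where g="\<lambda>y. y powr b" and g'="\<lambda>y. b * y powr (b - 1)", OF Suc.prems(1)])
    show "((\<lambda>y. y powr b) has_real_derivative b * f x powr (b - 1)) (at (f x))" for x
      using Suc.prems(2)[of x] by (rule has_real_derivative_powr)
    show "Ck k (\<lambda>x. b * f x powr (b - 1))"
      by (intro Ck_cmult Suc.IH Ck_Suc_imp[OF Suc.prems(1)] Suc.prems(2))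
  qed
qed

lemma Ck_ln:
  assumes "Ck k f" "\<And>x. 0 < f x"
  shows "Ck k (\<lambda>x. ln (f x))"
proof (cases k)
  case 0
  have "f x \<noteq> 0" for x using assms(2)[of x] by simp
  then have "continuous_on UNIV (\<lambda>x. ln (f x))"
    using assms(1) 0 by (intro continuous_on_ln) auto
  then show ?thesis using 0 by simp
next
  case (Suc j)
  have "Ck (Suc j) (\<lambda>x. ln (f x))"
  proof (rule Ck_chain[where g=ln and g'="\<lambda>y. y powr (- 1)"])
    show "Ck (Suc j) f" using assms Suc by simp
    show "(ln has_real_derivative f x powr (- 1)) (at (f x))" for x
      using DERIV_ln_divide[OF assms(2)[of x]] assms(2)[of x] by (simp add: powr_minus_divide)
    have "Ck j f" using assms(1) unfolding Suc by (rule Ck_Suc_imp)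
    then show "Ck j (\<lambda>x. f x powr (- 1))" using assms(2) by (intro Ck_powr)
  qed
  then show ?thesis using Suc by simp
qed

text \<open>\<open>flat 0\<close> is the classical smooth function with vanishing Taylor series at
  0. The powers \<open>1 / s ^ k\<close> make the family closed under differentiation up to linear
  combinations, so smoothness of all members follows by one induction.\<close>

definition flat :: "nat \<Rightarrow> real \<Rightarrow> real" where
  "flat k s = (if 0 < s then exp (- (1 / s)) / s ^ k else 0)"

lemma flat_tendsto_0: "((\<lambda>s. flat k s) \<longlongrightarrow> 0) (at_right 0)"
proof -
  have "((\<lambda>y::real. y ^ k / exp y) \<longlongrightarrow> 0) at_top" by (rule tendsto_power_div_exp_0)
  then have "((\<lambda>s::real. inverse s ^ k / exp (inverse s)) \<longlongrightarrow> 0) (at_right 0)"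
    by (rule filterlim_compose) (rule filterlim_inverse_at_top_right)
  then show ?thesis
    by (rule Lim_transform_eventually)
      (auto simp: flat_def eventually_at_right_less divide_inverse exp_minus power_inverse eventually_at intro!: exI[of _ 1])
qed

lemma DERIV_flat: "(flat k has_real_derivative flat (k + 2) s - real k * flat (k + 1) s) (at s)"
proof (cases s "0::real" rule: linorder_cases)
  case greater
  have s: "s \<noteq> 0" using greater by simp
  let ?E = "exp (- (1 / s))"
  have "((\<lambda>s. exp (- (1 / s)) / s ^ k) has_real_derivative (?E * (1 / s\<^sup>2) * s ^ k - ?E * (real k * s ^ (k - 1))) / (s ^ k * s ^ k)) (at s)"
    using s by (auto intro!: derivative_eq_intros simp: power2_eq_square)
  also have "(?E * (1 / s\<^sup>2) * s ^ k - ?E * (real k * s ^ (k - 1))) / (s ^ k * s ^ k) = ?E / s ^ (k + 2) - real k * (?E / s ^ (k + 1))"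
  proof -
    have a: "real k * s ^ (k - 1) = real k * s ^ k / s" using s by (cases k) auto
    have b: "(?E * (1 / s\<^sup>2) * y - ?E * (real k * y / s)) / (y * y) = ?E / (y * s\<^sup>2) - real k * (?E / (y * s))" if "y \<noteq> 0" for y
      using s that by (simp add: divide_simps power2_eq_square) (simp add: algebra_simps)
    show ?thesis unfolding a power_add power_one_right by (rule b) (use s in simp)
  qed
  also have "\<dots> = flat (k + 2) s - real k * flat (k + 1) s" using greater by (simp add: flat_def)
  finally show ?thesis
    by (rule has_field_derivative_transform_within_open[where S="{0<..}"]) (use greater in \<open>auto simp: flat_def\<close>)
next
  case less
  have "((\<lambda>s. 0) has_real_derivative 0) (at s)" by simp
  then have "(flat k has_real_derivative 0) (at s)"
    by (rule has_field_derivative_transform_within_open[where S="{..<0}"]) (use less in \<open>auto simp: flat_def\<close>)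
  then show ?thesis using less by (simp add: flat_def)
next
  case equal
  \<comment> \<open>The difference quotient at 0 is \<open>flat (k + 1) h\<close> for
    \<open>h > 0\<close> and 0 for \<open>h < 0\<close>.\<close>
  have "((\<lambda>h. (flat k h - flat k 0) / h) \<longlongrightarrow> 0) (at 0)"
  proof (rule filterlim_split_at)
    show "((\<lambda>h. (flat k h - flat k 0) / h) \<longlongrightarrow> 0) (at_left 0)"
      by (rule tendsto_eventually) (auto simp: flat_def eventually_at intro!: exI[of _ 1])
    show "((\<lambda>h. (flat k h - flat k 0) / h) \<longlongrightarrow> 0) (at_right 0)"
      by (rule Lim_transform_eventually[OF flat_tendsto_0[of "k + 1"]])
        (auto simp: flat_def eventually_at mult.commute intro!: exI[of _ 1])
  qed
  then have "(flat k has_real_derivative 0) (at 0)" by (simp add: DERIV_def)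
  then show ?thesis using equal by (simp add: flat_def)
qed

lemma isCont_flat: "isCont (flat k) s"
  using DERIV_flat by (rule DERIV_isCont)

lemma flat_nonneg: "0 \<le> flat k s"
  by (simp add: flat_def)

lemma flat_le_1: "flat 0 s \<le> 1"
  by (simp add: flat_def)

lemma Ck_flat: "Ck k f \<Longrightarrow> Ck k (\<lambda>x. flat m (f x))"
proof (induction k arbitrary: m)
  case 0
  have "continuous_on UNIV (flat m)" by (simp add: continuous_on_eq_continuous_at isCont_flat)
  from continuous_on_compose2[OF this, of UNIV f] 0 show ?case by simp
next
  case (Suc k)
  show ?case
    by (rule Ck_chain[where g="flat m" and g'="\<lambda>y. flat (m + 2) y - real m * flat (m + 1) y", OF Suc.prems DERIV_flat]) (intro Ck_diff Ck_cmult Suc.IH Ck_Suc_imp[OF Suc.prems])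
qed

section \<open>Closure properties and integrability of test functions\<close>

lemma test_functionsI:
  fixes f :: "'a::euclidean_space \<Rightarrow> real"
  shows "(\<And>k. Ck k f) \<Longrightarrow> bounded {x. f x \<noteq> 0} \<Longrightarrow> f \<in> test_functions"
  by (auto simp: test_functions_def compact_closure)

lemma test_functionsD:
  fixes f :: "'a::euclidean_space \<Rightarrow> real"
  assumes "f \<in> test_functions"
  shows "Ck k f" "continuous_on UNIV f" "(f has_derivative frechet_derivative f (at x)) (at x)"
  using assms Ck.simps(1)[of f] Ck_has_derivative[of 0 f] unfolding test_functions_def by blast+

lemma test_function_support:
  fixes f :: "'a::euclidean_space \<Rightarrow> real"
  assumes "f \<in> test_functions"
  obtains R where "0 < R" "\<And>x::'a. R \<le> norm x \<Longrightarrow> f x = 0"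
proof -
  have "bounded (closure {x. f x \<noteq> 0})" using assms compact_imp_bounded by (auto simp: test_functions_def)
  then obtain R where R: "\<forall>x\<in>closure {x. f x \<noteq> 0}. norm x \<le> R" by (auto simp: bounded_iff)
  show ?thesis
  proof (rule that[of "\<bar>R\<bar> + 1"])
    fix x :: 'a assume x: "\<bar>R\<bar> + 1 \<le> norm x"
    show "f x = 0"
    proof (rule ccontr)
      assume "f x \<noteq> 0"
      then have "x \<in> closure {x. f x \<noteq> 0}" using closure_subset[of "{x. f x \<noteq> 0}"] by auto
      then show False using R x by force
    qed
  qed simp
qed

lemma test_function_mult:
  fixes f g :: "'a::euclidean_space \<Rightarrow> real"
  assumes "f \<in> test_functions" "\<And>k. Ck k g"
  shows "(\<lambda>x. f x * g x) \<in> test_functions"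
proof (rule test_functionsI)
  show "Ck k (\<lambda>x. f x * g x)" for k using assms by (intro Ck_mult) (auto intro: test_functionsD(1) simp del: Ck.simps)
  have "bounded (closure {x. f x \<noteq> 0})" using assms compact_imp_bounded by (auto simp: test_functions_def)
  then show "bounded {x. f x * g x \<noteq> 0}" by (rule bounded_subset) (use closure_subset[of "{x. f x \<noteq> 0}"] in auto)
qed

lemma test_function_add:
  fixes f g :: "'a::euclidean_space \<Rightarrow> real"
  assumes "f \<in> test_functions" "g \<in> test_functions"
  shows "(\<lambda>x. f x + g x) \<in> test_functions"
proof (rule test_functionsI)
  show "Ck k (\<lambda>x. f x + g x)" for k using assms by (intro Ck_add test_functionsD(1))
  have "bounded (closure {x. f x \<noteq> 0} \<union> closure {x. g x \<noteq> 0})" using assms compact_imp_bounded by (auto simp: test_functions_def)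
  then show "bounded {x. f x + g x \<noteq> 0}" by (rule bounded_subset) (use closure_subset[of "{x. f x \<noteq> 0}"] closure_subset[of "{x. g x \<noteq> 0}"] in force)
qed

lemma test_function_cmult:
  fixes f :: "'a::euclidean_space \<Rightarrow> real"
  shows "f \<in> test_functions \<Longrightarrow> (\<lambda>x. c * f x) \<in> test_functions"
  using test_function_mult[of f "\<lambda>x. c", OF _ Ck_const] by (simp add: mult.commute)

lemma test_function_diff:
  fixes f g :: "'a::euclidean_space \<Rightarrow> real"
  shows "f \<in> test_functions \<Longrightarrow> g \<in> test_functions \<Longrightarrow> (\<lambda>x. f x - g x) \<in> test_functions"
  using test_function_add[of f "\<lambda>x. -1 * g x"] test_function_cmult[of g "-1"] by simp

lemma test_function_0: "(\<lambda>x::'a::euclidean_space. 0) \<in> test_functions"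
  by (rule test_functionsI) (auto intro: Ck_const)

lemma test_function_sum:
  fixes f :: "'i \<Rightarrow> 'a::euclidean_space \<Rightarrow> real"
  shows "(\<And>i. i \<in> A \<Longrightarrow> f i \<in> test_functions) \<Longrightarrow> (\<lambda>x. \<Sum>i\<in>A. f i x) \<in> test_functions"
  by (induction A rule: infinite_finite_induct) (auto intro: test_function_0 test_function_add)

lemma test_function_deriv:
  fixes f :: "'a::euclidean_space \<Rightarrow> real"
  assumes f: "f \<in> test_functions"
  shows "(\<lambda>x. frechet_derivative f (at x) v) \<in> test_functions"
proof (rule test_functionsI)
  show "Ck k (\<lambda>x. frechet_derivative f (at x) v)" for k by (intro Ck_SucD test_functionsD f)
  obtain R where R: "0 < R" "\<And>x. R \<le> norm x \<Longrightarrow> f x = 0" using test_function_support[OF f] by blast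
  have "frechet_derivative f (at x) v = 0" if x: "R < norm x" for x
  proof -
    have "open {x::'a. R < norm x}" by (intro open_Collect_less continuous_intros)
    have "(f has_derivative (\<lambda>v. 0)) (at x)"
    proof (rule has_derivative_transform_within_open[OF _ \<open>open {x::'a. R < norm x}\<close>])
      show "((\<lambda>x. 0) has_derivative (\<lambda>v. 0)) (at x)" by simp
    qed (use x R in auto)
    then show ?thesis using frechet_derivative_at by metis
  qed
  then have "{x. frechet_derivative f (at x) v \<noteq> 0} \<subseteq> cball 0 R" by (auto intro!: leI)
  then show "bounded {x. frechet_derivative f (at x) v \<noteq> 0}" using bounded_cball bounded_subset by blast
qed

lemma test_function_partial: "f \<in> test_functions \<Longrightarrow> partial i f \<in> test_functions"
  unfolding partial_def[abs_def] by (rule test_function_deriv)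

lemma test_function_laplacian: "f \<in> test_functions \<Longrightarrow> laplacian f \<in> test_functions"
  unfolding laplacian_def[abs_def] by (intro test_function_sum test_function_partial)

lemma test_function_borel[measurable_dest]:
  fixes f :: "'a::euclidean_space \<Rightarrow> real"
  shows "f \<in> test_functions \<Longrightarrow> f \<in> borel_measurable borel"
  by (intro borel_measurable_continuous_onI test_functionsD)

lemma test_function_bounded:
  fixes f :: "'a::euclidean_space \<Rightarrow> real"
  assumes f: "f \<in> test_functions"
  obtains M where "0 < M" "\<And>x::'a. \<bar>f x\<bar> \<le> M"
proof -
  obtain R where R: "0 < R" "\<And>x. R \<le> norm x \<Longrightarrow> f x = 0" using test_function_support[OF f] by blast
  have "bounded (f ` cball 0 R)"
    by (intro compact_imp_bounded compact_continuous_image continuous_on_subset[OF test_functionsD(2)[OF f]]) auto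
  then obtain M where M: "\<forall>y\<in>f ` cball 0 R. norm y \<le> M" unfolding bounded_iff by blast
  show ?thesis
  proof (rule that[of "\<bar>M\<bar> + 1"])
    show "\<bar>f x\<bar> \<le> \<bar>M\<bar> + 1" for x using M R(2)[of x] by (cases "norm x \<le> R") force+
  qed simp
qed

lemma test_function_integrable_mult:
  fixes f g :: "'a::euclidean_space \<Rightarrow> real"
  assumes f: "f \<in> test_functions" and g: "locally_integrable g"
  shows "integrable lebesgue (\<lambda>x. g x * f x)"
proof -
  obtain R where R: "0 < R" "\<And>x. R \<le> norm x \<Longrightarrow> f x = 0" using test_function_support[OF f] by blast
  obtain M where M: "0 < M" "\<And>x. \<bar>f x\<bar> \<le> M" using test_function_bounded[OF f] by blast
  have "integrable lebesgue (\<lambda>x. indicator (cball 0 R) x *\<^sub>R g x)"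
    using g by (auto simp: locally_integrable_def set_integrable_def)
  then have "integrable lebesgue (\<lambda>x. (indicator (cball 0 R) x *\<^sub>R g x) * f x)"
  proof (rule Bochner_Integration.integrable_bound[OF integrable_mult_left[where c=M]])
    have "f \<in> borel_measurable lebesgue" using test_function_borel[OF f] by (simp add: measurable_completion)
    then show "(\<lambda>x. indicator (cball 0 R) x *\<^sub>R g x * f x) \<in> borel_measurable lebesgue"
      using \<open>integrable lebesgue (\<lambda>x. indicator (cball 0 R) x *\<^sub>R g x)\<close> by auto
    show "AE x in lebesgue. norm (indicator (cball 0 R) x *\<^sub>R g x * f x) \<le> norm (indicator (cball 0 R) x *\<^sub>R g x * M)"
    proof (rule AE_I2)
      fix x
      have "\<bar>indicator (cball 0 R) x *\<^sub>R g x\<bar> * \<bar>f x\<bar> \<le> \<bar>indicator (cball 0 R) x *\<^sub>R g x\<bar> * M"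
        by (intro mult_left_mono M) simp
      then show "norm (indicator (cball 0 R) x *\<^sub>R g x * f x) \<le> norm (indicator (cball 0 R) x *\<^sub>R g x * M)"
        using M(1) by (simp add: abs_mult)
    qed
  qed
  also have "(\<lambda>x. (indicator (cball 0 R) x *\<^sub>R g x) * f x) = (\<lambda>x. g x * f x)"
  proof (rule ext)
    show "indicator (cball 0 R) x *\<^sub>R g x * f x = g x * f x" for x
      using R(2)[of x] by (cases "norm x \<le> R") simp_all
  qed
  finally show ?thesis .
qed

lemma continuous_imp_locally_integrable:
  fixes f :: "'a::euclidean_space \<Rightarrow> real"
  assumes "continuous_on UNIV f"
  shows "locally_integrable f"
  unfolding locally_integrable_def
proof (intro allI impI)
  fix K :: "'a set" assume K: "compact K"
  have "set_integrable lborel K f"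
    unfolding set_integrable_def
    by (rule borel_integrable_compact[OF K continuous_on_subset[OF assms]]) auto
  then show "set_integrable lebesgue K f"
    unfolding set_integrable_def
  proof (subst integrable_completion)
    have [measurable]: "K \<in> sets borel" "f \<in> borel_measurable borel"
      by (auto intro: borel_measurable_continuous_onI assms borel_compact K)
    show "(\<lambda>x. indicator K x *\<^sub>R f x) \<in> borel_measurable lborel" by measurable
  qed
qed

lemma test_function_integrable:
  fixes f :: "'a::euclidean_space \<Rightarrow> real"
  assumes f: "f \<in> test_functions"
  shows "integrable lborel f"
  using test_function_integrable_mult[OF f continuous_imp_locally_integrable[of "\<lambda>x. 1"]] test_function_borel[OF f]
  by (simp add: integrable_completion)

lemma Ck_inner: "Ck k (\<lambda>x::'a::euclidean_space. x \<bullet> i)"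
  by (intro Ck_bounded_linear bounded_linear_inner_left)

section \<open>The fundamental lemma and Green's identity\<close>

lemma flat_scaled_tendsto: "(\<lambda>k. flat 0 (real (Suc k) * s)) \<longlonglongrightarrow> indicator {0<..} s"
proof (cases "0 < s")
  case True
  have "(\<lambda>k. 1 / s * inverse (real (Suc k))) \<longlonglongrightarrow> 1 / s * 0"
    by (intro tendsto_mult tendsto_const LIMSEQ_inverse_real_of_nat)
  then have "(\<lambda>k. exp (- (1 / s * inverse (real (Suc k))))) \<longlonglongrightarrow> exp (- (1 / s * 0))"
    by (intro tendsto_exp tendsto_minus)
  moreover have "flat 0 (real (Suc k) * s) = exp (- (1 / s * inverse (real (Suc k))))" for k
    using True by (simp add: flat_def divide_inverse del: of_nat_Suc)
  ultimately show ?thesis using True by simp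
next
  case False
  then have "flat 0 (real (Suc k) * s) = 0" for k
    by (auto simp: flat_def zero_less_mult_iff simp del: of_nat_Suc)
  then show ?thesis using False by simp
qed

text \<open>Smooth approximations of the indicator of the open box, supported in the box, obtained
  by steepening \<open>flat 0\<close> at each face as \<open>k\<close> grows.\<close>

definition box_bump :: "'a::euclidean_space \<Rightarrow> 'a \<Rightarrow> nat \<Rightarrow> 'a \<Rightarrow> real" where
  "box_bump a b k x = (\<Prod>i\<in>Basis. flat 0 (real (Suc k) * (x \<bullet> i - a \<bullet> i)) * flat 0 (real (Suc k) * (b \<bullet> i - x \<bullet> i)))"

lemma box_bump_bounds: "0 \<le> box_bump a b k x" "box_bump a b k x \<le> 1"
  unfolding box_bump_def by (auto intro!: prod_nonneg prod_le_1 mult_nonneg_nonneg mult_le_one flat_nonneg flat_le_1)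

lemma box_bump_outside: "x \<notin> box a b \<Longrightarrow> box_bump a b k x = 0"
proof -
  assume "x \<notin> box a b"
  then obtain i where i: "i \<in> Basis" "\<not> (a \<bullet> i < x \<bullet> i \<and> x \<bullet> i < b \<bullet> i)" by (auto simp: mem_box)
  then have "flat 0 (real (Suc k) * (x \<bullet> i - a \<bullet> i)) * flat 0 (real (Suc k) * (b \<bullet> i - x \<bullet> i)) = 0"
    by (auto simp: flat_def zero_less_mult_iff simp del: of_nat_Suc)
  then show "box_bump a b k x = 0" unfolding box_bump_def using i(1) by (intro prod_zero) auto
qed

lemma box_bump_test: "box_bump a b k \<in> test_functions"
proof (rule test_functionsI)
  show "Ck j (box_bump a b k)" for j
    unfolding box_bump_def[abs_def] by (intro Ck_prod Ck_mult Ck_flat Ck_const Ck_diff Ck_inner)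
  have "{x. box_bump a b k x \<noteq> 0} \<subseteq> box a b" using box_bump_outside by blast
  then show "bounded {x. box_bump a b k x \<noteq> 0}" using bounded_box bounded_subset by blast
qed

lemma box_bump_tendsto: "(\<lambda>k. box_bump a b k x) \<longlonglongrightarrow> indicator (box a b) x"
proof -
  have "(\<lambda>k. box_bump a b k x) \<longlonglongrightarrow> (\<Prod>i\<in>Basis. indicator {0<..} (x \<bullet> i - a \<bullet> i) * indicator {0<..} (b \<bullet> i - x \<bullet> i))"
    unfolding box_bump_def by (intro tendsto_prod tendsto_mult flat_scaled_tendsto)
  also have "(\<Prod>i\<in>Basis. indicator {0<..} (x \<bullet> i - a \<bullet> i) * indicator {0<..} (b \<bullet> i - x \<bullet> i)) = (indicator (box a b) x :: real)"
  proof (cases "x \<in> box a b")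
    case True
    then show ?thesis by (simp add: mem_box)
  next
    case False
    then obtain i where i: "i \<in> Basis" "\<not> (a \<bullet> i < x \<bullet> i \<and> x \<bullet> i < b \<bullet> i)" by (auto simp: mem_box)
    have "(\<Prod>i\<in>Basis. indicator {0<..} (x \<bullet> i - a \<bullet> i) * indicator {0<..} (b \<bullet> i - x \<bullet> i)) = (0::real)"
      using i by (intro prod_zero) (auto intro!: bexI[of _ i])
    then show ?thesis using False by simp
  qed
  finally show ?thesis .
qed

text \<open>\<open>ennreal\<close> truncates negative values, so \<open>ennreal (G x)\<close> and
  \<open>ennreal (- G x)\<close> are the positive and the negative part. As densities they agree on
  boxes, a generating system stable under intersection; hence they are equal almost everywhere, and
  since one of them is always 0, both vanish.\<close>

lemma AE_zero_if_box_integrals_zero: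
  fixes G :: "'a::euclidean_space \<Rightarrow> real"
  assumes G: "integrable lborel G" and zero: "\<And>a b. (LINT x|lborel. G x * indicator (box a b) x) = 0"
  shows "AE x in lborel. G x = 0"
proof -
  have [measurable]: "G \<in> borel_measurable borel" using G by auto
  have "density lborel (\<lambda>x. ennreal (G x)) = density lborel (\<lambda>x. ennreal (- G x))" (is "?M = ?N")
  proof (rule measure_eqI_generator_eq[where E="range (\<lambda>(a, b). box a b)" and \<Omega>=UNIV and A="\<lambda>i. box (- (real i *\<^sub>R One)) (real i *\<^sub>R One)"])
    show "Int_stable (range (\<lambda>(a, b). box a b :: 'a set))" by (auto simp: Int_stable_def box_Int_box)
    show "sets ?M = sigma_sets UNIV (range (\<lambda>(a, b). box a b))" "sets ?N = sigma_sets UNIV (range (\<lambda>(a, b). box a b))"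
      by (simp_all add: borel_eq_box)
    have fin: "(\<integral>\<^sup>+x. ennreal (G x * indicator (box a b) x) \<partial>lborel) < \<infinity>" "(\<integral>\<^sup>+x. ennreal (- (G x * indicator (box a b) x)) \<partial>lborel) < \<infinity>" for a b
    proof -
      have "integrable lborel (\<lambda>x. G x * indicator (box a b) x)"
        by (rule Bochner_Integration.integrable_bound[OF G]) (auto split: split_indicator)
      then show "(\<integral>\<^sup>+x. ennreal (G x * indicator (box a b) x) \<partial>lborel) < \<infinity>" "(\<integral>\<^sup>+x. ennreal (- (G x * indicator (box a b) x)) \<partial>lborel) < \<infinity>"
        by (auto simp: real_integrable_def less_top)
    qed
    have M: "emeasure ?M (box a b) = (\<integral>\<^sup>+x. ennreal (G x * indicator (box a b) x) \<partial>lborel)"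
      and N: "emeasure ?N (box a b) = (\<integral>\<^sup>+x. ennreal (- (G x * indicator (box a b) x)) \<partial>lborel)" for a b
      by (auto simp: emeasure_density intro!: nn_integral_cong split: split_indicator)
    have MN: "emeasure ?M (box a b) = emeasure ?N (box a b)" for a b
    proof -
      have "integrable lborel (\<lambda>x. G x * indicator (box a b) x)"
        by (rule Bochner_Integration.integrable_bound[OF G]) (auto split: split_indicator)
      from real_lebesgue_integral_def[OF this] zero[of a b]
      have "enn2real (\<integral>\<^sup>+x. ennreal (G x * indicator (box a b) x) \<partial>lborel) = enn2real (\<integral>\<^sup>+x. ennreal (- (G x * indicator (box a b) x)) \<partial>lborel)"
        by simp
      then have "ennreal (enn2real (\<integral>\<^sup>+x. ennreal (G x * indicator (box a b) x) \<partial>lborel)) = ennreal (enn2real (\<integral>\<^sup>+x. ennreal (- (G x * indicator (box a b) x)) \<partial>lborel))"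
        by simp
      then show ?thesis unfolding M N using fin[of a b] by (metis ennreal_enn2real infinity_ennreal_def)
    qed
    then show "\<And>X. X \<in> range (\<lambda>(a, b). box a b) \<Longrightarrow> emeasure ?M X = emeasure ?N X" by auto
    show "(\<Union>i::nat. box (- (real i *\<^sub>R One)) (real i *\<^sub>R One)) = (UNIV :: 'a set)" by (rule UN_box_eq_UNIV)
    show "emeasure ?M (box (- (real i *\<^sub>R One)) (real i *\<^sub>R One)) \<noteq> \<infinity>" for i
      using fin(1)[of "- (real i *\<^sub>R One)" "real i *\<^sub>R One"] M by simp
  qed auto
  then have "AE x in lborel. ennreal (G x) = ennreal (- G x)"
    by (intro sigma_finite_measure.density_unique[OF sigma_finite_lborel]) auto
  then show ?thesis
  proof eventually_elim
    fix x assume "ennreal (G x) = ennreal (- G x)"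
    then have "ennreal (G x) = 0" "ennreal (- G x) = 0"
      by (cases "0 \<le> G x", simp_all add: ennreal_neg)+
    then show "G x = 0" by (simp add: ennreal_eq_0_iff)
  qed
qed

text \<open>Box bumps and dominated convergence turn the hypothesis into vanishing integrals over
  all boxes. On each box of an exhausting sequence the function is integrable, and the preceding
  lemma applies.\<close>

theorem du_Bois_Reymond:
  fixes g :: "'a::euclidean_space \<Rightarrow> real"
  assumes g: "locally_integrable g" and zero: "\<And>\<phi>. \<phi> \<in> test_functions \<Longrightarrow> (LINT x|lebesgue. g x * \<phi> x) = 0"
  shows "AE x in lebesgue. g x = 0"
proof -
  have int: "integrable lebesgue (\<lambda>x. g x * indicator (box a b) x)" for a b
  proof -
    have "set_integrable lebesgue (cbox a b) g" using g compact_cbox by (auto simp: locally_integrable_def)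
    then have "set_integrable lebesgue (box a b) g" by (rule set_integrable_subset) (auto simp: box_subset_cbox)
    then show ?thesis by (simp add: set_integrable_def mult.commute)
  qed
  have box0: "(LINT x|lebesgue. g x * indicator (box a b) x) = 0" for a b
  proof -
    have "(\<lambda>k. LINT x|lebesgue. g x * indicator (box a b) x * box_bump a b k x) \<longlonglongrightarrow> (LINT x|lebesgue. g x * indicator (box a b) x * indicator (box a b) x)"
    proof (rule integral_dominated_convergence)
      show "integrable lebesgue (\<lambda>x. norm (g x * indicator (box a b) x))" using int by (rule integrable_norm)
      have m1: "(\<lambda>x. g x * indicator (box a b) x) \<in> borel_measurable lebesgue" using int by auto
      have m2: "box_bump a b k \<in> borel_measurable lebesgue" for k
        by (intro measurable_completion) (simp add: test_function_borel[OF box_bump_test])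
      show "(\<lambda>x. g x * indicator (box a b) x * box_bump a b k x) \<in> borel_measurable lebesgue" for k
        by (rule borel_measurable_times[OF m1 m2])
      show "(\<lambda>x. g x * indicator (box a b) x * indicator (box a b) x) \<in> borel_measurable lebesgue"
        by (rule borel_measurable_times[OF m1 borel_measurable_indicator]) simp
      show "AE x in lebesgue. (\<lambda>k. g x * indicator (box a b) x * box_bump a b k x) \<longlonglongrightarrow> g x * indicator (box a b) x * indicator (box a b) x"
        by (intro AE_I2 tendsto_mult tendsto_const box_bump_tendsto)
      show "AE x in lebesgue. norm (g x * indicator (box a b) x * box_bump a b k x) \<le> norm (g x * indicator (box a b) x)" for k
        using box_bump_bounds[of a b k] by (intro AE_I2) (auto simp: abs_mult mult_left_le split: split_indicator)
    qed
    moreover have "(\<lambda>x. g x * indicator (box a b) x * box_bump a b k x) = (\<lambda>x. g x * box_bump a b k x)" for k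
      using box_bump_outside[of _ a b k] by (auto simp: fun_eq_iff split: split_indicator)
    moreover have "(\<lambda>x. g x * indicator (box a b) x * indicator (box a b) x) = (\<lambda>x. g x * indicator (box a b) x)"
      by (auto simp: fun_eq_iff split: split_indicator)
    ultimately show ?thesis using zero[OF box_bump_test] by (simp add: LIMSEQ_const_iff)
  qed
  have "AE x in lebesgue. g x * indicator (box (- (real N *\<^sub>R One)) (real N *\<^sub>R One)) x = 0" for N :: nat
  proof -
    define u where "u = - (real N *\<^sub>R One :: 'a)"
    define v where "v = (real N *\<^sub>R One :: 'a)"
    define G where "G = (\<lambda>x. g x * indicator (box u v) x)"
    have Gi: "integrable lebesgue G" unfolding G_def by (rule int)
    then have "G \<in> borel_measurable lebesgue" by auto
    \<comment> \<open>The argument with boxes lives on Borel sets, so \<open>G\<close> is replaced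
      by a Borel function equal to it almost everywhere.\<close>
    then obtain G' where G': "G' \<in> borel_measurable lborel" "AE x in lborel. G x = G' x"
      using completion_ex_borel_measurable_real by blast
    have AE: "AE x in lebesgue. G x = G' x" using G'(2) by (rule AE_completion)
    have G'l: "G' \<in> borel_measurable lebesgue" using G'(1) by (simp add: measurable_completion)
    have "integrable lebesgue G'" using AE by (intro integrable_cong_AE_imp[OF Gi G'l])
    then have "integrable lborel G'" using G'(1) by (simp add: integrable_completion)
    moreover have "(LINT x|lborel. G' x * indicator (box a b) x) = 0" for a b
    proof -
      have [measurable]: "G' \<in> borel_measurable borel" using G'(1) by simp
      obtain c d where cd: "box u v \<inter> box a b = box c d" by (rule that[OF box_Int_box])
      have "(LINT x|lborel. G' x * indicator (box a b) x) = (LINT x|lebesgue. G' x * indicator (box a b) x)"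
        by (rule integral_completion[symmetric]) measurable
      also have "\<dots> = (LINT x|lebesgue. G x * indicator (box a b) x)"
      proof (rule integral_cong_AE)
        have "(\<lambda>x. G' x * indicator (box a b) x) \<in> borel_measurable lborel" by measurable
        then show "(\<lambda>x. G' x * indicator (box a b) x) \<in> borel_measurable lebesgue" by (rule measurable_completion)
        have [measurable]: "G \<in> borel_measurable lebesgue" using Gi by auto
        have [measurable]: "box a b \<in> sets lebesgue" by simp
        show "(\<lambda>x. G x * indicator (box a b) x) \<in> borel_measurable lebesgue" by measurable
        show "AE x in lebesgue. G' x * indicator (box a b) x = G x * indicator (box a b) x" using AE by eventually_elim simp
      qed
      also have "(\<lambda>x. G x * indicator (box a b) x) = (\<lambda>x. g x * indicator (box c d) x)"
        unfolding G_def cd[symmetric] by (auto simp: fun_eq_iff split: split_indicator)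
      also have "(LINT x|lebesgue. g x * indicator (box c d) x) = 0" by (rule box0)
      finally show ?thesis .
    qed
    ultimately have "AE x in lborel. G' x = 0" by (rule AE_zero_if_box_integrals_zero)
    then have "AE x in lebesgue. G' x = 0" by (rule AE_completion)
    with AE have "AE x in lebesgue. G x = 0" by eventually_elim simp
    then show ?thesis unfolding G_def u_def v_def .
  qed
  then have "AE x in lebesgue. \<forall>N::nat. g x * indicator (box (- (real N *\<^sub>R One)) (real N *\<^sub>R One)) x = 0"
    unfolding AE_all_countable by blast
  then show ?thesis
  proof eventually_elim
    fix x assume *: "\<forall>N::nat. g x * indicator (box (- (real N *\<^sub>R One)) (real N *\<^sub>R One)) x = 0"
    have "x \<in> (\<Union>i::nat. box (- (real i *\<^sub>R One)) (real i *\<^sub>R One))" by (simp only: UN_box_eq_UNIV UNIV_I)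
    then obtain N :: nat where "x \<in> box (- (real N *\<^sub>R One)) (real N *\<^sub>R One)" by blast
    then show "g x = 0" using spec[OF *, of N] by simp
  qed
qed

section \<open>Integration by parts and Laplacians of radial functions\<close>

lemma integral_lborel_affine:
  fixes f :: "'a::euclidean_space \<Rightarrow> real"
  assumes [measurable]: "f \<in> borel_measurable borel" and c: "c \<noteq> 0"
  shows "(LINT y|lborel. f y) = \<bar>c\<bar> ^ DIM('a) * (LINT z|lborel. f (t + c *\<^sub>R z))"
proof -
  have "(LINT y|lborel. f y) = (LINT y|density (distr lborel borel (\<lambda>x. t + c *\<^sub>R x)) (\<lambda>_. \<bar>c\<bar>^DIM('a)). f y)"
    by (subst lborel_affine[OF c, of t]) simp
  then show ?thesis by (simp add: integral_density integral_distr)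
qed

text \<open>By translation invariance every difference quotient of \<open>f\<close> has integral 0.
  The mean value theorem bounds the quotients by \<open>M\<close> on a fixed ball outside which they
  vanish, so dominated convergence gives the limit.\<close>

theorem integral_derivative_test_function:
  fixes f :: "'a::euclidean_space \<Rightarrow> real"
  assumes f: "f \<in> test_functions"
  shows "(LINT x|lborel. frechet_derivative f (at x) e) = 0"
proof -
  let ?D = "\<lambda>x. frechet_derivative f (at x) e"
  have D: "?D \<in> test_functions" by (rule test_function_deriv[OF f])
  obtain M where M: "0 < M" "\<And>x. \<bar>?D x\<bar> \<le> M" using test_function_bounded[OF D] by blast
  obtain R where R: "0 < R" "\<And>x. R \<le> norm x \<Longrightarrow> f x = 0" using test_function_support[OF f] by blast
  have [measurable]: "f \<in> borel_measurable borel" "?D \<in> borel_measurable borel"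
    by (intro test_function_borel f D)+
  define h where "h = (\<lambda>k. inverse (real (Suc k)))"
  have h: "0 < h k" "h k \<le> 1" for k by (auto simp: h_def field_simps)
  define s where "s = (\<lambda>k x. (f (x + h k *\<^sub>R e) - f x) / h k)"
  have line: "((\<lambda>t. f (x + t *\<^sub>R e)) has_real_derivative ?D (x + t *\<^sub>R e)) (at t)" for x t
  proof -
    have "((\<lambda>t. x + t *\<^sub>R e) has_derivative (\<lambda>u. u *\<^sub>R e)) (at t)" by (auto intro!: derivative_eq_intros)
    from has_derivative_compose[OF this test_functionsD(3)[OF f]]
    have "((\<lambda>t. f (x + t *\<^sub>R e)) has_derivative (\<lambda>u. frechet_derivative f (at (x + t *\<^sub>R e)) (u *\<^sub>R e))) (at t)" .
    moreover have "frechet_derivative f (at (x + t *\<^sub>R e)) (u *\<^sub>R e) = ?D (x + t *\<^sub>R e) * u" for u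
      using has_derivative_linear[OF test_functionsD(3)[OF f, of "x + t *\<^sub>R e"]] by (simp add: linear_scale mult.commute)
    ultimately show ?thesis by (simp add: has_field_derivative_def)
  qed
  have "(\<lambda>k. LINT x|lborel. s k x) \<longlonglongrightarrow> (LINT x|lborel. ?D x)"
  proof (rule integral_dominated_convergence)
    show "s k \<in> borel_measurable lborel" for k unfolding s_def by measurable
    show "?D \<in> borel_measurable lborel" by measurable
    have "integrable lborel (indicator (cball (0::'a) (R + norm e)) :: 'a \<Rightarrow> real)"
      using emeasure_lborel_cball_finite[of "0::'a" "R + norm e"] by (intro integrable_real_indicator) auto
    then show "integrable lborel (\<lambda>x. M * indicator (cball (0::'a) (R + norm e)) x)" by (rule integrable_mult_right)
    show "AE x in lborel. (\<lambda>k. s k x) \<longlonglongrightarrow> ?D x"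
    proof (rule AE_I2)
      fix x
      have "((\<lambda>t. (f (x + t *\<^sub>R e) - f x) / t) \<longlongrightarrow> ?D x) (at 0)"
        using line[of x 0] by (simp add: DERIV_def)
      moreover have "filterlim h (at 0) sequentially"
        unfolding filterlim_at using h LIMSEQ_inverse_real_of_nat by (auto simp: h_def less_imp_neq[symmetric] simp del: of_nat_Suc)
      ultimately show "(\<lambda>k. s k x) \<longlonglongrightarrow> ?D x" unfolding s_def by (rule filterlim_compose)
    qed
    show "AE x in lborel. norm (s k x) \<le> M * indicator (cball (0::'a) (R + norm e)) x" for k
    proof (rule AE_I2)
      fix x
      show "norm (s k x) \<le> M * indicator (cball (0::'a) (R + norm e)) x"
      proof (cases "norm x \<le> R + norm e")
        case True
        obtain z where "f (x + h k *\<^sub>R e) - f (x + 0 *\<^sub>R e) = (h k - 0) * ?D (x + z *\<^sub>R e)"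
          using MVT2[of 0 "h k" "\<lambda>t. f (x + t *\<^sub>R e)" "\<lambda>t. ?D (x + t *\<^sub>R e)"] line h by blast
        then have "s k x = ?D (x + z *\<^sub>R e)" using h(1)[of k] by (simp add: s_def)
        then show ?thesis using True M by simp
      next
        case False
        have "norm x \<le> norm (x + h k *\<^sub>R e) + norm (h k *\<^sub>R e)" using norm_triangle_ineq4[of "x + h k *\<^sub>R e" "h k *\<^sub>R e"] by simp
        moreover have "norm (h k *\<^sub>R e) \<le> norm e" using h[of k] by (simp add: mult_left_le_one_le)
        ultimately have "f (x + h k *\<^sub>R e) = 0" using False by (intro R) auto
        moreover have "f x = 0" using False by (intro R) (use norm_ge_zero[of e] in linarith)
        ultimately show ?thesis using False by (simp add: s_def)
      qed
    qed
  qed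
  moreover have "(LINT x|lborel. s k x) = 0" for k
  proof -
    have i: "integrable lborel f" by (rule test_function_integrable[OF f])
    have i2: "integrable lborel (\<lambda>x. f (x + h k *\<^sub>R e))"
    proof -
      have "(\<lambda>x. f (h k *\<^sub>R e + x)) = (\<lambda>x. f (x + h k *\<^sub>R e))" by (simp add: add.commute)
      moreover have "integrable (distr lborel borel ((+) (h k *\<^sub>R e))) f" using i by (simp add: lborel_distr_plus)
      ultimately show ?thesis by (subst (asm) integrable_distr_eq) auto
    qed
    have "(LINT x|lborel. f (x + h k *\<^sub>R e)) = (LINT x|lborel. f x)"
      using integral_lborel_affine[of f 1 "h k *\<^sub>R e"] by (simp add: add.commute)
    then show ?thesis unfolding s_def using i i2 by simp
  qed
  ultimately show ?thesis by (simp add: LIMSEQ_const_iff)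
qed

lemma partial_has_derivative: "(f has_derivative f') (at x) \<Longrightarrow> partial i f x = f' (axis i 1)"
  unfolding partial_def using frechet_derivative_at by metis

lemma Ck_partial: "Ck (Suc k) f \<Longrightarrow> Ck k (partial i f)"
  unfolding partial_def[abs_def] by (rule Ck_SucD)

lemma partial_mult:
  assumes "Ck (Suc 0) f" "Ck (Suc 0) g"
  shows "partial i (\<lambda>x. f x * g x) x = f x * partial i g x + partial i f x * g x"
  using partial_has_derivative[OF has_derivative_mult[OF Ck_has_derivative[OF assms(1)] Ck_has_derivative[OF assms(2)]], of i x]
  by (simp add: partial_def)

lemma partial_diff:
  assumes "Ck (Suc 0) f" "Ck (Suc 0) g"
  shows "partial i (\<lambda>x. f x - g x) x = partial i f x - partial i g x"
  using partial_has_derivative[OF has_derivative_diff[OF Ck_has_derivative[OF assms(1)] Ck_has_derivative[OF assms(2)]], of i x]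
  by (simp add: partial_def)

text \<open>The difference of the integrands is the divergence of
  \<open>K grad \<phi> - \<phi> grad K\<close>, whose components are test functions because
  \<open>\<phi>\<close> is one. \<open>K\<close> may be any smooth function, which is what the
  regularised Newtonian kernel requires.\<close>

theorem Green_identity:
  fixes \<phi> K :: "real ^ 'n::finite \<Rightarrow> real"
  assumes \<phi>: "\<phi> \<in> test_functions" and K: "\<And>k. Ck k K"
  shows "(LINT x|lborel. K x * laplacian \<phi> x) = (LINT x|lborel. \<phi> x * laplacian K x)"
proof -
  have C\<phi>: "Ck k \<phi>" for k by (rule test_functionsD[OF \<phi>])
  have Kp: "Ck k (partial i K)" "Ck k (partial i (partial i K))" for k i by (intro Ck_partial K)+
  have \<phi>p: "Ck k (partial i \<phi>)" for k i by (intro Ck_partial C\<phi>)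
  have t1: "(\<lambda>x. partial i \<phi> x * K x) \<in> test_functions" for i by (intro test_function_mult test_function_partial \<phi> K)
  have t2: "(\<lambda>x. \<phi> x * partial i K x) \<in> test_functions" for i by (intro test_function_mult \<phi> Kp)
  have t3: "(\<lambda>x. partial i (partial i \<phi>) x * K x) \<in> test_functions" for i by (intro test_function_mult test_function_partial \<phi> K)
  have t4: "(\<lambda>x. \<phi> x * partial i (partial i K) x) \<in> test_functions" for i by (intro test_function_mult \<phi> Kp)
  have "(LINT x|lborel. partial i (partial i \<phi>) x * K x) = (LINT x|lborel. \<phi> x * partial i (partial i K) x)" for i
  proof -
    have "partial i (\<lambda>x. partial i \<phi> x * K x - \<phi> x * partial i K x) x
      = partial i (partial i \<phi>) x * K x - \<phi> x * partial i (partial i K) x" for x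
      by (subst partial_diff) (intro Ck_mult C\<phi> Kp \<phi>p K, intro Ck_mult C\<phi> Kp \<phi>p K,
        simp add: partial_mult[OF \<phi>p K] partial_mult[OF C\<phi> Kp(1)])
    moreover have "(LINT x|lborel. partial i (\<lambda>x. partial i \<phi> x * K x - \<phi> x * partial i K x) x) = 0"
      unfolding partial_def[of i "\<lambda>x. partial i \<phi> x * K x - \<phi> x * partial i K x"]
      by (intro integral_derivative_test_function test_function_diff t1 t2)
    ultimately have "(LINT x|lborel. partial i (partial i \<phi>) x * K x - \<phi> x * partial i (partial i K) x) = 0" by simp
    then show ?thesis using test_function_integrable[OF t3] test_function_integrable[OF t4] by simp
  qed
  then have "(\<Sum>i\<in>UNIV. LINT x|lborel. partial i (partial i \<phi>) x * K x) = (\<Sum>i\<in>UNIV. LINT x|lborel. \<phi> x * partial i (partial i K) x)"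
    by simp
  then have "(LINT x|lborel. (\<Sum>i\<in>UNIV. partial i (partial i \<phi>) x * K x)) = (LINT x|lborel. (\<Sum>i\<in>UNIV. \<phi> x * partial i (partial i K) x))"
    by (subst (1 2) Bochner_Integration.integral_sum) (auto intro: test_function_integrable t3 t4)
  then show ?thesis by (simp add: laplacian_def sum_distrib_left sum_distrib_right mult.commute)
qed

lemma laplacian_diff:
  assumes "f \<in> test_functions" "g \<in> test_functions"
  shows "laplacian (\<lambda>x. f x - g x) = (\<lambda>x. laplacian f x - laplacian g x)"
proof -
  have C: "Ck k f" "Ck k g" for k using assms by (auto intro: test_functionsD(1) simp del: Ck.simps)
  have "partial i (\<lambda>x. f x - g x) = (\<lambda>x. partial i f x - partial i g x)" for i
    using partial_diff[OF C] by blast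
  then show ?thesis unfolding laplacian_def by (simp add: partial_diff[OF Ck_partial[OF C(1)] Ck_partial[OF C(2)]] sum_subtractf)
qed

lemma laplacian_cmult:
  assumes "f \<in> test_functions"
  shows "laplacian (\<lambda>x. c * f x) = (\<lambda>x. c * laplacian f x)"
proof -
  have C: "Ck k f" for k using assms by (auto intro: test_functionsD(1) simp del: Ck.simps)
  have P: "partial i (\<lambda>x. c * g x) = (\<lambda>x. c * partial i g x)" if "Ck (Suc 0) g" for i g
  proof (rule ext)
    fix x
    have "((\<lambda>x. c * g x) has_derivative (\<lambda>v. c * frechet_derivative g (at x) v)) (at x)"
      by (rule has_derivative_mult_right, rule Ck_has_derivative, rule that)
    then show "partial i (\<lambda>x. c * g x) x = c * partial i g x"
      using partial_has_derivative[of "\<lambda>x. c * g x" _ x i] by (simp add: partial_def)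
  qed
  show ?thesis unfolding laplacian_def by (simp add: P[OF C] P[OF Ck_partial[OF C]] sum_distrib_left)
qed

text \<open>The profile is a function of the squared distance \<open>s\<close>, which is smooth at
  the centre, so the chain rule covers that point as well. \<open>F1\<close> and \<open>F2\<close>
  stand for the derivatives of \<open>F\<close> in \<open>s\<close>.\<close>

lemma laplacian_radial:
  fixes x y :: "real ^ 'n::finite" and F F1 F2 :: "real \<Rightarrow> real"
  assumes F: "\<And>s. 0 \<le> s \<Longrightarrow> (F has_real_derivative F1 s) (at s)" "\<And>s. 0 \<le> s \<Longrightarrow> (F1 has_real_derivative F2 s) (at s)"
  shows "laplacian (\<lambda>y. F ((y - x) \<bullet> (y - x))) y = 2 * real CARD('n) * F1 ((y - x) \<bullet> (y - x)) + 4 * ((y - x) \<bullet> (y - x)) * F2 ((y - x) \<bullet> (y - x))"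
proof -
  let ?r = "\<lambda>y. (y - x) \<bullet> (y - x)"
  have r: "(?r has_derivative (\<lambda>h. 2 * ((y - x) \<bullet> h))) (at y)" for y
    by (auto intro!: derivative_eq_intros simp: inner_commute)
  have comp: "((\<lambda>y. H (?r y)) has_derivative (\<lambda>h. H' (?r y) * (2 * ((y - x) \<bullet> h)))) (at y)"
    if "\<And>s. 0 \<le> s \<Longrightarrow> (H has_real_derivative H' s) (at s)" for H H' :: "real \<Rightarrow> real" and y
    using has_derivative_compose[OF r, of H "(*) (H' (?r y))"] that[of "?r y"] by (simp add: has_field_derivative_def)
  have p1: "partial i (\<lambda>y. F (?r y)) = (\<lambda>y. F1 (?r y) * (2 * (y $ i - x $ i)))" for i
    using partial_has_derivative[OF comp[of F F1, OF F(1)]] by (simp add: fun_eq_iff inner_axis)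
  have p2: "partial i (\<lambda>y. F1 (?r y) * (2 * (y $ i - x $ i))) y = F1 (?r y) * 2 + F2 (?r y) * (2 * (y $ i - x $ i)) * (2 * (y $ i - x $ i))" for i
  proof -
    have "((\<lambda>y::real ^ 'n. y $ i) has_derivative (\<lambda>h. h $ i)) (at y)"
      by (intro bounded_linear_imp_has_derivative bounded_linear_vec_nth)
    then have "((\<lambda>y. 2 * (y $ i - x $ i)) has_derivative (\<lambda>h. 2 * h $ i)) (at y)"
      by (auto intro!: derivative_eq_intros)
    from partial_has_derivative[OF has_derivative_mult[OF comp[of F1 F2, OF F(2)] this], of i]
    show ?thesis by (simp add: inner_axis)
  qed
  have "laplacian (\<lambda>y. F (?r y)) y = (\<Sum>i\<in>UNIV. F1 (?r y) * 2 + F2 (?r y) * 4 * (y $ i - x $ i)\<^sup>2)"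
    unfolding laplacian_def p1 p2 by (intro sum.cong refl) (simp add: power2_eq_square algebra_simps)
  also have "\<dots> = 2 * real CARD('n) * F1 (?r y) + 4 * (\<Sum>i\<in>UNIV. (y $ i - x $ i)\<^sup>2) * F2 (?r y)"
    by (simp add: sum.distrib sum_distrib_left[symmetric] mult_ac)
  also have "(\<Sum>i\<in>UNIV. (y $ i - x $ i)\<^sup>2) = ?r y" by (simp add: inner_vec_def power2_eq_square)
  finally show ?thesis .
qed

lemma Ck_sq_dist: "Ck k (\<lambda>y::'a::euclidean_space. (y - x) \<bullet> (y - x))"
proof -
  have "(\<lambda>y. (y - x) \<bullet> (y - x)) = (\<lambda>y. \<Sum>i\<in>Basis. (y \<bullet> i - x \<bullet> i) * (y \<bullet> i - x \<bullet> i))"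
    by (rule ext, subst euclidean_inner) (simp add: inner_diff_left)
  then show ?thesis by (simp only:) (intro Ck_sum Ck_mult Ck_diff Ck_inner Ck_const)
qed

section \<open>The Newtonian potential\<close>

lemma filterlim_scaled_powr_at_top:
  fixes V c :: real
  assumes "0 < V" "0 < c"
  shows "filterlim (\<lambda>t. (t / V) powr c) at_top at_top"
  using assms by real_asymp

text \<open>The integrand is \<open>1/n\<close> times the divergence of
  \<open>z (1 + |z|^2) powr (-n/2)\<close>. In the volume variable \<open>t = V |z|^n\<close>, with
  \<open>r t = |z|^2\<close>, this says that \<open>F t = t * (1 + r t) powr (-n/2)\<close> is a
  primitive, and \<open>F\<close> runs from 0 to \<open>V\<close>.\<close>

lemma nn_integral_Poisson_density:
  "(\<integral>\<^sup>+z. ennreal ((1 + z \<bullet> z) powr (- (real CARD('n) / 2) - 1)) \<partial>(lborel :: (real ^ 'n::finite) measure)) = ennreal (unit_ball_vol (real CARD('n)))"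
proof -
  define N where "N = real CARD('n)"
  have N: "1 \<le> N" by (simp add: N_def Suc_le_eq)
  define V where "V = unit_ball_vol N"
  have V: "0 < V" using N by (simp add: V_def)
  define r where "r = (\<lambda>t. (t / V) powr (2 / N))"
  define f where "f = (\<lambda>t. (1 + r t) powr (- (N / 2) - 1))"
  define F where "F = (\<lambda>t. t * (1 + r t) powr (- (N / 2)))"
  have r0: "0 \<le> r t" for t by (simp add: r_def)
  have pos: "0 < 1 + r t" for t using r0[of t] by linarith
  have [measurable]: "f \<in> borel_measurable borel" unfolding f_def r_def by measurable
  have z: "(1 + z \<bullet> z) powr (- (N / 2) - 1) = f (V * norm z ^ CARD('n))" for z :: "real ^ 'n"
  proof -
    have "r (V * norm z ^ CARD('n)) = z \<bullet> z"
    proof (cases "z = 0")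
      case False
      then have "norm z ^ CARD('n) = norm z powr N" by (simp add: N_def powr_realpow)
      then have "r (V * norm z ^ CARD('n)) = (norm z powr N) powr (2 / N)"
        using V by (simp add: r_def)
      then show ?thesis using N False by (simp add: powr_powr dot_square_norm)
    qed (simp add: r_def zero_power)
    then show ?thesis by (simp add: f_def)
  qed
  have dr: "(r has_real_derivative 2 / N * r t / t) (at t)" if "0 < t" for t
  proof -
    have "(r has_real_derivative (2 / N * (t / V) powr (2 / N - 1) * (1 / V))) (at t)"
      unfolding r_def using that V
      by (intro DERIV_chain2[OF has_real_derivative_powr] DERIV_cdivide DERIV_ident) simp
    also have "2 / N * (t / V) powr (2 / N - 1) * (1 / V) = 2 / N * r t / t"
      using that V by (simp add: r_def powr_diff)
    finally show ?thesis .
  qed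
  have dF: "(F has_real_derivative f t) (at t)" if t: "0 < t" for t
  proof -
    have "((\<lambda>t. (1 + r t) powr (- (N / 2))) has_real_derivative (- (N / 2) * (1 + r t) powr (- (N / 2) - 1) * (2 / N * r t / t))) (at t)"
    proof (rule DERIV_chain2[where f="\<lambda>z. z powr (- (N / 2))" and g="\<lambda>t. 1 + r t"])
      show "((\<lambda>z. z powr (- (N / 2))) has_real_derivative - (N / 2) * (1 + r t) powr (- (N / 2) - 1)) (at (1 + r t))"
        by (rule has_real_derivative_powr[OF pos])
      show "((\<lambda>t. 1 + r t) has_real_derivative 2 / N * r t / t) (at t)"
        using DERIV_add[OF DERIV_const[of 1] dr[OF t]] by simp
    qed
    from DERIV_mult[OF DERIV_ident this]
    have "(F has_real_derivative 1 * (1 + r t) powr (- (N / 2)) + - (N / 2) * (1 + r t) powr (- (N / 2) - 1) * (2 / N * r t / t) * t) (at t)"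
      unfolding F_def .
    also have "(1 + r t) powr (- (N / 2)) = (1 + r t) powr (- (N / 2) - 1) * (1 + r t)"
      using pos[of t] by (simp add: powr_diff)
    also have "1 * ((1 + r t) powr (- (N / 2) - 1) * (1 + r t)) + - (N / 2) * (1 + r t) powr (- (N / 2) - 1) * (2 / N * r t / t) * t = f t"
    proof -
      have "1 * (T * (1 + \<rho>)) + - (N / 2) * T * (2 / N * \<rho> / t) * t = T" for T \<rho>
        using N t by (simp add: field_simps)
      then show ?thesis unfolding f_def .
    qed
    finally show ?thesis .
  qed
  have Fbound: "F t = V * (1 - 1 / (1 + r t)) powr (N / 2)" if t: "0 < t" for t
  proof -
    have rp: "0 < r t" using t V by (simp add: r_def)
    have "r t powr (N / 2) = t / V" using t V N by (simp add: r_def powr_powr)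
    moreover have "1 - 1 / (1 + r t) = r t / (1 + r t)" using pos[of t] by (simp add: field_simps)
    ultimately show ?thesis using V rp t by (simp add: F_def powr_divide powr_minus_divide)
  qed
  have A: "((F \<circ> real_of_ereal) \<longlongrightarrow> 0) (at_right 0)"
  proof -
    have "(F \<longlongrightarrow> 0) (at_right 0)"
    proof (rule tendsto_sandwich)
      have "0 \<le> F t \<and> F t \<le> t" if "0 < t" for t
      proof -
        have "(1 + r t) powr (- (N / 2)) \<le> 1 powr (- (N / 2))" using r0[of t] N by (intro powr_mono2') auto
        then show ?thesis using that unfolding F_def by (simp add: mult_left_le)
      qed
      then show "eventually (\<lambda>t. 0 \<le> F t) (at_right 0)" "eventually (\<lambda>t. F t \<le> t) (at_right 0)"
        by (auto simp: eventually_at_filter)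
    qed (auto intro: tendsto_ident_at)
    then show ?thesis unfolding zero_ereal_def by (simp only: ereal_tendsto_simps)
  qed
  have B: "((F \<circ> real_of_ereal) \<longlongrightarrow> V) (at_left \<infinity>)"
  proof -
    have "0 < 2 / N" using N by simp
    then have "filterlim r at_top at_top"
      unfolding r_def using V by (intro filterlim_scaled_powr_at_top)
    then have "filterlim (\<lambda>t. 1 + r t) at_top at_top"
      by (intro filterlim_tendsto_add_at_top[OF tendsto_const])
    then have i: "((\<lambda>t. inverse (1 + r t)) \<longlongrightarrow> 0) at_top"
      by (rule tendsto_inverse_0_at_top)
    have "((\<lambda>t. V * (1 - inverse (1 + r t)) powr (N / 2)) \<longlongrightarrow> V * (1 - 0) powr (N / 2)) at_top"
      by (rule tendsto_mult[OF tendsto_const tendsto_powr[OF tendsto_diff[OF tendsto_const i] tendsto_const]]) simp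
    moreover have "eventually (\<lambda>t. V * (1 - inverse (1 + r t)) powr (N / 2) = F t) at_top"
      using eventually_gt_at_top[of "0::real"]
    proof eventually_elim
      fix t :: real assume "0 < t"
      then show "V * (1 - inverse (1 + r t)) powr (N / 2) = F t"
        unfolding inverse_eq_divide by (rule Fbound[symmetric])
    qed
    ultimately have "(F \<longlongrightarrow> V * (1 - 0) powr (N / 2)) at_top" by (rule Lim_transform_eventually)
    then have "(F \<longlongrightarrow> V) at_top" by simp
    then show ?thesis by (simp only: ereal_tendsto_simps)
  qed
  have cont: "isCont f t" if "0 < t" for t
  proof -
    have "isCont r t" using dr[OF that] by (rule DERIV_isCont)
    then show ?thesis unfolding f_def using pos[of t] by (intro continuous_intros) auto
  qed
  have p: "DERIV F x :> f x" "isCont f x" if "0 < ereal x" "ereal x < \<infinity>" for x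
    using that dF cont by auto
  have nn: "AE x in lborel. 0 < ereal x \<longrightarrow> ereal x < \<infinity> \<longrightarrow> 0 \<le> f x" by (simp add: f_def)
  have zi: "(0::ereal) < \<infinity>" by simp
  note FTC = interval_integral_FTC_nonneg[OF zi p nn A B]
  have ei: "einterval 0 \<infinity> = {0<..}" by (auto simp: einterval_def zero_ereal_def)
  have "(\<integral>\<^sup>+z. ennreal ((1 + z \<bullet> z) powr (- (N / 2) - 1)) \<partial>(lborel :: (real ^ 'n) measure)) = (\<integral>\<^sup>+t. ennreal (f t) * indicator {0<..} t \<partial>lborel)"
    unfolding z using nn_integral_radial[of "\<lambda>t. ennreal (f t)", where 'a="real ^ 'n"] by (simp add: V_def N_def)
  also have "\<dots> = (\<integral>\<^sup>+t. ennreal (indicator {0<..} t *\<^sub>R f t) \<partial>lborel)"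
    by (intro nn_integral_cong) (auto split: split_indicator)
  also have "\<dots> = ennreal (LINT t|lborel. indicator {0<..} t *\<^sub>R f t)"
    using FTC(1) unfolding ei set_integrable_def by (intro nn_integral_eq_integral) (auto simp: f_def)
  also have "(LINT t|lborel. indicator {0<..} t *\<^sub>R f t) = V"
    using FTC(2) by (simp add: interval_lebesgue_integral_def ei set_lebesgue_integral_def)
  finally show ?thesis by (simp add: N_def V_def)
qed

text \<open>Green's identity is applied with the regularised kernel
  \<open>(|y - x|^2 + e^2) powr ((2 - n)/2)\<close>. Its Laplacian is \<open>- n (n - 2)\<close>
  times an approximate identity of mass \<open>V\<close>, so \<open>e \<rightarrow> 0\<close>
  recovers \<open>\<phi> x\<close>. The regularised kernel stays below the singular one, so no limit
  of singular integrals has to be taken.\<close>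

theorem Newtonian_potential_bound:
  fixes \<phi> :: "real ^ 'n::finite \<Rightarrow> real"
  assumes n: "2 < CARD('n)" and \<phi>: "\<phi> \<in> test_functions"
  defines "N \<equiv> real CARD('n)"
  shows "ennreal \<bar>\<phi> x\<bar> \<le> ennreal (1 / ((N - 2) * N * unit_ball_vol N)) *
     (\<integral>\<^sup>+y. ennreal (norm (x - y) powr (2 - N) * \<bar>laplacian \<phi> y\<bar>) \<partial>lborel)"
proof -
  have N: "2 < N" using n by (simp add: N_def)
  define V where "V = unit_ball_vol N"
  have V: "0 < V" using N by (simp add: V_def)
  have \<Delta>: "laplacian \<phi> \<in> test_functions" by (rule test_function_laplacian[OF \<phi>])
  have [measurable]: "\<phi> \<in> borel_measurable borel" "laplacian \<phi> \<in> borel_measurable borel"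
    by (intro test_function_borel \<phi> \<Delta>)+
  obtain M where M: "0 < M" "\<And>y. \<bar>\<phi> y\<bar> \<le> M" using test_function_bounded[OF \<phi>] by blast
  define P where "P = (\<lambda>z :: real ^ 'n. (1 + z \<bullet> z) powr (- (N / 2) - 1))"
  have Pm[measurable]: "P \<in> borel_measurable borel" unfolding P_def by measurable
  have P0: "0 \<le> P z" for z by (simp add: P_def)
  have Pint: "has_bochner_integral lborel P V"
    using nn_integral_Poisson_density[where 'n='n] V unfolding P_def N_def V_def
    by (intro has_bochner_integral_nn_integral) auto
  define Q where "Q = (\<integral>\<^sup>+y. ennreal (norm (x - y) powr (2 - N) * \<bar>laplacian \<phi> y\<bar>) \<partial>lborel)"
  define \<epsilon> where "\<epsilon> = (\<lambda>k. inverse (real (Suc k)))"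
  have \<epsilon>: "0 < \<epsilon> k" for k by (simp add: \<epsilon>_def)
  define I where "I = (\<lambda>k. LINT z|lborel. P z * \<phi> (x + \<epsilon> k *\<^sub>R z))"
  have bound: "ennreal \<bar>N * (N - 2) * I k\<bar> \<le> Q" for k
  proof -
    define e where "e = \<epsilon> k"
    have e: "0 < e" using \<epsilon> by (simp add: e_def)
    define b where "b = (2 - N) / 2"
    define F where "F = (\<lambda>s. (s + e\<^sup>2) powr b)"
    define F1 where "F1 = (\<lambda>s. b * (s + e\<^sup>2) powr (b - 1))"
    define F2 where "F2 = (\<lambda>s. b * ((b - 1) * (s + e\<^sup>2) powr (b - 1 - 1)))"
    define K where "K = (\<lambda>y. F ((y - x) \<bullet> (y - x)))"
    have pos: "0 < s + e\<^sup>2" if "0 \<le> s" for s using that e by (simp add: add_nonneg_pos)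
    have dF: "(F has_real_derivative F1 s) (at s)" if "0 \<le> s" for s
      unfolding F_def F1_def using pos[OF that] by (auto intro!: derivative_eq_intros)
    have dF1: "(F1 has_real_derivative F2 s) (at s)" if "0 \<le> s" for s
      unfolding F1_def F2_def using pos[OF that] by (auto intro!: derivative_eq_intros)
    have CK: "Ck j K" for j
      unfolding K_def F_def using pos by (intro Ck_powr Ck_add Ck_sq_dist Ck_const) simp
    have lapK: "laplacian K y = - (N * (N - 2)) * (e\<^sup>2 * ((y - x) \<bullet> (y - x) + e\<^sup>2) powr (- (N / 2) - 1))" for y
    proof -
      define \<rho> where "\<rho> = (y - x) \<bullet> (y - x)"
      have \<rho>: "0 < \<rho> + e\<^sup>2" using pos[of \<rho>] by (simp add: \<rho>_def)
      define T where "T = (\<rho> + e\<^sup>2) powr (b - 1 - 1)"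
      have "(\<rho> + e\<^sup>2) powr (b - 1) = (\<rho> + e\<^sup>2) powr (b - 1 - 1 + 1)" by simp
      also have "\<dots> = T * (\<rho> + e\<^sup>2)" using \<rho> unfolding powr_add T_def by simp
      finally have T: "(\<rho> + e\<^sup>2) powr (b - 1) = T * (\<rho> + e\<^sup>2)" .
      have "laplacian K y = 2 * N * F1 \<rho> + 4 * \<rho> * F2 \<rho>"
        unfolding K_def \<rho>_def N_def by (rule laplacian_radial[OF dF dF1])
      also have "\<dots> = 2 * N * (b * (T * (\<rho> + e\<^sup>2))) + 4 * \<rho> * (b * ((b - 1) * T))"
        unfolding F1_def F2_def T by (simp add: T_def)
      also have "\<dots> = - (N * (N - 2)) * (e\<^sup>2 * T)" unfolding b_def by (simp add: field_simps)
      also have "b - 1 - 1 = - (N / 2) - 1" by (simp add: b_def field_simps)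
      then have "T = (\<rho> + e\<^sup>2) powr (- (N / 2) - 1)" by (simp add: T_def)
      finally show ?thesis by (simp add: \<rho>_def)
    qed
    have "(LINT y|lborel. K y * laplacian \<phi> y) = (LINT y|lborel. \<phi> y * laplacian K y)"
      by (rule Green_identity[OF \<phi> CK])
    also have "\<dots> = - (N * (N - 2)) * (LINT y|lborel. e\<^sup>2 * ((y - x) \<bullet> (y - x) + e\<^sup>2) powr (- (N / 2) - 1) * \<phi> y)"
      unfolding lapK integral_mult_right_zero[symmetric] by (intro Bochner_Integration.integral_cong) simp_all
    also have "(LINT y|lborel. e\<^sup>2 * ((y - x) \<bullet> (y - x) + e\<^sup>2) powr (- (N / 2) - 1) * \<phi> y) =
       \<bar>e\<bar> ^ CARD('n) * (LINT z|lborel. e\<^sup>2 * ((x + e *\<^sub>R z - x) \<bullet> (x + e *\<^sub>R z - x) + e\<^sup>2) powr (- (N / 2) - 1) * \<phi> (x + e *\<^sub>R z))"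
      using e integral_lborel_affine[of "\<lambda>y. e\<^sup>2 * ((y - x) \<bullet> (y - x) + e\<^sup>2) powr (- (N / 2) - 1) * \<phi> y" e x] by simp
    also have "\<dots> = (LINT z|lborel. P z * \<phi> (x + e *\<^sub>R z))"
    proof -
      \<comment> \<open>After the substitution \<open>y = x + e z\<close> the powers of
        \<open>e\<close> cancel, \<open>N + 2 + 2 * (- N/2 - 1) = 0\<close>, and the density is
        \<open>P\<close> for every \<open>e\<close>.\<close>
      have "\<bar>e\<bar> ^ CARD('n) * (e\<^sup>2 * ((x + e *\<^sub>R z - x) \<bullet> (x + e *\<^sub>R z - x) + e\<^sup>2) powr (- (N / 2) - 1)) = P z" for z :: "real ^ 'n"
      proof -
        have "(x + e *\<^sub>R z - x) \<bullet> (x + e *\<^sub>R z - x) + e\<^sup>2 = e\<^sup>2 * (1 + z \<bullet> z)"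
          by (simp add: power2_eq_square algebra_simps)
        then have "((x + e *\<^sub>R z - x) \<bullet> (x + e *\<^sub>R z - x) + e\<^sup>2) powr (- (N / 2) - 1) = (e\<^sup>2) powr (- (N / 2) - 1) * P z"
          by (simp add: P_def powr_mult)
        moreover have "\<bar>e\<bar> ^ CARD('n) * (e\<^sup>2 * (e\<^sup>2) powr (- (N / 2) - 1)) = 1"
        proof -
          have "\<bar>e\<bar> ^ CARD('n) = e powr N" using e by (simp add: N_def powr_realpow)
          moreover have "e\<^sup>2 = e powr 2" using e by simp
          ultimately have "\<bar>e\<bar> ^ CARD('n) * (e\<^sup>2 * (e\<^sup>2) powr (- (N / 2) - 1)) = e powr (N + (2 + 2 * (- (N / 2) - 1)))"
            by (simp only: powr_powr powr_add)
          also have "N + (2 + 2 * (- (N / 2) - 1)) = 0" by simp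
          finally show ?thesis using e by simp
        qed
        ultimately show ?thesis by (simp add: mult.assoc[symmetric])
      qed
      then have "\<bar>e\<bar> ^ CARD('n) * (e\<^sup>2 * ((x + e *\<^sub>R z - x) \<bullet> (x + e *\<^sub>R z - x) + e\<^sup>2) powr (- (N / 2) - 1) * \<phi> (x + e *\<^sub>R z)) = P z * \<phi> (x + e *\<^sub>R z)" for z
        by (metis mult.assoc)
      then show ?thesis unfolding integral_mult_right_zero[symmetric] by (intro Bochner_Integration.integral_cong) simp_all
    qed
    finally have eq: "(LINT y|lborel. K y * laplacian \<phi> y) = - (N * (N - 2)) * I k" by (simp add: I_def e_def)
    have "integrable lborel (\<lambda>y. laplacian \<phi> y * K y)"
      by (intro test_function_integrable test_function_mult \<Delta> CK)
    then have "integrable lborel (\<lambda>y. K y * laplacian \<phi> y)" by (simp add: mult.commute)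
    from integral_norm_bound_ennreal[OF this]
    have "ennreal \<bar>N * (N - 2) * I k\<bar> \<le> (\<integral>\<^sup>+y. ennreal (norm (K y * laplacian \<phi> y)) \<partial>lborel)"
      unfolding eq by (simp add: abs_mult)
    also have "\<dots> \<le> Q"
      unfolding Q_def
    proof (rule nn_integral_mono_AE)
      show "AE y in lborel. ennreal (norm (K y * laplacian \<phi> y)) \<le> ennreal (norm (x - y) powr (2 - N) * \<bar>laplacian \<phi> y\<bar>)"
        using AE_lborel_singleton[of x]
      proof eventually_elim
        fix y assume y: "y \<noteq> x"
        then have d: "0 < norm (x - y)" by simp
        have sq: "(y - x) \<bullet> (y - x) = (norm (x - y))\<^sup>2" by (simp add: dot_square_norm norm_minus_commute)
        have "K y \<le> ((norm (x - y))\<^sup>2) powr b"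
          unfolding K_def F_def sq using N zero_less_power[OF d, of 2]
          by (intro powr_mono2') (auto simp: b_def)
        also have "\<dots> = norm (x - y) powr (2 - N)"
        proof -
          have "(norm (x - y))\<^sup>2 = norm (x - y) powr 2" using d by simp
          moreover have "2 * b = 2 - N" by (simp add: b_def)
          ultimately show ?thesis by (simp only: powr_powr)
        qed
        finally have "\<bar>K y\<bar> * \<bar>laplacian \<phi> y\<bar> \<le> norm (x - y) powr (2 - N) * \<bar>laplacian \<phi> y\<bar>"
          by (intro mult_right_mono) (auto simp: K_def F_def)
        then show "ennreal (norm (K y * laplacian \<phi> y)) \<le> ennreal (norm (x - y) powr (2 - N) * \<bar>laplacian \<phi> y\<bar>)"
          by (intro ennreal_leI) (simp add: abs_mult)
      qed
    qed
    finally show ?thesis .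
  qed
  have "I \<longlonglongrightarrow> (LINT z|lborel. P z * \<phi> x)"
    unfolding I_def
  proof (rule integral_dominated_convergence)
    show "integrable lborel (\<lambda>z. P z * M)" using Pint by (auto intro: integrable_mult_left simp: has_bochner_integral_iff)
    show "AE z in lborel. norm (P z * \<phi> (x + \<epsilon> k *\<^sub>R z)) \<le> P z * M" for k
      using M P0 by (intro AE_I2) (auto simp: abs_mult intro!: mult_left_mono)
    show "AE z in lborel. (\<lambda>k. P z * \<phi> (x + \<epsilon> k *\<^sub>R z)) \<longlonglongrightarrow> P z * \<phi> x"
    proof (rule AE_I2)
      fix z
      have "(\<lambda>k. x + \<epsilon> k *\<^sub>R z) \<longlonglongrightarrow> x + 0 *\<^sub>R z"
        unfolding \<epsilon>_def by (intro tendsto_intros LIMSEQ_inverse_real_of_nat)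
      then have lim: "(\<lambda>k. x + \<epsilon> k *\<^sub>R z) \<longlonglongrightarrow> x" by simp
      have c: "isCont \<phi> x" using test_functionsD(2)[OF \<phi>] by (simp add: continuous_on_eq_continuous_at)
      show "(\<lambda>k. P z * \<phi> (x + \<epsilon> k *\<^sub>R z)) \<longlonglongrightarrow> P z * \<phi> x"
        by (rule tendsto_mult[OF tendsto_const isCont_tendsto_compose[OF c lim]])
    qed
  qed measurable
  also have "(LINT z|lborel. P z * \<phi> x) = V * \<phi> x" using Pint by (simp add: has_bochner_integral_iff)
  finally have "(\<lambda>k. ennreal \<bar>N * (N - 2) * I k\<bar>) \<longlonglongrightarrow> ennreal \<bar>N * (N - 2) * (V * \<phi> x)\<bar>"
    by (intro tendsto_ennrealI tendsto_rabs tendsto_mult_left)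
  then have "ennreal \<bar>N * (N - 2) * (V * \<phi> x)\<bar> \<le> Q"
    by (rule LIMSEQ_le_const2) (use bound in auto)
  then have "ennreal (1 / ((N - 2) * N * V)) * ennreal \<bar>N * (N - 2) * (V * \<phi> x)\<bar> \<le> ennreal (1 / ((N - 2) * N * V)) * Q"
    by (intro mult_left_mono) auto
  moreover have "ennreal (1 / ((N - 2) * N * V)) * ennreal \<bar>N * (N - 2) * (V * \<phi> x)\<bar> = ennreal \<bar>\<phi> x\<bar>"
    using N V by (simp add: ennreal_mult'[symmetric] abs_mult)
  ultimately show ?thesis by (simp add: Q_def V_def)
qed

section \<open>The space \<open>E\<close>\<close>

text \<open>Convexity of the power at the combination \<open>(1 - \<theta>) * (a / (1 - \<theta>)) +
  \<theta> * (b / \<theta>)\<close>. With \<open>\<theta> = B / (A + B)\<close> it yields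
  Minkowski's inequality; with small fixed \<open>\<theta>\<close> it keeps the factor of a main
  term close to 1, as sharpness requires.\<close>

lemma convex_powr_split:
  fixes a b s \<theta> :: real
  assumes "0 \<le> a" "0 \<le> b" "1 \<le> s" "0 < \<theta>" "\<theta> < 1"
  shows "(a + b) powr s \<le> (1 - \<theta>) powr (1 - s) * a powr s + \<theta> powr (1 - s) * b powr s"
proof -
  have conv: "((1 - \<theta>) * x + \<theta> * y) powr s \<le> (1 - \<theta>) * x powr s + \<theta> * y powr s" if xy: "0 \<le> x" "0 \<le> y" for x y
  proof -
    have scale: "(c * z) powr s \<le> c * z powr s" if "0 < c" "c < 1" for c z
    proof -
      have "c powr s \<le> c powr 1" using that assms by (intro powr_mono') auto
      then show ?thesis using that by (simp add: powr_mult mult_right_mono)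
    qed
    show ?thesis
    proof (cases "x = 0 \<or> y = 0")
      case True
      then show ?thesis using scale[of "1 - \<theta>" x] scale[of \<theta> y] assms by auto
    next
      case False
      then show ?thesis using convex_onD[OF powr_convex[OF assms(3)], of \<theta> x y] assms xy by simp
    qed
  qed
  have "((1 - \<theta>) * (a / (1 - \<theta>)) + \<theta> * (b / \<theta>)) powr s \<le> (1 - \<theta>) * (a / (1 - \<theta>)) powr s + \<theta> * (b / \<theta>) powr s"
    using assms by (intro conv) auto
  moreover have "(1 - \<theta>) * (a / (1 - \<theta>)) powr s = (1 - \<theta>) powr (1 - s) * a powr s"
    using assms by (simp add: powr_divide powr_diff)
  moreover have "\<theta> * (b / \<theta>) powr s = \<theta> powr (1 - s) * b powr s"
    using assms by (simp add: powr_divide powr_diff)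
  ultimately show ?thesis using assms by simp
qed

lemma nn_integral_Minkowski:
  fixes a b :: "'a \<Rightarrow> real"
  assumes [measurable]: "a \<in> borel_measurable M" "b \<in> borel_measurable M" and s: "1 \<le> s" and AB: "0 < A" "0 < B"
    and a: "(\<integral>\<^sup>+x. ennreal (\<bar>a x\<bar> powr s) \<partial>M) \<le> ennreal (A powr s)"
    and b: "(\<integral>\<^sup>+x. ennreal (\<bar>b x\<bar> powr s) \<partial>M) \<le> ennreal (B powr s)"
  shows "(\<integral>\<^sup>+x. ennreal (\<bar>a x + b x\<bar> powr s) \<partial>M) \<le> ennreal ((A + B) powr s)"
proof -
  define \<theta> where "\<theta> = B / (A + B)"
  have \<theta>: "0 < \<theta>" "\<theta> < 1" "1 - \<theta> = A / (A + B)" using AB by (auto simp: \<theta>_def field_simps)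
  have "(\<integral>\<^sup>+x. ennreal (\<bar>a x + b x\<bar> powr s) \<partial>M) \<le>
    (\<integral>\<^sup>+x. ennreal ((1 - \<theta>) powr (1 - s)) * ennreal (\<bar>a x\<bar> powr s) + ennreal (\<theta> powr (1 - s)) * ennreal (\<bar>b x\<bar> powr s) \<partial>M)"
  proof (intro nn_integral_mono)
    fix x
    have "\<bar>a x + b x\<bar> powr s \<le> (\<bar>a x\<bar> + \<bar>b x\<bar>) powr s" using s by (intro powr_mono2) auto
    also have "\<dots> \<le> (1 - \<theta>) powr (1 - s) * \<bar>a x\<bar> powr s + \<theta> powr (1 - s) * \<bar>b x\<bar> powr s"
      using s \<theta> by (intro convex_powr_split) auto
    finally show "ennreal (\<bar>a x + b x\<bar> powr s) \<le> ennreal ((1 - \<theta>) powr (1 - s)) * ennreal (\<bar>a x\<bar> powr s) + ennreal (\<theta> powr (1 - s)) * ennreal (\<bar>b x\<bar> powr s)"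
      by (simp add: ennreal_mult[symmetric] ennreal_plus[symmetric] ennreal_leI del: ennreal_plus)
  qed
  also have "\<dots> = ennreal ((1 - \<theta>) powr (1 - s)) * (\<integral>\<^sup>+x. ennreal (\<bar>a x\<bar> powr s) \<partial>M) + ennreal (\<theta> powr (1 - s)) * (\<integral>\<^sup>+x. ennreal (\<bar>b x\<bar> powr s) \<partial>M)"
    by (simp add: nn_integral_add nn_integral_cmult)
  also have "\<dots> \<le> ennreal ((1 - \<theta>) powr (1 - s)) * ennreal (A powr s) + ennreal (\<theta> powr (1 - s)) * ennreal (B powr s)"
    by (intro add_mono mult_left_mono a b) auto
  also have "\<dots> = ennreal ((1 - \<theta>) powr (1 - s) * A powr s + \<theta> powr (1 - s) * B powr s)"
    by (simp add: ennreal_mult[symmetric] ennreal_plus[symmetric] del: ennreal_plus)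
  also have "(1 - \<theta>) powr (1 - s) * A powr s = A * (A + B) powr (s - 1)"
  proof -
    have "A powr (1 - s) * A powr s = A" using AB by (simp add: powr_add[symmetric])
    moreover have "(A + B) powr (s - 1) = 1 / (A + B) powr (1 - s)" by (simp add: powr_minus_divide[symmetric])
    ultimately show ?thesis unfolding \<theta>(3) using AB by (simp add: powr_divide)
  qed
  also have "\<theta> powr (1 - s) * B powr s = B * (A + B) powr (s - 1)"
  proof -
    have "B powr (1 - s) * B powr s = B" using AB by (simp add: powr_add[symmetric])
    moreover have "(A + B) powr (s - 1) = 1 / (A + B) powr (1 - s)" by (simp add: powr_minus_divide[symmetric])
    ultimately show ?thesis unfolding \<theta>_def using AB by (simp add: powr_divide)
  qed
  also have "A * (A + B) powr (s - 1) + B * (A + B) powr (s - 1) = (A + B) * (A + B) powr (s - 1)"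
    by (simp only: distrib_right)
  also have "\<dots> = (A + B) powr s" using AB by (simp add: powr_diff)
  finally show ?thesis .
qed

text \<open>Along a subsequence with rapidly decreasing differences \<open>d k\<close>, the
  integrals of \<open>(|d k| * 2 ^ k) powr s\<close> have a finite sum. Hence almost everywhere
  \<open>|d k| \<le> (1/2) ^ k\<close> eventually, and the telescoping series converges.\<close>

lemma Riesz_Fischer_AE:
  fixes g :: "nat \<Rightarrow> 'a \<Rightarrow> real"
  assumes [measurable]: "\<And>k. g k \<in> borel_measurable M" and s: "0 < s"
    and cauchy: "\<And>e. 0 < e \<Longrightarrow> \<exists>K. \<forall>j\<ge>K. \<forall>k\<ge>K. (\<integral>\<^sup>+x. ennreal (\<bar>g j x - g k x\<bar> powr s) \<partial>M) \<le> ennreal e"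
  obtains r f where "strict_mono (r :: nat \<Rightarrow> nat)" "f \<in> borel_measurable M" "AE x in M. (\<lambda>k. g (r k) x) \<longlonglongrightarrow> f x"
proof -
  \<comment> \<open>The second factor compensates the weight \<open>(2 ^ k) powr s\<close>; the
    first is left over as a summable bound.\<close>
  define \<delta> where "\<delta> = (\<lambda>k::nat. (1/2) ^ k * ((1/2) ^ k) powr s :: real)"
  have \<delta>: "0 < \<delta> k" for k by (simp add: \<delta>_def)
  have "\<exists>K. \<forall>k. \<forall>j\<ge>K k. \<forall>i\<ge>K k. (\<integral>\<^sup>+x. ennreal (\<bar>g j x - g i x\<bar> powr s) \<partial>M) \<le> ennreal (\<delta> k)"
    by (rule choice) (use cauchy \<delta> in blast)
  then obtain K where K: "\<And>k j i. K k \<le> j \<Longrightarrow> K k \<le> i \<Longrightarrow> (\<integral>\<^sup>+x. ennreal (\<bar>g j x - g i x\<bar> powr s) \<partial>M) \<le> ennreal (\<delta> k)"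
    by blast
  \<comment> \<open>Adding \<open>k\<close> and summing the thresholds makes \<open>r\<close>
    strictly increasing while keeping \<open>K k \<le> r k\<close>.\<close>
  define r where "r = (\<lambda>k. k + (\<Sum>i\<le>k. K i))"
  have r: "strict_mono r" by (rule strict_monoI_Suc) (simp add: r_def)
  have rK: "K k \<le> r k" for k
    using member_le_sum[of k "{..k}" K] by (simp add: r_def trans_le_add2)
  have rS: "r k \<le> r (Suc k)" for k using r by (simp add: strict_mono_less_eq)
  define d where "d = (\<lambda>k x. g (r (Suc k)) x - g (r k) x)"
  have [measurable]: "d k \<in> borel_measurable M" for k unfolding d_def by measurable
  have dk: "(\<integral>\<^sup>+x. ennreal (\<bar>d k x\<bar> powr s) \<partial>M) \<le> ennreal (\<delta> k)" for k
    unfolding d_def using rK[of k] rS[of k] by (intro K) auto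
  let ?w = "\<lambda>k x. ennreal ((\<bar>d k x\<bar> * 2 ^ k) powr s)"
  have "(\<integral>\<^sup>+x. (\<Sum>k. ?w k x) \<partial>M) = (\<Sum>k. \<integral>\<^sup>+x. ?w k x \<partial>M)"
    by (rule nn_integral_suminf) measurable
  also have "\<dots> \<le> (\<Sum>k. ennreal ((1/2) ^ k))"
  proof (intro suminf_le)
    fix k
    have "(\<integral>\<^sup>+x. ?w k x \<partial>M) = ennreal ((2 ^ k) powr s) * (\<integral>\<^sup>+x. ennreal (\<bar>d k x\<bar> powr s) \<partial>M)"
      by (subst nn_integral_cmult[symmetric]) (auto simp: powr_mult ennreal_mult[symmetric] mult.commute)
    also have "\<dots> \<le> ennreal ((2 ^ k) powr s) * ennreal (\<delta> k)" by (intro mult_left_mono dk) auto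
    also have "\<dots> = ennreal ((1/2) ^ k)"
      unfolding \<delta>_def by (simp add: ennreal_mult[symmetric] powr_mult[symmetric] power_mult_distrib[symmetric] mult.left_commute)
    finally show "(\<integral>\<^sup>+x. ?w k x \<partial>M) \<le> ennreal ((1/2) ^ k)" .
  qed auto
  also have "\<dots> = ennreal (1 / (1 - 1/2))"
    using geometric_sums[of "1/2::real"] by (intro suminf_ennreal_eq) auto
  also have "\<dots> < \<infinity>" by simp
  finally have "(\<integral>\<^sup>+x. (\<Sum>k. ?w k x) \<partial>M) \<noteq> \<infinity>" by simp
  then have "AE x in M. (\<Sum>k. ?w k x) \<noteq> \<infinity>" by (intro nn_integral_PInf_AE) measurable
  then have conv: "AE x in M. convergent (\<lambda>k. g (r k) x)"
  proof eventually_elim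
    fix x assume "(\<Sum>k. ?w k x) \<noteq> \<infinity>"
    then have "summable (\<lambda>k. (\<bar>d k x\<bar> * 2 ^ k) powr s)"
      by (intro summable_suminf_not_top) auto
    then have "(\<lambda>k. (\<bar>d k x\<bar> * 2 ^ k) powr s) \<longlonglongrightarrow> 0" by (rule summable_LIMSEQ_zero)
    then have "eventually (\<lambda>k. (\<bar>d k x\<bar> * 2 ^ k) powr s < 1) sequentially" by (rule order_tendstoD) simp
    then have "eventually (\<lambda>k. norm (d k x) \<le> (1/2) ^ k) sequentially"
    proof eventually_elim
      fix k assume k: "(\<bar>d k x\<bar> * 2 ^ k) powr s < 1"
      have "\<bar>d k x\<bar> * 2 ^ k \<le> 1"
      proof (rule ccontr)
        assume "\<not> \<bar>d k x\<bar> * 2 ^ k \<le> 1"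
        then have "1 powr s \<le> (\<bar>d k x\<bar> * 2 ^ k) powr s" using s by (intro powr_mono2) auto
        then show False using k by simp
      qed
      then show "norm (d k x) \<le> (1/2) ^ k" by (simp add: power_divide field_simps)
    qed
    then have "summable (\<lambda>k. d k x)"
      by (rule summable_comparison_test_ev) (auto intro: summable_geometric)
    then have "convergent (\<lambda>n. \<Sum>k<n. d k x)" by (simp add: summable_iff_convergent)
    then have "convergent (\<lambda>n. (\<Sum>k<n. d k x) + g (r 0) x)" by (intro convergent_add convergent_const)
    moreover have "(\<Sum>k<n. d k x) + g (r 0) x = g (r n) x" for n
      unfolding d_def by (simp add: sum_lessThan_telescope[of "\<lambda>k. g (r k) x"])
    ultimately show "convergent (\<lambda>k. g (r k) x)" by simp
  qed
  have "AE x in M. (\<lambda>k. g (r k) x) \<longlonglongrightarrow> lim (\<lambda>k. g (r k) x)"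
    using conv by eventually_elim (simp add: convergent_LIMSEQ_iff)
  moreover have "(\<lambda>x. lim (\<lambda>k. g (r k) x)) \<in> borel_measurable M" by measurable
  ultimately show ?thesis using that r by blast
qed

text \<open>Fatou's lemma after composition with a continuous \<open>\<Psi>\<close>. It is used with
  \<open>\<Psi>\<close> a power, to identify limits in \<open>Lspace\<close>, and with
  \<open>\<Psi>\<close> the function \<open>Phi\<close>, to reach all of
  \<open>E_space\<close>.\<close>

lemma nn_integral_AE_limit_le:
  fixes h :: "nat \<Rightarrow> 'a \<Rightarrow> real" and \<Psi> :: "real \<Rightarrow> real" and w :: "'a \<Rightarrow> real"
  assumes [measurable]: "\<And>k. h k \<in> borel_measurable M" "w \<in> borel_measurable M"
    and \<Psi>: "continuous_on UNIV \<Psi>" and lim: "AE x in M. (\<lambda>k. h k x) \<longlonglongrightarrow> f x"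
    and le: "eventually (\<lambda>k. (\<integral>\<^sup>+x. ennreal (\<Psi> (h k x) * w x) \<partial>M) \<le> C) sequentially"
  shows "(\<integral>\<^sup>+x. ennreal (\<Psi> (f x) * w x) \<partial>M) \<le> C"
proof -
  have [measurable]: "\<Psi> \<in> borel_measurable borel" using \<Psi> by (rule borel_measurable_continuous_onI)
  have "(\<integral>\<^sup>+x. ennreal (\<Psi> (f x) * w x) \<partial>M) = (\<integral>\<^sup>+x. liminf (\<lambda>k. ennreal (\<Psi> (h k x) * w x)) \<partial>M)"
  proof (rule nn_integral_cong_AE)
    show "AE x in M. ennreal (\<Psi> (f x) * w x) = liminf (\<lambda>k. ennreal (\<Psi> (h k x) * w x))"
      using lim
    proof eventually_elim
      fix x assume lx: "(\<lambda>k. h k x) \<longlonglongrightarrow> f x"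
      have "isCont \<Psi> (f x)" using \<Psi> by (simp add: continuous_on_eq_continuous_at)
      then have "(\<lambda>k. \<Psi> (h k x)) \<longlonglongrightarrow> \<Psi> (f x)" using lx by (rule isCont_tendsto_compose)
      then have "(\<lambda>k. ennreal (\<Psi> (h k x) * w x)) \<longlonglongrightarrow> ennreal (\<Psi> (f x) * w x)"
        by (intro tendsto_ennrealI tendsto_mult_right)
      then show "ennreal (\<Psi> (f x) * w x) = liminf (\<lambda>k. ennreal (\<Psi> (h k x) * w x))"
        using lim_imp_Liminf[OF sequentially_bot] by metis
    qed
  qed
  also have "\<dots> \<le> liminf (\<lambda>k. \<integral>\<^sup>+x. ennreal (\<Psi> (h k x) * w x) \<partial>M)" by (rule nn_integral_liminf) measurable
  also have "\<dots> \<le> limsup (\<lambda>k. \<integral>\<^sup>+x. ennreal (\<Psi> (h k x) * w x) \<partial>M)" by (rule Liminf_le_Limsup) simp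
  also have "\<dots> \<le> C" by (rule Limsup_bounded[OF le])
  finally show ?thesis .
qed

section \<open>Norms and local integrability in \<open>Lspace\<close>\<close>

lemma continuous_on_abs_powr: "0 < s \<Longrightarrow> continuous_on UNIV (\<lambda>x::real. \<bar>x\<bar> powr s)"
  by (intro continuous_on_powr' continuous_intros) auto

lemma Lspace_measurable: "f \<in> Lspace s \<Longrightarrow> f \<in> borel_measurable lebesgue"
  by (simp add: Lspace_def)

lemma Lnorm_nonneg: "0 \<le> Lnorm s f"
  by (simp add: Lnorm_def)

lemma Lnorm_powr:
  assumes "0 < s"
  shows "Lnorm s f powr s = (LINT x|lebesgue. \<bar>f x\<bar> powr s)"
proof -
  have "0 \<le> (LINT x|lebesgue. \<bar>f x\<bar> powr s)" by (rule integral_nonneg_AE) simp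
  then show ?thesis using assms by (simp add: Lnorm_def powr_powr)
qed

lemma nn_integral_Lspace:
  assumes "f \<in> Lspace s" "0 < s"
  shows "(\<integral>\<^sup>+x. ennreal (\<bar>f x\<bar> powr s) \<partial>lebesgue) = ennreal (Lnorm s f powr s)"
  unfolding Lnorm_powr[OF assms(2)] using assms(1) by (intro nn_integral_eq_integral) (auto simp: Lspace_def)

lemma Lspace_I:
  assumes "f \<in> borel_measurable lebesgue" "(\<integral>\<^sup>+x. ennreal (\<bar>f x\<bar> powr s) \<partial>lebesgue) < \<infinity>"
  shows "f \<in> Lspace s"
  unfolding Lspace_def using assms by (auto intro!: integrableI_bounded)

lemma Lnorm_le:
  assumes f: "f \<in> borel_measurable lebesgue" and s: "0 < s" and A: "0 \<le> A"
    and le: "(\<integral>\<^sup>+x. ennreal (\<bar>f x\<bar> powr s) \<partial>lebesgue) \<le> ennreal (A powr s)"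
  shows "f \<in> Lspace s" "Lnorm s f \<le> A"
proof -
  show *: "f \<in> Lspace s" by (rule Lspace_I[OF f]) (use le in \<open>auto intro: le_less_trans\<close>)
  have "Lnorm s f powr s \<le> A powr s" using le unfolding nn_integral_Lspace[OF * s] by simp
  then show "Lnorm s f \<le> A" using s A Lnorm_nonneg[of s f] by (metis not_le powr_less_mono2)
qed

lemma Lspace_add:
  assumes f: "f \<in> Lspace s" and g: "g \<in> Lspace s" and s: "1 \<le> s"
  shows "(\<lambda>x. f x + g x) \<in> Lspace s" "Lnorm s (\<lambda>x. f x + g x) \<le> Lnorm s f + Lnorm s g"
proof -
  have [measurable]: "f \<in> borel_measurable lebesgue" "g \<in> borel_measurable lebesgue" using f g by (auto intro: Lspace_measurable)
  have m: "(\<lambda>x. f x + g x) \<in> borel_measurable lebesgue" by measurable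
  have s0: "0 < s" using s by simp
  \<comment> \<open>The surplus \<open>e\<close> makes both bounds positive, as the weights in
    \<open>nn_integral_Minkowski\<close> require; it is removed at the end.\<close>
  have *: "(\<integral>\<^sup>+x. ennreal (\<bar>f x + g x\<bar> powr s) \<partial>lebesgue) \<le> ennreal (((Lnorm s f + e) + (Lnorm s g + e)) powr s)" if e: "0 < e" for e
  proof (rule nn_integral_Minkowski[OF _ _ s])
    show "(\<integral>\<^sup>+x. ennreal (\<bar>f x\<bar> powr s) \<partial>lebesgue) \<le> ennreal ((Lnorm s f + e) powr s)"
      unfolding nn_integral_Lspace[OF f s0] using e s0 Lnorm_nonneg by (intro ennreal_leI powr_mono2) auto
    show "(\<integral>\<^sup>+x. ennreal (\<bar>g x\<bar> powr s) \<partial>lebesgue) \<le> ennreal ((Lnorm s g + e) powr s)"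
      unfolding nn_integral_Lspace[OF g s0] using e s0 Lnorm_nonneg by (intro ennreal_leI powr_mono2) auto
  qed (use e Lnorm_nonneg in \<open>auto intro: add_nonneg_pos\<close>)
  note L = Lnorm_le[OF m s0 _ *]
  have n: "0 \<le> (Lnorm s f + e) + (Lnorm s g + e)" if "0 < e" for e
    using that Lnorm_nonneg[of s f] Lnorm_nonneg[of s g] by linarith
  show "(\<lambda>x. f x + g x) \<in> Lspace s" using L(1)[OF n, of 1] by simp
  show "Lnorm s (\<lambda>x. f x + g x) \<le> Lnorm s f + Lnorm s g"
  proof (rule field_le_epsilon)
    fix e :: real assume "0 < e"
    then show "Lnorm s (\<lambda>x. f x + g x) \<le> Lnorm s f + Lnorm s g + e" using L(2)[OF n, of "e/2"] by simp
  qed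
qed

lemma Lspace_cmult:
  assumes f: "f \<in> Lspace s" and s: "0 < s"
  shows "(\<lambda>x. c * f x) \<in> Lspace s" "Lnorm s (\<lambda>x. c * f x) = \<bar>c\<bar> * Lnorm s f"
proof -
  show "(\<lambda>x. c * f x) \<in> Lspace s" using f by (auto simp: Lspace_def abs_mult powr_mult)
  have "0 \<le> (LINT x|lebesgue. \<bar>f x\<bar> powr s)" by (rule integral_nonneg_AE) simp
  then show "Lnorm s (\<lambda>x. c * f x) = \<bar>c\<bar> * Lnorm s f"
    using s by (simp add: Lnorm_def abs_mult powr_mult powr_powr)
qed

lemma Lspace_diff:
  assumes f: "f \<in> Lspace s" and g: "g \<in> Lspace s" and s: "1 \<le> s"
  shows "(\<lambda>x. f x - g x) \<in> Lspace s" "Lnorm s (\<lambda>x. f x - g x) \<le> Lnorm s f + Lnorm s g"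
  using Lspace_add[OF f Lspace_cmult(1)[OF g, of "-1"] s] Lspace_cmult(2)[OF g, of "-1"] s by auto

lemma test_function_lebesgue_measurable:
  fixes f :: "'a::euclidean_space \<Rightarrow> real"
  shows "f \<in> test_functions \<Longrightarrow> f \<in> borel_measurable lebesgue"
  by (intro measurable_completion) (simp add: test_function_borel)

lemma test_function_Lspace:
  fixes f :: "'a::euclidean_space \<Rightarrow> real"
  assumes f: "f \<in> test_functions" and s: "0 < s"
  shows "f \<in> Lspace s"
proof (rule Lspace_I[OF test_function_lebesgue_measurable[OF f]])
  obtain R where R: "0 < R" "\<And>x. R \<le> norm x \<Longrightarrow> f x = 0" using test_function_support[OF f] by blast
  obtain M where M: "0 < M" "\<And>x. \<bar>f x\<bar> \<le> M" using test_function_bounded[OF f] by blast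
  have "(\<integral>\<^sup>+x. ennreal (\<bar>f x\<bar> powr s) \<partial>lebesgue) \<le> (\<integral>\<^sup>+x. ennreal (M powr s) * indicator (cball (0::'a) R) x \<partial>lebesgue)"
  proof (intro nn_integral_mono)
    fix x :: 'a
    have "\<bar>f x\<bar> powr s \<le> M powr s" using M s by (intro powr_mono2) auto
    then show "ennreal (\<bar>f x\<bar> powr s) \<le> ennreal (M powr s) * indicator (cball 0 R) x"
      using R(2)[of x] by (cases "norm x \<le> R") (auto intro!: ennreal_leI)
  qed
  also have "\<dots> = ennreal (M powr s) * emeasure lborel (cball (0::'a) R)"
    by (simp add: nn_integral_completion nn_integral_cmult_indicator)
  also have "\<dots> < \<infinity>" using emeasure_lborel_cball_finite[of "0::'a" R] by (simp add: ennreal_mult_less_top)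
  finally show "(\<integral>\<^sup>+x. ennreal (\<bar>f x\<bar> powr s) \<partial>lebesgue) < \<infinity>" .
qed

text \<open>\<open>|f| \<le> 1 + |f| powr s\<close> because \<open>s \<ge> 1\<close>, and the
  constant is integrable over a compact set.\<close>

lemma Lspace_locally_integrable:
  fixes f :: "'a::euclidean_space \<Rightarrow> real"
  assumes f: "f \<in> Lspace s" and s: "1 \<le> s"
  shows "locally_integrable f"
  unfolding locally_integrable_def
proof (intro allI impI)
  fix K :: "'a set" assume K: "compact K"
  have Km: "K \<in> sets lebesgue" using lmeasurable_compact[OF K] by (rule fmeasurableD)
  have i1: "integrable lebesgue (\<lambda>x. indicator K x :: real)"
  proof (rule integrable_real_indicator[OF Km])
    show "emeasure lebesgue K < \<infinity>" using lmeasurable_compact[OF K] unfolding fmeasurable_def by blast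
  qed
  have i2: "integrable lebesgue (\<lambda>x. \<bar>f x\<bar> powr s)" using f by (simp add: Lspace_def)
  show "set_integrable lebesgue K f"
    unfolding set_integrable_def
  proof (rule Bochner_Integration.integrable_bound[OF Bochner_Integration.integrable_add[OF i1 i2]])
    show "(\<lambda>x. indicator K x *\<^sub>R f x) \<in> borel_measurable lebesgue"
      using Lspace_measurable[OF f] Km by (intro borel_measurable_scaleR borel_measurable_indicator)
    show "AE x in lebesgue. norm (indicator K x *\<^sub>R f x) \<le> norm (indicator K x + \<bar>f x\<bar> powr s)"
    proof (rule AE_I2)
      fix x
      have "\<bar>f x\<bar> \<le> 1 + \<bar>f x\<bar> powr s"
      proof (cases "\<bar>f x\<bar> \<le> 1")
        case True
        then show ?thesis using powr_ge_zero[of "\<bar>f x\<bar>" s] by linarith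
      next
        case False
        then have "\<bar>f x\<bar> powr 1 \<le> \<bar>f x\<bar> powr s" using s by (intro powr_mono) auto
        then show ?thesis using False by simp
      qed
      then show "norm (indicator K x *\<^sub>R f x) \<le> norm (indicator K x + \<bar>f x\<bar> powr s)"
        by (auto split: split_indicator)
    qed
  qed
qed

lemma locally_integrable_measurable:
  fixes f :: "'a::euclidean_space \<Rightarrow> real"
  assumes "locally_integrable f"
  shows "f \<in> borel_measurable lebesgue"
proof (rule borel_measurable_LIMSEQ_real)
  show "(\<lambda>x. indicator (cball 0 (real k)) x *\<^sub>R f x) \<in> borel_measurable lebesgue" for k
  proof -
    have "set_integrable lebesgue (cball 0 (real k)) f" using assms by (simp add: locally_integrable_def)
    then show ?thesis unfolding set_integrable_def by (rule borel_measurable_integrable)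
  qed
  fix x :: 'a
  obtain m where m: "norm x \<le> real m" using real_arch_simple by blast
  have "eventually (\<lambda>k. indicator (cball 0 (real k)) x *\<^sub>R f x = f x) sequentially"
    using eventually_ge_at_top[of m] by eventually_elim (use m in auto)
  then show "(\<lambda>k. indicator (cball 0 (real k)) x *\<^sub>R f x) \<longlonglongrightarrow> f x" by (rule tendsto_eventually)
qed

text \<open>Convergence in \<open>Lspace s\<close> thereby implies convergence of all pairings with
  test functions, which is how the distributional identity passes to limits.\<close>

lemma test_function_pairing_le:
  fixes h \<psi> :: "'a::euclidean_space \<Rightarrow> real"
  assumes h: "h \<in> Lspace s" and s: "1 < s" and \<psi>: "\<psi> \<in> test_functions"
  shows "\<bar>LINT x|lebesgue. h x * \<psi> x\<bar> \<le> Lnorm s h * Lnorm (s / (s - 1)) \<psi>"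
proof -
  have s': "1 < s / (s - 1)" "1 / s + 1 / (s / (s - 1)) = 1" using s by (auto simp: field_simps)
  have \<psi>L: "\<psi> \<in> Lspace (s / (s - 1))" using s' by (intro test_function_Lspace[OF \<psi>]) auto
  have "integrable lebesgue (\<lambda>x. h x * \<psi> x)"
    using s by (intro test_function_integrable_mult[OF \<psi>] Lspace_locally_integrable[OF h]) auto
  from integral_norm_bound_ennreal[OF this]
  have "ennreal \<bar>LINT x|lebesgue. h x * \<psi> x\<bar> \<le> (\<integral>\<^sup>+x. ennreal (\<bar>h x\<bar> * \<bar>\<psi> x\<bar>) \<partial>lebesgue)" by (simp add: abs_mult)
  also have "\<dots> \<le> ennreal (Lnorm s h * Lnorm (s / (s - 1)) \<psi>)"
  proof (rule nn_integral_Holder[OF _ _ _ _ s s'])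
    show "(\<lambda>x. \<bar>h x\<bar>) \<in> borel_measurable lebesgue" "(\<lambda>x. \<bar>\<psi> x\<bar>) \<in> borel_measurable lebesgue"
      using Lspace_measurable[OF h] Lspace_measurable[OF \<psi>L] by auto
    show "(\<integral>\<^sup>+x. ennreal (\<bar>h x\<bar> powr s) \<partial>lebesgue) \<le> ennreal (Lnorm s h powr s)"
      using s by (subst nn_integral_Lspace[OF h]) auto
    show "(\<integral>\<^sup>+x. ennreal (\<bar>\<psi> x\<bar> powr (s / (s - 1))) \<partial>lebesgue) \<le> ennreal (Lnorm (s / (s - 1)) \<psi> powr (s / (s - 1)))"
      using s' by (subst nn_integral_Lspace[OF \<psi>L]) auto
  qed (auto simp: Lnorm_nonneg)
  finally show ?thesis by (simp add: Lnorm_nonneg)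
qed

section \<open>Distributional Laplacians and the norm of \<open>E_space\<close>\<close>

lemma is_distr_laplacian_AE_unique:
  fixes u g g' :: "real ^ 'n::finite \<Rightarrow> real"
  assumes "is_distr_laplacian u g" "is_distr_laplacian u g'"
  shows "AE x in lebesgue. g x = g' x"
proof -
  have gl: "locally_integrable g" "locally_integrable g'" using assms by (auto simp: is_distr_laplacian_def)
  have "locally_integrable (\<lambda>x. g x - g' x)"
    using gl unfolding locally_integrable_def by (auto intro: set_integral_diff(1))
  then have "AE x in lebesgue. g x - g' x = 0"
  proof (rule du_Bois_Reymond)
    fix \<phi> :: "real ^ 'n \<Rightarrow> real" assume \<phi>: "\<phi> \<in> test_functions"
    have "(LINT x|lebesgue. g x * \<phi> x) = (LINT x|lebesgue. g' x * \<phi> x)"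
      using assms \<phi> by (auto simp: is_distr_laplacian_def)
    then show "(LINT x|lebesgue. (g x - g' x) * \<phi> x) = 0"
      using test_function_integrable_mult[OF \<phi> gl(1)] test_function_integrable_mult[OF \<phi> gl(2)]
      by (simp add: left_diff_distrib)
  qed
  then show ?thesis by simp
qed

lemma mixed_norm_cong_AE:
  assumes "AE x in lebesgue. f x = g x" "f \<in> borel_measurable lebesgue" "g \<in> borel_measurable lebesgue"
  shows "mixed_norm p f = mixed_norm p g"
proof -
  have "Lnorm s f = Lnorm s g" for s
  proof -
    have "(LINT x|lebesgue. \<bar>f x\<bar> powr s) = (LINT x|lebesgue. \<bar>g x\<bar> powr s)"
      using assms by (intro integral_cong_AE) (auto elim: AE_mp)
    then show ?thesis by (simp add: Lnorm_def)
  qed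
  then show ?thesis by (simp add: mixed_norm_def)
qed

text \<open>\<open>distr_laplacian\<close> is an arbitrary choice; uniqueness almost everywhere
  allows the norm to be computed with any representative at hand.\<close>

lemma E_norm_eq:
  assumes "is_distr_laplacian u g"
  shows "E_norm p u = mixed_norm p g"
proof -
  have *: "is_distr_laplacian u (distr_laplacian u)" unfolding distr_laplacian_def by (rule someI[of "is_distr_laplacian u" g, OF assms])
  show ?thesis unfolding E_norm_def
    using is_distr_laplacian_AE_unique[OF * assms] * assms
    by (intro mixed_norm_cong_AE locally_integrable_measurable) (auto simp: is_distr_laplacian_def)
qed

lemma lebesgue_integral_test:
  fixes f g :: "'a::euclidean_space \<Rightarrow> real"
  assumes "f \<in> borel_measurable borel"
  shows "(LINT x|lebesgue. f x) = (LINT x|lborel. f x)"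
  by (rule integral_completion) (use assms in simp)

lemma is_distr_laplacian_test:
  assumes \<phi>: "\<phi> \<in> test_functions"
  shows "is_distr_laplacian \<phi> (laplacian \<phi>)"
  unfolding is_distr_laplacian_def
proof (intro conjI ballI)
  show "locally_integrable \<phi>" "locally_integrable (laplacian \<phi>)"
    by (intro continuous_imp_locally_integrable test_functionsD(2) test_function_laplacian \<phi>)+
  fix \<psi> :: "real ^ 'a \<Rightarrow> real" assume \<psi>: "\<psi> \<in> test_functions"
  have [measurable]: "\<phi> \<in> borel_measurable borel" "\<psi> \<in> borel_measurable borel"
    "laplacian \<phi> \<in> borel_measurable borel" "laplacian \<psi> \<in> borel_measurable borel"
    by (intro test_function_borel test_function_laplacian \<phi> \<psi>)+
  have "(LINT x|lborel. \<phi> x * laplacian \<psi> x) = (LINT x|lborel. \<psi> x * laplacian \<phi> x)"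
    by (rule Green_identity[OF \<psi> test_functionsD(1)[OF \<phi>]])
  then show "(LINT x|lebesgue. \<phi> x * laplacian \<psi> x) = (LINT x|lebesgue. laplacian \<phi> x * \<psi> x)"
    by (simp add: lebesgue_integral_test mult.commute)
qed

lemma Lnorm_le_mixed_norm:
  fixes g :: "real ^ 'n::finite \<Rightarrow> real"
  shows "Lnorm (real CARD('n) / 2) g \<le> mixed_norm p g" "Lnorm p g \<le> mixed_norm p g"
proof -
  let ?q = "real CARD('n) / 2"
  have q: "0 < ?q" by simp
  have m: "mixed_norm p g = (Lnorm ?q g powr ?q + Lnorm p g powr ?q) powr (1 / ?q)"
    by (simp add: mixed_norm_def Let_def)
  have "(X powr ?q) powr (1 / ?q) \<le> (X powr ?q + Y) powr (1 / ?q)" "(X powr ?q) powr (1 / ?q) \<le> (Y + X powr ?q) powr (1 / ?q)"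
    if "0 \<le> Y" for X Y :: real
    using that q by (intro powr_mono2; simp)+
  moreover have "(X powr ?q) powr (1 / ?q) = X" if "0 \<le> X" for X :: real
    using that q by (simp add: powr_powr)
  ultimately show "Lnorm ?q g \<le> mixed_norm p g" "Lnorm p g \<le> mixed_norm p g"
    unfolding m by (metis Lnorm_nonneg powr_ge_zero)+
qed

text \<open>\<open>mixed_norm\<close> dominates the norms of exponents \<open>n/2\<close> and
  \<open>p\<close>, so the Laplacians of the approximating sequence are Cauchy for both. One almost
  everywhere limit \<open>f\<close> serves both exponents, and pairing with test functions shows
  that \<open>f\<close> is the distributional Laplacian of \<open>u\<close>.\<close>

lemma E_space_limit:
  fixes u :: "real ^ 'n::finite \<Rightarrow> real"
  assumes p: "1 < p" "p < real CARD('n) / 2" and u: "u \<in> E_space p"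
  obtains \<phi> f where "\<And>k::nat. \<phi> k \<in> test_functions" "is_distr_laplacian u f"
    "f \<in> Lspace (real CARD('n) / 2)" "f \<in> Lspace p"
    "(\<lambda>k. Lnorm (real CARD('n) / 2) (\<lambda>x. laplacian (\<phi> k) x - f x)) \<longlonglongrightarrow> 0"
    "(\<lambda>k. Lnorm p (\<lambda>x. laplacian (\<phi> k) x - f x)) \<longlonglongrightarrow> 0"
    "(\<lambda>k. Lnorm (pstar CARD('n) p) (\<lambda>x. \<phi> k x - u x)) \<longlonglongrightarrow> 0"
proof -
  define q where "q = real CARD('n) / 2"
  define s where "s = pstar CARD('n) p"
  have q: "1 < q" using p by (simp add: q_def)
  have s: "1 < s"
  proof -
    have "1 * (real CARD('n) - 2 * p) < p * real CARD('n)" using p by (intro mult_strict_mono') auto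
    then show ?thesis using p unfolding s_def pstar_def by (simp add: mult.commute)
  qed
  obtain \<phi> :: "nat \<Rightarrow> real ^ 'n \<Rightarrow> real" where \<phi>: "\<And>k. \<phi> k \<in> test_functions"
    and cau: "\<And>\<epsilon>. 0 < \<epsilon> \<Longrightarrow> \<exists>N. \<forall>j\<ge>N. \<forall>k\<ge>N. mixed_norm p (laplacian (\<lambda>x. \<phi> j x - \<phi> k x)) < \<epsilon>"
    and lim: "(\<lambda>k. Lnorm s (\<lambda>x. \<phi> k x - u x)) \<longlonglongrightarrow> 0" and uL: "u \<in> Lspace s"
    using u unfolding E_space_def s_def by blast
  define g where "g = (\<lambda>k. laplacian (\<phi> k))"
  have g: "g k \<in> test_functions" for k unfolding g_def by (intro test_function_laplacian \<phi>)
  have gm[measurable]: "g k \<in> borel_measurable lebesgue" for k by (intro test_function_lebesgue_measurable g)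
  have cauchy: "\<exists>K. \<forall>j\<ge>K. \<forall>k\<ge>K. (\<integral>\<^sup>+x. ennreal (\<bar>g j x - g k x\<bar> powr t) \<partial>lebesgue) \<le> ennreal e"
    if t: "t = q \<or> t = p" and e: "0 < e" for t e
  proof -
    have t0: "0 < t" using t q p by auto
    obtain K where K: "\<forall>j\<ge>K. \<forall>k\<ge>K. mixed_norm p (laplacian (\<lambda>x. \<phi> j x - \<phi> k x)) < e powr (1/t)"
      using cau[of "e powr (1/t)"] e by auto
    have "(\<integral>\<^sup>+x. ennreal (\<bar>g j x - g k x\<bar> powr t) \<partial>lebesgue) \<le> ennreal e" if "K \<le> j" "K \<le> k" for j k
    proof -
      have "mixed_norm p (\<lambda>x. g j x - g k x) < e powr (1/t)"
        using K that unfolding g_def laplacian_diff[OF \<phi> \<phi>, symmetric] by blast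
      then have "Lnorm t (\<lambda>x. g j x - g k x) < e powr (1/t)"
        using t Lnorm_le_mixed_norm[where g="\<lambda>x. g j x - g k x" and p=p, folded q_def] by (auto intro: le_less_trans)
      then have "Lnorm t (\<lambda>x. g j x - g k x) powr t \<le> (e powr (1/t)) powr t"
        using t0 by (intro powr_mono2) (auto simp: Lnorm_nonneg)
      also have "\<dots> = e" using e t0 by (simp add: powr_powr)
      finally show ?thesis
        by (subst nn_integral_Lspace[OF test_function_Lspace[OF test_function_diff[OF g g] t0] t0]) (rule ennreal_leI)
    qed
    then show ?thesis by blast
  qed
  \<comment> \<open>The limit is extracted for exponent \<open>q\<close> only. Fatou's lemma along
    the same subsequence then gives convergence of the whole sequence to this \<open>f\<close> for
    \<open>q\<close> and for \<open>p\<close>.\<close>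
  obtain r f where r: "strict_mono (r :: nat \<Rightarrow> nat)" and fm[measurable]: "f \<in> borel_measurable lebesgue"
    and gf: "AE x in lebesgue. (\<lambda>k. g (r k) x) \<longlonglongrightarrow> f x"
  proof -
    have "0 < q" using q by simp
    from Riesz_Fischer_AE[OF gm this cauchy[OF disjI1[OF refl]]] show ?thesis using that by blast
  qed
  have near: "\<exists>K. \<forall>j\<ge>K. (\<lambda>x. g j x - f x) \<in> Lspace t \<and> Lnorm t (\<lambda>x. g j x - f x) \<le> e"
    if t: "t = q \<or> t = p" and e: "0 < e" for t e
  proof -
    have t0: "0 < t" using t q p by auto
    obtain K where K: "\<And>j k. K \<le> j \<Longrightarrow> K \<le> k \<Longrightarrow> (\<integral>\<^sup>+x. ennreal (\<bar>g j x - g k x\<bar> powr t) \<partial>lebesgue) \<le> ennreal (e powr t)"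
      using cauchy[OF t, of "e powr t"] e by auto
    have "(\<integral>\<^sup>+x. ennreal (\<bar>g j x - f x\<bar> powr t * 1) \<partial>lebesgue) \<le> ennreal (e powr t)" if j: "K \<le> j" for j
    proof (rule nn_integral_AE_limit_le[where h="\<lambda>k x. g j x - g (r k) x" and w="\<lambda>x. 1" and \<Psi>="\<lambda>x. \<bar>x\<bar> powr t"])
      show "AE x in lebesgue. (\<lambda>k. g j x - g (r k) x) \<longlonglongrightarrow> g j x - f x"
        using gf by eventually_elim (intro tendsto_diff tendsto_const)
      show "\<forall>\<^sub>F k in sequentially. (\<integral>\<^sup>+x. ennreal (\<bar>g j x - g (r k) x\<bar> powr t * 1) \<partial>lebesgue) \<le> ennreal (e powr t)"
        using eventually_ge_at_top[of K]
      proof eventually_elim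
        fix k assume "K \<le> k"
        then have "K \<le> r k" using seq_suble[OF r, of k] by linarith
        then show "(\<integral>\<^sup>+x. ennreal (\<bar>g j x - g (r k) x\<bar> powr t * 1) \<partial>lebesgue) \<le> ennreal (e powr t)" using K[OF j] by simp
      qed
      show "continuous_on UNIV (\<lambda>x::real. \<bar>x\<bar> powr t)" by (rule continuous_on_abs_powr[OF t0])
    qed measurable
    then have *: "(\<integral>\<^sup>+x. ennreal (\<bar>g j x - f x\<bar> powr t) \<partial>lebesgue) \<le> ennreal (e powr t)" if j: "K \<le> j" for j
      using j by simp
    have "(\<lambda>x. g j x - f x) \<in> borel_measurable lebesgue" for j by measurable
    from Lnorm_le[OF this t0 _ *] e show ?thesis by (meson less_imp_le)
  qed
  have fL: "f \<in> Lspace t" if t: "t = q \<or> t = p" for t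
  proof -
    have t1: "1 < t" using t q p by auto
    obtain K where "(\<lambda>x. g K x - f x) \<in> Lspace t" using near[OF t, of 1] by auto
    from Lspace_diff(1)[OF test_function_Lspace[OF g[of K]] this] show ?thesis using t1 by simp
  qed
  have glim: "(\<lambda>k. Lnorm t (\<lambda>x. g k x - f x)) \<longlonglongrightarrow> 0" if t: "t = q \<or> t = p" for t
  proof (rule LIMSEQ_I)
    fix e :: real assume e: "0 < e"
    obtain K where "\<forall>j\<ge>K. Lnorm t (\<lambda>x. g j x - f x) \<le> e / 2" using near[OF t, of "e/2"] e by auto
    then have K: "Lnorm t (\<lambda>x. g j x - f x) \<le> e / 2" if "K \<le> j" for j using that by blast
    have "norm (Lnorm t (\<lambda>x. g j x - f x) - 0) < e" if "K \<le> j" for j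
      using K[OF that] e Lnorm_nonneg[of t "\<lambda>x. g j x - f x"] unfolding real_norm_def by linarith
    then show "\<exists>K. \<forall>j\<ge>K. norm (Lnorm t (\<lambda>x. g j x - f x) - 0) < e" by blast
  qed
  have "is_distr_laplacian u f"
    unfolding is_distr_laplacian_def
  proof (intro conjI ballI)
    show ul: "locally_integrable u" by (rule Lspace_locally_integrable[OF uL]) (use s in simp)
    show fl: "locally_integrable f" by (rule Lspace_locally_integrable[OF fL[of p]]) (use p in auto)
    fix \<psi> :: "real ^ 'n \<Rightarrow> real" assume \<psi>: "\<psi> \<in> test_functions"
    have \<Delta>\<psi>: "laplacian \<psi> \<in> test_functions" by (rule test_function_laplacian[OF \<psi>])
    have loc: "locally_integrable h" if "h \<in> test_functions" for h :: "real ^ 'n \<Rightarrow> real"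
      by (intro continuous_imp_locally_integrable test_functionsD(2) that)
    have "(\<lambda>k. LINT x|lebesgue. (\<phi> k x - u x) * laplacian \<psi> x) \<longlonglongrightarrow> 0"
    proof (rule Lim_null_comparison[OF always_eventually])
      have "(\<lambda>x. \<phi> k x - u x) \<in> Lspace s" for k
        using s by (intro Lspace_diff(1)[OF test_function_Lspace[OF \<phi>] uL]) auto
      then show "\<forall>k. norm (LINT x|lebesgue. (\<phi> k x - u x) * laplacian \<psi> x) \<le> Lnorm s (\<lambda>x. \<phi> k x - u x) * Lnorm (s / (s - 1)) (laplacian \<psi>)"
        using test_function_pairing_le[OF _ s \<Delta>\<psi>] by simp
      show "(\<lambda>k. Lnorm s (\<lambda>x. \<phi> k x - u x) * Lnorm (s / (s - 1)) (laplacian \<psi>)) \<longlonglongrightarrow> 0"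
        by (rule tendsto_mult_left_zero[OF lim])
    qed
    moreover have "(\<lambda>k. LINT x|lebesgue. (g k x - f x) * \<psi> x) \<longlonglongrightarrow> 0"
    proof (rule Lim_null_comparison[OF always_eventually])
      have "(\<lambda>x. g k x - f x) \<in> Lspace p" for k
        using p by (intro Lspace_diff(1)[OF test_function_Lspace[OF g] fL]) auto
      then show "\<forall>k. norm (LINT x|lebesgue. (g k x - f x) * \<psi> x) \<le> Lnorm p (\<lambda>x. g k x - f x) * Lnorm (p / (p - 1)) \<psi>"
        using test_function_pairing_le[OF _ p(1) \<psi>] by simp
      have "(\<lambda>k. Lnorm p (\<lambda>x. g k x - f x)) \<longlonglongrightarrow> 0" by (rule glim) simp
      then show "(\<lambda>k. Lnorm p (\<lambda>x. g k x - f x) * Lnorm (p / (p - 1)) \<psi>) \<longlonglongrightarrow> 0"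
        by (rule tendsto_mult_left_zero)
    qed
    ultimately have "(\<lambda>k. (LINT x|lebesgue. (g k x - f x) * \<psi> x) - (LINT x|lebesgue. (\<phi> k x - u x) * laplacian \<psi> x)) \<longlonglongrightarrow> 0 - 0"
      by (intro tendsto_diff)
    moreover have "(LINT x|lebesgue. (g k x - f x) * \<psi> x) - (LINT x|lebesgue. (\<phi> k x - u x) * laplacian \<psi> x)
       = (LINT x|lebesgue. u x * laplacian \<psi> x) - (LINT x|lebesgue. f x * \<psi> x)" for k
    proof -
      have i: "integrable lebesgue (\<lambda>x. g k x * \<psi> x)" "integrable lebesgue (\<lambda>x. f x * \<psi> x)"
        "integrable lebesgue (\<lambda>x. \<phi> k x * laplacian \<psi> x)" "integrable lebesgue (\<lambda>x. u x * laplacian \<psi> x)"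
        by (intro test_function_integrable_mult \<psi> \<Delta>\<psi> loc g \<phi> fl ul)+
      have "(LINT x|lebesgue. \<phi> k x * laplacian \<psi> x) = (LINT x|lebesgue. g k x * \<psi> x)"
        using is_distr_laplacian_test[OF \<phi>] \<psi> unfolding is_distr_laplacian_def g_def by blast
      then show ?thesis using i by (simp add: left_diff_distrib)
    qed
    ultimately show "(LINT x|lebesgue. u x * laplacian \<psi> x) = (LINT x|lebesgue. f x * \<psi> x)"
      by (simp add: LIMSEQ_const_iff)
  qed
  then show ?thesis
    using that[of \<phi> f] \<phi> fL glim lim unfolding g_def q_def s_def by blast
qed

section \<open>Finiteness up to the critical constant\<close>

theorem test_function_exponential_bound:
  fixes p \<gamma> \<alpha> :: real
  defines "N \<equiv> real CARD('n::finite)"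
  assumes n: "2 < CARD('n)" and p: "1 < p" "p < N / 2" and \<gamma>: "0 \<le> \<gamma>" "\<gamma> < N"
    and \<alpha>: "0 \<le> \<alpha>" "\<alpha> \<le> beta_gamma \<gamma> TYPE('n)"
  obtains C where "0 \<le> C" "\<And>\<phi> :: real ^ 'n \<Rightarrow> real. \<phi> \<in> test_functions \<Longrightarrow>
     Lnorm (N / 2) (laplacian \<phi>) powr (N / 2) + Lnorm p (laplacian \<phi>) powr (N / 2) \<le> 1 \<Longrightarrow>
     (\<integral>\<^sup>+x. ennreal (Phi CARD('n) \<alpha> (j0 CARD('n) p) (\<phi> x) * (1 / norm x powr \<gamma>)) \<partial>lebesgue) \<le> ennreal C"
proof -
  have N: "2 < N" using n by (simp add: N_def)
  obtain C where C: "0 \<le> C" "\<And>(a :: real ^ 'n \<Rightarrow> real) g A B M. a \<in> borel_measurable borel \<Longrightarrow> g \<in> borel_measurable borel \<Longrightarrow>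
     (\<And>x. 0 \<le> a x) \<Longrightarrow> (\<And>x. 0 \<le> g x) \<Longrightarrow> (\<And>x. g x \<le> M) \<Longrightarrow> emeasure lborel {x. 0 < g x} < \<infinity> \<Longrightarrow>
     (\<And>x. ennreal (a x) \<le> ennreal (1 / ((N - 2) * N * unit_ball_vol N)) * (\<integral>\<^sup>+y. ennreal (norm (x - y) powr (2 - N) * g y) \<partial>lborel)) \<Longrightarrow>
     0 \<le> A \<Longrightarrow> 0 \<le> B \<Longrightarrow>
     (\<integral>\<^sup>+x. ennreal (g x powr (N / 2)) \<partial>lborel) \<le> ennreal (A powr (N / 2)) \<Longrightarrow>
     (\<integral>\<^sup>+x. ennreal (g x powr p) \<partial>lborel) \<le> ennreal (B powr p) \<Longrightarrow> A powr (N / 2) + B powr (N / 2) \<le> 1 \<Longrightarrow>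
     (\<integral>\<^sup>+x. ennreal (Phi CARD('n) \<alpha> (j0 CARD('n) p) (a x) / norm x powr \<gamma>) \<partial>lborel) \<le> ennreal C"
    using weighted_exponential_integral_bound[where 'n='n, OF n p[unfolded N_def] \<gamma>[unfolded N_def] \<alpha>] unfolding N_def by blast
  show ?thesis
  proof (rule that[OF C(1)])
    fix \<phi> :: "real ^ 'n \<Rightarrow> real"
    assume \<phi>: "\<phi> \<in> test_functions"
      and le: "Lnorm (N / 2) (laplacian \<phi>) powr (N / 2) + Lnorm p (laplacian \<phi>) powr (N / 2) \<le> 1"
    have \<Delta>: "laplacian \<phi> \<in> test_functions" by (rule test_function_laplacian[OF \<phi>])
    have [measurable]: "\<phi> \<in> borel_measurable borel" "laplacian \<phi> \<in> borel_measurable borel"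
      by (intro test_function_borel \<phi> \<Delta>)+
    obtain M where M: "0 < M" "\<And>x. \<bar>laplacian \<phi> x\<bar> \<le> M" using test_function_bounded[OF \<Delta>] by blast
    obtain R where R: "0 < R" "\<And>x. R \<le> norm x \<Longrightarrow> laplacian \<phi> x = 0" using test_function_support[OF \<Delta>] by blast
    have "{x. 0 < \<bar>laplacian \<phi> x\<bar>} \<subseteq> cball 0 R" using R(2) by force
    then have "emeasure lborel {x. 0 < \<bar>laplacian \<phi> x\<bar>} \<le> emeasure lborel (cball (0::real ^ 'n) R)"
      by (intro emeasure_mono) auto
    then have fin: "emeasure lborel {x. 0 < \<bar>laplacian \<phi> x\<bar>} < \<infinity>"
      using emeasure_lborel_cball_finite[of "0::real ^ 'n" R] by (rule le_less_trans)
    have eq: "(\<integral>\<^sup>+x. ennreal (\<bar>laplacian \<phi> x\<bar> powr t) \<partial>lborel) \<le> ennreal (Lnorm t (laplacian \<phi>) powr t)" if "0 < t" for t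
      using nn_integral_Lspace[OF test_function_Lspace[OF \<Delta> that] that] by (simp add: nn_integral_completion)
    have "(\<integral>\<^sup>+x. ennreal (Phi CARD('n) \<alpha> (j0 CARD('n) p) \<bar>\<phi> x\<bar> / norm x powr \<gamma>) \<partial>lborel) \<le> ennreal C"
      using M(2) fin N p le
      by (intro C(2)[of "\<lambda>x. \<bar>\<phi> x\<bar>" "\<lambda>x. \<bar>laplacian \<phi> x\<bar>" M "Lnorm (N / 2) (laplacian \<phi>)" "Lnorm p (laplacian \<phi>)"]
        Newtonian_potential_bound[OF n \<phi>, folded N_def] eq Lnorm_nonneg) auto
    then show "(\<integral>\<^sup>+x. ennreal (Phi CARD('n) \<alpha> (j0 CARD('n) p) (\<phi> x) * (1 / norm x powr \<gamma>)) \<partial>lebesgue) \<le> ennreal C"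
      by (simp add: nn_integral_completion Phi_abs)
  qed
qed

text \<open>Approximating test functions may have norms slightly above 1. They are divided by
  numbers \<open>\<nu> k \<ge> 1\<close> that tend to 1, the uniform bound is applied, and it passes
  to \<open>u\<close> along an almost everywhere convergent subsequence.\<close>

theorem adams_sup_finite:
  fixes p \<gamma> \<alpha> :: real
  assumes n: "2 < CARD('n::finite)" and p: "1 < p" "p < real CARD('n) / 2" and \<gamma>: "0 \<le> \<gamma>" "\<gamma> < real CARD('n)"
    and \<alpha>: "0 \<le> \<alpha>" "\<alpha> \<le> beta_gamma \<gamma> TYPE('n)"
  shows "adams_sup TYPE('n) p \<gamma> \<alpha> < \<infinity>"
proof -
  define q where "q = real CARD('n) / 2"
  define s where "s = pstar CARD('n) p"
  have q: "1 < q" using p by (simp add: q_def)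
  have s: "0 < s" using p by (simp add: s_def pstar_def)
  obtain C where C: "0 \<le> C" "\<And>\<phi> :: real ^ 'n \<Rightarrow> real. \<phi> \<in> test_functions \<Longrightarrow>
     Lnorm q (laplacian \<phi>) powr q + Lnorm p (laplacian \<phi>) powr q \<le> 1 \<Longrightarrow>
     (\<integral>\<^sup>+x. ennreal (Phi CARD('n) \<alpha> (j0 CARD('n) p) (\<phi> x) * (1 / norm x powr \<gamma>)) \<partial>lebesgue) \<le> ennreal C"
    using test_function_exponential_bound[where 'n='n, OF n p \<gamma> \<alpha>] unfolding q_def by blast
  have "(\<integral>\<^sup>+x. ennreal (Phi CARD('n) \<alpha> (j0 CARD('n) p) (u x) / norm x powr \<gamma>) \<partial>lebesgue) \<le> ennreal C"
    if u: "u \<in> E_space p" and u1: "E_norm p u \<le> 1" for u :: "real ^ 'n \<Rightarrow> real"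
  proof -
    obtain \<phi> f where \<phi>: "\<And>k::nat. \<phi> k \<in> test_functions" and f: "is_distr_laplacian u f"
      and fL: "f \<in> Lspace q" "f \<in> Lspace p"
      and gq: "(\<lambda>k. Lnorm q (\<lambda>x. laplacian (\<phi> k) x - f x)) \<longlonglongrightarrow> 0"
      and gp: "(\<lambda>k. Lnorm p (\<lambda>x. laplacian (\<phi> k) x - f x)) \<longlonglongrightarrow> 0"
      and \<phi>u: "(\<lambda>k. Lnorm s (\<lambda>x. \<phi> k x - u x)) \<longlonglongrightarrow> 0"
      using E_space_limit[OF p u] unfolding q_def s_def by blast
    define A where "A = Lnorm q f"
    define B where "B = Lnorm p f"
    define a where "a = (\<lambda>k. Lnorm q (\<lambda>x. laplacian (\<phi> k) x - f x))"
    define b where "b = (\<lambda>k. Lnorm p (\<lambda>x. laplacian (\<phi> k) x - f x))"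
    \<comment> \<open>By the triangle inequality for each exponent this bounds the norm of
      \<open>\<phi> k\<close>; as \<open>a k\<close> and \<open>b k\<close> tend to 0 it tends to
      the norm of \<open>u\<close>, which is at most 1.\<close>
    define \<mu> where "\<mu> = (\<lambda>k. ((A + a k) powr q + (B + b k) powr q) powr (1/q))"
    define \<nu> where "\<nu> = (\<lambda>k. max 1 (\<mu> k))"
    have nn: "0 \<le> A" "0 \<le> B" "0 \<le> a k" "0 \<le> b k" for k by (simp_all add: A_def B_def a_def b_def Lnorm_nonneg)
    have \<Delta>: "laplacian (\<phi> k) \<in> test_functions" for k by (intro test_function_laplacian \<phi>)
    have split: "Lnorm t (laplacian (\<phi> k)) \<le> Lnorm t f + Lnorm t (\<lambda>x. laplacian (\<phi> k) x - f x)"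
      if "f \<in> Lspace t" "1 < t" for t k
    proof -
      have "(\<lambda>x. laplacian (\<phi> k) x - f x) \<in> Lspace t"
        using that by (intro Lspace_diff(1)[OF test_function_Lspace[OF \<Delta>] that(1)]) auto
      from Lspace_add(2)[OF that(1) this] that show ?thesis by simp
    qed
    have ml: "\<mu> \<longlonglongrightarrow> ((A + 0) powr q + (B + 0) powr q) powr (1/q)"
      unfolding \<mu>_def
    proof (rule tendsto_powr'[OF tendsto_add tendsto_const])
      show "(\<lambda>k. (A + a k) powr q) \<longlonglongrightarrow> (A + 0) powr q"
        using gq nn q by (intro tendsto_powr'[OF tendsto_add[OF tendsto_const] tendsto_const]) (auto simp: a_def)
      show "(\<lambda>k. (B + b k) powr q) \<longlonglongrightarrow> (B + 0) powr q"
        using gp nn q by (intro tendsto_powr'[OF tendsto_add[OF tendsto_const] tendsto_const]) (auto simp: b_def)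
    qed (use q in auto)
    have "mixed_norm p f \<le> 1" using u1 E_norm_eq[OF f] by simp
    moreover have "mixed_norm p f = ((A + 0) powr q + (B + 0) powr q) powr (1/q)"
      by (simp add: mixed_norm_def Let_def A_def B_def q_def)
    ultimately have "max 1 (((A + 0) powr q + (B + 0) powr q) powr (1/q)) = 1" by simp
    then have \<nu>l: "\<nu> \<longlonglongrightarrow> 1" unfolding \<nu>_def using tendsto_max[OF tendsto_const[of 1] ml] by simp
    have \<nu>1: "1 \<le> \<nu> k" "\<mu> k \<le> \<nu> k" for k by (auto simp: \<nu>_def)
    define \<psi> where "\<psi> = (\<lambda>k x. (1 / \<nu> k) * \<phi> k x)"
    have \<psi>: "\<psi> k \<in> test_functions" for k unfolding \<psi>_def by (intro test_function_cmult \<phi>)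
    have \<psi>C: "(\<integral>\<^sup>+x. ennreal (Phi CARD('n) \<alpha> (j0 CARD('n) p) (\<psi> k x) * (1 / norm x powr \<gamma>)) \<partial>lebesgue) \<le> ennreal C" for k
    proof (rule C(2)[OF \<psi>])
      have L: "laplacian (\<psi> k) = (\<lambda>x. (1 / \<nu> k) * laplacian (\<phi> k) x)"
        unfolding \<psi>_def by (rule laplacian_cmult[OF \<phi>])
      have Ln: "Lnorm t (laplacian (\<psi> k)) = Lnorm t (laplacian (\<phi> k)) / \<nu> k" if "0 < t" for t
        unfolding L using Lspace_cmult(2)[OF test_function_Lspace[OF \<Delta> that] that, of "1 / \<nu> k"] \<nu>1[of k] by simp
      have "Lnorm q (laplacian (\<phi> k)) powr q + Lnorm p (laplacian (\<phi> k)) powr q \<le> (A + a k) powr q + (B + b k) powr q"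
        using split[OF fL(1) q] split[OF fL(2) p(1)] q
        by (intro add_mono powr_mono2) (auto simp: A_def B_def a_def b_def Lnorm_nonneg)
      also have "\<dots> = \<mu> k powr q" using q by (simp add: \<mu>_def powr_powr)
      also have "\<dots> \<le> \<nu> k powr q" using \<nu>1[of k] q by (intro powr_mono2) (auto simp: \<mu>_def)
      finally have le: "Lnorm q (laplacian (\<phi> k)) powr q + Lnorm p (laplacian (\<phi> k)) powr q \<le> \<nu> k powr q" .
      have "Lnorm q (laplacian (\<psi> k)) powr q + Lnorm p (laplacian (\<psi> k)) powr q
        = (Lnorm q (laplacian (\<phi> k)) powr q + Lnorm p (laplacian (\<phi> k)) powr q) / \<nu> k powr q"
        using q p by (simp add: Ln powr_divide add_divide_distrib)
      also have "\<dots> \<le> 1" using le \<nu>1[of k] by (simp add: divide_le_eq)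
      finally show "Lnorm q (laplacian (\<psi> k)) powr q + Lnorm p (laplacian (\<psi> k)) powr q \<le> 1" .
    qed
    have uL: "u \<in> Lspace s" using u by (simp add: E_space_def s_def)
    have s1: "1 \<le> s"
    proof -
      have "1 * (real CARD('n) - 2 * p) \<le> p * real CARD('n)" using p by (intro mult_mono) auto
      then show ?thesis using p unfolding s_def pstar_def by (simp add: mult.commute)
    qed
    have dL: "(\<lambda>x. \<phi> k x - u x) \<in> Lspace s" for k
      using s s1 by (intro Lspace_diff(1)[OF test_function_Lspace[OF \<phi>] uL]) auto
    \<comment> \<open>The \<open>s\<close>-th powers of the differences tend to 0 in mean, hence
      almost everywhere along a subsequence.\<close>
    obtain r where r: "strict_mono (r :: nat \<Rightarrow> nat)" "AE x in lebesgue. (\<lambda>k. \<bar>\<phi> (r k) x - u x\<bar> powr s) \<longlonglongrightarrow> 0"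
    proof -
      have i: "integrable lebesgue (\<lambda>x. \<bar>\<phi> k x - u x\<bar> powr s)" for k using dL by (simp add: Lspace_def)
      have "(\<lambda>k. Lnorm s (\<lambda>x. \<phi> k x - u x) powr s) \<longlonglongrightarrow> 0 powr s"
        using s by (intro tendsto_powr'[OF \<phi>u tendsto_const]) (auto simp: Lnorm_nonneg)
      then have "(\<lambda>k. LINT x|lebesgue. norm (\<bar>\<phi> k x - u x\<bar> powr s)) \<longlonglongrightarrow> 0" by (simp add: Lnorm_powr[OF s])
      from tendsto_L1_AE_subseq[OF i this] show ?thesis using that by blast
    qed
    have "AE x in lebesgue. (\<lambda>k. \<psi> (r k) x) \<longlonglongrightarrow> u x"
      using r(2)
    proof eventually_elim
      fix x assume "(\<lambda>k. \<bar>\<phi> (r k) x - u x\<bar> powr s) \<longlonglongrightarrow> 0"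
      then have "(\<lambda>k. (\<bar>\<phi> (r k) x - u x\<bar> powr s) powr (1/s)) \<longlonglongrightarrow> 0 powr (1/s)"
        using s by (intro tendsto_powr'[OF _ tendsto_const]) auto
      then have "(\<lambda>k. \<bar>\<phi> (r k) x - u x\<bar>) \<longlonglongrightarrow> 0" using s by (simp add: powr_powr)
      then have "(\<lambda>k. \<phi> (r k) x - u x) \<longlonglongrightarrow> 0" by (simp add: tendsto_rabs_zero_iff)
      then have 1: "(\<lambda>k. \<phi> (r k) x) \<longlonglongrightarrow> u x" by (rule LIM_zero_cancel)
      have "(\<lambda>k. \<nu> (r k)) \<longlonglongrightarrow> 1" using LIMSEQ_subseq_LIMSEQ[OF \<nu>l r(1)] by (simp add: o_def)
      then have "(\<lambda>k. (1 / \<nu> (r k)) * \<phi> (r k) x) \<longlonglongrightarrow> (1 / 1) * u x"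
        using 1 by (intro tendsto_mult tendsto_divide tendsto_const) auto
      then show "(\<lambda>k. \<psi> (r k) x) \<longlonglongrightarrow> u x" by (simp add: \<psi>_def)
    qed
    then have "(\<integral>\<^sup>+x. ennreal (Phi CARD('n) \<alpha> (j0 CARD('n) p) (u x) * (1 / norm x powr \<gamma>)) \<partial>lebesgue) \<le> ennreal C"
    proof (rule nn_integral_AE_limit_le[where h="\<lambda>k. \<psi> (r k)", rotated 3])
      show "\<forall>\<^sub>F k in sequentially. (\<integral>\<^sup>+x. ennreal (Phi CARD('n) \<alpha> (j0 CARD('n) p) (\<psi> (r k) x) * (1 / norm x powr \<gamma>)) \<partial>lebesgue) \<le> ennreal C"
        using \<psi>C by simp
      show "\<psi> (r k) \<in> borel_measurable lebesgue" for k by (intro test_function_lebesgue_measurable \<psi>)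
      show "(\<lambda>x::real ^ 'n. 1 / norm x powr \<gamma>) \<in> borel_measurable lebesgue"
        by (rule measurable_completion) measurable
      show "continuous_on UNIV (Phi CARD('n) \<alpha> (j0 CARD('n) p))" by (rule continuous_on_Phi[OF n])
    qed
    then show ?thesis by simp
  qed
  then have "adams_sup TYPE('n) p \<gamma> \<alpha> \<le> ennreal C"
    unfolding adams_sup_def by (intro SUP_least) auto
  then show ?thesis by (rule le_less_trans) simp
qed

section \<open>Sharpness\<close>

lemma test_function_in_E_space:
  fixes \<phi> :: "real ^ 'n::finite \<Rightarrow> real"
  assumes p: "1 < p" "p < real CARD('n) / 2" and \<phi>: "\<phi> \<in> test_functions"
  shows "\<phi> \<in> E_space p" "E_norm p \<phi> = mixed_norm p (laplacian \<phi>)"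
proof -
  have s: "0 < pstar CARD('n) p" using p by (simp add: pstar_def)
  have "laplacian (\<lambda>x. \<phi> x - \<phi> x) = (\<lambda>x. 0)" unfolding laplacian_diff[OF \<phi> \<phi>] by simp
  then have "mixed_norm p (laplacian (\<lambda>x. \<phi> x - \<phi> x)) = 0" by (simp add: mixed_norm_def Let_def Lnorm_def)
  moreover have "Lnorm (pstar CARD('n) p) (\<lambda>x. \<phi> x - \<phi> x) = 0" by (simp add: Lnorm_def)
  ultimately show "\<phi> \<in> E_space p"
    unfolding E_space_def using test_function_Lspace[OF \<phi> s] \<phi> by (auto intro!: exI[of _ "\<lambda>k. \<phi>"])
  show "E_norm p \<phi> = mixed_norm p (laplacian \<phi>)" by (rule E_norm_eq[OF is_distr_laplacian_test[OF \<phi>]])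
qed

text \<open>To be evaluated at \<open>s = |x|^2\<close>; the factor \<open>exp 1\<close> makes
  \<open>cutoff 0 = 1\<close>. Since \<open>1 - s^2\<close> has zero derivative at
  \<open>s = 0\<close>, so has the cutoff, and this tames the logarithm that multiplies its
  derivative.\<close>

definition cutoff :: "real \<Rightarrow> real" where
  "cutoff s = exp 1 * flat 0 (1 - s\<^sup>2)"

definition cutoff' :: "real \<Rightarrow> real" where
  "cutoff' s = exp 1 * (-2 * s * flat 2 (1 - s\<^sup>2))"

definition cutoff'' :: "real \<Rightarrow> real" where
  "cutoff'' s = exp 1 * (-2 * flat 2 (1 - s\<^sup>2) + 4 * s\<^sup>2 * (flat 4 (1 - s\<^sup>2) - 2 * flat 3 (1 - s\<^sup>2)))"

lemma DERIV_flat_cutoff: "((\<lambda>s. flat k (1 - s\<^sup>2)) has_real_derivative (flat (k + 2) (1 - s\<^sup>2) - real k * flat (k + 1) (1 - s\<^sup>2)) * (- (2 * s))) (at s)"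
  by (rule DERIV_chain2[where f="flat k" and g="\<lambda>s. 1 - s\<^sup>2", OF DERIV_flat]) (auto intro!: derivative_eq_intros)

lemma DERIV_cutoff: "(cutoff has_real_derivative cutoff' s) (at s)"
  unfolding cutoff_def[abs_def] cutoff'_def
  using DERIV_cmult[OF DERIV_flat_cutoff[of 0 s], of "exp 1"] by (simp add: mult_ac numeral_2_eq_2)

lemma DERIV_cutoff': "(cutoff' has_real_derivative cutoff'' s) (at s)"
proof -
  have "((\<lambda>s. -2 * s) has_real_derivative -2) (at s)" by (auto intro!: derivative_eq_intros)
  moreover have "(2::nat) + 1 = 3" "(2::nat) + 2 = 4" by simp_all
  note D = DERIV_flat_cutoff[of 2 s, unfolded this]
  ultimately have "((\<lambda>s. exp 1 * (-2 * s * flat 2 (1 - s\<^sup>2))) has_real_derivative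
      exp 1 * (-2 * flat 2 (1 - s\<^sup>2) + (flat 4 (1 - s\<^sup>2) - real 2 * flat 3 (1 - s\<^sup>2)) * (- (2 * s)) * (-2 * s))) (at s)"
    by (intro DERIV_cmult DERIV_mult D)
  then
  show ?thesis unfolding cutoff'_def[abs_def] cutoff''_def
    by (rule DERIV_cong) (simp add: power2_eq_square algebra_simps)
qed

lemma cutoff_bounds: "0 \<le> cutoff s" "cutoff s \<le> 1"
proof -
  show "0 \<le> cutoff s" by (simp add: cutoff_def flat_nonneg)
  show "cutoff s \<le> 1"
  proof (cases "s\<^sup>2 < 1")
    case True
    then have "1 \<le> 1 / (1 - s\<^sup>2)" by simp
    then have "exp (1 - 1 / (1 - s\<^sup>2)) \<le> 1" by simp
    then show ?thesis using True by (simp add: cutoff_def flat_def exp_diff exp_minus field_simps)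
  qed (simp add: cutoff_def flat_def)
qed

lemma cutoff_outside: "1 \<le> s \<Longrightarrow> cutoff s = 0 \<and> cutoff' s = 0 \<and> cutoff'' s = 0"
proof -
  assume "1 \<le> s"
  then have "\<not> 0 < 1 - s\<^sup>2" using one_le_power[of s 2] by linarith
  then show ?thesis by (simp add: cutoff_def cutoff'_def cutoff''_def flat_def)
qed

lemma cutoff_tendsto: "cutoff \<midarrow>0\<rightarrow> 1"
proof -
  have "cutoff 0 = 1" by (simp add: cutoff_def flat_def exp_minus)
  then show ?thesis using DERIV_isCont[OF DERIV_cutoff, of 0] by (simp add: isCont_def)
qed

text \<open>The factor \<open>s\<close> in the first bound matters: in the Laplacian of the product,
  \<open>cutoff'\<close> meets the logarithm without any other factor \<open>s\<close>, whereas
  \<open>cutoff''\<close> already comes with one.\<close>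

lemma cutoff_deriv_bound:
  obtains M where "0 < M" "\<And>s. 0 \<le> s \<Longrightarrow> s \<le> 1 \<Longrightarrow> \<bar>cutoff' s\<bar> \<le> M * s \<and> \<bar>cutoff'' s\<bar> \<le> M"
proof -
  have "continuous_on {0..1} (\<lambda>s. flat k (1 - s\<^sup>2))" for k
    by (intro DERIV_continuous_on[OF has_field_derivative_at_within[OF DERIV_flat_cutoff]])
  then have "compact ((\<lambda>s. flat k (1 - s\<^sup>2)) ` {0..1})" for k by (intro compact_continuous_image) auto
  then have "bounded ((\<lambda>s. flat k (1 - s\<^sup>2)) ` {0..1})" for k by (rule compact_imp_bounded)
  then have "\<forall>k. \<exists>B. \<forall>s\<in>{0..1}. \<bar>flat k (1 - s\<^sup>2)\<bar> \<le> B" unfolding bounded_iff by auto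
  then obtain B where B: "\<And>k s. 0 \<le> s \<Longrightarrow> s \<le> 1 \<Longrightarrow> \<bar>flat k (1 - s\<^sup>2)\<bar> \<le> B k" by (metis atLeastAtMost_iff)
  have B0: "0 \<le> B k" for k using B[of 0 k] by (meson abs_ge_zero le_numeral_extra(3) order.trans zero_le_one)
  define M where "M = exp 1 * (2 * B 2 + 4 * B 4 + 8 * B 3) + 1"
  show ?thesis
  proof (rule that[of M])
    show "0 < M" using B0 unfolding M_def by (intro add_nonneg_pos mult_nonneg_nonneg add_nonneg_nonneg) auto
    fix s :: real assume s: "0 \<le> s" "s \<le> 1"
    have "\<bar>cutoff' s\<bar> = exp 1 * (2 * \<bar>flat 2 (1 - s\<^sup>2)\<bar>) * s" using s by (simp add: cutoff'_def abs_mult)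
    also have "\<dots> \<le> M * s"
      using s B[OF s, of 2] B0[of 4] B0[of 3]
      by (intro mult_right_mono) (auto simp: M_def intro!: add_increasing2 mult_left_mono)
    finally have 1: "\<bar>cutoff' s\<bar> \<le> M * s" .
    have s2: "s\<^sup>2 \<le> 1" using s by (simp add: power_le_one)
    have "\<bar>-2 * flat 2 (1 - s\<^sup>2) + 4 * s\<^sup>2 * (flat 4 (1 - s\<^sup>2) - 2 * flat 3 (1 - s\<^sup>2))\<bar> \<le> 2 * B 2 + 4 * 1 * (B 4 + 2 * B 3)"
    proof -
      have "\<bar>4 * s\<^sup>2 * (flat 4 (1 - s\<^sup>2) - 2 * flat 3 (1 - s\<^sup>2))\<bar> \<le> 4 * 1 * (B 4 + 2 * B 3)"
        unfolding abs_mult using s2 B[OF s, of 4] B[OF s, of 3] B0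
        by (intro mult_mono) auto
      then show ?thesis using B[OF s, of 2] by linarith
    qed
    then have "\<bar>cutoff'' s\<bar> \<le> exp 1 * (2 * B 2 + 4 * 1 * (B 4 + 2 * B 3))"
      unfolding cutoff''_def abs_mult[of "exp 1"] by (simp add: mult_left_mono)
    also have "\<dots> \<le> M" by (simp add: M_def algebra_simps)
    finally show "\<bar>cutoff' s\<bar> \<le> M * s \<and> \<bar>cutoff'' s\<bar> \<le> M" using 1 by simp
  qed
qed

text \<open>A smooth truncation of \<open>ln (1 / \<bar>x\<bar>)\<close>, of height about \<open>ln (1 / \<epsilon>)\<close> on the ball of radius \<open>\<epsilon>\<close>.\<close>

definition adams_function :: "real \<Rightarrow> 'a::real_inner \<Rightarrow> real" where
  "adams_function \<epsilon> x = cutoff (x \<bullet> x) * (- (1/2) * ln (x \<bullet> x + \<epsilon>\<^sup>2))"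

lemma adams_function_test:
  fixes \<epsilon> :: real
  assumes "0 < \<epsilon>"
  shows "(adams_function \<epsilon> :: 'a::euclidean_space \<Rightarrow> real) \<in> test_functions"
proof (rule test_functionsI)
  have Cx: "Ck k (\<lambda>x::'a. x \<bullet> x)" for k using Ck_sq_dist[of k "0::'a"] by simp
  show "Ck k (adams_function \<epsilon> :: 'a \<Rightarrow> real)" for k
    unfolding adams_function_def[abs_def] cutoff_def power2_eq_square using assms
    by (intro Ck_mult Ck_const Ck_flat Ck_diff Ck_ln Ck_add Cx) (auto intro: add_nonneg_pos)
  have "{x::'a. adams_function \<epsilon> x \<noteq> 0} \<subseteq> cball 0 1"
  proof
    fix x :: 'a assume "x \<in> {x. adams_function \<epsilon> x \<noteq> 0}"
    then have "\<not> 1 \<le> x \<bullet> x" using cutoff_outside[of "x \<bullet> x"] by (auto simp: adams_function_def)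
    then show "x \<in> cball 0 1" using one_le_power[of "norm x" 2] by (force simp: power2_norm_eq_inner)
  qed
  then show "bounded {x::'a. adams_function \<epsilon> x \<noteq> 0}" using bounded_cball bounded_subset by blast
qed

lemma abs_mult_ln_le:
  fixes y :: real
  assumes "0 < y" "y \<le> 2"
  shows "y * \<bar>ln y\<bar> \<le> 2"
proof (cases "y \<le> 1")
  case True
  have "- ln y \<le> 1 / y - 1" using ln_le_minus_one[of "1/y"] assms by (simp add: ln_div)
  then have "y * (- ln y) \<le> y * (1 / y - 1)" using assms by (intro mult_left_mono) auto
  also have "\<dots> \<le> 2" using assms by (simp add: right_diff_distrib)
  finally show ?thesis using True assms by simp
next
  case False
  have "ln y \<le> y - 1" using ln_le_minus_one[of y] assms by simp
  then have "y * ln y \<le> 2 * 1" using assms False by (intro mult_mono) auto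
  then show ?thesis using False assms by simp
qed

text \<open>Without cutoff, the Laplacian of \<open>- (1/2) ln (|x|^2 + \<epsilon>^2)\<close> is
  \<open>-(n - 2)/y - 2 \<epsilon>^2 / y^2\<close> with \<open>y = |x|^2 + \<epsilon>^2\<close>.
  Every term containing a derivative of the cutoff carries a factor \<open>|x|^2\<close>, from the
  formula or from the bound on \<open>cutoff'\<close>; it compensates the logarithm and
  \<open>1/y\<close> uniformly in \<open>\<epsilon>\<close>.\<close>

lemma laplacian_adams_function_le:
  obtains M where "0 < M" "\<And>\<epsilon> (x :: real ^ 'n::finite). 0 < \<epsilon> \<Longrightarrow> \<epsilon> \<le> 1 \<Longrightarrow> 2 \<le> CARD('n) \<Longrightarrow>
    \<bar>laplacian (adams_function \<epsilon>) x\<bar> \<le>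
      (if x \<bullet> x < 1 then (real CARD('n) - 2) / (x \<bullet> x + \<epsilon>\<^sup>2) + (2 * \<epsilon>\<^sup>2 / (x \<bullet> x + \<epsilon>\<^sup>2)\<^sup>2 + M) else 0)"
proof -
  define N where "N = real CARD('n)"
  obtain M where M: "0 < M" "\<And>s. 0 \<le> s \<Longrightarrow> s \<le> 1 \<Longrightarrow> \<bar>cutoff' s\<bar> \<le> M * s \<and> \<bar>cutoff'' s\<bar> \<le> M"
    using cutoff_deriv_bound by blast
  show ?thesis
  \<comment> \<open>The three cutoff terms contribute \<open>2 * N * M\<close>, \<open>4 * M\<close>
    and \<open>4 * M\<close>.\<close>
  proof (rule that[of "2 * N * M + 8 * M"])
    show "0 < 2 * N * M + 8 * M" using M(1) by (simp add: N_def add_nonneg_pos)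
    fix \<epsilon> :: real and x :: "real ^ 'n" assume \<epsilon>: "0 < \<epsilon>" "\<epsilon> \<le> 1" and n: "2 \<le> CARD('n)"
    have N: "2 \<le> N" using n by (simp add: N_def)
    define l where "l = (\<lambda>s. - (1/2) * ln (s + \<epsilon>\<^sup>2))"
    define l1 where "l1 = (\<lambda>s. - (1/2) * (1 / (s + \<epsilon>\<^sup>2)))"
    define l2 where "l2 = (\<lambda>s. (1/2) * (1 / (s + \<epsilon>\<^sup>2)\<^sup>2))"
    have pos: "0 < s + \<epsilon>\<^sup>2" if "0 \<le> s" for s using that \<epsilon> by (simp add: add_nonneg_pos)
    have dl: "(l has_real_derivative l1 s) (at s)" if "0 \<le> s" for s
      unfolding l_def l1_def using pos[OF that] by (auto intro!: derivative_eq_intros simp: field_simps)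
    have dl1: "(l1 has_real_derivative l2 s) (at s)" if "0 \<le> s" for s
    proof -
      have "((\<lambda>s. 1 / (s + \<epsilon>\<^sup>2)) has_real_derivative - (1 / (s + \<epsilon>\<^sup>2)\<^sup>2)) (at s)"
        using pos[OF that] by (auto intro!: derivative_eq_intros simp: power2_eq_square)
      from DERIV_cmult[OF this, of "- (1/2)"] show ?thesis unfolding l1_def l2_def by simp
    qed
    define F1 where "F1 = (\<lambda>s. cutoff' s * l s + l1 s * cutoff s)"
    define F2 where "F2 = (\<lambda>s. (cutoff'' s * l s + l1 s * cutoff' s) + (l2 s * cutoff s + cutoff' s * l1 s))"
    have dF: "((\<lambda>s. cutoff s * l s) has_real_derivative F1 s) (at s)" if "0 \<le> s" for s
      unfolding F1_def by (rule DERIV_mult[OF DERIV_cutoff dl[OF that]])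
    have dF1: "(F1 has_real_derivative F2 s) (at s)" if "0 \<le> s" for s
      unfolding F1_def F2_def by (rule DERIV_add[OF DERIV_mult[OF DERIV_cutoff' dl[OF that]] DERIV_mult[OF dl1[OF that] DERIV_cutoff]])
    define \<rho> where "\<rho> = x \<bullet> x"
    have \<rho>: "0 \<le> \<rho>" by (simp add: \<rho>_def)
    have "(adams_function \<epsilon> :: real ^ 'n \<Rightarrow> real) = (\<lambda>y. cutoff ((y - 0) \<bullet> (y - 0)) * l ((y - 0) \<bullet> (y - 0)))"
      by (simp add: adams_function_def fun_eq_iff l_def)
    then have L: "laplacian (adams_function \<epsilon>) x = 2 * N * F1 \<rho> + 4 * \<rho> * F2 \<rho>"
      using laplacian_radial[of "\<lambda>s. cutoff s * l s" F1 F2 0 x, OF dF dF1] by (simp add: N_def \<rho>_def)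
    show "\<bar>laplacian (adams_function \<epsilon>) x\<bar> \<le>
      (if x \<bullet> x < 1 then (real CARD('n) - 2) / (x \<bullet> x + \<epsilon>\<^sup>2) + (2 * \<epsilon>\<^sup>2 / (x \<bullet> x + \<epsilon>\<^sup>2)\<^sup>2 + (2 * N * M + 8 * M)) else 0)"
    proof (cases "\<rho> < 1")
      case False
      then have "cutoff \<rho> = 0" "cutoff' \<rho> = 0" "cutoff'' \<rho> = 0" using cutoff_outside[of \<rho>] by auto
      then have "laplacian (adams_function \<epsilon>) x = 0" unfolding L F1_def F2_def by simp
      then show ?thesis using False by (simp add: \<rho>_def)
    next
      case True
      define y where "y = \<rho> + \<epsilon>\<^sup>2"
      have "\<epsilon>\<^sup>2 \<le> 1" using \<epsilon> by (simp add: power_le_one)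
      then have y: "0 < y" "y \<le> 2" "\<rho> \<le> y" using pos[OF \<rho>] True by (auto simp: y_def)
      have M1: "\<bar>cutoff' \<rho>\<bar> \<le> M * \<rho>" "\<bar>cutoff'' \<rho>\<bar> \<le> M" using M(2)[of \<rho>] \<rho> True by auto
      have "\<rho> * \<bar>l \<rho>\<bar> = (1/2) * (\<rho> * \<bar>ln y\<bar>)" by (simp add: l_def y_def abs_mult)
      also have "\<dots> \<le> (1/2) * (y * \<bar>ln y\<bar>)" using y by (intro mult_left_mono mult_right_mono) auto
      also have "\<dots> \<le> 1" using abs_mult_ln_le[OF y(1,2)] by simp
      finally have \<rho>l: "\<rho> * \<bar>l \<rho>\<bar> \<le> 1" .
      have \<rho>l1: "\<rho> * \<bar>l1 \<rho>\<bar> \<le> 1/2"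
      proof -
        have "\<bar>l1 \<rho>\<bar> = (1/2) * (1 / y)" using y(1) unfolding l1_def y_def[symmetric] abs_mult by simp
        moreover have "\<rho> * (1 / y) \<le> 1" using y by simp
        ultimately show ?thesis by simp
      qed
      have "laplacian (adams_function \<epsilon>) x = cutoff \<rho> * (2 * N * l1 \<rho> + 4 * \<rho> * l2 \<rho>) + 2 * N * (cutoff' \<rho> * l \<rho>) + 4 * (\<rho> * (cutoff'' \<rho> * l \<rho>)) + 8 * (\<rho> * (cutoff' \<rho> * l1 \<rho>))"
        unfolding L F1_def F2_def by (simp add: algebra_simps)
      moreover have "\<bar>cutoff \<rho> * (2 * N * l1 \<rho> + 4 * \<rho> * l2 \<rho>)\<bar> \<le> (N - 2) / y + 2 * \<epsilon>\<^sup>2 / y\<^sup>2"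
      proof -
        have ly: "l1 \<rho> = - (1/2) * (1 / y)" "l2 \<rho> = (1/2) * (1 / y\<^sup>2)"
          unfolding l1_def l2_def y_def by (rule refl)+
        have "\<rho> = y - \<epsilon>\<^sup>2" by (simp add: y_def)
        then have 1: "4 * \<rho> * l2 \<rho> = 4 * (y - \<epsilon>\<^sup>2) * ((1/2) * (1 / y\<^sup>2))" using ly by metis
        have "2 * N * l1 \<rho> + 4 * \<rho> * l2 \<rho> = - (N / y) + 2 * (y - \<epsilon>\<^sup>2) / y\<^sup>2"
          unfolding 1 ly(1) using y(1) by (simp add: divide_simps)
        also have "\<dots> = - ((N - 2) / y + 2 * \<epsilon>\<^sup>2 / y\<^sup>2)"
          using y by (simp add: field_simps power2_eq_square)
        finally have e0: "2 * N * l1 \<rho> + 4 * \<rho> * l2 \<rho> = - ((N - 2) / y + 2 * \<epsilon>\<^sup>2 / y\<^sup>2)" .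
        have "0 \<le> (N - 2) / y + 2 * \<epsilon>\<^sup>2 / y\<^sup>2" using N y by simp
        then have e: "\<bar>2 * N * l1 \<rho> + 4 * \<rho> * l2 \<rho>\<bar> = (N - 2) / y + 2 * \<epsilon>\<^sup>2 / y\<^sup>2"
          unfolding e0 by (simp only: abs_minus_cancel abs_of_nonneg)
        have "\<bar>cutoff \<rho>\<bar> * \<bar>2 * N * l1 \<rho> + 4 * \<rho> * l2 \<rho>\<bar> \<le> 1 * \<bar>2 * N * l1 \<rho> + 4 * \<rho> * l2 \<rho>\<bar>"
          using cutoff_bounds[of \<rho>] by (intro mult_right_mono) auto
        then show ?thesis unfolding e by (simp only: abs_mult e mult_1_left)
      qed
      moreover have "\<bar>2 * N * (cutoff' \<rho> * l \<rho>)\<bar> \<le> 2 * N * M"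
      proof -
        have "\<bar>cutoff' \<rho>\<bar> * \<bar>l \<rho>\<bar> \<le> M * \<rho> * \<bar>l \<rho>\<bar>" using M1 by (intro mult_right_mono) auto
        also have "\<dots> \<le> M * 1" unfolding mult.assoc using \<rho>l M by (intro mult_left_mono) auto
        finally show ?thesis using N by (simp add: abs_mult)
      qed
      moreover have "\<bar>4 * (\<rho> * (cutoff'' \<rho> * l \<rho>))\<bar> \<le> 4 * M"
      proof -
        have "\<bar>cutoff'' \<rho>\<bar> * (\<rho> * \<bar>l \<rho>\<bar>) \<le> M * 1" using M1 M \<rho>l \<rho> by (intro mult_mono) auto
        then show ?thesis using \<rho> by (simp add: abs_mult mult_ac)
      qed
      moreover have "\<bar>8 * (\<rho> * (cutoff' \<rho> * l1 \<rho>))\<bar> \<le> 4 * M"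
      proof -
        have "M * \<rho> \<le> M * 1" using True M by (intro mult_left_mono) auto
        then have "\<bar>cutoff' \<rho>\<bar> \<le> M" using M1(1) by linarith
        then have "\<bar>cutoff' \<rho>\<bar> * (\<rho> * \<bar>l1 \<rho>\<bar>) \<le> M * (1/2)" using M(1) \<rho>l1 \<rho> by (intro mult_mono) auto
        then show ?thesis using \<rho> by (simp add: abs_mult mult_ac)
      qed
      ultimately have "\<bar>laplacian (adams_function \<epsilon>) x\<bar> \<le> (N - 2) / y + 2 * \<epsilon>\<^sup>2 / y\<^sup>2 + 2 * N * M + 4 * M + 4 * M" by linarith
      then show ?thesis using True by (simp add: y_def \<rho>_def N_def)
    qed
  qed
qed

section \<open>Radial integrals for the Laplacian of the test family\<close>

lemma nn_integral_radial_le: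
  fixes f :: "'a::euclidean_space \<Rightarrow> ennreal" and g :: "real \<Rightarrow> ennreal"
  assumes [measurable]: "g \<in> borel_measurable borel"
    and le: "\<And>x. x \<noteq> 0 \<Longrightarrow> f x \<le> g (unit_ball_vol (real DIM('a)) * norm x ^ DIM('a))"
  shows "(\<integral>\<^sup>+x. f x \<partial>lborel) \<le> (\<integral>\<^sup>+t. g t * indicator {0<..} t \<partial>lborel)"
proof -
  have "(\<integral>\<^sup>+x. f x \<partial>lborel) \<le> (\<integral>\<^sup>+(x::'a). g (unit_ball_vol (real DIM('a)) * norm x ^ DIM('a)) \<partial>lborel)"
    using AE_lborel_singleton[of "0::'a"] by (intro nn_integral_mono_AE) (auto intro: le elim!: eventually_mono)
  then show ?thesis by (simp add: nn_integral_radial)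
qed

lemma inverse_square_powr_half:
  fixes s :: real
  assumes "0 < s"
  shows "(1 / s\<^sup>2) powr (real n / 2) = 1 / s ^ n"
proof -
  have "1 / s\<^sup>2 = s powr (- 2)" using assms by (simp add: powr_minus_divide)
  then have "(1 / s\<^sup>2) powr (real n / 2) = s powr (- real n)" by (simp only: powr_powr) simp
  then show ?thesis using assms by (simp add: powr_minus_divide powr_realpow)
qed

text \<open>On the ball of radius \<open>\<epsilon>\<close> the integrand is at most
  \<open>\<epsilon> powr (-n)\<close>, which contributes \<open>V\<close>; outside it is at most
  \<open>|x| powr (-n)\<close>, whose integral over the shell is
  \<open>n V ln (1/\<epsilon>)\<close>. This is the only contribution that grows.\<close>

lemma nn_integral_log_part:
  fixes \<epsilon> :: real
  assumes \<epsilon>: "0 < \<epsilon>" "\<epsilon> \<le> 1"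
  defines "N \<equiv> real CARD('n::finite)" and "V \<equiv> unit_ball_vol (real CARD('n))"
  shows "(\<integral>\<^sup>+(x::real ^ 'n). ennreal (if x \<bullet> x < 1 then (1 / (x \<bullet> x + \<epsilon>\<^sup>2)) powr (N / 2) else 0) \<partial>lborel) \<le> ennreal (V + V * (N * ln (1 / \<epsilon>)))"
proof -
  let ?n = "CARD('n)"
  have V: "0 < V" by (simp add: V_def)
  define g where "g = (\<lambda>t. ennreal (if t < V * \<epsilon> ^ ?n then 1 / \<epsilon> ^ ?n else if t < V then V / t else 0))"
  have gm[measurable]: "g \<in> borel_measurable borel" unfolding g_def by measurable
  have "(\<integral>\<^sup>+(x::real ^ 'n). ennreal (if x \<bullet> x < 1 then (1 / (x \<bullet> x + \<epsilon>\<^sup>2)) powr (N / 2) else 0) \<partial>lborel) \<le> (\<integral>\<^sup>+t. g t * indicator {0<..} t \<partial>lborel)"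
  proof (rule nn_integral_radial_le[OF gm])
    fix x :: "real ^ 'n" assume "x \<noteq> 0"
    define r where "r = norm x"
    have r: "0 < r" using \<open>x \<noteq> 0\<close> by (simp add: r_def)
    have xx: "x \<bullet> x = r\<^sup>2" by (simp add: r_def power2_norm_eq_inner)
    have le: "(1 / (x \<bullet> x + \<epsilon>\<^sup>2)) powr (N / 2) \<le> 1 / s ^ ?n" if "0 < s" "s\<^sup>2 \<le> x \<bullet> x + \<epsilon>\<^sup>2" for s
    proof -
      have "(1 / (x \<bullet> x + \<epsilon>\<^sup>2)) powr (N / 2) \<le> (1 / s\<^sup>2) powr (N / 2)"
        using that \<epsilon> by (intro powr_mono2 divide_left_mono) (auto simp: N_def intro!: mult_pos_pos add_nonneg_pos)
      then show ?thesis using inverse_square_powr_half[OF that(1), of ?n] by (simp add: N_def)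
    qed
    have 1: "(1 / (x \<bullet> x + \<epsilon>\<^sup>2)) powr (N / 2) \<le> 1 / \<epsilon> ^ ?n" using \<epsilon> by (intro le) auto
    have 2: "(1 / (x \<bullet> x + \<epsilon>\<^sup>2)) powr (N / 2) \<le> 1 / r ^ ?n" using r by (intro le) (auto simp: xx)
    have 3: "r ^ ?n < 1" if "x \<bullet> x < 1"
    proof -
      have "r < 1" using that r by (simp add: xx power_less_one_iff)
      then show ?thesis using r by (simp add: power_less_one_iff)
    qed
    show "ennreal (if x \<bullet> x < 1 then (1 / (x \<bullet> x + \<epsilon>\<^sup>2)) powr (N / 2) else 0) \<le> g (unit_ball_vol (real DIM(real ^ 'n)) * norm x ^ DIM(real ^ 'n))"
      using 1 2 3 V r \<epsilon> by (auto simp: g_def V_def[symmetric] r_def[symmetric] intro!: ennreal_leI)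
  qed
  also have "\<dots> \<le> (\<integral>\<^sup>+t. ennreal (1 / \<epsilon> ^ ?n) * indicator {0<..<V * \<epsilon> ^ ?n} t + ennreal V * (ennreal (1 / t) * indicator {V * \<epsilon> ^ ?n..V} t) \<partial>lborel)"
    using V by (intro nn_integral_mono) (auto simp: g_def ennreal_mult[symmetric] split: split_indicator)
  also have "\<dots> = ennreal (1 / \<epsilon> ^ ?n) * ennreal (V * \<epsilon> ^ ?n) + ennreal V * ennreal (ln V - ln (V * \<epsilon> ^ ?n))"
  proof -
    have "V * \<epsilon> ^ ?n \<le> V * 1" using V \<epsilon> by (intro mult_left_mono power_le_one) auto
    then have I: "(\<integral>\<^sup>+t. ennreal (1 / t) * indicator {V * \<epsilon> ^ ?n..V} t \<partial>lborel) = ennreal (ln V - ln (V * \<epsilon> ^ ?n))"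
      using V \<epsilon> by (intro nn_integral_inverse_Icc) auto
    show ?thesis using V \<epsilon> by (subst nn_integral_add) (auto simp: nn_integral_cmult nn_integral_cmult_indicator I)
  qed
  also have "\<dots> = ennreal (V + V * (N * ln (1 / \<epsilon>)))"
  proof -
    have "ln V - ln (V * \<epsilon> ^ ?n) = N * ln (1 / \<epsilon>)" using V \<epsilon> by (simp add: ln_mult ln_realpow ln_div N_def)
    moreover have "0 \<le> N * ln (1 / \<epsilon>)" using \<epsilon> by (simp add: N_def)
    ultimately show ?thesis using V \<epsilon> by (simp add: ennreal_mult[symmetric] ennreal_plus[symmetric] del: ennreal_plus)
  qed
  finally show ?thesis .
qed

text \<open>Scaling by \<open>\<epsilon>\<close> removes \<open>\<epsilon>\<close> from the
  integrand. Concretely it is at most \<open>\<epsilon> powr (-n)\<close> on the ball of radius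
  \<open>\<epsilon>\<close> and \<open>\<epsilon> powr n * |x| powr (-2n)\<close> outside, and each
  region contributes at most \<open>V\<close>.\<close>

lemma nn_integral_concentrated_part:
  fixes \<epsilon> :: real
  assumes \<epsilon>: "0 < \<epsilon>" "\<epsilon> \<le> 1"
  defines "N \<equiv> real CARD('n::finite)" and "V \<equiv> unit_ball_vol (real CARD('n))"
  shows "(\<integral>\<^sup>+(x::real ^ 'n). ennreal (if x \<bullet> x < 1 then (\<epsilon>\<^sup>2 / (x \<bullet> x + \<epsilon>\<^sup>2)\<^sup>2) powr (N / 2) else 0) \<partial>lborel) \<le> ennreal (2 * V)"
proof -
  let ?n = "CARD('n)"
  have V: "0 < V" by (simp add: V_def)
  define g where "g = (\<lambda>t. ennreal (if t < V * \<epsilon> ^ ?n then 1 / \<epsilon> ^ ?n else \<epsilon> ^ ?n * V\<^sup>2 * t powr (-2)))"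
  have [measurable]: "(\<lambda>t::real. t powr (-2)) \<in> borel_measurable borel" by (rule powr_real_measurable) auto
  have gm[measurable]: "g \<in> borel_measurable borel" unfolding g_def by measurable
  have "(\<integral>\<^sup>+(x::real ^ 'n). ennreal (if x \<bullet> x < 1 then (\<epsilon>\<^sup>2 / (x \<bullet> x + \<epsilon>\<^sup>2)\<^sup>2) powr (N / 2) else 0) \<partial>lborel) \<le> (\<integral>\<^sup>+t. g t * indicator {0<..} t \<partial>lborel)"
  proof (rule nn_integral_radial_le[OF gm])
    fix x :: "real ^ 'n" assume "x \<noteq> 0"
    define r where "r = norm x"
    have r: "0 < r" using \<open>x \<noteq> 0\<close> by (simp add: r_def)
    have xx: "x \<bullet> x = r\<^sup>2" by (simp add: r_def power2_norm_eq_inner)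
    have le: "(\<epsilon>\<^sup>2 / (x \<bullet> x + \<epsilon>\<^sup>2)\<^sup>2) powr (N / 2) \<le> 1 / (s\<^sup>2 / \<epsilon>) ^ ?n" if "0 < s" "s\<^sup>2 \<le> x \<bullet> x + \<epsilon>\<^sup>2" for s
    proof -
      have "(\<epsilon>\<^sup>2 / (x \<bullet> x + \<epsilon>\<^sup>2)\<^sup>2) powr (N / 2) \<le> (\<epsilon>\<^sup>2 / (s\<^sup>2)\<^sup>2) powr (N / 2)"
        using that \<epsilon> by (intro powr_mono2 divide_left_mono power_mono) (auto simp: N_def intro!: mult_pos_pos zero_less_power add_nonneg_pos)
      also have "\<epsilon>\<^sup>2 / (s\<^sup>2)\<^sup>2 = 1 / (s\<^sup>2 / \<epsilon>)\<^sup>2" using \<epsilon> by (simp add: power_divide)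
      also have "(1 / (s\<^sup>2 / \<epsilon>)\<^sup>2) powr (N / 2) = 1 / (s\<^sup>2 / \<epsilon>) ^ ?n"
        unfolding N_def using that \<epsilon> by (intro inverse_square_powr_half) simp
      finally show ?thesis .
    qed
    have "(\<epsilon>\<^sup>2 / (x \<bullet> x + \<epsilon>\<^sup>2)\<^sup>2) powr (N / 2) \<le> 1 / (\<epsilon>\<^sup>2 / \<epsilon>) ^ ?n" using \<epsilon> by (intro le) auto
    then have 1: "(\<epsilon>\<^sup>2 / (x \<bullet> x + \<epsilon>\<^sup>2)\<^sup>2) powr (N / 2) \<le> 1 / \<epsilon> ^ ?n" using \<epsilon> by (simp add: power2_eq_square)
    have "(\<epsilon>\<^sup>2 / (x \<bullet> x + \<epsilon>\<^sup>2)\<^sup>2) powr (N / 2) \<le> 1 / (r\<^sup>2 / \<epsilon>) ^ ?n" using r by (intro le) (auto simp: xx)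
    also have "\<dots> = \<epsilon> ^ ?n * V\<^sup>2 * (V * r ^ ?n) powr (-2)"
    proof -
      have "(V * r ^ ?n) powr (-2) = 1 / (V * r ^ ?n)\<^sup>2" using V r by (simp add: powr_minus_divide)
      then show ?thesis using V r \<epsilon> by (simp add: power_divide power_mult_distrib power_mult[symmetric] mult.commute)
    qed
    finally have 2: "(\<epsilon>\<^sup>2 / (x \<bullet> x + \<epsilon>\<^sup>2)\<^sup>2) powr (N / 2) \<le> \<epsilon> ^ ?n * V\<^sup>2 * (V * r ^ ?n) powr (-2)" .
    show "ennreal (if x \<bullet> x < 1 then (\<epsilon>\<^sup>2 / (x \<bullet> x + \<epsilon>\<^sup>2)\<^sup>2) powr (N / 2) else 0) \<le> g (unit_ball_vol (real DIM(real ^ 'n)) * norm x ^ DIM(real ^ 'n))"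
      unfolding g_def using 1 2 by (simp add: V_def[symmetric] r_def[symmetric] ennreal_leI)
  qed
  also have "\<dots> \<le> (\<integral>\<^sup>+t. ennreal (1 / \<epsilon> ^ ?n) * indicator {0<..<V * \<epsilon> ^ ?n} t + ennreal (\<epsilon> ^ ?n * V\<^sup>2) * (ennreal (t powr (-2)) * indicator {V * \<epsilon> ^ ?n<..} t) \<partial>lborel)"
  proof (rule nn_integral_mono_AE)
    show "AE t in lborel. g t * indicator {0<..} t \<le> ennreal (1 / \<epsilon> ^ ?n) * indicator {0<..<V * \<epsilon> ^ ?n} t + ennreal (\<epsilon> ^ ?n * V\<^sup>2) * (ennreal (t powr (-2)) * indicator {V * \<epsilon> ^ ?n<..} t)"
      using AE_lborel_singleton[of "V * \<epsilon> ^ ?n"]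
      by eventually_elim (use V \<epsilon> in \<open>auto simp: g_def ennreal_mult[symmetric] split: split_indicator\<close>)
  qed
  also have "\<dots> = ennreal (1 / \<epsilon> ^ ?n) * ennreal (V * \<epsilon> ^ ?n) + ennreal (\<epsilon> ^ ?n * V\<^sup>2) * ennreal ((V * \<epsilon> ^ ?n) powr (-2 + 1) / (-(-2 + 1)))"
  proof -
    have I: "(\<integral>\<^sup>+t. ennreal (t powr (-2)) * indicator {V * \<epsilon> ^ ?n<..} t \<partial>lborel) = ennreal ((V * \<epsilon> ^ ?n) powr (-2 + 1) / (-(-2 + 1)))"
      using V \<epsilon> by (intro nn_integral_powr_Ioi) auto
    show ?thesis using V \<epsilon> by (subst nn_integral_add) (auto simp: nn_integral_cmult nn_integral_cmult_indicator I)
  qed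
  also have "\<dots> = ennreal (2 * V)"
  proof -
    have "(V * \<epsilon> ^ ?n) powr (-2 + 1) / (-(-2 + 1)) = 1 / (V * \<epsilon> ^ ?n)" using V \<epsilon> by (simp add: powr_minus_divide)
    then show ?thesis using V \<epsilon> by (simp add: ennreal_mult[symmetric] ennreal_plus[symmetric] power2_eq_square del: ennreal_plus)
  qed
  finally show ?thesis .
qed

text \<open>The integrand stays below \<open>|x| powr (-2p)\<close>, integrable at the origin
  because \<open>2p < n\<close>. This keeps the norm of exponent \<open>p\<close> bounded as
  \<open>\<epsilon>\<close> tends to 0.\<close>

lemma nn_integral_subcritical_part:
  fixes \<epsilon> p :: real
  defines "N \<equiv> real CARD('n::finite)" and "V \<equiv> unit_ball_vol (real CARD('n))"
  assumes p: "0 < p" "p < N / 2" and \<epsilon>: "0 < \<epsilon>"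
  shows "(\<integral>\<^sup>+(x::real ^ 'n). ennreal (if x \<bullet> x < 1 then (1 / (x \<bullet> x + \<epsilon>\<^sup>2)) powr p else 0) \<partial>lborel) \<le> ennreal (V / (1 - 2 * p / N))"
proof -
  let ?n = "CARD('n)"
  have V: "0 < V" by (simp add: V_def)
  have N: "0 < N" by (simp add: N_def)
  define a where "a = - (2 * p / N)"
  have a: "-1 < a" using p N by (simp add: a_def field_simps)
  define g where "g = (\<lambda>t. ennreal (if 0 < t \<and> t < V then (t / V) powr a else 0))"
  have gm[measurable]: "g \<in> borel_measurable borel" unfolding g_def by measurable
  have "(\<integral>\<^sup>+(x::real ^ 'n). ennreal (if x \<bullet> x < 1 then (1 / (x \<bullet> x + \<epsilon>\<^sup>2)) powr p else 0) \<partial>lborel) \<le> (\<integral>\<^sup>+t. g t * indicator {0<..} t \<partial>lborel)"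
  proof (rule nn_integral_radial_le[OF gm])
    fix x :: "real ^ 'n" assume "x \<noteq> 0"
    define r where "r = norm x"
    have r: "0 < r" using \<open>x \<noteq> 0\<close> by (simp add: r_def)
    have xx: "x \<bullet> x = r\<^sup>2" by (simp add: r_def power2_norm_eq_inner)
    have "(1 / (x \<bullet> x + \<epsilon>\<^sup>2)) powr p \<le> (1 / r\<^sup>2) powr p"
      using r p \<epsilon> by (intro powr_mono2 divide_left_mono) (auto simp: xx intro!: mult_pos_pos add_nonneg_pos)
    also have "1 / r\<^sup>2 = r powr (- 2)" using r by (simp add: powr_minus_divide)
    also have "(r powr (- 2)) powr p = (r powr N) powr a" using N by (simp add: powr_powr a_def)
    also have "r powr N = (V * r ^ ?n) / V" using V r by (simp add: N_def powr_realpow)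
    finally have 1: "(1 / (x \<bullet> x + \<epsilon>\<^sup>2)) powr p \<le> (V * r ^ ?n / V) powr a" .
    have 3: "r ^ ?n < 1" if "x \<bullet> x < 1"
    proof -
      have "r < 1" using that r by (simp add: xx power_less_one_iff)
      then show ?thesis using r by (simp add: power_less_one_iff)
    qed
    show "ennreal (if x \<bullet> x < 1 then (1 / (x \<bullet> x + \<epsilon>\<^sup>2)) powr p else 0) \<le> g (unit_ball_vol (real DIM(real ^ 'n)) * norm x ^ DIM(real ^ 'n))"
      using 1 3 V r by (auto simp: g_def V_def[symmetric] r_def[symmetric] intro!: ennreal_leI)
  qed
  also have "\<dots> = (\<integral>\<^sup>+t. ennreal (1 / V powr a) * (ennreal (t powr a) * indicator {0<..<V} t) \<partial>lborel)"
    using V by (intro nn_integral_cong) (auto simp: g_def powr_divide ennreal_mult[symmetric] split: split_indicator)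
  also have "\<dots> = ennreal (1 / V powr a) * ennreal (V powr (a + 1) / (a + 1))"
    using V a by (subst nn_integral_cmult) (auto simp: nn_integral_powr_Ioo)
  also have "\<dots> = ennreal (V / (1 - 2 * p / N))"
    using V a by (simp add: ennreal_mult[symmetric] powr_add) (simp add: a_def)
  finally show ?thesis .
qed

text \<open>Convex splitting leaves the main term \<open>(n - 2)/y\<close> with the factor
  \<open>(1 - \<theta>) powr (1 - n/2)\<close>. The constant in front of the logarithm is the
  \<open>n/2\<close>-th power of \<open>(n - 2) (n V) powr (2/n)\<close>, the base occurring in
  \<open>beta\<close>, which is why the two thresholds coincide.\<close>

lemma adams_norm_bound:
  fixes p \<theta> :: real
  defines "N \<equiv> real CARD('n::finite)" and "V \<equiv> unit_ball_vol (real CARD('n))"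
  assumes p: "1 < p" "p < N / 2" and \<theta>: "0 < \<theta>" "\<theta> < 1"
  obtains K where "0 \<le> K" "\<And>\<epsilon>. 0 < \<epsilon> \<Longrightarrow> \<epsilon> \<le> 1 \<Longrightarrow>
    Lnorm (N / 2) (laplacian (adams_function \<epsilon> :: real ^ 'n \<Rightarrow> real)) powr (N / 2) + Lnorm p (laplacian (adams_function \<epsilon> :: real ^ 'n \<Rightarrow> real)) powr (N / 2)
      \<le> (1 - \<theta>) powr (1 - N / 2) * ((N - 2) powr (N / 2) * (N * V) * ln (1 / \<epsilon>)) + K"
proof -
  define q where "q = N / 2"
  have q: "1 < q" using p by (simp add: q_def)
  have N: "2 < N" using p by simp
  have V: "0 < V" by (simp add: V_def)
  obtain M where M: "0 < M" and L: "\<And>\<epsilon> (x :: real ^ 'n). 0 < \<epsilon> \<Longrightarrow> \<epsilon> \<le> 1 \<Longrightarrow> 2 \<le> CARD('n) \<Longrightarrow>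
    \<bar>laplacian (adams_function \<epsilon>) x\<bar> \<le>
      (if x \<bullet> x < 1 then (real CARD('n) - 2) / (x \<bullet> x + \<epsilon>\<^sup>2) + (2 * \<epsilon>\<^sup>2 / (x \<bullet> x + \<epsilon>\<^sup>2)\<^sup>2 + M) else 0)"
    using laplacian_adams_function_le by blast
  have n2: "2 \<le> CARD('n)" using N by (simp add: N_def)
  define C1 where "C1 = (1 - \<theta>) powr (1 - q) * (N - 2) powr q"
  define C2 where "C2 = \<theta> powr (1 - q) * ((1/2) powr (1 - q) * 2 powr q)"
  define C3 where "C3 = \<theta> powr (1 - q) * ((1/2) powr (1 - q) * M powr q)"
  define B where "B = (N + 2 * M) powr p * (V / (1 - 2 * p / N))"
  have C: "0 \<le> C1" "0 \<le> C2" "0 \<le> C3" by (simp_all add: C1_def C2_def C3_def)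
  have B: "0 \<le> B" using p V N by (simp add: B_def field_simps)
  define K where "K = C1 * V + C2 * (2 * V) + C3 * V + (B powr (1 / p)) powr q"
  show ?thesis
  proof (rule that[of K])
    show "0 \<le> K" using C V by (simp add: K_def)
    fix \<epsilon> :: real assume \<epsilon>: "0 < \<epsilon>" "\<epsilon> \<le> 1"
    let ?L = "laplacian (adams_function \<epsilon> :: real ^ 'n \<Rightarrow> real)"
    have T: "?L \<in> test_functions" by (intro test_function_laplacian adams_function_test \<epsilon>)
    have y: "0 < x \<bullet> x + \<epsilon>\<^sup>2" for x :: "real ^ 'n" using \<epsilon> by (intro add_nonneg_pos) auto
    have lnpos: "0 \<le> ln (1 / \<epsilon>)" using \<epsilon> by simp
    have 1: "Lnorm q ?L powr q \<le> C1 * (V + V * (N * ln (1 / \<epsilon>))) + C2 * (2 * V) + C3 * V"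
    proof -
      define f1 where "f1 = (\<lambda>x::real ^ 'n. if x \<bullet> x < 1 then (1 / (x \<bullet> x + \<epsilon>\<^sup>2)) powr (N / 2) else 0)"
      define f2 where "f2 = (\<lambda>x::real ^ 'n. if x \<bullet> x < 1 then (\<epsilon>\<^sup>2 / (x \<bullet> x + \<epsilon>\<^sup>2)\<^sup>2) powr (N / 2) else 0)"
      have m[measurable]: "f1 \<in> borel_measurable borel" "f2 \<in> borel_measurable borel"
        unfolding f1_def f2_def by measurable
      have [measurable]: "ball (0 :: real ^ 'n) 1 \<in> sets borel" by simp
      have "ennreal (\<bar>?L x\<bar> powr q) \<le> ennreal C1 * ennreal (f1 x) + ennreal C2 * ennreal (f2 x) + ennreal C3 * indicator (ball 0 1) x" for x
      proof (cases "x \<bullet> x < 1")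
        case False
        then have "?L x = 0" using L[OF \<epsilon> n2, of x] by simp
        then show ?thesis by simp
      next
        case True
        define y where "y = x \<bullet> x + \<epsilon>\<^sup>2"
        have y0: "0 < y" using y by (simp add: y_def)
        \<comment> \<open>The remainder is split again, now in equal parts, since only its
          boundedness in \<open>\<epsilon>\<close> matters.\<close>
        have s: "(2 * \<epsilon>\<^sup>2 / y\<^sup>2 + M) powr q \<le> (1 - 1/2) powr (1 - q) * (2 * \<epsilon>\<^sup>2 / y\<^sup>2) powr q + (1/2) powr (1 - q) * M powr q"
          using y0 M q by (intro convex_powr_split) auto
        have "\<bar>?L x\<bar> \<le> (N - 2) / y + (2 * \<epsilon>\<^sup>2 / y\<^sup>2 + M)" using L[OF \<epsilon> n2, of x] True by (simp add: y_def N_def)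
        then have "\<bar>?L x\<bar> powr q \<le> ((N - 2) / y + (2 * \<epsilon>\<^sup>2 / y\<^sup>2 + M)) powr q" using q by (intro powr_mono2) auto
        also have "\<dots> \<le> (1 - \<theta>) powr (1 - q) * ((N - 2) / y) powr q + \<theta> powr (1 - q) * (2 * \<epsilon>\<^sup>2 / y\<^sup>2 + M) powr q"
          using y0 N M q \<theta> by (intro convex_powr_split) auto
        also have "\<dots> \<le> (1 - \<theta>) powr (1 - q) * ((N - 2) / y) powr q + \<theta> powr (1 - q) * ((1 - 1/2) powr (1 - q) * (2 * \<epsilon>\<^sup>2 / y\<^sup>2) powr q + (1/2) powr (1 - q) * M powr q)"
          by (intro add_left_mono mult_left_mono s) simp
        also have "((N - 2) / y) powr q = (N - 2) powr q * (1 / y) powr q" using N y0 by (simp add: powr_divide)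
        also have "(2 * \<epsilon>\<^sup>2 / y\<^sup>2) powr q = 2 powr q * (\<epsilon>\<^sup>2 / y\<^sup>2) powr q" by (simp add: powr_mult powr_divide)
        finally have "\<bar>?L x\<bar> powr q \<le> C1 * f1 x + C2 * f2 x + C3"
          using True by (simp add: C1_def C2_def C3_def f1_def f2_def y_def q_def algebra_simps)
        moreover have "x \<in> ball 0 1" using True by (simp add: power2_norm_eq_inner[symmetric] power_less_one_iff)
        moreover have "0 \<le> f1 x" "0 \<le> f2 x" by (simp_all add: f1_def f2_def)
        ultimately show ?thesis using C by (simp add: ennreal_mult[symmetric] ennreal_plus[symmetric] del: ennreal_plus)
      qed
      then have "(\<integral>\<^sup>+x. ennreal (\<bar>?L x\<bar> powr q) \<partial>lebesgue) \<le> (\<integral>\<^sup>+x. ennreal C1 * ennreal (f1 x) + ennreal C2 * ennreal (f2 x) + ennreal C3 * indicator (ball 0 1) x \<partial>lborel)"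
        unfolding nn_integral_completion by (intro nn_integral_mono) auto
      also have "\<dots> = ennreal C1 * (\<integral>\<^sup>+x. ennreal (f1 x) \<partial>lborel) + ennreal C2 * (\<integral>\<^sup>+x. ennreal (f2 x) \<partial>lborel) + ennreal C3 * emeasure lborel (ball (0 :: real ^ 'n) 1)"
        by (simp add: nn_integral_add nn_integral_cmult nn_integral_cmult_indicator)
      also have "\<dots> \<le> ennreal C1 * ennreal (V + V * (N * ln (1 / \<epsilon>))) + ennreal C2 * ennreal (2 * V) + ennreal C3 * ennreal V"
        using nn_integral_log_part[OF \<epsilon>, where 'n='n] nn_integral_concentrated_part[OF \<epsilon>, where 'n='n] emeasure_ball[of 1 "0 :: real ^ 'n"]
        unfolding f1_def f2_def N_def V_def by (intro add_mono mult_left_mono) auto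
      also have "\<dots> = ennreal (C1 * (V + V * (N * ln (1 / \<epsilon>))) + C2 * (2 * V) + C3 * V)"
        using C V N lnpos by (simp add: ennreal_mult[symmetric] ennreal_plus[symmetric] del: ennreal_plus)
      finally show ?thesis
        using C V N lnpos q by (subst (asm) nn_integral_Lspace[OF test_function_Lspace[OF T]]) (simp_all add: ennreal_le_iff del: ennreal_plus)
    qed
    have 2: "Lnorm p ?L \<le> B powr (1 / p)"
    proof (rule Lnorm_le)
      show "?L \<in> borel_measurable lebesgue" by (rule test_function_lebesgue_measurable[OF T])
      define f1 where "f1 = (\<lambda>x::real ^ 'n. if x \<bullet> x < 1 then (1 / (x \<bullet> x + \<epsilon>\<^sup>2)) powr p else 0)"
      have m[measurable]: "f1 \<in> borel_measurable borel" unfolding f1_def by measurable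
      have "ennreal (\<bar>?L x\<bar> powr p) \<le> ennreal ((N + 2 * M) powr p) * ennreal (f1 x)" for x
      proof (cases "x \<bullet> x < 1")
        case False
        then have "?L x = 0" using L[OF \<epsilon> n2, of x] by simp
        then show ?thesis by simp
      next
        case True
        define y where "y = x \<bullet> x + \<epsilon>\<^sup>2"
        have y0: "0 < y" using y by (simp add: y_def)
        have "\<epsilon>\<^sup>2 \<le> 1" using \<epsilon> by (simp add: power_le_one)
        then have y2: "y \<le> 2" "\<epsilon>\<^sup>2 \<le> y" using True by (auto simp: y_def)
        have "\<epsilon>\<^sup>2 / y\<^sup>2 \<le> y / y\<^sup>2" using y2 by (intro divide_right_mono) auto
        then have a: "2 * \<epsilon>\<^sup>2 / y\<^sup>2 \<le> 2 * (1 / y)" using y0 by (simp add: power2_eq_square)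
        \<comment> \<open>Since \<open>y \<le> 2\<close>, the constant is absorbed into a multiple
          of \<open>1/y\<close>, so that one integral controls all three terms.\<close>
        have b: "M \<le> 2 * M * (1 / y)" using y0 y2 M by (simp add: field_simps)
        have "\<bar>?L x\<bar> \<le> (N - 2) / y + (2 * \<epsilon>\<^sup>2 / y\<^sup>2 + M)" using L[OF \<epsilon> n2, of x] True by (simp add: y_def N_def)
        also have "\<dots> \<le> (N - 2) * (1 / y) + (2 * (1 / y) + 2 * M * (1 / y))" using a b by simp
        also have "\<dots> = (N + 2 * M) * (1 / y)" by (simp only: distrib_right[symmetric]) simp
        finally have "\<bar>?L x\<bar> powr p \<le> ((N + 2 * M) * (1 / y)) powr p" using p by (intro powr_mono2) auto
        also have "\<dots> = (N + 2 * M) powr p * f1 x" using True N M y0 by (simp add: powr_mult powr_divide f1_def y_def)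
        finally show ?thesis by (simp add: ennreal_mult''[symmetric] f1_def)
      qed
      then have "(\<integral>\<^sup>+x. ennreal (\<bar>?L x\<bar> powr p) \<partial>lebesgue) \<le> (\<integral>\<^sup>+x. ennreal ((N + 2 * M) powr p) * ennreal (f1 x) \<partial>lborel)"
        unfolding nn_integral_completion by (intro nn_integral_mono) auto
      also have "\<dots> = ennreal ((N + 2 * M) powr p) * (\<integral>\<^sup>+x. ennreal (f1 x) \<partial>lborel)" by (simp add: nn_integral_cmult)
      also have "\<dots> \<le> ennreal ((N + 2 * M) powr p) * ennreal (V / (1 - 2 * p / N))"
        using nn_integral_subcritical_part[of p \<epsilon>, where 'n='n] p \<epsilon> by (intro mult_left_mono) (auto simp: f1_def N_def V_def)
      also have "\<dots> = ennreal B" by (simp add: ennreal_mult'[symmetric] B_def)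
      also have "B = (B powr (1 / p)) powr p" using p B by (simp add: powr_powr)
      finally show "(\<integral>\<^sup>+x. ennreal (\<bar>?L x\<bar> powr p) \<partial>lebesgue) \<le> ennreal ((B powr (1 / p)) powr p)" .
    qed (use p B in auto)
    then have "Lnorm p ?L powr q \<le> (B powr (1 / p)) powr q" using Lnorm_nonneg[of p ?L] q by (intro powr_mono2) auto
    with 1 have "Lnorm q ?L powr q + Lnorm p ?L powr q \<le> C1 * (V * (N * ln (1 / \<epsilon>))) + K"
      by (simp add: K_def distrib_left)
    then show "Lnorm (N / 2) ?L powr (N / 2) + Lnorm p ?L powr (N / 2)
      \<le> (1 - \<theta>) powr (1 - N / 2) * ((N - 2) powr (N / 2) * (N * V) * ln (1 / \<epsilon>)) + K"
      by (simp add: C1_def q_def mult_ac)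
  qed
qed

section \<open>Divergence beyond the critical constant\<close>

lemma exp_tail_ge_half: "eventually (\<lambda>y::real. exp y / 2 \<le> exp y - (\<Sum>j<m. y ^ j / fact j)) at_top"
proof -
  have "((\<lambda>y::real. \<Sum>j<m. (y ^ j / exp y) / fact j) \<longlongrightarrow> (\<Sum>j<m. 0 / fact j)) at_top"
    by (intro tendsto_intros tendsto_power_div_exp_0) auto
  then have "eventually (\<lambda>y::real. (\<Sum>j<m. (y ^ j / exp y) / fact j) < 1/2) at_top"
    by (intro order_tendstoD) auto
  then show ?thesis
  proof eventually_elim
    case (elim y)
    have "(\<Sum>j<m. y ^ j / fact j) = (\<Sum>j<m. (y ^ j / exp y) / fact j) * exp y"
      by (simp add: sum_distrib_right)
    also have "\<dots> \<le> 1/2 * exp y" using elim by (intro mult_right_mono) auto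
    finally show ?case by simp
  qed
qed

text \<open>\<open>T\<close> bounds the \<open>n/2\<close>-th power of the norm at
  \<open>\<epsilon> = exp (- \<Lambda>)\<close>, so that
  \<open>\<Lambda> = ln (1/\<epsilon>)\<close>, and the norm is homogeneous. The additive constant
  of the norm bound is raised by 1 to make \<open>T\<close> positive.\<close>

lemma scaled_adams_function_in_unit_ball:
  fixes p \<theta> :: real
  defines "N \<equiv> real CARD('n::finite)" and "V \<equiv> unit_ball_vol (real CARD('n))"
  assumes p: "1 < p" "p < N / 2" and \<theta>: "0 < \<theta>" "\<theta> < 1"
  obtains K where "0 < K" "\<And>\<Lambda> T. 0 \<le> \<Lambda> \<Longrightarrow> T = (1 - \<theta>) powr (1 - N / 2) * ((N - 2) powr (N / 2) * (N * V)) * \<Lambda> + K \<Longrightarrow>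
    (\<lambda>x :: real ^ 'n. 1 / T powr (2 / N) * adams_function (exp (- \<Lambda>)) x) \<in> {u. u \<in> E_space p \<and> E_norm p u \<le> 1}"
proof -
  obtain K where K: "0 \<le> K" "\<And>\<epsilon>. 0 < \<epsilon> \<Longrightarrow> \<epsilon> \<le> 1 \<Longrightarrow>
    Lnorm (N / 2) (laplacian (adams_function \<epsilon> :: real ^ 'n \<Rightarrow> real)) powr (N / 2) + Lnorm p (laplacian (adams_function \<epsilon> :: real ^ 'n \<Rightarrow> real)) powr (N / 2)
      \<le> (1 - \<theta>) powr (1 - N / 2) * ((N - 2) powr (N / 2) * (N * V) * ln (1 / \<epsilon>)) + K"
    using adams_norm_bound[of p \<theta>, where 'n='n] p \<theta> unfolding N_def V_def by blast
  have N: "2 < N" using p by simp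
  have V: "0 < V" by (simp add: V_def)
  show ?thesis
  proof (rule that[of "K + 1"])
    show "0 < K + 1" using K by simp
    fix \<Lambda> T assume \<Lambda>: "0 \<le> \<Lambda>" and T: "T = (1 - \<theta>) powr (1 - N / 2) * ((N - 2) powr (N / 2) * (N * V)) * \<Lambda> + (K + 1)"
    have T0: "0 < T" unfolding T using K \<Lambda> N V \<theta> by (intro add_nonneg_pos mult_nonneg_nonneg) auto
    define u where "u = (adams_function (exp (- \<Lambda>)) :: real ^ 'n \<Rightarrow> real)"
    have u: "u \<in> test_functions" unfolding u_def by (rule adams_function_test) simp
    define c where "c = 1 / T powr (2 / N)"
    have c: "0 < c" using T0 by (simp add: c_def)
    have cN: "c powr (N / 2) = 1 / T" using T0 N by (simp add: c_def powr_divide powr_powr)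
    have w: "(\<lambda>x. c * u x) \<in> test_functions" using u by (rule test_function_cmult)
    have L: "laplacian u \<in> Lspace s" if "0 < s" for s by (intro test_function_Lspace test_function_laplacian u that)
    have b: "Lnorm (N / 2) (laplacian u) powr (N / 2) + Lnorm p (laplacian u) powr (N / 2) \<le> T"
      using K(2)[of "exp (- \<Lambda>)"] \<Lambda> unfolding u_def T by (simp add: ln_div mult_ac)
    have "E_norm p (\<lambda>x. c * u x) = mixed_norm p (\<lambda>x. c * laplacian u x)"
      using test_function_in_E_space(2)[OF _ _ w, of p] p by (simp add: laplacian_cmult[OF u] N_def)
    also have "\<dots> = ((c * Lnorm (N / 2) (laplacian u)) powr (N / 2) + (c * Lnorm p (laplacian u)) powr (N / 2)) powr (2 / N)"
      using p N c Lspace_cmult(2)[OF L, of "N/2" c] Lspace_cmult(2)[OF L, of p c] by (simp add: mixed_norm_def Let_def N_def)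
    also have "\<dots> = ((Lnorm (N / 2) (laplacian u) powr (N / 2) + Lnorm p (laplacian u) powr (N / 2)) / T) powr (2 / N)"
      using c Lnorm_nonneg[of _ "laplacian u"] by (simp add: powr_mult cN add_divide_distrib)
    also have "\<dots> \<le> 1 powr (2 / N)" using b T0 N by (intro powr_mono2) auto
    finally have "E_norm p (\<lambda>x. c * u x) \<le> 1" by simp
    moreover have "(\<lambda>x. c * u x) \<in> E_space p" using test_function_in_E_space(1)[OF _ _ w, of p] p by (simp add: N_def)
    ultimately show "(\<lambda>x :: real ^ 'n. 1 / T powr (2 / N) * adams_function (exp (- \<Lambda>)) x) \<in> {u. u \<in> E_space p \<and> E_norm p u \<le> 1}"
      by (simp add: c_def u_def)
  qed
qed

text \<open>On the ball of radius \<open>\<epsilon> = exp (- \<Lambda>)\<close> the scaled function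
  is at least \<open>m \<Lambda>\<close> and the weight at least
  \<open>\<epsilon> powr (-\<gamma>)\<close>, so the integral is at least \<open>V / 2 * exp
  (\<alpha> * m \<Lambda> powr r - (N - \<gamma>) * \<Lambda>)\<close>. Here
  \<open>m \<Lambda> powr r\<close> grows linearly in \<open>\<Lambda>\<close>, and for small
  \<open>\<theta>\<close> its slope times \<open>\<alpha>\<close> exceeds
  \<open>N - \<gamma>\<close>.\<close>

lemma adams_sup_infinite:
  fixes p \<gamma> \<alpha> :: real
  assumes p: "1 < p" "p < real CARD('n::finite) / 2" and \<gamma>: "0 \<le> \<gamma>" "\<gamma> < real CARD('n)"
    and \<alpha>: "beta_gamma \<gamma> TYPE('n) < \<alpha>"
  shows "adams_sup TYPE('n) p \<gamma> \<alpha> = \<infinity>"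
proof (rule ccontr)
  assume not_inf: "adams_sup TYPE('n) p \<gamma> \<alpha> \<noteq> \<infinity>"
  define N where "N = real CARD('n)"
  define V where "V = unit_ball_vol (real CARD('n))"
  define r where "r = N / (N - 2)"
  define A where "A = (N - 2) * (N * V) powr (2 / N)"
  define D where "D = (N - 2) powr (N / 2) * (N * V)"
  let ?n = "CARD('n)" and ?m = "j0 CARD('n) p"
  have N: "2 < N" using p by (simp add: N_def)
  have V: "0 < V" by (simp add: V_def)
  have r: "0 < r" using N by (simp add: r_def)
  have A: "0 < A" using N V by (simp add: A_def)
  have D: "0 < D" using N V by (simp add: D_def)
  have DA: "D powr (2 / N) = A" using N V by (simp add: D_def A_def powr_mult powr_powr)
  have \<gamma>N: "\<gamma> < N" using \<gamma> by (simp add: N_def)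
  have "beta_gamma \<gamma> TYPE('n) = (1 - \<gamma> / N) * (N * A powr r)"
    by (simp add: beta_gamma_def beta_def Let_def sphere_area_eq A_def N_def V_def r_def)
  also have "\<dots> = (N - \<gamma>) * A powr r" using N by (simp add: field_simps)
  finally have \<alpha>A: "(N - \<gamma>) * A powr r < \<alpha>" using \<alpha> by simp
  have "0 < (N - \<gamma>) * A powr r" using \<gamma>N A by simp
  then have \<alpha>0: "0 < \<alpha>" using \<alpha>A by linarith
  \<comment> \<open>At \<open>\<theta> = 0\<close> the desired inequality is
    \<open>(N - \<gamma>) * A powr r < \<alpha>\<close>, the hypothesis on \<open>\<alpha>\<close>;
    continuity leaves room for a positive \<open>\<theta>\<close>.\<close>
  have "((\<lambda>\<theta>::real. \<alpha> * ((1 - \<theta>) powr r * (1 - \<theta>) / A powr r)) \<longlongrightarrow> \<alpha> * ((1 - 0) powr r * (1 - 0) / A powr r)) (at_right 0)"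
    using A by (intro tendsto_intros) auto
  moreover have "N - \<gamma> < \<alpha> * ((1 - 0) powr r * (1 - 0) / A powr r)" using \<alpha>A A by (simp add: field_simps)
  ultimately have "eventually (\<lambda>\<theta>. N - \<gamma> < \<alpha> * ((1 - \<theta>) powr r * (1 - \<theta>) / A powr r)) (at_right 0)"
    by (rule order_tendstoD)
  moreover have "eventually (\<lambda>\<theta>::real. \<theta> \<in> {0<..<1}) (at_right 0)" by (rule eventually_at_right_real) simp
  ultimately have "eventually (\<lambda>\<theta>. N - \<gamma> < \<alpha> * ((1 - \<theta>) powr r * (1 - \<theta>) / A powr r) \<and> \<theta> \<in> {0<..<1}) (at_right 0)"
    by (rule eventually_conj)
  from eventually_happens[OF this] obtain \<theta> :: real where \<theta>: "0 < \<theta>" "\<theta> < 1" and gap: "N - \<gamma> < \<alpha> * ((1 - \<theta>) powr r * (1 - \<theta>) / A powr r)"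
    by auto
  obtain K where K: "0 < K" and unit: "\<And>\<Lambda> T. 0 \<le> \<Lambda> \<Longrightarrow> T = (1 - \<theta>) powr (1 - N / 2) * D * \<Lambda> + K \<Longrightarrow>
    (\<lambda>x :: real ^ 'n. 1 / T powr (2 / N) * adams_function (exp (- \<Lambda>)) x) \<in> {u. u \<in> E_space p \<and> E_norm p u \<le> 1}"
    using scaled_adams_function_in_unit_ball[of p \<theta>, where 'n='n] p \<theta> unfolding N_def V_def D_def by blast
  define a where "a = (1 - \<theta>) powr (1 - N / 2) * D"
  have a: "0 < a" using \<theta> D by (simp add: a_def)
  \<comment> \<open>\<open>(1 - N/2) * (2/N) * r = -1\<close> because
    \<open>r = N / (N - 2)\<close>. So the norm estimate costs one factor
    \<open>1 - \<theta>\<close> in the slope, while the cutoff costs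
    \<open>(1 - \<theta>) powr r\<close>.\<close>
  have aA: "a powr (2 / N * r) = A powr r / (1 - \<theta>)"
  proof -
    have "(1 - N / 2) * (2 / N * r) = -1" using N by (simp add: r_def field_simps)
    then have "((1 - \<theta>) powr (1 - N / 2)) powr (2 / N * r) = 1 / (1 - \<theta>)"
      using \<theta> by (simp only: powr_powr) (simp add: powr_minus_divide)
    moreover have "D powr (2 / N * r) = A powr r" by (simp only: powr_powr[symmetric] DA)
    ultimately show ?thesis by (simp add: a_def powr_mult)
  qed
  \<comment> \<open>\<open>1 - \<theta>\<close> bounds the cutoff near the origin, and
    \<open>\<Lambda> - 1\<close> the logarithm: for \<open>|x| \<le> \<epsilon>\<close> it falls
    short of \<open>\<Lambda>\<close> by at most \<open>(ln 2) / 2\<close>.\<close>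
  define m where "m = (\<lambda>\<Lambda>. (1 - \<theta>) * (\<Lambda> - 1) / (a * \<Lambda> + K) powr (2 / N))"
  have ratio: "((\<lambda>\<Lambda>. \<alpha> * (m \<Lambda> powr r / \<Lambda>) - (N - \<gamma>)) \<longlongrightarrow> \<alpha> * ((1 - \<theta>) powr r * (1 - \<theta>) / A powr r) - (N - \<gamma>)) at_top"
  proof -
    have "((\<lambda>\<Lambda>::real. (1 - \<theta>) powr r * ((\<Lambda> - 1) / \<Lambda>) powr r / (a + K / \<Lambda>) powr (2 / N * r)) \<longlongrightarrow>
        (1 - \<theta>) powr r * 1 powr r / (a + 0) powr (2 / N * r)) at_top"
    proof (intro tendsto_intros)
      show "((\<lambda>\<Lambda>::real. (\<Lambda> - 1) / \<Lambda>) \<longlongrightarrow> 1) at_top" by real_asymp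
      show "((\<lambda>\<Lambda>. K / \<Lambda>) \<longlongrightarrow> 0) at_top" by real_asymp
    qed (use a in auto)
    moreover have "eventually (\<lambda>\<Lambda>::real. (1 - \<theta>) powr r * ((\<Lambda> - 1) / \<Lambda>) powr r / (a + K / \<Lambda>) powr (2 / N * r) = m \<Lambda> powr r / \<Lambda>) at_top"
      using eventually_gt_at_top[of 1]
    proof eventually_elim
      case (elim \<Lambda>)
      have t: "a * \<Lambda> + K = \<Lambda> * (a + K / \<Lambda>)" using elim by (simp add: field_simps)
      have p0: "0 < a + K / \<Lambda>" using a K elim by (intro add_pos_pos) auto
      \<comment> \<open>The numerator of \<open>m\<close> grows like \<open>\<Lambda>\<close> and
        the denominator like its power \<open>2/N\<close>; after raising to \<open>r\<close> the net
        power is \<open>r - 2 * r / N = 1\<close>.\<close>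
      have e: "r = 1 + 2 / N * r" using N by (simp add: r_def field_simps)
      have "(\<Lambda> powr r) = \<Lambda> * \<Lambda> powr (2 / N * r)" by (subst e) (use elim in \<open>simp add: powr_add\<close>)
      moreover have "m \<Lambda> powr r = (1 - \<theta>) powr r * (\<Lambda> - 1) powr r / (\<Lambda> powr (2 / N * r) * (a + K / \<Lambda>) powr (2 / N * r))"
        unfolding m_def t using elim \<theta> p0 by (simp add: powr_divide powr_mult powr_powr)
      ultimately show ?case using elim by (simp add: powr_divide)
    qed
    ultimately have "((\<lambda>\<Lambda>. m \<Lambda> powr r / \<Lambda>) \<longlongrightarrow> (1 - \<theta>) powr r * 1 powr r / (a + 0) powr (2 / N * r)) at_top"
      by (rule Lim_transform_eventually)
    then have "((\<lambda>\<Lambda>. m \<Lambda> powr r / \<Lambda>) \<longlongrightarrow> (1 - \<theta>) powr r * (1 - \<theta>) / A powr r) at_top"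
      using \<theta> A by (simp only: add_0_right aA powr_one_eq_one) simp
    then show ?thesis by (intro tendsto_diff tendsto_mult tendsto_const)
  qed
  have pos: "0 < \<alpha> * ((1 - \<theta>) powr r * (1 - \<theta>) / A powr r) - (N - \<gamma>)" using gap by simp
  have "filterlim (\<lambda>\<Lambda>. (\<alpha> * (m \<Lambda> powr r / \<Lambda>) - (N - \<gamma>)) * \<Lambda>) at_top at_top"
    by (rule filterlim_tendsto_pos_mult_at_top[OF ratio pos filterlim_ident])
  then have lim: "filterlim (\<lambda>\<Lambda>. \<alpha> * m \<Lambda> powr r - (N - \<gamma>) * \<Lambda>) at_top at_top"
  proof (rule filterlim_mono_eventually)
    show "eventually (\<lambda>\<Lambda>. (\<alpha> * (m \<Lambda> powr r / \<Lambda>) - (N - \<gamma>)) * \<Lambda> = \<alpha> * m \<Lambda> powr r - (N - \<gamma>) * \<Lambda>) at_top"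
      using eventually_gt_at_top[of 0] by eventually_elim (simp add: left_diff_distrib)
  qed auto
  have lim2: "filterlim (\<lambda>\<Lambda>. \<alpha> * m \<Lambda> powr r) at_top at_top"
    using lim by (rule filterlim_at_top_mono) (use eventually_mono[OF eventually_ge_at_top[of 0], of "\<lambda>\<Lambda>. 0 \<le> (N - \<gamma>) * \<Lambda>"] \<gamma>N in simp)
  \<comment> \<open>Removing finitely many terms of the series costs at most half of the exponential
    once the argument is large.\<close>
  have tail: "eventually (\<lambda>\<Lambda>. exp (\<alpha> * m \<Lambda> powr r) / 2 \<le> exp (\<alpha> * m \<Lambda> powr r) - (\<Sum>j<?m. (\<alpha> * m \<Lambda> powr r) ^ j / fact j)) at_top"
    using lim2 exp_tail_ge_half[of ?m] by (rule eventually_compose_filterlim[rotated])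
  obtain d where d: "0 < d" "\<And>s. s \<noteq> 0 \<Longrightarrow> \<bar>s\<bar> < d \<Longrightarrow> \<bar>cutoff s - 1\<bar> < \<theta>"
    using LIM_D[OF cutoff_tendsto \<theta>(1)] by auto
  have "((\<lambda>\<Lambda>::real. (exp (- \<Lambda>))\<^sup>2) \<longlongrightarrow> 0) at_top" by real_asymp
  then have near: "eventually (\<lambda>\<Lambda>::real. (exp (- \<Lambda>))\<^sup>2 < d) at_top" using d(1) by (rule order_tendstoD)
  have "eventually (\<lambda>\<Lambda>. ennreal (V / 2 * exp (\<alpha> * m \<Lambda> powr r - (N - \<gamma>) * \<Lambda>)) \<le> adams_sup TYPE('n) p \<gamma> \<alpha>) at_top"
    using tail near eventually_gt_at_top[of 1]
  proof eventually_elim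
    case (elim \<Lambda>)
    define \<epsilon> where "\<epsilon> = exp (- \<Lambda>)"
    have \<epsilon>: "0 < \<epsilon>" by (simp add: \<epsilon>_def)
    define c where "c = 1 / (a * \<Lambda> + K) powr (2 / N)"
    have T: "0 < a * \<Lambda> + K" using a K elim by (simp add: add_pos_pos)
    then have c: "0 < c" by (simp add: c_def)
    define w where "w = (\<lambda>x :: real ^ 'n. c * adams_function \<epsilon> x)"
    have w: "w \<in> {u. u \<in> E_space p \<and> E_norm p u \<le> 1}"
      unfolding w_def c_def \<epsilon>_def using elim by (intro unit) (auto simp: a_def)
    define C where "C = exp (\<alpha> * m \<Lambda> powr r) / 2 / \<epsilon> powr \<gamma>"
    have C: "0 < C" using \<epsilon> by (simp add: C_def)
    have m0: "0 < m \<Lambda>" using \<theta> elim T by (simp add: m_def)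
    have wm: "m \<Lambda> \<le> w x" if "x \<noteq> 0" "norm x \<le> \<epsilon>" for x
    proof -
      have xx: "0 < x \<bullet> x" "x \<bullet> x \<le> \<epsilon>\<^sup>2" using that power_mono[OF that(2), of 2] by (simp_all add: power2_norm_eq_inner)
      have cx: "1 - \<theta> \<le> cutoff (x \<bullet> x)" using d(2)[of "x \<bullet> x"] xx elim by (auto simp: \<epsilon>_def)
      have "ln (x \<bullet> x + \<epsilon>\<^sup>2) \<le> ln (2 * \<epsilon>\<^sup>2)" using xx \<epsilon> by (intro ln_mono) (auto intro: add_nonneg_pos)
      also have "\<dots> = ln 2 - 2 * \<Lambda>" using \<epsilon> by (simp add: ln_mult ln_realpow \<epsilon>_def)
      finally have "\<Lambda> - 1 \<le> - (1/2) * ln (x \<bullet> x + \<epsilon>\<^sup>2)" using ln_le_minus_one[of 2] by simp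
      then have "(1 - \<theta>) * (\<Lambda> - 1) \<le> adams_function \<epsilon> x"
        unfolding adams_function_def using cx \<theta> elim by (intro mult_mono) auto
      then have "c * ((1 - \<theta>) * (\<Lambda> - 1)) \<le> w x" unfolding w_def using c by (intro mult_left_mono) auto
      then show ?thesis by (simp add: m_def c_def)
    qed
    have e: "V / 2 * exp (\<alpha> * m \<Lambda> powr r - (N - \<gamma>) * \<Lambda>) = C * (V * \<epsilon> ^ ?n)"
    proof -
      have "\<epsilon> ^ ?n = exp (- (N * \<Lambda>))" by (simp add: \<epsilon>_def N_def exp_of_nat_mult[symmetric])
      moreover have "\<epsilon> powr \<gamma> = exp (- (\<gamma> * \<Lambda>))" by (simp add: \<epsilon>_def powr_def)
      moreover have "exp (\<alpha> * m \<Lambda> powr r - (N - \<gamma>) * \<Lambda>) = exp (\<alpha> * m \<Lambda> powr r) * exp (- (N * \<Lambda>)) / exp (- (\<gamma> * \<Lambda>))"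
        by (simp only: exp_add[symmetric] exp_diff[symmetric]) (simp add: left_diff_distrib)
      ultimately show ?thesis by (simp only: C_def) simp
    qed
    have "ennreal (V / 2 * exp (\<alpha> * m \<Lambda> powr r - (N - \<gamma>) * \<Lambda>)) = ennreal C * emeasure lborel (cball (0 :: real ^ 'n) \<epsilon>)"
      using C \<epsilon> emeasure_cball[of \<epsilon> "0 :: real ^ 'n"] unfolding e by (simp add: ennreal_mult' V_def[symmetric])
    also have "\<dots> = (\<integral>\<^sup>+(x :: real ^ 'n). ennreal C * indicator (cball 0 \<epsilon>) x \<partial>lborel)"
      by (simp add: nn_integral_cmult_indicator)
    also have "\<dots> \<le> (\<integral>\<^sup>+x. ennreal (Phi ?n \<alpha> ?m (w x) / norm x powr \<gamma>) \<partial>lborel)"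
    proof (rule nn_integral_mono_AE)
      have "ennreal C * indicator (cball 0 \<epsilon>) x \<le> ennreal (Phi ?n \<alpha> ?m (w x) / norm x powr \<gamma>)" if "x \<noteq> 0" for x
      proof (cases "norm x \<le> \<epsilon>")
        case True
        have "exp (\<alpha> * m \<Lambda> powr r) / 2 \<le> Phi ?n \<alpha> ?m (m \<Lambda>)"
          using elim m0 unfolding Phi_eq by (simp add: r_def N_def)
        also have "\<dots> \<le> Phi ?n \<alpha> ?m (w x)"
          using \<alpha>0 N wm[OF that True] m0 by (intro Phi_mono) (auto simp: N_def)
        finally have "C \<le> Phi ?n \<alpha> ?m (w x) / \<epsilon> powr \<gamma>" unfolding C_def by (intro divide_right_mono) auto
        also have "\<dots> \<le> Phi ?n \<alpha> ?m (w x) / norm x powr \<gamma>"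
          using True that \<gamma> \<epsilon> Phi_nonneg[of \<alpha> ?n ?m "w x"] \<alpha>0 by (intro divide_left_mono powr_mono2) auto
        finally show ?thesis using True by (simp add: ennreal_leI)
      qed auto
      then show "AE x in lborel. ennreal C * indicator (cball 0 \<epsilon>) x \<le> ennreal (Phi ?n \<alpha> ?m (w x) / norm x powr \<gamma>)"
        using AE_lborel_singleton[of "0 :: real ^ 'n"] by (auto elim!: eventually_mono)
    qed
    also have "\<dots> = (\<integral>\<^sup>+x. ennreal (Phi ?n \<alpha> ?m (w x) / norm x powr \<gamma>) \<partial>lebesgue)" by (simp only: nn_integral_completion)
    also have "\<dots> \<le> adams_sup TYPE('n) p \<gamma> \<alpha>" unfolding adams_sup_def by (rule SUP_upper[OF w])
    finally show ?case .
  qed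
  moreover obtain B where B: "adams_sup TYPE('n) p \<gamma> \<alpha> = ennreal B" "0 \<le> B"
    using not_inf by (cases "adams_sup TYPE('n) p \<gamma> \<alpha>") auto
  ultimately have "eventually (\<lambda>\<Lambda>. V / 2 * exp (\<alpha> * m \<Lambda> powr r - (N - \<gamma>) * \<Lambda>) \<le> B) at_top"
    by (simp add: ennreal_le_iff)
  moreover have "filterlim (\<lambda>\<Lambda>. V / 2 * exp (\<alpha> * m \<Lambda> powr r - (N - \<gamma>) * \<Lambda>)) at_top at_top"
    using V by (intro filterlim_tendsto_pos_mult_at_top[OF tendsto_const] filterlim_compose[OF exp_at_top lim]) auto
  then have "eventually (\<lambda>\<Lambda>. B < V / 2 * exp (\<alpha> * m \<Lambda> powr r - (N - \<gamma>) * \<Lambda>)) at_top"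
    by (simp add: filterlim_at_top_dense)
  ultimately have "eventually (\<lambda>\<Lambda>::real. False) at_top" by eventually_elim simp
  then show False by simp
qed

theorem theorem1p1:
  fixes p \<gamma> :: real
  assumes "CARD('n::finite) \<ge> 4"
    and "1 < p" and "p < real CARD('n) / 2"
    and "0 \<le> \<gamma>" and "\<gamma> < real CARD('n)"
  shows "(\<forall>\<alpha>. 0 \<le> \<alpha> \<and> \<alpha> \<le> beta_gamma \<gamma> TYPE('n) \<longrightarrow> adams_sup TYPE('n) p \<gamma> \<alpha> < \<infinity>) \<and>
         (\<forall>\<alpha>. \<alpha> > beta_gamma \<gamma> TYPE('n) \<longrightarrow> adams_sup TYPE('n) p \<gamma> \<alpha> = \<infinity>)"
proof (intro conjI allI impI)
  have n: "2 < CARD('n)" using assms(1) by simp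
  show "adams_sup TYPE('n) p \<gamma> \<alpha> < \<infinity>" if "0 \<le> \<alpha> \<and> \<alpha> \<le> beta_gamma \<gamma> TYPE('n)" for \<alpha>
    using adams_sup_finite[OF n assms(2-5)] that by blast
  show "adams_sup TYPE('n) p \<gamma> \<alpha> = \<infinity>" if "beta_gamma \<gamma> TYPE('n) < \<alpha>" for \<alpha>
    using adams_sup_infinite[OF assms(2-5) that] .
qed

end
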